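(* Let $G$ be a connected locally finite regular graph. Then $D'(G)\leq 2$, unless $G$ is one of the following graphs: the complete graph $K_n$ with $n \leq 5$, the complete bipartite graph $K_{n,n}$ with $n \leq 3$, or the cycle $C_5$.
   Context: Graphs are simple and undirected. A graph is locally finite if every vertex has finite degree, and regular if all vertices have the same degree. An edge colouring $c$ of $G$ preserves an automorphism $\varphi$ of $G$ if every edge $e$ has the same colour as $\varphi(e)$; $c$ is distinguishing if the only automorphism of $G$ preserved by $c$ is the identity. The distinguishing index $D'(G)$ is the least number of colours in a distinguishing edge colouring of $G$. *)

theory Defs
  imports Main "HOL-Library.Extended_Nat"
begin

definition simple_graph :: "'a set \<Rightarrow> 'a set set \<Rightarrow> bool" where
  "simple_graph V E \<longleftrightarrow> (\<forall>e\<in>E. \<exists>u v. e = {u, v} \<and> u \<noteq> v \<and> u \<in> V \<and> v \<in> V)"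

definition neighbours :: "'a set set \<Rightarrow> 'a \<Rightarrow> 'a set" where
  "neighbours E v = {u. {u, v} \<in> E}"

definition locally_finite :: "'a set \<Rightarrow> 'a set set \<Rightarrow> bool" where
  "locally_finite V E \<longleftrightarrow> (\<forall>v\<in>V. finite (neighbours E v))"

definition regular :: "'a set \<Rightarrow> 'a set set \<Rightarrow> bool" where
  "regular V E \<longleftrightarrow> (\<exists>d. \<forall>v\<in>V. card (neighbours E v) = d)"

definition connected_graph :: "'a set \<Rightarrow> 'a set set \<Rightarrow> bool" where
  "connected_graph V E \<longleftrightarrow> V \<noteq> {} \<and>
     (\<forall>u\<in>V. \<forall>v\<in>V. (\<lambda>x y. {x, y} \<in> E)\<^sup>*\<^sup>* u v)"

definition graph_automorphism :: "'a set \<Rightarrow> 'a set set \<Rightarrow> ('a \<Rightarrow> 'a) \<Rightarrow> bool" where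
  "graph_automorphism V E \<phi> \<longleftrightarrow> bij_betw \<phi> V V \<and>
     (\<forall>u\<in>V. \<forall>v\<in>V. {u, v} \<in> E \<longleftrightarrow> {\<phi> u, \<phi> v} \<in> E)"

definition preserves :: "'a set set \<Rightarrow> ('a set \<Rightarrow> 'c) \<Rightarrow> ('a \<Rightarrow> 'a) \<Rightarrow> bool" where
  "preserves E c \<phi> \<longleftrightarrow> (\<forall>e\<in>E. c (\<phi> ` e) = c e)"

definition distinguishing :: "'a set \<Rightarrow> 'a set set \<Rightarrow> ('a set \<Rightarrow> 'c) \<Rightarrow> bool" where
  "distinguishing V E c \<longleftrightarrow>
     (\<forall>\<phi>. graph_automorphism V E \<phi> \<and> preserves E c \<phi> \<longrightarrow> (\<forall>v\<in>V. \<phi> v = v))"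

text \<open>Distinguishing index: least number k of colours (colours 0..k-1) admitting a
distinguishing edge colouring; \<infinity> if there is none.\<close>
definition distinguishing_index :: "'a set \<Rightarrow> 'a set set \<Rightarrow> enat" where
  "distinguishing_index V E =
     Inf {enat k | k. \<exists>c :: 'a set \<Rightarrow> nat. (\<forall>e\<in>E. c e < k) \<and> distinguishing V E c}"

definition graph_iso :: "'a set \<Rightarrow> 'a set set \<Rightarrow> 'b set \<Rightarrow> 'b set set \<Rightarrow> bool" where
  "graph_iso V E V' E' \<longleftrightarrow> (\<exists>f. bij_betw f V V' \<and>
     (\<forall>u\<in>V. \<forall>v\<in>V. {u, v} \<in> E \<longleftrightarrow> {f u, f v} \<in> E'))"

definition K_verts :: "nat \<Rightarrow> nat set" where "K_verts n = {0..<n}"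
definition K_edges :: "nat \<Rightarrow> nat set set" where
  "K_edges n = {{i, j} | i j. i < n \<and> j < n \<and> i \<noteq> j}"

definition Knn_verts :: "nat \<Rightarrow> nat set" where "Knn_verts n = {0..<2 * n}"
definition Knn_edges :: "nat \<Rightarrow> nat set set" where
  "Knn_edges n = {{i, j} | i j. i < n \<and> n \<le> j \<and> j < 2 * n}"

definition C5_verts :: "nat set" where "C5_verts = {0..<5}"
definition C5_edges :: "nat set set" where
  "C5_edges = {{i, (i + 1) mod 5} | i. i < 5}"

end

theory Submission
  imports Defs Complex_Main "HOL-Library.Disjoint_Sets"
begin

text \<open>The edges are coloured red and blue. Once the edges at a set \<open>F\<close> of vertices are coloured such that all
  automorphisms under consideration fix \<open>F\<close> pointwise, call two vertices outside \<open>F\<close> equivalent if they have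
  the same neighbours in \<open>F\<close>, joined to them in the same colours. The invariant is that a class of vertices with
  \<open>\<delta>\<close> neighbours outside \<open>F\<close> has at most \<open>max 1 (\<delta> - 1)\<close> members. A class with least \<open>\<delta>\<close> is fixed by colouring
  the edges inside it like a threshold graph and giving its members suitable numbers of red edges to the outside;
  by Hall's theorem these edges can be chosen such that they split the other classes sufficiently. All vertices
  added to the initial set \<open>F0\<close> get edges of both colours. Only finite components of \<open>G - F\<close> that are trees can
  obstruct this, and in a colouring with the least number of unsatisfied vertices they do not.
  Hence the initial set can be recognised by vertices all of whose edges have the same colour. Such an initial set
  is found near an edge contained in triangles, a 4-cycle, or else along a shortest cycle or a double ray, except
  in some complete or complete bipartite graphs and in cycles, which are treated directly.\<close>

subsection \<open>Splitting classes by means of Hall's theorem\<close>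

text \<open>The bound \<delta> - 1 is dictated from two sides. A vertex that sees both colours on
  its \<delta> edges to the outside has between 1 and \<delta> - 1 red ones, so an independent class
  with more than \<delta> - 1 members could not be separated by these numbers. Conversely, vertices
  first reached from an attached vertex obey the bound automatically: there are at most d - 1 of
  them, and each has \<delta> = d. Taking a class \<open>Q\<close> with least \<delta> ensures that
  every other vertex keeps an edge leading neither to \<open>F\<close> nor to \<open>Q\<close>, that
  a vertex keeping only one such edge is adjacent to all of \<open>Q\<close>, and that members of
  \<open>Q\<close> have few enough outside edges for Hall's condition. Trees are special because a
  finite tree has fewer edges than vertices: its vertices cannot each receive a free edge of their
  own that provides a second colour. So one vertex must get both colours from the edges to
  \<open>F\<close>, or two adjacent vertices must lack the same colour.\<close>

lemma hall_transversal:
  assumes "finite I" "\<forall>i\<in>I. finite (A i)" "\<forall>J\<subseteq>I. card J \<le> card (\<Union>(A ` J))"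
  shows "\<exists>f. inj_on f I \<and> (\<forall>i\<in>I. f i \<in> A i)"
  using assms
proof (induction "card I" arbitrary: I A rule: less_induct)
  case less
  have fin: "finite (\<Union>(A ` J))" if "J \<subseteq> I" for J
    using less.prems(1,2) that finite_subset[OF that] by blast
  show ?case
  \<comment> \<open>The induction of Halmos and Vaughan: a tight proper subfamily is matched inside
    its union, and the rest outside this union. If there is none, any first choice leaves Hall's
    condition intact.\<close>
  proof (cases "\<exists>J. J \<subset> I \<and> J \<noteq> {} \<and> card (\<Union>(A ` J)) = card J")
    case True
    then obtain J where J: "J \<subset> I" "J \<noteq> {}" "card (\<Union>(A ` J)) = card J" by blast
    define U where "U = \<Union>(A ` J)"
    have finJ: "finite J" using J less.prems(1) by (auto intro: finite_subset)
    have lt: "card J < card I" using J less.prems(1) by (simp add: psubset_card_mono)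
    have "\<exists>f. inj_on f J \<and> (\<forall>i\<in>J. f i \<in> A i)"
      by (rule less.hyps[OF lt finJ]) (use J less.prems in auto)
    then obtain f where f: "inj_on f J" "\<forall>i\<in>J. f i \<in> A i" by blast
    define B where "B = (\<lambda>i. A i - U)"
    have lt2: "card (I - J) < card I"
      by (rule psubset_card_mono) (use J less.prems in auto)
    have "\<exists>g. inj_on g (I - J) \<and> (\<forall>i\<in>I - J. g i \<in> B i)"
    proof (rule less.hyps[OF lt2])
      show "finite (I - J)" using less.prems by auto
      show "\<forall>i\<in>I - J. finite (B i)" using less.prems by (auto simp: B_def)
      show "\<forall>K\<subseteq>I - J. card K \<le> card (\<Union>(B ` K))"
      proof (intro allI impI)
        fix K assume K: "K \<subseteq> I - J"
        have e1: "\<Union>(A ` (K \<union> J)) = \<Union>(B ` K) \<union> U" by (auto simp: B_def U_def)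
        have finU: "finite U" unfolding U_def by (rule fin) (use J in auto)
        have d: "\<Union>(B ` K) \<inter> U = {}" by (auto simp: B_def)
        have finB: "finite (\<Union>(B ` K))"
          by (rule finite_subset[OF _ fin[of K]]) (use K in \<open>auto simp: B_def\<close>)
        have "card K + card J = card (K \<union> J)"
          using K finJ less.prems(1) by (subst card_Un_disjoint) (auto intro: finite_subset)
        also have "\<dots> \<le> card (\<Union>(A ` (K \<union> J)))"
          by (rule less.prems(3)[rule_format]) (use K J in auto)
        also have "\<dots> = card (\<Union>(B ` K)) + card U"
          unfolding e1 using finB finU d by (simp add: card_Un_disjoint)
        finally show "card K \<le> card (\<Union>(B ` K))" using J(3) by (simp add: U_def)
      qed
    qed
    then obtain g where g: "inj_on g (I - J)" "\<forall>i\<in>I - J. g i \<in> B i" by blast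
    define h where "h = (\<lambda>i. if i \<in> J then f i else g i)"
    have "inj_on h I"
    proof (rule inj_onI)
      fix x y assume xy: "x \<in> I" "y \<in> I" "h x = h y"
      have m: "f u \<noteq> g v" if "u \<in> J" "v \<in> I - J" for u v
        using f(2) g(2) that by (auto simp: U_def B_def)
      show "x = y"
      proof (cases "x \<in> J")
        case True
        then show ?thesis using xy m[of x y] inj_onD[OF f(1), of x y] by (auto simp: h_def split: if_splits)
      next
        case False
        then show ?thesis using xy m[of y x] inj_onD[OF g(1), of x y] by (auto simp: h_def split: if_splits)
      qed
    qed
    moreover have "\<forall>i\<in>I. h i \<in> A i" using f g by (auto simp: h_def B_def)
    ultimately show ?thesis by blast
  next
    case False
    show ?thesis
    proof (cases "I = {}")
      case True then show ?thesis by auto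
    next
      case False': False
      then obtain i where i: "i \<in> I" by blast
      have "card {i} \<le> card (\<Union>(A ` {i}))" using less.prems(3) i by blast
      then have "A i \<noteq> {}" by auto
      then obtain x where x: "x \<in> A i" by blast
      define B where "B = (\<lambda>j. A j - {x})"
      have lt: "card (I - {i}) < card I" using i less.prems(1) by (metis card_Diff1_less)
      have "\<exists>g. inj_on g (I - {i}) \<and> (\<forall>j\<in>I - {i}. g j \<in> B j)"
      proof (rule less.hyps[OF lt])
        show "finite (I - {i})" using less.prems by auto
        show "\<forall>j\<in>I - {i}. finite (B j)" using less.prems by (auto simp: B_def)
        show "\<forall>K\<subseteq>I - {i}. card K \<le> card (\<Union>(B ` K))"
        proof (intro allI impI)
          fix K assume K: "K \<subseteq> I - {i}"
          show "card K \<le> card (\<Union>(B ` K))"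
          proof (cases "K = {}")
            case True then show ?thesis by simp
          next
            case ne: False
            have KI: "K \<subset> I" using K i by blast
            then have "card K \<noteq> card (\<Union>(A ` K))" using False ne by metis
            moreover have "card K \<le> card (\<Union>(A ` K))" using less.prems(3) KI by blast
            ultimately have c: "card K < card (\<Union>(A ` K))" by simp
            have e: "\<Union>(B ` K) = \<Union>(A ` K) - {x}" by (auto simp: B_def)
            show ?thesis unfolding e using c by (auto simp: card_Diff_singleton_if)
          qed
        qed
      qed
      then obtain g where g: "inj_on g (I - {i})" "\<forall>j\<in>I - {i}. g j \<in> B j" by blast
      define h where "h = g(i := x)"
      have "inj_on h I" using g by (auto simp: h_def inj_on_def B_def)
      moreover have "\<forall>i\<in>I. h i \<in> A i" using g x by (auto simp: h_def B_def)
      ultimately show ?thesis by blast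
    qed
  qed
qed

lemma hall_demands:
  assumes "finite \<D>" "\<forall>D\<in>\<D>. finite (A D)"
    and "\<forall>\<J>\<subseteq>\<D>. (\<Sum>D\<in>\<J>. dem D) \<le> card (\<Union>(A ` \<J>))"
  shows "\<exists>B. (\<forall>D\<in>\<D>. B D \<subseteq> A D \<and> card (B D) = dem D) \<and> disjoint_family_on B \<D>"
proof -
  \<comment> \<open>Each class is replaced by \<open>dem D\<close> copies of itself, all with the
    same candidates.\<close>
  define I where "I = (SIGMA D:\<D>. {..<dem D})"
  have "\<exists>f. inj_on f I \<and> (\<forall>i\<in>I. f i \<in> A (fst i))"
  proof (rule hall_transversal)
    show "finite I" using assms by (auto simp: I_def)
    show "\<forall>i\<in>I. finite (A (fst i))" using assms by (auto simp: I_def)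
    show "\<forall>J\<subseteq>I. card J \<le> card (\<Union>i\<in>J. A (fst i))"
    proof (intro allI impI)
      fix J assume J: "J \<subseteq> I"
      define \<J> where "\<J> = fst ` J"
      have sub: "\<J> \<subseteq> \<D>" using J by (auto simp: \<J>_def I_def)
      then have fj: "finite \<J>" using assms finite_subset by blast
      have "J \<subseteq> (SIGMA D:\<J>. {..<dem D})" using J by (force simp: \<J>_def I_def)
      then have "card J \<le> card (SIGMA D:\<J>. {..<dem D})" using fj by (intro card_mono) auto
      also have "\<dots> = (\<Sum>D\<in>\<J>. dem D)" using fj by simp
      also have "\<dots> \<le> card (\<Union>(A ` \<J>))" using assms sub by blast
      also have "\<Union>(A ` \<J>) = (\<Union>i\<in>J. A (fst i))" by (auto simp: \<J>_def)
      finally show "card J \<le> card (\<Union>i\<in>J. A (fst i))" .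
    qed
  qed
  then obtain f where f: "inj_on f I" "\<forall>i\<in>I. f i \<in> A (fst i)" by blast
  define B where "B = (\<lambda>D. (\<lambda>k. f (D, k)) ` {..<dem D})"
  have "B D \<subseteq> A D \<and> card (B D) = dem D" if "D \<in> \<D>" for D
  proof
    show "B D \<subseteq> A D" using f(2) that by (force simp: B_def I_def)
    have "inj_on (\<lambda>k. f (D, k)) {..<dem D}"
      using f(1) that by (auto simp: I_def inj_on_def)
    then show "card (B D) = dem D" by (simp add: B_def card_image)
  qed
  moreover have "disjoint_family_on B \<D>"
    unfolding disjoint_family_on_def
  proof (intro ballI impI)
    fix D D' assume D: "D \<in> \<D>" "D' \<in> \<D>" "D \<noteq> D'"
    show "B D \<inter> B D' = {}"
    proof (rule ccontr)
      assume "B D \<inter> B D' \<noteq> {}"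
      then obtain k k' where k: "k < dem D" "k' < dem D'" "f (D, k) = f (D', k')" by (auto simp: B_def)
      then have "(D, k) = (D', k')" using f(1) D by (intro inj_onD[OF f(1)]) (auto simp: I_def)
      then show False using D by simp
    qed
  qed
  ultimately show ?thesis by blast
qed

text \<open>The fractional assignment giving \<open>D\<close> the share \<open>dem D / card (A D)\<close> of each of its servers
  is feasible, so Hall's condition holds.\<close>
lemma hall_weighted:
  fixes dem s :: "'b \<Rightarrow> nat" and T :: "'a \<Rightarrow> nat"
  assumes fin: "finite \<D>" "\<forall>D\<in>\<D>. finite (A D)"
    and pos: "\<forall>D\<in>\<D>. dem D > 0 \<longrightarrow> A D \<noteq> {}"
    and w: "\<forall>D\<in>\<D>. \<forall>x\<in>A D. dem D * T x \<le> card (A D) * s D"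
    and T: "\<forall>x. (\<Sum>D\<in>{D\<in>\<D>. x \<in> A D}. s D) \<le> T x"
    and s: "\<forall>D\<in>\<D>. dem D > 0 \<longrightarrow> s D > 0"
  shows "\<exists>B. (\<forall>D\<in>\<D>. B D \<subseteq> A D \<and> card (B D) = dem D) \<and> disjoint_family_on B \<D>"
proof (rule hall_demands[OF fin], intro allI impI)
  fix \<J> assume J: "\<J> \<subseteq> \<D>"
  have fJ: "finite \<J>" using fin J finite_subset by blast
  define U where "U = \<Union>(A ` \<J>)"
  have fU: "finite U" using fin J fJ by (auto simp: U_def)
  have share: "real (dem D) \<le> (\<Sum>x\<in>A D. real (s D) / real (T x))" if D: "D \<in> \<J>" for D
  proof (cases "dem D = 0")
    case True then show ?thesis by (auto intro: sum_nonneg)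
  next
    case False
    have DD: "D \<in> \<D>" using D J by auto
    have fA: "finite (A D)" using fin DD by auto
    have ne: "A D \<noteq> {}" using pos DD False by auto
    have sp: "s D > 0" using s DD False by auto
    have "real (dem D) / real (card (A D)) \<le> real (s D) / real (T x)" if x: "x \<in> A D" for x
    proof -
      have "s D \<le> (\<Sum>D\<in>{D\<in>\<D>. x \<in> A D}. s D)"
        using fin DD x by (intro member_le_sum) auto
      then have Tp: "T x > 0" using T sp by (metis le_trans not_gr_zero not_le less_le_trans)
      have "real (dem D * T x) \<le> real (card (A D) * s D)" using w DD x by (intro of_nat_mono) blast
      then show ?thesis using Tp ne fA by (simp add: field_simps card_gt_0_iff)
    qed
    then have "(\<Sum>x\<in>A D. real (dem D) / real (card (A D))) \<le> (\<Sum>x\<in>A D. real (s D) / real (T x))"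
      by (intro sum_mono)
    then show ?thesis using ne fA by simp
  qed
  have "real (\<Sum>D\<in>\<J>. dem D) \<le> (\<Sum>D\<in>\<J>. \<Sum>x\<in>A D. real (s D) / real (T x))"
    using share by (simp add: sum_mono)
  \<comment> \<open>Extending the inner sums to the common index set \<open>U\<close> allows the
    order of summation to be exchanged, so that the shares are collected at each server.\<close>
  also have "\<dots> = (\<Sum>D\<in>\<J>. \<Sum>x\<in>U. if x \<in> A D then real (s D) / real (T x) else 0)"
  proof (rule sum.cong[OF refl])
    fix D assume D: "D \<in> \<J>"
    have "{x\<in>U. x \<in> A D} = A D" using D by (auto simp: U_def)
    then show "(\<Sum>x\<in>A D. real (s D) / real (T x)) = (\<Sum>x\<in>U. if x \<in> A D then real (s D) / real (T x) else 0)"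
      using sum.inter_filter[OF fU, of "\<lambda>x. real (s D) / real (T x)" "\<lambda>x. x \<in> A D"] by simp
  qed
  also have "\<dots> = (\<Sum>x\<in>U. \<Sum>D\<in>\<J>. if x \<in> A D then real (s D) / real (T x) else 0)"
    by (rule sum.swap)
  also have "\<dots> \<le> (\<Sum>x\<in>U. 1)"
  proof (rule sum_mono)
    fix x assume "x \<in> U"
    have "(\<Sum>D\<in>\<J>. if x \<in> A D then real (s D) / real (T x) else 0)
        = (\<Sum>D\<in>{D\<in>\<J>. x \<in> A D}. real (s D) / real (T x))"
      using fJ by (simp add: sum.inter_filter)
    also have "\<dots> = real (\<Sum>D\<in>{D\<in>\<J>. x \<in> A D}. s D) / real (T x)"
      by (simp add: sum_divide_distrib)
    also have "\<dots> \<le> 1"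
    proof -
      have "(\<Sum>D\<in>{D\<in>\<J>. x \<in> A D}. s D) \<le> (\<Sum>D\<in>{D\<in>\<D>. x \<in> A D}. s D)"
        using fin J by (intro sum_mono2) auto
      then have "(\<Sum>D\<in>{D\<in>\<J>. x \<in> A D}. s D) \<le> T x" using T le_trans by blast
      then show ?thesis by (auto simp: divide_le_eq_1 simp del: of_nat_sum)
    qed
    finally show "(\<Sum>D\<in>\<J>. if x \<in> A D then real (s D) / real (T x) else 0) \<le> 1" .
  qed
  also have "\<dots> = real (card U)" by simp
  finally show "(\<Sum>D\<in>\<J>. dem D) \<le> card (\<Union>(A ` \<J>))" unfolding U_def[symmetric] of_nat_le_iff .
qed

lemma obtain_subset_between:
  assumes "finite F" "u \<in> F" "v \<in> F" "u \<noteq> v" "1 \<le> q" "q < card F"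
  shows "\<exists>S. S \<subseteq> F \<and> card S = q \<and> u \<in> S \<and> v \<notin> S"
proof -
  have "card (F - {u, v}) = card F - 2" using assms by (simp add: card_Diff_subset)
  then have "q - 1 \<le> card (F - {u, v})" using assms by simp
  then obtain S where S: "S \<subseteq> F - {u, v}" "card S = q - 1" "finite S"
    by (meson obtain_subset_with_card_n)
  have "card (insert u S) = q" using S assms by (subst card_insert_disjoint) auto
  then show ?thesis using S assms by (intro exI[of _ "insert u S"]) auto
qed

text \<open>Each server assigned to a class splits one of the blocks into which its
  predecessors have divided this class.\<close>
lemma split_classes:
  fixes fw :: "'a \<Rightarrow> 'b set" and q :: "'a \<Rightarrow> nat" and B :: "'b set \<Rightarrow> 'a set"
  assumes "finite Q" "\<forall>x\<in>Q. finite (fw x) \<and> q x \<le> card (fw x)"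
    and finD: "\<forall>D\<in>\<D>. finite D \<and> D \<noteq> {}"
    and B: "\<forall>D\<in>\<D>. \<forall>x\<in>B D \<inter> Q. D \<subseteq> fw x \<and> 1 \<le> q x \<and> q x < card (fw x)"
    and disj: "disjoint_family_on B \<D>"
  shows "\<exists>\<rho>. (\<forall>x\<in>Q. \<rho> x \<subseteq> fw x \<and> card (\<rho> x) = q x) \<and>
     (\<forall>D\<in>\<D>. min (card D) (card (B D \<inter> Q) + 1) \<le> card ((\<lambda>w. {x\<in>Q. w \<in> \<rho> x}) ` D))"
  using assms(1,2) B
proof (induction Q rule: finite_induct)
  case empty
  then show ?case using finD by (auto simp: image_constant_conv)
next
  case (insert x Q)
  have "\<exists>\<rho>. (\<forall>x\<in>Q. \<rho> x \<subseteq> fw x \<and> card (\<rho> x) = q x) \<and>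
     (\<forall>D\<in>\<D>. min (card D) (card (B D \<inter> Q) + 1) \<le> card ((\<lambda>w. {x\<in>Q. w \<in> \<rho> x}) ` D))"
    using insert by auto
  then obtain \<rho> where \<rho>: "\<forall>x\<in>Q. \<rho> x \<subseteq> fw x \<and> card (\<rho> x) = q x"
    "\<forall>D\<in>\<D>. min (card D) (card (B D \<inter> Q) + 1) \<le> card ((\<lambda>w. {x\<in>Q. w \<in> \<rho> x}) ` D)" by blast
  \<comment> \<open>Two vertices have the same code iff the servers treated so far do not separate
    them, so the number of codes in \<open>D\<close> is the number of its blocks.\<close>
  define code where "code = (\<lambda>w. {y\<in>Q. w \<in> \<rho> y})"
  have key: "\<exists>S. S \<subseteq> fw x \<and> card S = q x \<and>
      (\<forall>D\<in>\<D>. x \<in> B D \<and> \<not> inj_on code D \<longrightarrow> (\<exists>u\<in>D. \<exists>v\<in>D. code u = code v \<and> u \<in> S \<and> v \<notin> S))"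
  proof (cases "\<exists>D\<in>\<D>. x \<in> B D \<and> \<not> inj_on code D")
    case True
    then obtain D where D: "D \<in> \<D>" "x \<in> B D" "\<not> inj_on code D" by blast
    then obtain u v where uv: "u \<in> D" "v \<in> D" "u \<noteq> v" "code u = code v" by (auto simp: inj_on_def)
    have Dx: "D \<subseteq> fw x" "1 \<le> q x" "q x < card (fw x)" using insert.prems(2) D by auto
    obtain S where S: "S \<subseteq> fw x" "card S = q x" "u \<in> S" "v \<notin> S"
      using obtain_subset_between[of "fw x" u v "q x"] insert.prems(1) Dx uv by auto
    \<comment> \<open>By disjointness \<open>x\<close> serves no other class, so it is enough to
      split the one pair \<open>u\<close>, \<open>v\<close>.\<close>
    have "D' = D" if "D' \<in> \<D>" "x \<in> B D'" for D'
      using disj D that unfolding disjoint_family_on_def by blast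
    then show ?thesis using S uv by (intro exI[of _ S]) blast
  next
    case False
    obtain S where "S \<subseteq> fw x" "card S = q x"
      using insert.prems(1) by (meson insertI1 obtain_subset_with_card_n)
    then show ?thesis using False by (intro exI[of _ S]) blast
  qed
  then obtain S where S: "S \<subseteq> fw x" "card S = q x"
    "\<And>D. D \<in> \<D> \<Longrightarrow> x \<in> B D \<Longrightarrow> \<not> inj_on code D \<Longrightarrow> (\<exists>u\<in>D. \<exists>v\<in>D. code u = code v \<and> u \<in> S \<and> v \<notin> S)" by blast
  define \<rho>' where "\<rho>' = \<rho>(x := S)"
  define code' where "code' = (\<lambda>w. {y\<in>insert x Q. w \<in> \<rho>' y})"
  have c1: "code' w - {x} = code w" for w using insert.hyps by (auto simp: code_def code'_def \<rho>'_def)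
  have c2: "x \<in> code' w \<longleftrightarrow> w \<in> S" for w by (auto simp: code'_def \<rho>'_def)
  have im: "(\<lambda>c. c - {x}) ` code' ` D = code ` D" for D by (auto simp: image_image c1)
  have main: "min (card D) (card (B D \<inter> insert x Q) + 1) \<le> card (code' ` D)" if D: "D \<in> \<D>" "D \<noteq> {}" for D
  proof -
    have fD: "finite D" using finD D by auto
    have ge: "card (code ` D) \<le> card (code' ` D)" using card_image_le[of "code' ` D" "\<lambda>c. c - {x}"] fD im by simp
    have IH: "min (card D) (card (B D \<inter> Q) + 1) \<le> card (code ` D)" using \<rho>(2) D unfolding code_def by blast
    show ?thesis
    proof (cases "x \<in> B D \<and> \<not> inj_on code D")
      case False
      show ?thesis
      proof (cases "x \<in> B D")
        case True
        then have "inj_on code D" using False by auto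
        then have "card (code ` D) = card D" by (rule card_image)
        then show ?thesis using ge by simp
      next
        case False
        then have "B D \<inter> insert x Q = B D \<inter> Q" by auto
        then show ?thesis using IH ge by simp
      qed
    next
      case True
      then obtain u v where uv: "u \<in> D" "v \<in> D" "code u = code v" "u \<in> S" "v \<notin> S" using S(3) D by blast
      \<comment> \<open>Forgetting \<open>x\<close> merges the codes of \<open>u\<close> and
        \<open>v\<close>, so there were strictly fewer codes before.\<close>
      have ninj: "\<not> inj_on (\<lambda>c. c - {x}) (code' ` D)"
      proof
        assume i: "inj_on (\<lambda>c. c - {x}) (code' ` D)"
        have "code' u = code' v" using inj_onD[OF i, of "code' u" "code' v"] uv c1 by auto
        then show False using c2 uv by blast
      qed
      have "card (code ` D) \<noteq> card (code' ` D)"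
        using ninj im[of D] fD by (metis eq_card_imp_inj_on finite_imageI)
      then have lt: "card (code ` D) < card (code' ` D)" using ge by simp
      have "B D \<inter> insert x Q = insert x (B D \<inter> Q)" using True by auto
      then have "card (B D \<inter> insert x Q) = card (B D \<inter> Q) + 1" using insert.hyps by simp
      then show ?thesis using IH lt by simp
    qed
  qed
  have "\<forall>y\<in>insert x Q. \<rho>' y \<subseteq> fw y \<and> card (\<rho>' y) = q y"
    using S \<rho>(1) insert.hyps by (auto simp: \<rho>'_def)
  moreover have "\<forall>D\<in>\<D>. min (card D) (card (B D \<inter> insert x Q) + 1) \<le> card (code' ` D)"
    using main finD by blast
  ultimately show ?case unfolding code'_def by blast
qed

text \<open>Each of the other blocks uses up at least one of the remaining elements of
  \<open>D\<close>.\<close>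

lemma card_block_le:
  assumes "finite D" "w \<in> D"
  shows "card {w'\<in>D. c w' = c w} + card (c ` D) \<le> card D + 1"
proof -
  define X where "X = {w'\<in>D. c w' = c w}"
  have f: "finite X" "finite (D - X)" using assms by (auto simp: X_def)
  have "c ` D \<subseteq> insert (c w) (c ` (D - X))" by (auto simp: X_def)
  then have "card (c ` D) \<le> card (insert (c w) (c ` (D - X)))" using f by (intro card_mono) auto
  also have "\<dots> \<le> card (c ` (D - X)) + 1" by (simp add: card_insert_if f)
  also have "\<dots> \<le> card (D - X) + 1" using f by (simp add: card_image_le)
  also have "card (D - X) = card D - card X" using assms by (intro card_Diff_subset) (auto simp: X_def)
  finally show ?thesis using card_mono[of D X] assms unfolding X_def by auto
qed

subsection \<open>Rigid labellings of a class by threshold graphs\<close>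

lemma bij_prescribed_pair:
  assumes "finite Q" "x \<in> Q" "y \<in> Q" "x \<noteq> y" "a \<in> {1..card Q}" "b \<in> {1..card Q}" "a \<noteq> b"
  shows "\<exists>p. bij_betw p Q {1..card Q} \<and> p x = a \<and> p y = b"
proof -
  have "card (Q - {x, y}) = card ({1..card Q} - {a, b})"
    using assms by (simp add: card_Diff_subset)
  then obtain g where g: "bij_betw g (Q - {x, y}) ({1..card Q} - {a, b})"
    using assms(1) by (meson finite_Diff finite_atLeastAtMost finite_same_card_bij)
  define p where "p = (\<lambda>z. if z = x then a else if z = y then b else g z)"
  have "bij_betw p (Q - {x, y}) ({1..card Q} - {a, b})"
    using g by (rule bij_betw_cong[THEN iffD1, rotated]) (auto simp: p_def)
  moreover have "bij_betw p {x, y} {a, b}"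
    using assms by (auto simp: bij_betw_def p_def inj_on_def)
  ultimately have "bij_betw p ((Q - {x, y}) \<union> {x, y}) (({1..card Q} - {a, b}) \<union> {a, b})"
    by (rule bij_betw_combine) auto
  moreover have "(Q - {x, y}) \<union> {x, y} = Q" "({1..card Q} - {a, b}) \<union> {a, b} = {1..card Q}"
    using assms by auto
  ultimately show ?thesis using assms by (intro exI[of _ p]) (auto simp: p_def)
qed

locale threshold_order =
  fixes Q :: "'a set" and n :: nat and p :: "'a \<Rightarrow> nat" and L :: "'a \<Rightarrow> 'a \<Rightarrow> bool"
  assumes fin: "finite Q" and n: "n = card Q" and p: "bij_betw p Q {1..n}"
    and Lsym: "L x y \<Longrightarrow> L y x" and Lirr: "\<not> L x x"
begin

text \<open>For complete \<open>L\<close> this is the antiregular graph, in which only the two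
  middle vertices share their degree. For other \<open>L\<close> the missing edges merely lower the
  counts, for which \<open>q\<close> compensates later.\<close>

definition thr where "thr x y \<longleftrightarrow> L x y \<and> p x + p y > n + 1"
definition rd where "rd x = card {y\<in>Q. thr x y}"
definition bd where "bd x = card {y\<in>Q. L x y \<and> \<not> thr x y}"
definition hd where "hd x = card {y\<in>Q. L x y}"

lemma thr_sym: "thr x y \<longleftrightarrow> thr y x"
  using Lsym by (auto simp: thr_def add.commute)

lemma rd_bd: "rd x + bd x = hd x"
proof -
  have "{y\<in>Q. L x y} = {y\<in>Q. thr x y} \<union> {y\<in>Q. L x y \<and> \<not> thr x y}" by (auto simp: thr_def)
  moreover have "{y\<in>Q. thr x y} \<inter> {y\<in>Q. L x y \<and> \<not> thr x y} = {}" by auto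
  ultimately show ?thesis unfolding rd_def bd_def hd_def using fin by (simp add: card_Un_disjoint)
qed

lemma p_range: "x \<in> Q \<Longrightarrow> 1 \<le> p x \<and> p x \<le> n"
  using p by (auto simp: bij_betw_def)

lemma p_inj: "x \<in> Q \<Longrightarrow> y \<in> Q \<Longrightarrow> p x = p y \<Longrightarrow> x = y"
  using p by (auto simp: bij_betw_def inj_on_def)

lemma card_p_le: "S \<subseteq> Q \<Longrightarrow> p ` S \<subseteq> T \<Longrightarrow> finite T \<Longrightarrow> card S \<le> card T"
  by (metis card_image card_mono inj_on_subset p bij_betw_def)

text \<open>The labels of the red neighbours of \<open>x\<close> exceed \<open>n + 1 - p x\<close>,
  which leaves \<open>p x - 1\<close> labels. If \<open>2 * p x > n + 1\<close>, the label of
  \<open>x\<close> itself is among these and does not count.\<close>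

lemma rd_le:
  assumes x: "x \<in> Q"
  shows "rd x + 1 \<le> p x" "2 * p x > n + 1 \<Longrightarrow> rd x + 2 \<le> p x"
proof -
  have im: "p ` {y\<in>Q. thr x y} \<subseteq> {n + 2 - p x..n} - {p x}"
    using p_range x Lirr by (auto simp: thr_def dest: p_inj[OF _ x])
  have "rd x \<le> card {n + 2 - p x..n}"
    unfolding rd_def by (rule card_p_le) (use im in auto)
  also have "\<dots> = p x - 1" using p_range[OF x] by auto
  finally show "rd x + 1 \<le> p x" using p_range[OF x] by auto
  assume "2 * p x > n + 1"
  then have i: "p x \<in> {n + 2 - p x..n}" using p_range[OF x] by auto
  have "rd x \<le> card ({n + 2 - p x..n} - {p x})"
    unfolding rd_def by (rule card_p_le) (use im in auto)
  also have "\<dots> = card {n + 2 - p x..n} - 1" using i by (rule card_Diff_singleton)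
  also have "\<dots> = p x - 2" using p_range[OF x] by auto
  finally show "rd x + 2 \<le> p x" using \<open>2 * p x > n + 1\<close> p_range[OF x] by auto
qed

lemma bd_le:
  assumes x: "x \<in> Q"
  shows "bd x + p x \<le> n + 1" "2 * p x \<le> n + 1 \<Longrightarrow> bd x + p x \<le> n"
proof -
  have im: "p ` {y\<in>Q. L x y \<and> \<not> thr x y} \<subseteq> {1..n + 1 - p x} - {p x}"
    using p_range x Lirr by (fastforce simp: thr_def dest: p_inj[OF _ x])
  have "bd x \<le> card {1..n + 1 - p x}"
    unfolding bd_def by (rule card_p_le) (use im in auto)
  then show "bd x + p x \<le> n + 1" using p_range[OF x] by auto
  assume "2 * p x \<le> n + 1"
  then have i: "p x \<in> {1..n + 1 - p x}" using p_range[OF x] by auto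
  have "bd x \<le> card ({1..n + 1 - p x} - {p x})"
    unfolding bd_def by (rule card_p_le) (use im in auto)
  also have "\<dots> = card {1..n + 1 - p x} - 1" using i by (rule card_Diff_singleton)
  finally show "bd x + p x \<le> n" using \<open>2 * p x \<le> n + 1\<close> p_range[OF x] by auto
qed

text \<open>The red and the blue degree add up to \<open>n - 1\<close>, which is also the sum of
  their upper bounds, so both bounds are attained.\<close>

lemma rd_complete:
  assumes x: "x \<in> Q" and compl: "\<And>y z. y \<in> Q \<Longrightarrow> z \<in> Q \<Longrightarrow> y \<noteq> z \<Longrightarrow> L y z"
  shows "rd x = (if 2 * p x \<le> n + 1 then p x - 1 else p x - 2)"
proof -
  have "hd x = n - 1"
  proof -
    have "{y\<in>Q. L x y} = Q - {x}" using compl x Lirr by auto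
    then show ?thesis unfolding hd_def using fin x n by simp
  qed
  then show ?thesis using rd_le[OF x] bd_le[OF x] rd_bd[of x] p_range[OF x] by auto
qed

lemma rd_invariant:
  assumes "bij_betw \<pi> Q Q" "\<forall>x\<in>Q. \<forall>y\<in>Q. L (\<pi> x) (\<pi> y) = L x y \<and> (L x y \<longrightarrow> R (\<pi> x) (\<pi> y) = R x y)"
    and "\<And>x y. x \<in> Q \<Longrightarrow> y \<in> Q \<Longrightarrow> L x y \<Longrightarrow> R x y = thr x y" and x: "x \<in> Q"
  shows "rd (\<pi> x) = rd x"
proof -
  have "\<pi> ` {y\<in>Q. thr x y} = {y\<in>Q. thr (\<pi> x) y}"
  proof
    have \<pi>Q: "\<And>u. u \<in> Q \<Longrightarrow> \<pi> u \<in> Q" using assms(1) by (auto simp: bij_betw_def)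
    have eq: "thr (\<pi> x) (\<pi> y) = thr x y" if "y \<in> Q" for y
      using assms(2,3) x that \<pi>Q unfolding thr_def by metis
    show "\<pi> ` {y\<in>Q. thr x y} \<subseteq> {y\<in>Q. thr (\<pi> x) y}" using eq \<pi>Q by auto
    show "{y\<in>Q. thr (\<pi> x) y} \<subseteq> \<pi> ` {y\<in>Q. thr x y}"
    proof
      fix z assume z: "z \<in> {y\<in>Q. thr (\<pi> x) y}"
      then obtain y where "y \<in> Q" "z = \<pi> y" using assms(1) by (auto simp: bij_betw_def)
      then show "z \<in> \<pi> ` {y\<in>Q. thr x y}" using z eq by auto
    qed
  qed
  moreover have "inj_on \<pi> {y\<in>Q. thr x y}" using assms(1) by (auto simp: bij_betw_def inj_on_def)
  ultimately show ?thesis unfolding rd_def by (metis card_image)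
qed

end

text \<open>This collects what an automorphism mapping the class to itself has to respect:
  \<open>L\<close> stands for adjacency, \<open>R\<close> for the colours inside the class, and
  \<open>q\<close> for the numbers of red edges leaving it.\<close>

definition rigid_labels :: "'a set \<Rightarrow> ('a \<Rightarrow> 'a \<Rightarrow> bool) \<Rightarrow> ('a \<Rightarrow> 'a \<Rightarrow> bool) \<Rightarrow> ('a \<Rightarrow> nat) \<Rightarrow> bool" where
  "rigid_labels Q L R q \<longleftrightarrow> (\<forall>\<pi>. bij_betw \<pi> Q Q \<and>
      (\<forall>x\<in>Q. \<forall>y\<in>Q. L (\<pi> x) (\<pi> y) = L x y \<and> (L x y \<longrightarrow> R (\<pi> x) (\<pi> y) = R x y)) \<and> (\<forall>x\<in>Q. q (\<pi> x) = q x)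
      \<longrightarrow> (\<forall>x\<in>Q. \<pi> x = x))"

text \<open>The aim is to choose \<open>q\<close> such that the total red degree
  \<open>rd x + q x\<close> is the label \<open>p x\<close>. If
  \<open>card Q + 2 \<le> \<delta>\<close>, the bounds on \<open>rd\<close> and \<open>bd\<close>
  leave room for both colours among the \<open>e x\<close> outside edges. With one edge less, the
  upper half of the total red degrees has to be lowered by one, which makes the two middle vertices
  agree.\<close>

lemma threshold_labels:
  fixes Q :: "'a set" and L :: "'a \<Rightarrow> 'a \<Rightarrow> bool"
  assumes fin: "finite Q" and Lsym: "\<And>x y. L x y \<Longrightarrow> L y x" and Lirr: "\<And>x. \<not> L x x"
    and he: "\<And>x. x \<in> Q \<Longrightarrow> card {y\<in>Q. L x y} + e x = \<delta>"
    and small: "card Q + 1 \<le> \<delta>" "2 \<le> card Q"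
    and nontwin: "card Q + 1 = \<delta> \<Longrightarrow> (\<forall>x\<in>Q. \<forall>y\<in>Q. \<not> L x y) \<or>
       (\<exists>x\<in>Q. \<exists>y\<in>Q. \<exists>z\<in>Q. x \<noteq> y \<and> z \<noteq> x \<and> z \<noteq> y \<and> L x z \<noteq> L y z)"
  shows "\<exists>R q. (\<forall>x y. R x y = R y x) \<and> (\<forall>x\<in>Q. 1 \<le> q x \<and> q x < e x) \<and> rigid_labels Q L R q"
proof -
  define n where "n = card Q"
  have ord: "threshold_order Q n p L" if "bij_betw p Q {1..n}" for p
    using that fin Lsym Lirr by unfold_locales (auto simp: n_def)
  consider (A) "card Q + 2 \<le> \<delta>" | (B) "\<forall>x\<in>Q. \<forall>y\<in>Q. \<not> L x y"
    | (C) "card Q + 1 = \<delta>" "\<exists>x\<in>Q. \<exists>y\<in>Q. \<exists>z\<in>Q. x \<noteq> y \<and> z \<noteq> x \<and> z \<noteq> y \<and> L x z \<noteq> L y z"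
    using small nontwin by linarith
  then show ?thesis
  proof cases
    case A
    obtain p where p: "bij_betw p Q {1..n}"
      unfolding n_def using ex_bij_betw_finite_nat[OF fin] fin
      by (metis card_atLeastAtMost diff_Suc_1 finite_atLeastAtMost finite_same_card_bij)
    interpret threshold_order Q n p L by (rule ord[OF p])
    define q where "q = (\<lambda>x. p x - rd x)"
    have "1 \<le> q x \<and> q x < e x" if "x \<in> Q" for x
      using rd_le[OF that] bd_le[OF that] rd_bd[of x] he[OF that] A
      unfolding q_def hd_def n_def[symmetric] by linarith
    moreover have "rigid_labels Q L thr q"
      unfolding rigid_labels_def
    proof (intro allI impI ballI)
      fix \<pi> x assume \<pi>: "bij_betw \<pi> Q Q \<and>
        (\<forall>x\<in>Q. \<forall>y\<in>Q. L (\<pi> x) (\<pi> y) = L x y \<and> (L x y \<longrightarrow> thr (\<pi> x) (\<pi> y) = thr x y)) \<and> (\<forall>x\<in>Q. q (\<pi> x) = q x)"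
        and x: "x \<in> Q"
      have rdi: "rd (\<pi> x) = rd x" by (rule rd_invariant[where R = thr]) (use \<pi> x in auto)
      have px: "\<pi> x \<in> Q" using \<pi> x by (auto simp: bij_betw_def)
      have "q (\<pi> x) = q x" using \<pi> x by blast
      then have "p (\<pi> x) = p x" using rdi rd_le(1)[OF x] rd_le(1)[OF px] unfolding q_def by linarith
      then show "\<pi> x = x" using p_inj px x by blast
    qed
    ultimately show ?thesis using thr_sym by blast
  next
    case B
    obtain p where p: "bij_betw p Q {1..n}"
      unfolding n_def using ex_bij_betw_finite_nat[OF fin] fin
      by (metis card_atLeastAtMost diff_Suc_1 finite_atLeastAtMost finite_same_card_bij)
    have e: "e x = \<delta>" if "x \<in> Q" for x
    proof -
      have "{y\<in>Q. L x y} = {}" using B that by auto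
      then show ?thesis using he[OF that] by (metis add_0 card.empty)
    qed
    have "1 \<le> p x \<and> p x < e x" if "x \<in> Q" for x
    proof -
      have "p x \<in> {1..card Q}" using p that unfolding n_def bij_betw_def by blast
      then show ?thesis using small e[OF that] by auto
    qed
    moreover have "rigid_labels Q L (\<lambda>_ _. False) p"
      unfolding rigid_labels_def
    proof (intro allI impI ballI)
      fix \<pi> x assume \<pi>: "bij_betw \<pi> Q Q \<and> (\<forall>x\<in>Q. \<forall>y\<in>Q. L (\<pi> x) (\<pi> y) = L x y \<and>
          (L x y \<longrightarrow> False = False)) \<and> (\<forall>x\<in>Q. p (\<pi> x) = p x)" and x: "x \<in> Q"
      then have "\<pi> x \<in> Q" "p (\<pi> x) = p x" by (auto simp: bij_betw_def)
      then show "\<pi> x = x" using p x by (auto simp: bij_betw_def inj_on_def)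
    qed
    ultimately show ?thesis by (intro exI[of _ "\<lambda>_ _. False"] exI[of _ p]) auto
  next
    case C
    then obtain x0 y0 z0 where x0: "x0 \<in> Q" "y0 \<in> Q" "z0 \<in> Q" "x0 \<noteq> y0" "z0 \<noteq> x0" "z0 \<noteq> y0" "L x0 z0 \<noteq> L y0 z0"
      by blast
    \<comment> \<open>The middle labels \<open>a\<close> and \<open>a + 1\<close> are the only ones
      that will have the same total red degree. They are given to two vertices that differ in their
      adjacency to \<open>z0\<close>, which is fixed by its own degree.\<close>
    define a where "a = (n + 1) div 2"
    have a: "a \<in> {1..card Q}" "a + 1 \<in> {1..card Q}" using small by (auto simp: a_def n_def)
    obtain p where p': "bij_betw p Q {1..n}" "p x0 = a" "p y0 = a + 1"
      using bij_prescribed_pair[OF fin x0(1,2,4) a] unfolding n_def by auto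
    interpret threshold_order Q n p L by (rule ord[OF p'(1)])
    define q where "q = (\<lambda>x. if 2 * p x \<le> n + 1 then p x - rd x else p x - 1 - rd x)"
    have "1 \<le> q x \<and> q x < e x" if "x \<in> Q" for x
      using rd_le[OF that] bd_le[OF that] rd_bd[of x] he[OF that] C(1)
      unfolding q_def hd_def n_def[symmetric] by (cases "2 * p x \<le> n + 1"; simp; linarith)
    moreover have "rigid_labels Q L thr q"
      unfolding rigid_labels_def
    proof (intro allI impI)
      fix \<pi> assume \<pi>: "bij_betw \<pi> Q Q \<and>
        (\<forall>x\<in>Q. \<forall>y\<in>Q. L (\<pi> x) (\<pi> y) = L x y \<and> (L x y \<longrightarrow> thr (\<pi> x) (\<pi> y) = thr x y)) \<and> (\<forall>x\<in>Q. q (\<pi> x) = q x)"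
      have \<pi>Q: "\<pi> x \<in> Q" if "x \<in> Q" for x using \<pi> that by (auto simp: bij_betw_def)
      \<comment> \<open>This is the total red degree \<open>q x + rd x\<close>.\<close>
      define \<rho> where "\<rho> = (\<lambda>x. if p x \<le> a then p x else p x - 1)"
      have \<rho>: "\<rho> (\<pi> x) = \<rho> x" if x: "x \<in> Q" for x
      proof -
        have rdi: "rd (\<pi> x) = rd x" by (rule rd_invariant[where R = thr]) (use \<pi> x in auto)
        have l: "2 * p u \<le> n + 1 \<longleftrightarrow> p u \<le> a" for u unfolding a_def by linarith
        have "\<rho> u = q u + rd u" if "u \<in> Q" for u
          using rd_le[OF that] unfolding q_def \<rho>_def l by (auto simp: l)
        moreover have "q (\<pi> x) = q x" using \<pi> x by blast
        ultimately show ?thesis using rdi x \<pi>Q by metis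
      qed
      have oth: "\<pi> x = x" if x: "x \<in> Q" "x \<noteq> x0" "x \<noteq> y0" for x
      proof -
        have "p x \<noteq> a" "p x \<noteq> a + 1"
          using p'(2,3) x p_inj[OF x(1) x0(1)] p_inj[OF x(1) x0(2)] by auto
        then have "p (\<pi> x) = p x" using \<rho>[OF x(1)] unfolding \<rho>_def by (auto split: if_splits)
        then show ?thesis using p_inj \<pi>Q x by blast
      qed
      have inj: "\<And>u v. u \<in> Q \<Longrightarrow> v \<in> Q \<Longrightarrow> \<pi> u = \<pi> v \<Longrightarrow> u = v"
        using \<pi> by (auto simp: bij_betw_def inj_on_def)
      have "\<pi> x0 = x0"
      proof (rule ccontr)
        assume ne: "\<pi> x0 \<noteq> x0"
        have "\<pi> x0 = y0" using oth[of "\<pi> x0"] inj[of "\<pi> x0" x0] \<pi>Q[of x0] x0 ne by metis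
        moreover have "\<pi> z0 = z0" using oth x0 by auto
        ultimately have "L y0 z0 = L x0 z0" using \<pi> x0 by metis
        then show False using x0 by simp
      qed
      moreover have "\<pi> y0 = y0"
        using oth[of "\<pi> y0"] inj[of "\<pi> y0" y0] inj[of x0 y0] \<pi>Q[of y0] x0 calculation by metis
      ultimately show "\<forall>x\<in>Q. \<pi> x = x" using oth by metis
    qed
    ultimately show ?thesis using thr_sym by blast
  qed
qed

context threshold_order
begin

text \<open>The antiregular graph has a single nontrivial automorphism, which exchanges the two
  middle vertices. It is excluded once \<open>q\<close> singles out one of them.\<close>

lemma rigid_thr:
  assumes z: "z \<in> Q" "p z = (n + 1) div 2" and compl: "\<And>x y. x \<in> Q \<Longrightarrow> y \<in> Q \<Longrightarrow> x \<noteq> y \<Longrightarrow> L x y"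
    and q: "\<forall>x\<in>Q. q x = q z \<longrightarrow> x = z"
  shows "rigid_labels Q L thr q"
  unfolding rigid_labels_def
proof (intro allI impI ballI)
  define a where "a = (n + 1) div 2"
  fix \<pi> x assume \<pi>: "bij_betw \<pi> Q Q \<and>
    (\<forall>x\<in>Q. \<forall>y\<in>Q. L (\<pi> x) (\<pi> y) = L x y \<and> (L x y \<longrightarrow> thr (\<pi> x) (\<pi> y) = thr x y)) \<and> (\<forall>x\<in>Q. q (\<pi> x) = q x)"
    and x: "x \<in> Q"
  have \<pi>Q: "\<pi> x \<in> Q" if "x \<in> Q" for x using \<pi> that by (auto simp: bij_betw_def)
  have inj: "\<And>u v. u \<in> Q \<Longrightarrow> v \<in> Q \<Longrightarrow> \<pi> u = \<pi> v \<Longrightarrow> u = v"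
    using \<pi> by (auto simp: bij_betw_def inj_on_def)
  have \<pi>z: "\<pi> z = z" using q \<pi> \<pi>Q z(1) by blast
  have rdi: "rd (\<pi> x) = rd x" by (rule rd_invariant[where R = thr]) (use \<pi> x in auto)
  show "\<pi> x = x"
  proof (cases "x = z")
    case False
    then have "\<pi> x \<noteq> z" using inj[of x z] \<pi>z x z(1) by auto
    then have pz: "p (\<pi> x) \<noteq> a" "p x \<noteq> a"
      using p_inj[OF x z(1)] p_inj[OF \<pi>Q[OF x] z(1)] False z(2) by (auto simp: a_def)
    have l: "2 * p u \<le> n + 1 \<longleftrightarrow> p u \<le> a" for u unfolding a_def by linarith
    have e1: "rd x = (if p x \<le> a then p x - 1 else p x - 2)"
      using rd_complete[OF x compl] unfolding l by blast
    have e2: "rd (\<pi> x) = (if p (\<pi> x) \<le> a then p (\<pi> x) - 1 else p (\<pi> x) - 2)"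
      using rd_complete[OF \<pi>Q[OF x] compl] unfolding l by blast
    have "p (\<pi> x) = p x"
      using rdi pz p_range[OF x] p_range[OF \<pi>Q[OF x]] p_range[OF z(1)] e1 e2 z(2) unfolding a_def[symmetric] by (simp split: if_splits)
    then show ?thesis using p_inj \<pi>Q x by blast
  qed (use \<pi>z in simp)
qed

end

text \<open>The colours inside are chosen before \<open>q\<close>, because in
  \<open>multi_step\<close> the value of \<open>q\<close> at \<open>z\<close> depends on
  them.\<close>

lemma threshold_complete:
  fixes Q :: "'a set" and L :: "'a \<Rightarrow> 'a \<Rightarrow> bool"
  assumes fin: "finite Q" and Lsym: "\<And>x y. L x y \<Longrightarrow> L y x" and Lirr: "\<And>x. \<not> L x x"
    and "2 \<le> card Q" "z \<in> Q" and compl: "\<And>x y. x \<in> Q \<Longrightarrow> y \<in> Q \<Longrightarrow> x \<noteq> y \<Longrightarrow> L x y"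
  shows "\<exists>R. (\<forall>x y. R x y = R y x) \<and> (\<forall>q. (\<forall>x\<in>Q. q x = q z \<longrightarrow> x = z) \<longrightarrow> rigid_labels Q L R q)"
proof -
  define n where "n = card Q"
  define a where "a = (n + 1) div 2"
  have a: "a \<in> {1..card Q}" "a + 1 \<in> {1..card Q}" using assms by (auto simp: a_def n_def)
  have "Q \<noteq> {z}" using assms by auto
  then obtain y where y: "y \<in> Q" "y \<noteq> z" using assms by blast
  obtain p where p': "bij_betw p Q {1..n}" "p z = a" "p y = a + 1"
    using bij_prescribed_pair[OF fin \<open>z \<in> Q\<close> y(1) _ a] y unfolding n_def by auto
  interpret threshold_order Q n p L
    using p' fin Lsym Lirr by unfold_locales (auto simp: n_def)
  have "rigid_labels Q L thr q" if "\<forall>x\<in>Q. q x = q z \<longrightarrow> x = z" for q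
    using rigid_thr[OF assms(5) _ compl that] p'(2) unfolding a_def by blast
  then show ?thesis using thr_sym by blast
qed

subsection \<open>Colourings of regular graphs\<close>

locale rgraph =
  fixes V :: "'a set" and A :: "'a \<Rightarrow> 'a \<Rightarrow> bool" and d :: nat
  assumes A_sym: "A u v \<Longrightarrow> A v u" and A_irr: "\<not> A u u" and A_V: "A u v \<Longrightarrow> u \<in> V"
    and fin: "v \<in> V \<Longrightarrow> finite {u. A v u}" and deg: "v \<in> V \<Longrightarrow> card {u. A v u} = d"
    and conn: "S \<subseteq> V \<Longrightarrow> S \<noteq> {} \<Longrightarrow> S \<noteq> V \<Longrightarrow> \<exists>u\<in>S. \<exists>v\<in>V - S. A u v"
begin

definition N :: "'a \<Rightarrow> 'a set" where "N v = {u. A v u}"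
definition \<delta> :: "'a set \<Rightarrow> 'a \<Rightarrow> nat" where "\<delta> F v = card (N v - F)"
text \<open>For a vertex without neighbours in \<open>F\<close> this is the set of all such
  vertices, which may be infinite. Bounds are therefore stated only for attached vertices or inside
  some \<open>N x\<close>.\<close>

definition cls :: "'a set \<Rightarrow> ('a \<Rightarrow> 'a \<Rightarrow> bool) \<Rightarrow> 'a \<Rightarrow> 'a set" where
  "cls F C v = {w\<in>V - F. N w \<inter> F = N v \<inter> F \<and> (\<forall>u\<in>N v \<inter> F. C u w = C u v)}"
definition aut :: "('a \<Rightarrow> 'a) \<Rightarrow> bool" where
  "aut \<phi> \<longleftrightarrow> bij_betw \<phi> V V \<and> (\<forall>u\<in>V. \<forall>v\<in>V. A (\<phi> u) (\<phi> v) = A u v)"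
definition pres :: "('a \<Rightarrow> 'a \<Rightarrow> bool) \<Rightarrow> ('a \<Rightarrow> 'a) \<Rightarrow> bool" where
  "pres C \<phi> \<longleftrightarrow> (\<forall>u v. A u v \<longrightarrow> C (\<phi> u) (\<phi> v) = C u v)"
definition symc :: "('a \<Rightarrow> 'a \<Rightarrow> bool) \<Rightarrow> bool" where "symc C \<longleftrightarrow> (\<forall>u v. C u v = C v u)"
definition agree :: "'a set \<Rightarrow> ('a \<Rightarrow> 'a \<Rightarrow> bool) \<Rightarrow> ('a \<Rightarrow> 'a \<Rightarrow> bool) \<Rightarrow> bool" where
  "agree F C C' \<longleftrightarrow> (\<forall>u\<in>F. \<forall>v. A u v \<longrightarrow> C' u v = C u v)"

lemma NI: "A u v \<Longrightarrow> v \<in> N u" by (simp add: N_def)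
lemma ND: "v \<in> N u \<Longrightarrow> A u v" by (simp add: N_def)
lemma N_sym: "u \<in> N v \<longleftrightarrow> v \<in> N u" by (auto simp: N_def A_sym)
lemma N_V: "u \<in> N v \<Longrightarrow> u \<in> V" "u \<in> N v \<Longrightarrow> v \<in> V" using A_V A_sym by (auto simp: N_def)
lemma N_irr: "u \<notin> N u" by (simp add: N_def A_irr)
lemma fin_N: "v \<in> V \<Longrightarrow> finite (N v)" by (simp add: N_def fin)
lemma card_N: "v \<in> V \<Longrightarrow> card (N v) = d" by (simp add: N_def deg)

lemma \<delta>_add: "v \<in> V \<Longrightarrow> \<delta> F v + card (N v \<inter> F) = d"
  using card_Int_Diff[OF fin_N, of v F] card_N[of v] by (simp add: \<delta>_def)

lemma \<delta>_attached: assumes "v \<in> V" shows "N v \<inter> F \<noteq> {} \<longleftrightarrow> \<delta> F v < d"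
proof -
  have "finite (N v \<inter> F)" using fin_N assms by auto
  then show ?thesis using \<delta>_add[OF assms, of F] by (metis add.right_neutral card_0_eq card_gt_0_iff
        less_add_same_cancel1 not_less_iff_gr_or_eq)
qed

lemma cls_refl: "v \<in> V - F \<Longrightarrow> v \<in> cls F C v" by (auto simp: cls_def)
lemma cls_eq: "w \<in> cls F C v \<Longrightarrow> cls F C w = cls F C v" by (auto simp: cls_def)
lemma cls_sub: "cls F C v \<subseteq> V - F" by (auto simp: cls_def)
lemma cls_N: "w \<in> cls F C v \<Longrightarrow> N w \<inter> F = N v \<inter> F" by (auto simp: cls_def)

lemma fin_cls: assumes "N v \<inter> F \<noteq> {}" shows "finite (cls F C v)"
proof -
  obtain u where u: "u \<in> N v" "u \<in> F" using assms by blast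
  have "cls F C v \<subseteq> N u" using u N_sym by (auto simp: cls_def)
  then show ?thesis using fin_N N_V(1)[OF u(1)] finite_subset by blast
qed

lemma cls_\<delta>: "w \<in> cls F C v \<Longrightarrow> v \<in> V \<Longrightarrow> \<delta> F w = \<delta> F v"
  using \<delta>_add[of w F] \<delta>_add[of v F] cls_N[of w F C v] cls_sub[of F C v] by (metis DiffD1 add_right_cancel subsetD)

lemma symcD: "symc C \<Longrightarrow> C u v = C v u" by (auto simp: symc_def)
lemma agreeD: "agree F C C' \<Longrightarrow> u \<in> F \<Longrightarrow> A u v \<Longrightarrow> C' u v = C u v" by (auto simp: agree_def)
lemma agreeD2: "agree F C C' \<Longrightarrow> symc C \<Longrightarrow> symc C' \<Longrightarrow> u \<in> F \<Longrightarrow> A v u \<Longrightarrow> C' v u = C v u"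
  using agreeD[of F C C' u v] A_sym symcD[of C v u] symcD[of C' v u] by auto

lemma aut_V: "aut \<phi> \<Longrightarrow> v \<in> V \<Longrightarrow> \<phi> v \<in> V" by (auto simp: aut_def bij_betw_def)
lemma aut_inj: "aut \<phi> \<Longrightarrow> u \<in> V \<Longrightarrow> v \<in> V \<Longrightarrow> \<phi> u = \<phi> v \<Longrightarrow> u = v"
  by (auto simp: aut_def bij_betw_def inj_on_def)
lemma aut_A: "aut \<phi> \<Longrightarrow> u \<in> V \<Longrightarrow> v \<in> V \<Longrightarrow> A (\<phi> u) (\<phi> v) = A u v" by (auto simp: aut_def)
lemma aut_surj: "aut \<phi> \<Longrightarrow> v \<in> V \<Longrightarrow> \<exists>u\<in>V. \<phi> u = v"
  unfolding aut_def bij_betw_def by (metis imageE)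
lemma aut_N: assumes "aut \<phi>" "v \<in> V" shows "N (\<phi> v) = \<phi> ` N v"
proof
  show "\<phi> ` N v \<subseteq> N (\<phi> v)" using aut_A[OF assms(1) assms(2)] N_V by (auto simp: N_def)
  show "N (\<phi> v) \<subseteq> \<phi> ` N v"
  proof
    fix u assume u: "u \<in> N (\<phi> v)"
    then obtain w where "w \<in> V" "\<phi> w = u" using aut_surj assms N_V by metis
    then show "u \<in> \<phi> ` N v" using u aut_A[OF assms(1) assms(2)] by (auto simp: N_def)
  qed
qed
lemma aut_inv_cases: "aut \<phi> \<Longrightarrow> v \<in> V \<Longrightarrow> w \<in> N (\<phi> v) \<Longrightarrow> \<exists>u\<in>N v. \<phi> u = w" using aut_N by auto
lemma presD: "pres C \<phi> \<Longrightarrow> A u v \<Longrightarrow> C (\<phi> u) (\<phi> v) = C u v" by (auto simp: pres_def)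

text \<open>As \<phi> fixes \<open>F\<close>, an edge from \<open>u\<close> in \<open>F\<close> to
  \<open>v\<close> is mapped to an edge from the same \<open>u\<close> to \<open>\<phi> v\<close> of
  the same colour.\<close>

lemma aut_cls:
  assumes "aut \<phi>" "pres C' \<phi>" "agree F C C'" "\<forall>u\<in>F. \<phi> u = u" "F \<subseteq> V" "v \<in> V - F"
  shows "\<phi> v \<in> cls F C v"
proof -
  have nF: "\<phi> v \<notin> F"
    using assms aut_inj[OF assms(1), of v "\<phi> v"] aut_V by (metis DiffD1 DiffD2)
  have e: "A u (\<phi> v) = A u v" if "u \<in> F" for u
    using aut_A[OF assms(1), of u v] that assms by auto
  have "C u (\<phi> v) = C u v" if u: "u \<in> F" "A u v" for u
    using agreeD[OF assms(3) u(1)] presD[OF assms(2) u(2)] e[OF u(1)] u assms(4) by (metis (full_types))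
  moreover have "N (\<phi> v) \<inter> F = N v \<inter> F" using e N_sym by (auto simp: N_def)
  ultimately show ?thesis using nF aut_V assms N_sym by (auto simp: cls_def N_def)
qed

end

locale extension = rgraph +
  fixes F0 F1 :: "'a set"
  assumes d3: "3 \<le> d" and F1_sub: "F1 \<subseteq> F0" and F0_sub: "F0 \<subseteq> V" and F0_ne: "F0 \<noteq> {}"
    and F1_few: "v \<in> V - F0 \<Longrightarrow> card (N v \<inter> F1) + 3 \<le> d"
begin

text \<open>Edges to \<open>F1\<close> are disregarded, so that a start can mark a vertex by giving it no red edge apart
  from one to \<open>F1\<close>.\<close>
definition sat :: "('a \<Rightarrow> 'a \<Rightarrow> bool) \<Rightarrow> 'a \<Rightarrow> bool" where
  "sat C v \<longleftrightarrow> (\<exists>u\<in>N v - F1. C v u) \<and> (\<exists>u\<in>N v - F1. \<not> C v u)"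
definition fsat :: "'a set \<Rightarrow> ('a \<Rightarrow> 'a \<Rightarrow> bool) \<Rightarrow> 'a \<Rightarrow> bool" where
  "fsat F C v \<longleftrightarrow> (\<exists>u\<in>N v \<inter> F - F1. C v u) \<and> (\<exists>u\<in>N v \<inter> F - F1. \<not> C v u)"
text \<open>The degree sum singles out the finite components of \<open>G - F\<close> that are trees.\<close>
definition tcomp :: "'a set \<Rightarrow> 'a set \<Rightarrow> bool" where
  "tcomp F K \<longleftrightarrow> K \<subseteq> V - F \<and> finite K \<and> K \<noteq> {} \<and> (\<forall>v\<in>K. N v - F \<subseteq> K) \<and>
     (\<forall>S\<subseteq>K. S \<noteq> {} \<longrightarrow> S \<noteq> K \<longrightarrow> (\<exists>a\<in>S. \<exists>b\<in>K - S. A a b)) \<and> (\<Sum>v\<in>K. \<delta> F v) + 2 = 2 * card K"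
text \<open>The colours of the edges inside \<open>K\<close> are still open; those of the edges to
  \<open>F\<close> are not.\<close>

definition satK :: "'a set \<Rightarrow> ('a \<Rightarrow> 'a \<Rightarrow> bool) \<Rightarrow> 'a set \<Rightarrow> bool" where
  "satK F C K \<longleftrightarrow> (\<exists>C'. symc C' \<and> (\<forall>u\<in>F. \<forall>v\<in>K. A u v \<longrightarrow> C' u v = C u v) \<and> (\<forall>v\<in>K. sat C' v))"
text \<open>The maximum with 1 admits singletons, which are fixed whatever their \<delta>.\<close>

definition inv1 :: "'a set \<Rightarrow> ('a \<Rightarrow> 'a \<Rightarrow> bool) \<Rightarrow> bool" where
  "inv1 F C \<longleftrightarrow> (\<forall>v\<in>V - F. N v \<inter> F \<noteq> {} \<longrightarrow> card (cls F C v) \<le> max 1 (\<delta> F v - 1))"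
definition inv2 :: "'a set \<Rightarrow> ('a \<Rightarrow> 'a \<Rightarrow> bool) \<Rightarrow> bool" where
  "inv2 F C \<longleftrightarrow> (\<forall>K. tcomp F K \<longrightarrow> satK F C K)"
text \<open>The condition ranges over all colourings that extend the present partial one, since the
  final colouring is not known at this stage.\<close>

definition fixing :: "'a set \<Rightarrow> ('a \<Rightarrow> 'a \<Rightarrow> bool) \<Rightarrow> bool" where
  "fixing F C \<longleftrightarrow> (\<forall>\<phi> C'. aut \<phi> \<and> symc C' \<and> agree F C C' \<and> pres C' \<phi> \<and> (\<forall>v\<in>F0. \<phi> v = v) \<longrightarrow> (\<forall>v\<in>F. \<phi> v = v))"
definition good :: "'a set \<Rightarrow> ('a \<Rightarrow> 'a \<Rightarrow> bool) \<Rightarrow> bool" where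
  "good F C \<longleftrightarrow> F0 \<subseteq> F \<and> F \<subseteq> V \<and> symc C \<and> inv1 F C \<and> inv2 F C \<and> fixing F C \<and> (\<forall>v\<in>F - F0. sat C v)"

section \<open>Satisfiability of tree components\<close>

lemma sat_cong: "(\<And>u. u \<in> N v \<Longrightarrow> C' v u = C v u) \<Longrightarrow> sat C v \<Longrightarrow> sat C' v"
  unfolding sat_def by (metis DiffD1)

lemma relevant_two: assumes "v \<in> V - F0" "a \<in> N v" shows "\<exists>b\<in>N v - F1. b \<noteq> a"
proof -
  have f: "finite (N v)" using assms fin_N by auto
  have "card (N v - F1) = d - card (N v \<inter> F1)"
    using card_Int_Diff[OF f, of F1] card_N[of v] assms by auto
  then have "card (N v - F1) \<ge> 3" using F1_few[OF assms(1)] by linarith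
  then have "\<not> N v - F1 \<subseteq> {a}" using card_mono[of "{a}" "N v - F1"] by auto
  then show ?thesis by blast
qed

text \<open>The vertices of \<open>K\<close> are attached to \<open>S\<close> one after the other;
  the edge by which \<open>b\<close> is attached gets the colour that some other edge at
  \<open>b\<close> does not have.\<close>

lemma recolour:
  assumes "finite K" "K \<subseteq> V - F0" "S \<subseteq> K" "S \<noteq> {}" "symc C"
    and cut: "\<forall>S\<subseteq>K. S \<noteq> {} \<longrightarrow> S \<noteq> K \<longrightarrow> (\<exists>a\<in>S. \<exists>b\<in>K - S. A a b)"
  shows "\<exists>C'. symc C' \<and> (\<forall>u v. C' u v \<noteq> C u v \<longrightarrow> u \<in> K \<and> v \<in> K \<and> \<not> (u \<in> S \<and> v \<in> S)) \<and> (\<forall>v\<in>K - S. sat C' v)"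
  using assms(3,4)
proof (induction "card (K - S)" arbitrary: S rule: less_induct)
  case less
  show ?case
  proof (cases "S = K")
    case True
    then show ?thesis using assms(5) by blast
  next
    case False
    then obtain a b where ab: "a \<in> S" "b \<in> K - S" "A a b" using cut less.prems by blast
    have "card (K - insert b S) < card (K - S)"
      using ab assms(1) by (intro psubset_card_mono) auto
    \<comment> \<open>The edges farther out are coloured before the edge joining \<open>a\<close>
      and \<open>b\<close>, so the edge from \<open>b\<close> to \<open>f\<close> does not change
      its colour afterwards.\<close>
    from less.hyps[OF this] obtain C' where C': "symc C'"
      "\<And>u v. C' u v \<noteq> C u v \<Longrightarrow> u \<in> K \<and> v \<in> K \<and> \<not> (u \<in> insert b S \<and> v \<in> insert b S)"
      "\<forall>v\<in>K - insert b S. sat C' v" using ab less.prems by (metis DiffD1 insert_not_empty insert_subset)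
    have bV: "b \<in> V - F0" using ab assms(2) by auto
    obtain f where f: "f \<in> N b - F1" "f \<noteq> a" using relevant_two[OF bV, of a] ab A_sym NI by blast
    have aF1: "a \<notin> F1" using ab less.prems assms(2) F1_sub by blast
    define C'' where "C'' = (\<lambda>u v. if (u = a \<and> v = b) \<or> (u = b \<and> v = a) then \<not> C' b f else C' u v)"
    have fb: "f \<noteq> b" using f N_irr by auto
    have 1: "symc C''" using C'(1) unfolding symc_def C''_def by auto
    have 2: "u \<in> K \<and> v \<in> K \<and> \<not> (u \<in> S \<and> v \<in> S)" if h: "C'' u v \<noteq> C u v" for u v
    proof (cases "(u = a \<and> v = b) \<or> (u = b \<and> v = a)")
      case True then show ?thesis using ab less.prems by auto
    next
      case False
      then have "C' u v \<noteq> C u v" using h unfolding C''_def by auto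
      then show ?thesis using C'(2) by blast
    qed
    have 3: "sat C'' v" if v: "v \<in> K - S" for v
    proof (cases "v = b")
      case True
      have "C'' b a = (\<not> C' b f)" "C'' b f = C' b f" using f fb ab by (auto simp: C''_def)
      then show ?thesis using f aF1 ab A_sym NI unfolding True sat_def
        by (cases "C' b f") (metis DiffI)+
    next
      case False
      then have "sat C' v" using C'(3) v by blast
      moreover have "C'' v u = C' v u" for u using False v ab by (auto simp: C''_def)
      ultimately show ?thesis using sat_cong by blast
    qed
    show ?thesis using 1 2 3 by blast
  qed
qed

lemma tcompD: assumes "tcomp F K"
  shows "K \<subseteq> V - F" "finite K" "K \<noteq> {}" "\<And>v. v \<in> K \<Longrightarrow> N v - F \<subseteq> K"
    "\<forall>S\<subseteq>K. S \<noteq> {} \<longrightarrow> S \<noteq> K \<longrightarrow> (\<exists>a\<in>S. \<exists>b\<in>K - S. A a b)" "(\<Sum>v\<in>K. \<delta> F v) + 2 = 2 * card K"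
  using assms unfolding tcomp_def by blast+

text \<open>The edges showing both colours at the vertices of \<open>S\<close> lead to
  \<open>F\<close> or lie inside \<open>S\<close>, and \<open>recolour\<close> leaves these
  alone.\<close>

lemma satK_set:
  assumes "tcomp F K" "F0 \<subseteq> F" "S \<subseteq> K" "S \<noteq> {}" "symc C" "\<forall>v\<in>S. \<exists>f g. f \<in> N v - F1 \<and> g \<in> N v - F1 \<and> f \<in> F \<union> S \<and> g \<in> F \<union> S \<and> C v f \<and> \<not> C v g"
  shows "satK F C K"
proof -
  note K = tcompD[OF assms(1)]
  have K0: "K \<subseteq> V - F0" using K(1) assms(2) by blast
  obtain C' where C': "symc C'" "\<And>u v. C' u v \<noteq> C u v \<Longrightarrow> u \<in> K \<and> v \<in> K \<and> \<not> (u \<in> S \<and> v \<in> S)" "\<forall>v\<in>K - S. sat C' v"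
    using recolour[OF K(2) K0 assms(3,4,5) K(5)] by blast
  have "sat C' v" if v: "v \<in> S" for v
  proof -
    obtain f g where fg: "f \<in> N v - F1" "g \<in> N v - F1" "f \<in> F \<union> S" "g \<in> F \<union> S" "C v f" "\<not> C v g"
      using assms(6) v by blast
    have "C' v f = C v f" "C' v g = C v g" using C'(2) fg v K(1) by blast+
    then show ?thesis using fg unfolding sat_def by auto
  qed
  moreover have "C' u v = C u v" if "u \<in> F" "v \<in> K" for u v using C'(2) that K(1) by blast
  ultimately show ?thesis unfolding satK_def using C' by blast
qed

lemma satK_root:
  assumes "tcomp F K" "F0 \<subseteq> F" "u \<in> K" "symc C" "fsat F C u"
  shows "satK F C K"
  by (rule satK_set[OF assms(1,2), of "{u}"]) (use assms in \<open>auto simp: fsat_def\<close>)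

text \<open>If two adjacent vertices lack the same colour, give it to the edge joining them.\<close>
lemma satK_edge:
  assumes "tcomp F K" "F0 \<subseteq> F" "u \<in> K" "w \<in> K" "A u w" "symc C"
    and "f \<in> N u \<inter> F - F1" "g \<in> N w \<inter> F - F1" "C u f = C w g"
  shows "satK F C K"
proof -
  define C1 where "C1 = (\<lambda>x y. if (x = u \<and> y = w) \<or> (x = w \<and> y = u) then \<not> C u f else C x y)"
  note K = tcompD[OF assms(1)]
  have ne: "u \<noteq> w" using assms(5) A_irr by auto
  have nF1: "u \<notin> F1" "w \<notin> F1" using K(1) assms F1_sub by blast+
  have uw: "u \<notin> F" "w \<notin> F" using K(1) assms by blast+
  have sym: "symc C1" using assms(6) unfolding symc_def C1_def by auto
  have fw: "f \<noteq> w" "g \<noteq> u" "f \<noteq> u" "g \<noteq> w" using assms uw by auto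
  have c: "C1 u w = (\<not> C u f)" "C1 w u = (\<not> C u f)" "C1 u f = C u f" "C1 w g = C u f"
    using ne fw assms(9) by (auto simp: C1_def)
  have "satK F C1 K"
  proof (rule satK_set[OF assms(1,2), of "{u, w}"])
    have 1: "w \<in> N u - F1" "u \<in> N w - F1" using assms(5) A_sym nF1 NI by auto
    show "\<forall>v\<in>{u, w}. \<exists>f g. f \<in> N v - F1 \<and> g \<in> N v - F1 \<and> f \<in> F \<union> {u, w} \<and> g \<in> F \<union> {u, w} \<and> C1 v f \<and> \<not> C1 v g"
    proof (cases "C u f")
      case True
      then show ?thesis using c 1 assms(7,8) by blast
    next
      case False
      then show ?thesis using c 1 assms(7,8) by blast
    qed
  qed (use assms sym in auto)
  moreover have "C1 x v = C x v" if "x \<in> F" for x v using that uw by (auto simp: C1_def)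
  ultimately show ?thesis unfolding satK_def by (metis (no_types, lifting))
qed

lemma tcomp_unique:
  assumes "tcomp F K" "tcomp F K'" "x \<in> K" "x \<in> K'" shows "K = K'"
proof -
  have "K \<subseteq> K'" if "tcomp F K" "tcomp F K'" "x \<in> K" "x \<in> K'" for K K'
  proof (rule ccontr)
    assume "\<not> K \<subseteq> K'"
    note t = that
    have "K \<inter> K' \<noteq> K" "K \<inter> K' \<noteq> {}" "K \<inter> K' \<subseteq> K" using \<open>\<not> K \<subseteq> K'\<close> t by auto
    then have "\<exists>a\<in>K \<inter> K'. \<exists>b\<in>K - K \<inter> K'. A a b" using tcompD(5)[OF t(1)] by blast
    then obtain a b where ab: "a \<in> K \<inter> K'" "b \<in> K - K \<inter> K'" "A a b" by blast
    then have "b \<in> N a - F" using tcompD(1)[OF t(1)] NI by blast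
    then have "b \<in> K'" using tcompD(4)[OF t(2), of a] ab by blast
    then show False using ab by blast
  qed
  then show ?thesis using assms by blast
qed

text \<open>In a tree the average of \<delta> is less than 2.\<close>

lemma tcomp_leaf: assumes "tcomp F K" shows "\<exists>v\<in>K. \<delta> F v \<le> 1"
proof (rule ccontr)
  assume "\<not> (\<exists>v\<in>K. \<delta> F v \<le> 1)"
  then have "(\<Sum>v\<in>K. 2) \<le> (\<Sum>v\<in>K. \<delta> F v)" by (intro sum_mono) auto
  then show False using tcompD(6)[OF assms] by simp
qed

text \<open>All vertices other than \<open>v\<close> and the leaves contribute at least 2 to a
  degree sum of \<open>2 * card K - 2\<close>.\<close>

lemma tcomp_leaves:
  assumes K: "tcomp F K" and v: "v \<in> K" "2 \<le> \<delta> F v" and pos: "\<forall>u\<in>K. 1 \<le> \<delta> F u"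
  shows "\<delta> F v \<le> card {u\<in>K. \<delta> F u = 1}"
proof -
  define L where "L = {u\<in>K. \<delta> F u = 1}"
  have fK: "finite K" using tcompD(2)[OF K] .
  have fL: "finite L" "L \<subseteq> K" "v \<notin> L" using fK v by (auto simp: L_def)
  have "(\<Sum>u\<in>K. \<delta> F u) = \<delta> F v + (\<Sum>u\<in>K - {v}. \<delta> F u)" using fK v by (simp add: sum.remove)
  also have "(\<Sum>u\<in>K - {v}. \<delta> F u) = (\<Sum>u\<in>L. \<delta> F u) + (\<Sum>u\<in>K - {v} - L. \<delta> F u)"
    using fK fL by (subst sum.subset_diff[of L "K - {v}"]) auto
  also have "(\<Sum>u\<in>L. \<delta> F u) = card L" by (simp add: L_def)
  finally have eq: "(\<Sum>u\<in>K. \<delta> F u) = \<delta> F v + (card L + (\<Sum>u\<in>K - {v} - L. \<delta> F u))" .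
  have "(\<Sum>u\<in>K - {v} - L. 2) \<le> (\<Sum>u\<in>K - {v} - L. \<delta> F u)"
  proof (rule sum_mono)
    fix u assume u: "u \<in> K - {v} - L"
    then have "1 \<le> \<delta> F u" "\<delta> F u \<noteq> 1" using pos by (auto simp: L_def)
    then show "2 \<le> \<delta> F u" by simp
  qed
  then have "\<delta> F v + (card L + 2 * card (K - {v} - L)) \<le> (\<Sum>u\<in>K. \<delta> F u)" using eq by simp
  moreover have "card (K - {v} - L) = card K - 1 - card L"
  proof -
    have "card (K - {v} - L) = card (K - {v}) - card L" using fL fK by (intro card_Diff_subset) auto
    then show ?thesis using v by simp
  qed
  moreover have "card L + 1 \<le> card K"
    using card_mono[of K "insert v L"] fK fL v by auto
  ultimately show ?thesis using tcompD(6)[OF K] unfolding L_def[symmetric] by linarith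
qed

text \<open>Of the at least \<open>d - 2\<close> neighbours of \<open>v\<close> in \<open>F\<close>,
  at most \<open>d - 3\<close> lie in \<open>F1\<close>.\<close>

lemma attached_relevant:
  assumes "v \<in> V - F" "F0 \<subseteq> F" "\<delta> F v \<le> 2"
  shows "\<exists>f\<in>N v \<inter> F - F1. True"
proof (rule ccontr)
  assume "\<not> ?thesis"
  then have "N v \<inter> F \<subseteq> N v \<inter> F1" by blast
  then have "card (N v \<inter> F) \<le> card (N v \<inter> F1)" using fin_N assms by (intro card_mono) auto
  then show False using F1_few[of v] \<delta>_add[of v F] assms by auto
qed

text \<open>For attached \<open>v\<close> this is the invariant. An unattached one has \<delta> =
  \<open>d\<close>, whereas the attached vertex \<open>x\<close> has at most \<open>d - 1\<close>
  neighbours outside \<open>F\<close>.\<close>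

lemma new_class_bound:
  assumes inv: "inv1 F C" and v: "v \<in> V - F" and D: "D \<subseteq> cls F C v" "finite D" "D \<subseteq> N x" "x \<in> V - F"
    and x: "N x \<inter> F \<noteq> {}" and two: "2 \<le> card D"
  shows "card D \<le> \<delta> F v - 1"
proof (cases "N v \<inter> F = {}")
  case True
  have "D \<subseteq> N x - F" using D cls_sub by blast
  then have "card D \<le> \<delta> F x" unfolding \<delta>_def using fin_N D by (intro card_mono) auto
  also have "\<delta> F x < d" using x \<delta>_attached D by blast
  finally show ?thesis using \<delta>_add[of v F] v True by simp
next
  case False
  have "card D \<le> card (cls F C v)" using D fin_cls[OF False] by (intro card_mono) auto
  also have "\<dots> \<le> max 1 (\<delta> F v - 1)" using inv v False unfolding inv1_def by blast
  finally show ?thesis using two by simp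
qed

lemma tcomp_untouched:
  assumes K: "tcomp (F \<union> Q) K" and un: "\<And>v. v \<in> K \<Longrightarrow> N v \<inter> Q = {}"
  shows "tcomp F K"
proof -
  note D = tcompD[OF K]
  have e: "N v - (F \<union> Q) = N v - F" if "v \<in> K" for v using un[OF that] by blast
  then have s: "(\<Sum>v\<in>K. \<delta> F v) = (\<Sum>v\<in>K. \<delta> (F \<union> Q) v)" by (intro sum.cong) (auto simp: \<delta>_def)
  have "K \<subseteq> V - F" using D(1) by blast
  moreover have "\<forall>v\<in>K. N v - F \<subseteq> K" using D(4) e by metis
  ultimately show ?thesis unfolding tcomp_def using D(2,3,5,6) s by metis
qed

section \<open>Fixing a class with a single member\<close>

definition paint :: "'a set \<Rightarrow> ('a \<Rightarrow> 'a \<Rightarrow> bool) \<Rightarrow> 'a \<Rightarrow> 'a set \<Rightarrow> 'a \<Rightarrow> 'a \<Rightarrow> bool" where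
  "paint F C x R u v = (if u \<in> F \<or> v \<in> F then C u v else if u = x then v \<in> R else if v = x then u \<in> R else C u v)"

lemma paint_symc: "symc C \<Longrightarrow> x \<notin> R \<Longrightarrow> symc (paint F C x R)"
  unfolding symc_def paint_def by auto

lemma paint_agree: "agree F C (paint F C x R)"
  unfolding agree_def paint_def by auto

lemma agree_sat: "agree F C C' \<Longrightarrow> v \<in> F \<Longrightarrow> sat C v \<Longrightarrow> sat C' v"
  by (rule sat_cong) (auto simp: agree_def N_def)

text \<open>Adding \<open>x\<close> lowers \<delta> only at the neighbours of \<open>x\<close>, and
  only by one; there the class loses at least one member because \<open>R\<close> splits it.\<close>

lemma single_inv1:
  assumes inv: "inv1 F C" and x: "x \<in> V - F" "N x \<inter> F \<noteq> {}"
    and R: "R \<subseteq> N x - F"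
    and split: "\<And>v D. v \<in> N x - F \<Longrightarrow> D = cls F C v \<inter> N x \<Longrightarrow> 2 \<le> card D \<Longrightarrow> R \<inter> D \<noteq> {} \<and> D - R \<noteq> {}"
  shows "inv1 (F \<union> {x}) (paint F C x R)"
  unfolding inv1_def
proof (intro ballI impI)
  define C' where "C' = paint F C x R"
  fix v assume v: "v \<in> V - (F \<union> {x})" and att: "N v \<inter> (F \<union> {x}) \<noteq> {}"
  have finx: "finite (N x)" using fin_N x by auto
  have sub: "cls (F \<union> {x}) C' v \<subseteq> cls F C v"
  proof
    fix w assume w: "w \<in> cls (F \<union> {x}) C' v"
    have "N w \<inter> F = N v \<inter> F" using w unfolding cls_def by blast
    moreover have "C u w = C u v" if "u \<in> N v \<inter> F" for u
    proof -
      have "C' u w = C' u v" using w that unfolding cls_def by blast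
      then show ?thesis using that by (simp add: C'_def paint_def)
    qed
    ultimately show "w \<in> cls F C v" using w unfolding cls_def by auto
  qed
  show "card (cls (F \<union> {x}) C' v) \<le> max 1 (\<delta> (F \<union> {x}) v - 1)"
  proof (cases "x \<in> N v")
    case False
    then have a: "N v \<inter> F \<noteq> {}" using att by auto
    have "\<delta> (F \<union> {x}) v = \<delta> F v" using False unfolding \<delta>_def by (metis Diff_Diff_Int Diff_insert0 Diff_insert2 Un_insert_right sup_bot_right Diff_insert)
    moreover have "card (cls (F \<union> {x}) C' v) \<le> card (cls F C v)" using sub fin_cls[OF a] by (intro card_mono) auto
    ultimately show ?thesis using inv v a unfolding inv1_def by fastforce
  next
    case True
    define D where "D = cls F C v \<inter> N x"
    have vx: "v \<in> N x - F" using True N_sym v by auto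
    have fD: "finite D" using finx by (auto simp: D_def)
    have \<delta>1: "\<delta> (F \<union> {x}) v = \<delta> F v - 1"
    proof -
      have "N v - (F \<union> {x}) = (N v - F) - {x}" by auto
      then show ?thesis unfolding \<delta>_def using True x by (simp add: card_Diff_singleton)
    qed
    have E: "cls (F \<union> {x}) C' v \<subseteq> {w\<in>D. (w \<in> R) = (v \<in> R)}"
    proof
      fix w assume w: "w \<in> cls (F \<union> {x}) C' v"
      have "x \<in> N w" using w True unfolding cls_def by blast
      moreover have "C' x w = C' x v" using w True unfolding cls_def by blast
      moreover have "w \<notin> F" "v \<notin> F" "x \<notin> F" using w v x unfolding cls_def by auto
      ultimately show "w \<in> {w\<in>D. (w \<in> R) = (v \<in> R)}"
        using sub w N_sym unfolding D_def C'_def paint_def by auto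
    qed
    show ?thesis
    proof (cases "2 \<le> card D")
      case False
      have "card (cls (F \<union> {x}) C' v) \<le> card D" using E fD by (intro card_mono) auto
      then show ?thesis using False by simp
    next
      case big: True
      have "{w\<in>D. (w \<in> R) = (v \<in> R)} \<subset> D" using split[OF vx D_def big] by auto
      then have "card {w\<in>D. (w \<in> R) = (v \<in> R)} < card D" using fD by (intro psubset_card_mono)
      moreover have "card (cls (F \<union> {x}) C' v) \<le> card {w\<in>D. (w \<in> R) = (v \<in> R)}"
        using E fD by (intro card_mono) auto
      moreover have "card D \<le> \<delta> F v - 1"
        by (rule new_class_bound[OF inv _ _ fD _ x(1) x(2) big]) (use v in \<open>auto simp: D_def\<close>)
      ultimately show ?thesis using \<delta>1 by simp
    qed
  qed
qed

text \<open>A tree component without neighbours of \<open>x\<close> was one before \<open>x\<close>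
  was added, so the second invariant has to be checked only for components touched by
  \<open>x\<close>.\<close>

lemma single_good:
  assumes g: "good F C" and x: "x \<in> V - F" "N x \<inter> F \<noteq> {}" "cls F C x = {x}"
    and R: "R \<subseteq> N x - F" and i1: "inv1 (F \<union> {x}) (paint F C x R)"
    and i2: "\<And>K. tcomp (F \<union> {x}) K \<Longrightarrow> N x \<inter> K \<noteq> {} \<Longrightarrow> satK (F \<union> {x}) (paint F C x R) K"
    and s: "sat (paint F C x R) x"
  shows "good (F \<union> {x}) (paint F C x R)"
proof -
  define C' where "C' = paint F C x R"
  note G = g[unfolded good_def]
  have xR: "x \<notin> R" using R N_irr by auto
  have sym: "symc C'" unfolding C'_def using paint_symc xR G by blast
  have ag: "agree F C C'" unfolding C'_def by (rule paint_agree)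
  have "satK (F \<union> {x}) C' K" if K: "tcomp (F \<union> {x}) K" for K
  proof (cases "N x \<inter> K = {}")
    case False then show ?thesis using i2 K C'_def by auto
  next
    case True
    then have un: "N v \<inter> {x} = {}" if "v \<in> K" for v using that N_sym by auto
    have "tcomp F K" by (rule tcomp_untouched[OF K un])
    then have "satK F C K" using G unfolding inv2_def by blast
    then obtain C1 where C1: "symc C1" "\<forall>u\<in>F. \<forall>v\<in>K. A u v \<longrightarrow> C1 u v = C u v" "\<forall>v\<in>K. sat C1 v"
      unfolding satK_def by blast
    have "C1 u v = C' u v" if "u \<in> F \<union> {x}" "v \<in> K" "A u v" for u v
    proof -
      have "u \<noteq> x" using True that NI by blast
      then show ?thesis using that C1(2) agreeD[OF ag] by auto
    qed
    then show ?thesis unfolding satK_def using C1 by blast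
  qed
  then have "inv2 (F \<union> {x}) C'" unfolding inv2_def by blast
  moreover have "fixing (F \<union> {x}) C'"
    unfolding fixing_def
  proof (intro allI impI)
    fix \<phi> C2 assume h: "aut \<phi> \<and> symc C2 \<and> agree (F \<union> {x}) C' C2 \<and> pres C2 \<phi> \<and> (\<forall>v\<in>F0. \<phi> v = v)"
    have ag2: "agree F C C2" using h ag unfolding agree_def by auto
    have fx: "\<forall>v\<in>F. \<phi> v = v" using G h ag2 unfolding fixing_def by blast
    have "\<phi> x \<in> cls F C x" by (rule aut_cls[of \<phi> C2]) (use h ag2 fx G x in auto)
    then show "\<forall>v\<in>F \<union> {x}. \<phi> v = v" using fx x by auto
  qed
  moreover have "\<forall>v\<in>F \<union> {x} - F0. sat C' v"
    using G s agree_sat[OF ag] unfolding C'_def[symmetric] by auto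
  ultimately show ?thesis unfolding good_def C'_def[symmetric]
    using G sym x i1[folded C'_def] by auto
qed

text \<open>A leaf of a tree component of the new graph had \<delta> at most 2, and \<delta> is
  least at \<open>x\<close>; so trees are no concern if \<open>x\<close> has three or more edges
  left. The smaller values of \<delta> need an individual choice of colours.\<close>

lemma single_step:
  assumes g: "good F C" and x: "x \<in> V - F" "N x \<inter> F \<noteq> {}" "cls F C x = {x}"
    and min: "\<And>v. v \<in> V - F \<Longrightarrow> N v \<inter> F \<noteq> {} \<Longrightarrow> \<delta> F x \<le> \<delta> F v"
  shows "\<exists>C'. agree F C C' \<and> good (F \<union> {x}) C'"
proof -
  note G = g[unfolded good_def]
  have F0F: "F0 \<subseteq> F" and inv: "inv1 F C" and sym: "symc C" using G by auto
  have xV: "x \<in> V" and xF: "x \<notin> F" using x by auto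
  have finx: "finite (N x - F)" using fin_N xV by auto
  have xF1: "x \<notin> F1" using xF F1_sub F0F by blast
  \<comment> \<open>Since \<open>3 \<le> d\<close>, a vertex with at most one edge left was attached
    before, so the minimality of \<open>\<delta> F x\<close> applies to it.\<close>
  have leaf: "\<delta> F x \<le> \<delta> (F \<union> {x}) v + 1 \<and> (v \<notin> N x \<longrightarrow> \<delta> F x \<le> \<delta> (F \<union> {x}) v)"
    if v: "v \<in> V - (F \<union> {x})" "\<delta> (F \<union> {x}) v \<le> 1" for v
  proof -
    have fv: "finite (N v)" using fin_N v by auto
    have "N v - F \<subseteq> insert x (N v - (F \<union> {x}))" by auto
    then have "\<delta> F v \<le> card (insert x (N v - (F \<union> {x})))" unfolding \<delta>_def using fv by (intro card_mono) auto
    also have "\<dots> \<le> \<delta> (F \<union> {x}) v + 1" unfolding \<delta>_def using fv by (simp add: card_insert_if)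
    finally have 1: "\<delta> F v \<le> \<delta> (F \<union> {x}) v + 1" .
    have 2: "\<delta> F v = \<delta> (F \<union> {x}) v" if "v \<notin> N x"
    proof -
      have "N v - F = N v - (F \<union> {x})" using that N_sym by auto
      then show ?thesis by (simp only: \<delta>_def)
    qed
    have "\<delta> F v < d" using 1 v d3 by linarith
    then have "N v \<inter> F \<noteq> {}" using \<delta>_attached v by blast
    then have "\<delta> F x \<le> \<delta> F v" using min v by blast
    then show ?thesis using 1 2 by auto
  qed
  have both: "sat (paint F C x R) x" if "p \<in> N x - F" "q \<in> N x - F" "p \<in> R" "q \<notin> R" for R p q
  proof -
    have "paint F C x R x p" "\<not> paint F C x R x q" using that xF by (auto simp: paint_def)
    then show ?thesis using that F1_sub F0F unfolding sat_def by blast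
  qed
  consider "3 \<le> \<delta> F x" | "\<delta> F x = 2" | "\<delta> F x = 1" | "\<delta> F x = 0" by linarith
  then show ?thesis
  proof cases
    case 1
    define big where "big = {v\<in>N x - F. 2 \<le> card (cls F C v \<inter> N x)}"
    define rep where "rep = (\<lambda>D :: 'a set. SOME v. v \<in> D)"
    \<comment> \<open>One representative of each class with two or more neighbours of
      \<open>x\<close> is made red. If there is no such class, any single red edge shows both
      colours at \<open>x\<close>.\<close>
    define R where "R = (if big = {} then {SOME v. v \<in> N x - F} else rep ` (\<lambda>v. cls F C v \<inter> N x) ` big)"
    have ne: "N x - F \<noteq> {}"
    proof
      assume "N x - F = {}"
      then have "\<delta> F x = 0" by (simp only: \<delta>_def card.empty)
      then show False using 1 by simp
    qed
    have repin: "rep (cls F C v \<inter> N x) \<in> cls F C v \<inter> N x" if "v \<in> N x - F" for v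
    proof -
      have "v \<in> cls F C v \<inter> N x" using that cls_refl N_V by blast
      then show ?thesis unfolding rep_def by (rule someI)
    qed
    have R: "R \<subseteq> N x - F"
    proof (cases "big = {}")
      case True then show ?thesis using ne some_in_eq[of "N x - F"] by (simp add: R_def)
    next
      case False
      have "rep (cls F C v \<inter> N x) \<in> N x - F" if "v \<in> big" for v
        using repin[of v] that cls_sub unfolding big_def by blast
      then show ?thesis using False by (auto simp: R_def)
    qed
    have split: "R \<inter> D \<noteq> {} \<and> D - R \<noteq> {}"
      if v: "v \<in> N x - F" "D = cls F C v \<inter> N x" "2 \<le> card D" for v D
    proof -
      have vb: "v \<in> big" using v by (auto simp: big_def)
      have "rep D \<in> R \<inter> D" using vb v repin[OF v(1)] by (auto simp: R_def)
      moreover have "R \<inter> D \<subseteq> {rep D}"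
      proof
        fix w assume w: "w \<in> R \<inter> D"
        then obtain u where u: "u \<in> big" "w = rep (cls F C u \<inter> N x)" using vb by (auto simp: R_def split: if_splits)
        have "w \<in> cls F C u" using repin[of u] u by (auto simp: big_def)
        then have "cls F C u = cls F C v" using w v cls_eq by (metis IntD1 IntD2)
        then show "w \<in> {rep D}" using u v by simp
      qed
      moreover have "\<not> D \<subseteq> {rep D}" using v(3) card_mono[of "{rep D}" D] by auto
      ultimately show ?thesis by blast
    qed
    have bothR: "\<exists>p\<in>N x - F. \<exists>q\<in>N x - F. p \<in> R \<and> q \<notin> R"
    proof (cases "big = {}")
      case True
      then have R1: "R = {SOME v. v \<in> N x - F}" by (simp add: R_def)
      have "\<not> N x - F \<subseteq> R" using 1 R1 card_mono[of R "N x - F"] unfolding \<delta>_def by auto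
      then show ?thesis using R R1 by blast
    next
      case False
      then obtain v where "v \<in> big" by blast
      then have v: "v \<in> N x - F" "2 \<le> card (cls F C v \<inter> N x)" by (auto simp: big_def)
      show ?thesis using split[OF v(1) refl v(2)] cls_sub R by blast
    qed
    have i1: "inv1 (F \<union> {x}) (paint F C x R)" by (rule single_inv1[OF inv x(1,2) R split])
    have "good (F \<union> {x}) (paint F C x R)"
    proof (rule single_good[OF g x R i1])
      fix K assume K: "tcomp (F \<union> {x}) K"
      obtain v where v: "v \<in> K" "\<delta> (F \<union> {x}) v \<le> 1" using tcomp_leaf[OF K] by blast
      then show "satK (F \<union> {x}) (paint F C x R) K" using leaf[of v] 1 tcompD(1)[OF K] by fastforce
    next
      show "sat (paint F C x R) x" using bothR both by blast
    qed
    then show ?thesis using paint_agree by blast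
  next
    case 2
    then obtain p q where pq: "N x - F = {p, q}" "p \<noteq> q" unfolding \<delta>_def by (auto simp: card_2_iff)
    \<comment> \<open>If \<open>p\<close> has an edge to \<open>F - F1\<close>, the edge from
      \<open>x\<close> to \<open>p\<close> gets the colour opposite to one such edge, which
      satisfies \<open>p\<close>.\<close>
    define R where "R = (if (\<exists>f\<in>N p \<inter> F - F1. C p f) then {q} else {p})"
    have R: "R \<subseteq> N x - F" using pq by (auto simp: R_def)
    have split: "R \<inter> D \<noteq> {} \<and> D - R \<noteq> {}"
      if v: "v \<in> N x - F" "D = cls F C v \<inter> N x" "2 \<le> card D" for v D
    proof -
      have "D \<subseteq> {p, q}" using v(2) pq cls_sub by blast
      then have "D = {p, q}" using v(3) pq by (metis card_2_iff card_seteq finite.emptyI finite_insert)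
      then show ?thesis using pq by (auto simp: R_def)
    qed
    have i1: "inv1 (F \<union> {x}) (paint F C x R)" by (rule single_inv1[OF inv x(1,2) R split])
    have "good (F \<union> {x}) (paint F C x R)"
    proof (rule single_good[OF g x R i1])
      fix K assume K: "tcomp (F \<union> {x}) K"
      note KD = tcompD[OF K]
      have lf: "u = p \<or> u = q" "\<delta> (F \<union> {x}) u = 1" if u: "u \<in> K" "\<delta> (F \<union> {x}) u \<le> 1" for u
      proof -
        have uV: "u \<in> V - (F \<union> {x})" using KD(1) u by blast
        show "u = p \<or> u = q" using leaf[OF uV u(2)] 2 u(2) pq(1) uV by fastforce
        show "\<delta> (F \<union> {x}) u = 1" using leaf[OF uV u(2)] 2 u(2) by linarith
      qed
      \<comment> \<open>Only \<open>p\<close> and \<open>q\<close> can be leaves of the new tree,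
        and a degree sum of \<open>2 * card K - 2\<close> requires both.\<close>
      have pK: "p \<in> K \<and> \<delta> (F \<union> {x}) p \<le> 1"
      proof (rule ccontr)
        assume np: "\<not> ?thesis"
        have ge: "(if u = q then 1 else 2) \<le> \<delta> (F \<union> {x}) u" if "u \<in> K" for u
          using lf[OF that] np that by (cases "\<delta> (F \<union> {x}) u \<le> 1") auto
        have "(\<Sum>u\<in>K. if u = q then 1 else 2) \<le> (\<Sum>u\<in>K. \<delta> (F \<union> {x}) u)" by (intro sum_mono ge)
        moreover have "(\<Sum>u\<in>K. (if u = q then 1 else 2::nat)) + 1 \<ge> 2 * card K"
        proof (cases "q \<in> K")
          case True
          have "(\<Sum>u\<in>K. (if u = q then 1 else 2::nat)) = 1 + (\<Sum>u\<in>K - {q}. 2)"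
            using KD(2) True by (subst sum.remove[of K q]) (auto intro!: sum.cong)
          moreover have "card (K - {q}) = card K - 1" "card K \<ge> 1" using True KD(2) by (auto simp: Suc_le_eq card_gt_0_iff)
          ultimately show ?thesis by simp
        next
          case False
          then have "(\<Sum>u\<in>K. (if u = q then 1 else 2::nat)) = (\<Sum>u\<in>K. 2)" by (intro sum.cong) auto
          then show ?thesis by simp
        qed
        ultimately show False using KD(6) by linarith
      qed
      have pV: "p \<in> V - F" "p \<noteq> x" using pq N_V N_irr by blast+
      have "\<delta> F p \<le> 2"
      proof -
        have "N p - F \<subseteq> insert x (N p - (F \<union> {x}))" by auto
        then have "\<delta> F p \<le> card (insert x (N p - (F \<union> {x})))" unfolding \<delta>_def using fin_N pV by (intro card_mono) auto
        also have "\<dots> \<le> \<delta> (F \<union> {x}) p + 1" unfolding \<delta>_def using fin_N pV by (simp add: card_insert_if)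
        finally show ?thesis using pK by simp
      qed
      then obtain f where f: "f \<in> N p \<inter> F - F1" using attached_relevant[OF pV(1) F0F] by blast
      have xp: "x \<in> N p \<inter> (F \<union> {x}) - F1" using pq(1) N_sym xF1 by blast
      have "\<exists>f\<in>N p \<inter> F - F1. C p f \<noteq> paint F C x R p x"
        using f pV xF pq unfolding paint_def R_def by auto
      then obtain f' where f': "f' \<in> N p \<inter> F - F1" "C p f' \<noteq> paint F C x R p x" by blast
      have "paint F C x R p f' = C p f'" using f' by (auto simp: paint_def)
      then have "fsat (F \<union> {x}) (paint F C x R) p" using f' xp unfolding fsat_def by blast
      then show "satK (F \<union> {x}) (paint F C x R) K"
        using satK_root[OF K _ _ paint_symc[OF sym], of p x R F] pK F0F R N_irr by blast
    next
      show "sat (paint F C x R) x"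
      proof (cases "R = {q}")
        case True
        show ?thesis by (rule both[of q p R]) (use pq True in auto)
      next
        case False
        then have "R = {p}" using R_def by (metis (full_types))
        then show ?thesis by (intro both[of p q R]) (use pq in auto)
      qed
    qed
    then show ?thesis using paint_agree by blast
  next
    case 3
    then obtain p where p: "N x - F = {p}" unfolding \<delta>_def by (auto simp: card_1_singleton_iff)
    have pV: "p \<in> V - F" "p \<noteq> x" "p \<in> N x" "x \<in> N p" using p N_V N_irr N_sym by blast+
    obtain f where f: "f \<in> N x \<inter> F - F1" using attached_relevant[OF x(1) F0F] 3 by auto
    \<comment> \<open>A tree component beyond \<open>x\<close> was, together with \<open>x\<close>,
      a tree component before. Hence the edge from \<open>x\<close> to \<open>p\<close> takes its
      colour from a colouring \<open>C1\<close> that satisfies the larger component.\<close>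
    define good_col where "good_col = (\<lambda>K C1. tcomp F K \<and> x \<in> K \<and> symc C1 \<and>
        (\<forall>u\<in>F. \<forall>v\<in>K. A u v \<longrightarrow> C1 u v = C u v) \<and> (\<forall>v\<in>K. sat C1 v))"
    obtain R C1 where R: "R \<subseteq> {p}"
      and RC: "\<And>K. tcomp F K \<Longrightarrow> x \<in> K \<Longrightarrow> good_col K C1 \<and> (p \<in> R \<longleftrightarrow> C1 x p)"
      and nosat: "(\<nexists>K. tcomp F K \<and> x \<in> K) \<Longrightarrow> (p \<in> R \<longleftrightarrow> \<not> C x f)"
    proof (cases "\<exists>K. tcomp F K \<and> x \<in> K")
      case True
      then obtain K where K: "tcomp F K" "x \<in> K" by blast
      then have "satK F C K" using G unfolding inv2_def by blast
      then obtain C1 where C1: "good_col K C1" using K unfolding satK_def good_col_def by blast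
      show ?thesis
      proof (rule that[of "if C1 x p then {p} else {}" C1])
        fix K' assume "tcomp F K'" "x \<in> K'"
        then have "K' = K" using K tcomp_unique by metis
        then show "good_col K' C1 \<and> (p \<in> (if C1 x p then {p} else {}) \<longleftrightarrow> C1 x p)" using C1 by auto
      qed (use True in auto)
    next
      case False
      show ?thesis by (rule that[of "if C x f then {} else {p}"]) (use False in auto)
    qed
    have RN: "R \<subseteq> N x - F" using R p by auto
    have i1: "inv1 (F \<union> {x}) (paint F C x R)"
    proof (rule single_inv1[OF inv x(1,2) RN])
      fix v D assume "v \<in> N x - F" "D = cls F C v \<inter> N x" "2 \<le> card D"
      moreover have "cls F C v \<inter> N x \<subseteq> {p}" using cls_sub p by blast
      ultimately show "R \<inter> D \<noteq> {} \<and> D - R \<noteq> {}" using card_mono[of "{p}" "cls F C v \<inter> N x"] by simp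
    qed
    have "good (F \<union> {x}) (paint F C x R)"
    proof (rule single_good[OF g x RN i1])
      fix K assume K: "tcomp (F \<union> {x}) K" and t: "N x \<inter> K \<noteq> {}"
      note KD = tcompD[OF K]
      obtain y where y: "y \<in> N x" "y \<in> K" using t by blast
      then have "y \<in> N x - F" using KD(1) by blast
      then have pK: "p \<in> K" using p y by simp
      define K' where "K' = insert x K"
      have xK: "x \<notin> K" using KD(1) by blast
      have "tcomp F K'"
        unfolding tcomp_def
      proof (intro conjI)
        show "K' \<subseteq> V - F" "finite K'" "K' \<noteq> {}" using KD x unfolding K'_def by auto
        show "\<forall>v\<in>K'. N v - F \<subseteq> K'"
        proof
          fix v assume "v \<in> K'"
          then consider "v = x" | "v \<in> K" unfolding K'_def by blast
          then show "N v - F \<subseteq> K'"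
          proof cases
            case 1
            then show ?thesis using p pK by (simp add: K'_def)
          next
            case 2
            then show ?thesis using KD(4)[of v] unfolding K'_def by blast
          qed
        qed
        show "\<forall>S\<subseteq>K'. S \<noteq> {} \<longrightarrow> S \<noteq> K' \<longrightarrow> (\<exists>a\<in>S. \<exists>b\<in>K' - S. A a b)"
        proof (intro allI impI)
          fix S assume S: "S \<subseteq> K'" "S \<noteq> {}" "S \<noteq> K'"
          consider "S - {x} = {}" | "S - {x} = K" | "S - {x} \<noteq> {}" "S - {x} \<noteq> K" by blast
          then show "\<exists>a\<in>S. \<exists>b\<in>K' - S. A a b"
          proof cases
            case 1
            then have "S = {x}" using S by auto
            then show ?thesis using pK pV ND unfolding K'_def by auto
          next
            case 2
            then have "x \<notin> S" using S unfolding K'_def by auto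
            then show ?thesis using pK pV ND 2 unfolding K'_def by blast
          next
            case 3
            have "S - {x} \<subseteq> K" using S unfolding K'_def by auto
            then obtain a b where "a \<in> S - {x}" "b \<in> K - (S - {x})" "A a b" using KD(5) 3 by metis
            then show ?thesis using xK unfolding K'_def by blast
          qed
        qed
        have e: "\<delta> F v = (if v = p then \<delta> (F \<union> {x}) v + 1 else \<delta> (F \<union> {x}) v)" if v: "v \<in> K" for v
        proof (cases "v = p")
          case True
          have "N p - F = insert x (N p - (F \<union> {x}))" using pV xF by auto
          then have "card (N p - F) = card (insert x (N p - (F \<union> {x})))" by (rule arg_cong)
          also have "\<dots> = card (N p - (F \<union> {x})) + 1"
            using fin_N[of p] pV by (subst card_insert_disjoint) auto
          finally show ?thesis by (simp only: \<delta>_def True if_True refl simp_thms)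
        next
          case False
          have "v \<in> V - F" using v KD(1) by blast
          then have "x \<notin> N v" using False p N_sym by blast
          then have "N v - F = N v - (F \<union> {x})" by auto
          then have "\<delta> F v = \<delta> (F \<union> {x}) v" by (simp only: \<delta>_def)
          then show ?thesis using False by simp
        qed
        have "(\<Sum>v\<in>K. \<delta> F v) = (\<Sum>v\<in>K. \<delta> (F \<union> {x}) v + (if v = p then 1 else 0))"
          by (intro sum.cong refl) (simp add: e)
        also have "\<dots> = (\<Sum>v\<in>K. \<delta> (F \<union> {x}) v) + 1"
          using KD(2) pK by (simp add: sum.distrib)
        finally show "(\<Sum>v\<in>K'. \<delta> F v) + 2 = 2 * card K'"
          unfolding K'_def using KD(2,6) xK 3 by simp
      qed
      then have C1: "good_col K' C1" "p \<in> R \<longleftrightarrow> C1 x p" using RC[of K'] unfolding K'_def by auto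
      have "C1 u v = paint F C x R u v" if uv: "u \<in> F \<union> {x}" "v \<in> K" "A u v" for u v
      proof (cases "u = x")
        case True
        then have "v = p" using uv KD(1) p NI by blast
        then show ?thesis using C1(2) True pV xF by (auto simp: paint_def)
      next
        case False
        then show ?thesis using uv C1(1) unfolding good_col_def K'_def paint_def by auto
      qed
      moreover have "symc C1" "\<forall>v\<in>K. sat C1 v" using C1(1) unfolding good_col_def K'_def by auto
      ultimately show "satK (F \<union> {x}) (paint F C x R) K" unfolding satK_def by blast
    next
      show "sat (paint F C x R) x"
      proof (cases "\<exists>K. tcomp F K \<and> x \<in> K")
        case True
        then obtain K where K: "tcomp F K" "x \<in> K" by blast
        then have c: "good_col K C1" "p \<in> R \<longleftrightarrow> C1 x p" using RC by auto
        have s1: "sat C1 x" using c K unfolding good_col_def by blast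
        have "paint F C x R x u = C1 x u" if u: "u \<in> N x" for u
        proof (cases "u \<in> F")
          case True
          have "C1 u x = C u x" using c(1) True u K ND A_sym unfolding good_col_def by blast
          then show ?thesis using True sym c(1) unfolding good_col_def paint_def symc_def by auto
        next
          case False
          then have "u = p" using u p by blast
          then show ?thesis using c(2) xF pV by (auto simp: paint_def)
        qed
        then show ?thesis using sat_cong s1 by blast
      next
        case False
        have 1: "paint F C x R x p \<longleftrightarrow> \<not> C x f" using nosat[OF False] pV xF by (auto simp: paint_def)
        have 2: "paint F C x R x f \<longleftrightarrow> C x f" using f by (auto simp: paint_def)
        have "p \<in> N x - F1" using pV F1_sub F0F by blast
        then show ?thesis using 1 2 f unfolding sat_def by (cases "C x f") blast+
      qed
    qed
    then show ?thesis using paint_agree by blast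
  next
    case 4
    then have NF: "N x \<subseteq> F" using finx unfolding \<delta>_def by auto
    \<comment> \<open>A vertex without edges left is a tree by itself, so the second invariant says
      that it sees both colours already.\<close>
    have "tcomp F {x}" unfolding tcomp_def using x NF 4 by auto
    then have "satK F C {x}" using G unfolding inv2_def by blast
    then obtain C1 where C1: "symc C1" "\<forall>u\<in>F. A u x \<longrightarrow> C1 u x = C u x" "sat C1 x" unfolding satK_def by blast
    have "C x u = C1 x u" if "u \<in> N x" for u
      using C1(1,2) sym NF that ND A_sym unfolding symc_def by (metis subsetD)
    then have s: "sat C x" using sat_cong C1(3) by blast
    have s': "sat (paint F C x {}) x"
    proof (rule sat_cong[OF _ s])
      fix u assume "u \<in> N x"
      then show "paint F C x {} x u = C x u" using NF by (auto simp: paint_def)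
    qed
    have i1: "inv1 (F \<union> {x}) (paint F C x {})"
      by (rule single_inv1[OF inv x(1,2)]) (use NF in auto)
    have "good (F \<union> {x}) (paint F C x {})"
    proof (rule single_good[OF g x _ i1 _ s'])
      fix K assume K: "tcomp (F \<union> {x}) K" and t: "N x \<inter> K \<noteq> {}"
      then show "satK (F \<union> {x}) (paint F C x {}) K" using tcompD(1)[OF K] NF by blast
    qed auto
    then show ?thesis using paint_agree by blast
  qed
qed

end

subsection \<open>Colouring the edges at a class\<close>

text \<open>The class bound is assumed only outside \<open>Q\<close>, since
  \<open>start_c4_big\<close> applies this locale to a set \<open>Q\<close> that exceeds the bound
  by one.\<close>

locale class_step = extension V A d F0 F1 for V :: "'a set" and A d F0 F1 +
  fixes F Q :: "'a set" and C R :: "'a \<Rightarrow> 'a \<Rightarrow> bool" and q :: "'a \<Rightarrow> nat"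
  assumes F: "F0 \<subseteq> F" "F \<subseteq> V" "symc C"
    and Q: "finite Q" "Q \<subseteq> V - F" "2 \<le> card Q" "card Q + 2 \<le> d"
    and R_sym: "R x y = R y x"
    and \<delta>_n: "v \<in> V - F - Q \<Longrightarrow> card Q + 1 \<le> \<delta> F v"
    and inv1W: "v \<in> V - F - Q \<Longrightarrow> N v \<inter> F \<noteq> {} \<Longrightarrow> card (cls F C v - Q) \<le> max 1 (\<delta> F v - 1)"
begin

definition fwd :: "'a \<Rightarrow> 'a set" where "fwd x = N x - F - Q"
text \<open>These are the sets that have to be split by the colours of the edges from
  \<open>Q\<close>: vertices with different neighbours in \<open>Q\<close> end up in different
  classes anyway.\<close>

definition dcls :: "'a \<Rightarrow> 'a set" where "dcls v = {w \<in> cls F C v - Q. N w \<inter> Q = N v \<inter> Q}"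
text \<open>The number of blocks that the servers have to split off from a class to restore the class bound.\<close>
definition dem :: "'a \<Rightarrow> nat" where
  "dem v = card (dcls v) - max 1 (\<delta> F v - 1 - card (N v \<inter> Q))"
definition pt :: "('a \<Rightarrow> 'a set) \<Rightarrow> 'a \<Rightarrow> 'a \<Rightarrow> bool" where
  "pt \<rho> u v = (if u \<in> F \<or> v \<in> F then C u v else if u \<in> Q \<and> v \<in> Q then R u v
     else if u \<in> Q then v \<in> \<rho> u else if v \<in> Q then u \<in> \<rho> v else C u v)"
text \<open>The second condition is the class bound for \<open>F \<union> Q\<close>, where \<delta>
  has dropped by the number of neighbours in \<open>Q\<close>.\<close>

definition valid :: "('a \<Rightarrow> 'a set) \<Rightarrow> bool" where
  "valid \<rho> \<longleftrightarrow> (\<forall>x\<in>Q. \<rho> x \<subseteq> fwd x \<and> card (\<rho> x) = q x) \<and>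
     (\<forall>v\<in>V - F - Q. N v \<inter> Q \<noteq> {} \<longrightarrow> card {w\<in>dcls v. \<forall>y\<in>Q. (w \<in> \<rho> y) = (v \<in> \<rho> y)}
         \<le> max 1 (\<delta> F v - 1 - card (N v \<inter> Q)))"
text \<open>A vertex can separate two of its outside neighbours only if it has outside edges of both
  colours.\<close>

definition servers :: "'a set" where "servers = {x\<in>Q. 1 \<le> q x \<and> q x < card (fwd x)}"

lemma QF: "x \<in> Q \<Longrightarrow> x \<in> V \<and> x \<notin> F \<and> x \<notin> F1" using Q F F1_sub by blast
lemma fin_fwd: "x \<in> Q \<Longrightarrow> finite (fwd x)" unfolding fwd_def using fin_N QF by auto
lemma fwdD: "w \<in> fwd x \<Longrightarrow> w \<in> V - F - Q \<and> w \<in> N x \<and> x \<in> N w" unfolding fwd_def using N_sym N_V by blast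
lemma dcls_refl: "v \<in> V - F - Q \<Longrightarrow> v \<in> dcls v" using cls_refl by (auto simp: dcls_def)
lemma dcls_eq: "w \<in> dcls v \<Longrightarrow> dcls w = dcls v" unfolding dcls_def using cls_eq by auto
lemma dcls_sub: "dcls v \<subseteq> V - F - Q" unfolding dcls_def using cls_sub by auto
lemma dcls_N: "w \<in> dcls v \<Longrightarrow> N w \<inter> Q = N v \<inter> Q" unfolding dcls_def by auto
lemma dcls_\<delta>: "w \<in> dcls v \<Longrightarrow> v \<in> V \<Longrightarrow> \<delta> F w = \<delta> F v" unfolding dcls_def using cls_\<delta> by auto
lemma dcls_fwd: assumes "v \<in> fwd x" "x \<in> Q" shows "dcls v \<subseteq> fwd x"
proof
  fix w assume w: "w \<in> dcls v"
  then have "x \<in> N w" using dcls_N[OF w] fwdD[OF assms(1)] assms by blast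
  then show "w \<in> fwd x" using dcls_sub w N_sym unfolding fwd_def by blast
qed
lemma touched: "v \<in> V - F - Q \<Longrightarrow> x \<in> N v \<inter> Q \<Longrightarrow> v \<in> fwd x" unfolding fwd_def using N_sym by blast
lemma fin_dcls: assumes "v \<in> V - F - Q" "N v \<inter> Q \<noteq> {}" shows "finite (dcls v)"
proof -
  obtain x where "x \<in> N v \<inter> Q" using assms by blast
  then have "v \<in> fwd x" "x \<in> Q" using touched assms by auto
  then show ?thesis using dcls_fwd fin_fwd finite_subset by metis
qed

lemma pt_symc: "symc (pt \<rho>)" using F(3) R_sym unfolding symc_def pt_def by auto
lemma pt_agree: "agree F C (pt \<rho>)" unfolding agree_def pt_def by auto
lemma pt_code: "x \<in> Q \<Longrightarrow> w \<in> V - F - Q \<Longrightarrow> pt \<rho> x w = (w \<in> \<rho> x)" using QF unfolding pt_def by auto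
lemma pt_code': "x \<in> Q \<Longrightarrow> w \<in> V - F - Q \<Longrightarrow> pt \<rho> w x = (w \<in> \<rho> x)" using QF unfolding pt_def by auto

lemma \<delta>_Q: assumes "v \<in> V" shows "\<delta> F v = \<delta> (F \<union> Q) v + card (N v \<inter> Q)"
proof -
  have "N v - F = (N v - (F \<union> Q)) \<union> (N v \<inter> Q)" "(N v - (F \<union> Q)) \<inter> (N v \<inter> Q) = {}" using Q by auto
  moreover have "finite (N v - (F \<union> Q))" "finite (N v \<inter> Q)" using fin_N assms by auto
  ultimately show ?thesis unfolding \<delta>_def by (metis card_Un_disjoint)
qed

lemma N_Q_le: "card (N v \<inter> Q) \<le> card Q" using Q by (intro card_mono) auto

lemma \<delta>_pos: assumes "v \<in> V - F - Q" shows "1 \<le> \<delta> (F \<union> Q) v"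
  using \<delta>_Q[of v] \<delta>_n[OF assms] N_Q_le[of v] assms by auto

text \<open>Here \<delta> drops from at least \<open>card Q + 1\<close> to at most 1, which takes
  all of \<open>Q\<close>.\<close>

lemma leaf: assumes "v \<in> V - F - Q" "\<delta> (F \<union> Q) v \<le> 1"
  shows "Q \<subseteq> N v" "\<delta> F v = card Q + 1" "N v \<inter> F \<noteq> {}"
proof -
  have i: "card (N v \<inter> Q) = card Q" using \<delta>_Q[of v] \<delta>_n[OF assms(1)] N_Q_le[of v] assms by auto
  then have "N v \<inter> Q = Q" using Q by (intro card_subset_eq) auto
  then show "Q \<subseteq> N v" by blast
  show e: "\<delta> F v = card Q + 1" using \<delta>_Q[of v] \<delta>_n[OF assms(1)] i assms by auto
  show "N v \<inter> F \<noteq> {}" using \<delta>_attached[of v F] e Q assms by auto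
qed

lemma valid_inv1: assumes "valid \<rho>" shows "inv1 (F \<union> Q) (pt \<rho>)"
  unfolding inv1_def
proof (intro ballI impI)
  fix v assume v: "v \<in> V - (F \<union> Q)" and att: "N v \<inter> (F \<union> Q) \<noteq> {}"
  have v': "v \<in> V - F - Q" using v by auto
  have sub: "cls (F \<union> Q) (pt \<rho>) v \<subseteq> {w\<in>dcls v. \<forall>y\<in>Q. (w \<in> \<rho> y) = (v \<in> \<rho> y)}"
  proof
    fix w assume w: "w \<in> cls (F \<union> Q) (pt \<rho>) v"
    have wV: "w \<in> V - F - Q" using w unfolding cls_def by auto
    have n: "N w \<inter> (F \<union> Q) = N v \<inter> (F \<union> Q)" and c: "\<And>u. u \<in> N v \<inter> (F \<union> Q) \<Longrightarrow> pt \<rho> u w = pt \<rho> u v"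
      using w unfolding cls_def by auto
    have "N w \<inter> F = N v \<inter> F" using n by blast
    moreover have "C u w = C u v" if "u \<in> N v \<inter> F" for u using c[of u] that unfolding pt_def by auto
    ultimately have "w \<in> cls F C v" using wV unfolding cls_def by auto
    moreover have nq: "N w \<inter> Q = N v \<inter> Q" using n by blast
    ultimately have "w \<in> dcls v" using wV unfolding dcls_def by auto
    moreover have "(w \<in> \<rho> y) = (v \<in> \<rho> y)" if y: "y \<in> Q" for y
    proof (cases "y \<in> N v")
      case True
      then show ?thesis using c[of y] y pt_code[OF y wV] pt_code[OF y v'] by auto
    next
      case False
      then have "y \<notin> N w" using nq y by blast
      then show ?thesis using False assms y fwdD unfolding valid_def by blast
    qed
    ultimately show "w \<in> {w\<in>dcls v. \<forall>y\<in>Q. (w \<in> \<rho> y) = (v \<in> \<rho> y)}" by auto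
  qed
  show "card (cls (F \<union> Q) (pt \<rho>) v) \<le> max 1 (\<delta> (F \<union> Q) v - 1)"
  proof (cases "N v \<inter> Q = {}")
    case True
    then have a: "N v \<inter> F \<noteq> {}" using att by auto
    have "card (cls (F \<union> Q) (pt \<rho>) v) \<le> card (cls F C v - Q)"
      using sub fin_cls[OF a] by (intro card_mono) (auto simp: dcls_def)
    then show ?thesis using inv1W[OF v' a] \<delta>_Q[of v] True v by auto
  next
    case False
    have "card (cls (F \<union> Q) (pt \<rho>) v) \<le> card {w\<in>dcls v. \<forall>y\<in>Q. (w \<in> \<rho> y) = (v \<in> \<rho> y)}"
      using sub fin_dcls[OF v' False] by (intro card_mono) auto
    also have "\<dots> \<le> max 1 (\<delta> F v - 1 - card (N v \<inter> Q))" using assms v' False unfolding valid_def by blast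
    also have "\<dots> = max 1 (\<delta> (F \<union> Q) v - 1)" using \<delta>_Q[of v] v by auto
    finally show ?thesis .
  qed
qed

text \<open>A server \<open>x\<close> is divided among the classes \<open>D\<close> in
  \<open>fwd x\<close> in proportion to \<open>card D - 1\<close>, the number of splits after which
  \<open>D\<close> is completely separated. These numbers add up to \<open>card (fwd x)\<close>
  minus the number of classes, whence the form of the condition.\<close>

lemma exists_valid:
  assumes q_le: "\<And>x. x \<in> Q \<Longrightarrow> q x \<le> card (fwd x)"
    and hall: "\<And>v. v \<in> V - F - Q \<Longrightarrow> 0 < dem v \<Longrightarrow> N v \<inter> Q \<noteq> {} \<Longrightarrow> N v \<inter> servers \<noteq> {} \<and>
       (\<forall>x\<in>N v \<inter> servers. dem v * (card (fwd x) - card (dcls ` fwd x)) \<le> card (N v \<inter> servers) * (card (dcls v) - 1))"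
  shows "\<exists>\<rho>. valid \<rho>"
proof -
  define W where "W = (\<Union>x\<in>Q. fwd x)"
  define \<D> where "\<D> = dcls ` W"
  \<comment> \<open>Hall's theorem is applied to the classes as sets; a representative gives access
    to demands and neighbours in \<open>Q\<close>, which are the same for all members.\<close>
  define rp where "rp = (\<lambda>D :: 'a set. SOME w. w \<in> D)"
  define AA where "AA = (\<lambda>D. N (rp D) \<inter> servers)"
  have finW: "finite W" using Q fin_fwd by (auto simp: W_def)
  have W: "w \<in> V - F - Q \<and> N w \<inter> Q \<noteq> {}" if "w \<in> W" for w using that fwdD unfolding W_def by blast
  have rp: "rp (dcls w) \<in> dcls w" if "w \<in> V - F - Q" for w
    unfolding rp_def using dcls_refl[OF that] by (rule someI)
  have fin\<D>: "finite \<D>" using finW by (simp add: \<D>_def)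
  have finS: "finite servers" using Q by (auto simp: servers_def)
  have D: "D = dcls (rp D) \<and> rp D \<in> V - F - Q \<and> N (rp D) \<inter> Q \<noteq> {} \<and> finite D \<and> D \<noteq> {}" if "D \<in> \<D>" for D
  proof -
    from that obtain w where w: "w \<in> W" "D = dcls w" unfolding \<D>_def by blast
    have r: "rp D \<in> dcls w" using rp W w by auto
    then have "dcls (rp D) = D" using dcls_eq w by metis
    moreover have "rp D \<in> V - F - Q" using r dcls_sub by blast
    moreover have "N (rp D) \<inter> Q \<noteq> {}" using dcls_N[OF r] W w by auto
    ultimately show ?thesis using fin_dcls[of "rp D"] dcls_refl[of "rp D"] by auto
  qed
  have "\<exists>B. (\<forall>D\<in>\<D>. B D \<subseteq> AA D \<and> card (B D) = dem (rp D)) \<and> disjoint_family_on B \<D>"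
  proof (rule hall_weighted[where s = "\<lambda>D. card D - 1" and T = "\<lambda>x. if x \<in> servers then card (fwd x) - card (dcls ` fwd x) else 0"])
    show "finite \<D>" by (rule fin\<D>)
    show "\<forall>D\<in>\<D>. finite (AA D)" using finS by (simp add: AA_def)
    show "\<forall>D\<in>\<D>. 0 < dem (rp D) \<longrightarrow> AA D \<noteq> {}" using hall D unfolding AA_def by blast
    show "\<forall>D\<in>\<D>. 0 < dem (rp D) \<longrightarrow> 0 < card D - 1"
    proof (intro ballI impI)
      fix D assume "D \<in> \<D>" "0 < dem (rp D)"
      then show "0 < card D - 1" using D[of D] unfolding dem_def by auto
    qed
    show "\<forall>D\<in>\<D>. \<forall>x\<in>AA D. dem (rp D) * (if x \<in> servers then card (fwd x) - card (dcls ` fwd x) else 0) \<le> card (AA D) * (card D - 1)"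
    proof (intro ballI)
      fix D x assume h: "D \<in> \<D>" "x \<in> AA D"
      show "dem (rp D) * (if x \<in> servers then card (fwd x) - card (dcls ` fwd x) else 0) \<le> card (AA D) * (card D - 1)"
      proof (cases "0 < dem (rp D)")
        case True
        then show ?thesis using hall[of "rp D"] D[OF h(1)] h(2) unfolding AA_def by auto
      qed auto
    qed
    show "\<forall>x. (\<Sum>D\<in>{D\<in>\<D>. x \<in> AA D}. card D - 1) \<le> (if x \<in> servers then card (fwd x) - card (dcls ` fwd x) else 0)"
    proof
      fix x
      show "(\<Sum>D\<in>{D\<in>\<D>. x \<in> AA D}. card D - 1) \<le> (if x \<in> servers then card (fwd x) - card (dcls ` fwd x) else 0)"
      proof (cases "x \<in> servers")
        case False
        then have e: "{D\<in>\<D>. x \<in> AA D} = {}" unfolding AA_def by blast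
        show ?thesis unfolding e by simp
      next
        case True
        then have x: "x \<in> Q" by (auto simp: servers_def)
        have sub: "{D\<in>\<D>. x \<in> AA D} \<subseteq> dcls ` fwd x"
        proof
          fix D' assume h: "D' \<in> {D\<in>\<D>. x \<in> AA D}"
          then have "rp D' \<in> fwd x" using D[of D'] touched[of "rp D'" x] x by (auto simp: AA_def)
          then show "D' \<in> dcls ` fwd x" using D[of D'] h by blast
        qed
        have f: "finite (fwd x)" using fin_fwd x by auto
        have "(\<Sum>D\<in>{D\<in>\<D>. x \<in> AA D}. card D - 1) \<le> (\<Sum>D\<in>dcls ` fwd x. card D - 1)"
          using sub f by (intro sum_mono2) auto
        also have "(\<Sum>D\<in>dcls ` fwd x. card D - 1) = (\<Sum>D\<in>dcls ` fwd x. card D) - (\<Sum>D\<in>dcls ` fwd x. 1)"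
        proof (rule sum_subtractf_nat)
          fix D' assume "D' \<in> dcls ` fwd x"
          then obtain w where w: "w \<in> fwd x" "D' = dcls w" by blast
          then have "finite D'" using dcls_fwd x f finite_subset by metis
          moreover have "w \<in> D'" using w dcls_refl fwdD by metis
          ultimately show "1 \<le> card D'" by (metis One_nat_def Suc_leI card_gt_0_iff empty_iff)
        qed
        also have "(\<Sum>D\<in>dcls ` fwd x. card D) = card (\<Union>(dcls ` fwd x))"
        proof (rule card_Union_disjoint[symmetric])
          show "pairwise disjnt (dcls ` fwd x)"
            unfolding pairwise_def disjnt_def using dcls_eq by blast
          show "finite A" if "A \<in> dcls ` fwd x" for A using that dcls_fwd x f finite_subset by (metis imageE)
        qed
        also have "\<Union>(dcls ` fwd x) = fwd x" using dcls_fwd[OF _ x] dcls_refl fwdD by blast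
        finally show ?thesis using True by simp
      qed
    qed
  qed
  then obtain B where B: "\<forall>D\<in>\<D>. B D \<subseteq> AA D \<and> card (B D) = dem (rp D)" "disjoint_family_on B \<D>" by blast
  have BQ: "B D \<subseteq> Q" if "D \<in> \<D>" for D using B that unfolding AA_def servers_def by blast
  have "\<exists>\<rho>. (\<forall>x\<in>Q. \<rho> x \<subseteq> fwd x \<and> card (\<rho> x) = q x) \<and>
     (\<forall>D\<in>\<D>. min (card D) (card (B D \<inter> Q) + 1) \<le> card ((\<lambda>w. {x\<in>Q. w \<in> \<rho> x}) ` D))"
  proof (rule split_classes[OF Q(1) _ _ _ B(2)])
    show "\<forall>x\<in>Q. finite (fwd x) \<and> q x \<le> card (fwd x)" using fin_fwd q_le by blast
    show "\<forall>D\<in>\<D>. finite D \<and> D \<noteq> {}" using D by blast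
    show "\<forall>D\<in>\<D>. \<forall>x\<in>B D \<inter> Q. D \<subseteq> fwd x \<and> 1 \<le> q x \<and> q x < card (fwd x)"
    proof (intro ballI)
      fix D' x assume h: "D' \<in> \<D>" "x \<in> B D' \<inter> Q"
      have x: "x \<in> N (rp D') \<inter> servers" using h B by (auto simp: AA_def)
      then have "rp D' \<in> fwd x" using D[OF h(1)] touched[of "rp D'" x] h by auto
      then have "D' \<subseteq> fwd x" using dcls_fwd[of "rp D'" x] D[OF h(1)] h by auto
      then show "D' \<subseteq> fwd x \<and> 1 \<le> q x \<and> q x < card (fwd x)" using x by (auto simp: servers_def)
    qed
  qed
  then obtain \<rho> where \<rho>: "\<forall>x\<in>Q. \<rho> x \<subseteq> fwd x \<and> card (\<rho> x) = q x"
     "\<forall>D\<in>\<D>. min (card D) (card (B D \<inter> Q) + 1) \<le> card ((\<lambda>w. {x\<in>Q. w \<in> \<rho> x}) ` D)" by blast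
  have "card {w\<in>dcls v. \<forall>y\<in>Q. (w \<in> \<rho> y) = (v \<in> \<rho> y)} \<le> max 1 (\<delta> F v - 1 - card (N v \<inter> Q))"
    if v: "v \<in> V - F - Q" "N v \<inter> Q \<noteq> {}" for v
  proof -
    have vW: "v \<in> W" using v touched unfolding W_def by blast
    then have DD: "dcls v \<in> \<D>" by (simp add: \<D>_def)
    have r: "rp (dcls v) \<in> dcls v" using rp v by auto
    have demr: "dem (rp (dcls v)) = dem v"
      unfolding dem_def using dcls_eq[OF r] dcls_N[OF r] dcls_\<delta>[OF r] v by auto
    have "card (B (dcls v) \<inter> Q) = dem v" using B(1) BQ[OF DD] DD demr by (metis inf.absorb1)
    then have 1: "min (card (dcls v)) (dem v + 1) \<le> card ((\<lambda>w. {x\<in>Q. w \<in> \<rho> x}) ` dcls v)" using \<rho>(2)[rule_format, OF DD] by simp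
    have fD: "finite (dcls v)" using fin_dcls v by auto
    have 2: "card {w\<in>dcls v. {x\<in>Q. w \<in> \<rho> x} = {x\<in>Q. v \<in> \<rho> x}} + card ((\<lambda>w. {x\<in>Q. w \<in> \<rho> x}) ` dcls v) \<le> card (dcls v) + 1"
      by (rule card_block_le[OF fD dcls_refl[OF v(1)]])
    have "{w\<in>dcls v. {x\<in>Q. w \<in> \<rho> x} = {x\<in>Q. v \<in> \<rho> x}} = {w\<in>dcls v. \<forall>y\<in>Q. (w \<in> \<rho> y) = (v \<in> \<rho> y)}" by blast
    then show ?thesis using 1 2 unfolding dem_def by auto
  qed
  then have "valid \<rho>" unfolding valid_def using \<rho>(1) by blast
  then show ?thesis by blast
qed

section \<open>Exchanging the colours of two edges at a member of the class\<close>

definition swp :: "('a \<Rightarrow> 'a set) \<Rightarrow> 'a \<Rightarrow> 'a \<Rightarrow> 'a \<Rightarrow> 'a \<Rightarrow> 'a set" where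
  "swp \<rho> x a b = \<rho>(x := {w. (if w = a then b else if w = b then a else w) \<in> \<rho> x})"

definition unsat :: "('a \<Rightarrow> 'a set) \<Rightarrow> 'a set" where
  "unsat \<rho> = {w\<in>\<Union>(fwd ` Q). \<not> fsat (F \<union> Q) (pt \<rho>) w}"

text \<open>This is what obstructs an exchange at \<open>x\<close>: afterwards \<open>a\<close>
  would have the code of \<open>w\<close>.\<close>

definition flips :: "('a \<Rightarrow> 'a set) \<Rightarrow> 'a \<Rightarrow> 'a \<Rightarrow> 'a \<Rightarrow> bool" where
  "flips \<rho> x a w \<longleftrightarrow> (\<forall>y\<in>Q. (w \<in> \<rho> y) = ((a \<in> \<rho> y) \<noteq> (y = x)))"

lemma swp_other: "w \<noteq> a \<Longrightarrow> w \<noteq> b \<Longrightarrow> (w \<in> swp \<rho> x a b y) = (w \<in> \<rho> y)"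
  by (auto simp: swp_def)
lemma swp_a: assumes "(a \<in> \<rho> x) \<noteq> (b \<in> \<rho> x)" shows "(a \<in> swp \<rho> x a b y) = ((a \<in> \<rho> y) \<noteq> (y = x))"
proof -
  have "(a \<in> swp \<rho> x a b y) = (if y = x then b \<in> \<rho> x else a \<in> \<rho> y)" by (simp add: swp_def)
  then show ?thesis using assms by (cases "a \<in> \<rho> x"; cases "y = x") simp_all
qed
lemma swp_b: assumes "(a \<in> \<rho> x) \<noteq> (b \<in> \<rho> x)" shows "(b \<in> swp \<rho> x a b y) = ((b \<in> \<rho> y) \<noteq> (y = x))"
proof -
  have "b \<noteq> a" using assms by blast
  then have "(b \<in> swp \<rho> x a b y) = (if y = x then a \<in> \<rho> x else b \<in> \<rho> y)" by (simp add: swp_def)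
  then show ?thesis using assms by (cases "a \<in> \<rho> x"; cases "y = x") simp_all
qed

text \<open>The blocks of \<open>a\<close> and \<open>b\<close> become singletons, and every other
  block can only lose members.\<close>

lemma swp_valid:
  assumes v: "valid \<rho>" and x: "x \<in> Q" "a \<in> fwd x" "b \<in> fwd x" "(a \<in> \<rho> x) \<noteq> (b \<in> \<rho> x)"
    and hA: "\<And>w. w \<in> dcls a - {a, b} \<Longrightarrow> \<not> flips \<rho> x a w"
    and hB: "\<And>w. w \<in> dcls b - {a, b} \<Longrightarrow> \<not> flips \<rho> x b w"
  shows "valid (swp \<rho> x a b)"
  unfolding valid_def
proof (intro conjI ballI impI)
  define t where "t = (\<lambda>w. if w = a then b else if w = b then a else w)"
  have tt: "t (t w) = w" for w by (auto simp: t_def)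
  have img: "{w. t w \<in> \<rho> x} = t ` \<rho> x"
  proof
    show "{w. t w \<in> \<rho> x} \<subseteq> t ` \<rho> x"
    proof
      fix w assume "w \<in> {w. t w \<in> \<rho> x}"
      then show "w \<in> t ` \<rho> x" using tt[of w] by (intro image_eqI[of _ _ "t w"]) auto
    qed
    show "t ` \<rho> x \<subseteq> {w. t w \<in> \<rho> x}" using tt by auto
  qed
  have sx: "swp \<rho> x a b x = t ` \<rho> x" using img by (simp only: swp_def fun_upd_same t_def)
  have inj: "inj_on t S" for S by (rule inj_on_inverseI[of _ t]) (rule tt)
  fix y assume y: "y \<in> Q"
  show "swp \<rho> x a b y \<subseteq> fwd y"
  proof (cases "y = x")
    case True
    have "\<rho> x \<subseteq> fwd x" using v x unfolding valid_def by blast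
    then show ?thesis using x unfolding True sx t_def by auto
  next
    case False then show ?thesis using v y unfolding valid_def swp_def by auto
  qed
  show "card (swp \<rho> x a b y) = q y"
  proof (cases "y = x")
    case True
    then show ?thesis using v x sx card_image[OF inj] unfolding valid_def by auto
  next
    case False then show ?thesis using v y unfolding valid_def swp_def by auto
  qed
next
  fix u assume u: "u \<in> V - F - Q" "N u \<inter> Q \<noteq> {}"
  let ?M = "max 1 (\<delta> F u - 1 - card (N u \<inter> Q))"
  let ?S = "{w \<in> dcls u. \<forall>y\<in>Q. (w \<in> swp \<rho> x a b y) = (u \<in> swp \<rho> x a b y)}"
  note a' = swp_a[of a \<rho> x b, OF x(4)] and b' = swp_b[of a \<rho> x b, OF x(4)]
  have uu: "u \<in> dcls w" if "w \<in> dcls u" for w using dcls_eq[OF that] dcls_refl u by auto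
  have one: "card {w} \<le> ?M" for w :: 'a by simp
  consider "u = a" | "u = b" | "u \<noteq> a" "u \<noteq> b" by blast
  then show "card ?S \<le> ?M"
  proof cases
    case 1
    have "?S \<subseteq> {a}"
    proof
      fix w assume w: "w \<in> ?S"
      have "w \<noteq> b" using w a' b' x 1 by blast
      moreover have "w = a" if "w \<noteq> b"
      proof (rule ccontr)
        assume "w \<noteq> a"
        then have "flips \<rho> x a w" using w a' swp_other[of w a b \<rho> x] that 1 unfolding flips_def by auto
        then show False using hA w 1 that \<open>w \<noteq> a\<close> by blast
      qed
      ultimately show "w \<in> {a}" by blast
    qed
    then have "card ?S \<le> card {a}" by (intro card_mono) auto
    then show ?thesis using one[of a] by linarith
  next
    case 2
    have "?S \<subseteq> {b}"
    proof
      fix w assume w: "w \<in> ?S"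
      have "w \<noteq> a" using w a' b' x 2 by blast
      moreover have "w = b" if "w \<noteq> a"
      proof (rule ccontr)
        assume "w \<noteq> b"
        then have "flips \<rho> x b w" using w b' swp_other[of w a b \<rho> x] that 2 unfolding flips_def by auto
        then show False using hB w 2 that \<open>w \<noteq> b\<close> by blast
      qed
      ultimately show "w \<in> {b}" by blast
    qed
    then have "card ?S \<le> card {b}" by (intro card_mono) auto
    then show ?thesis using one[of b] by linarith
  next
    case 3
    have "?S \<subseteq> {w \<in> dcls u. \<forall>y\<in>Q. (w \<in> \<rho> y) = (u \<in> \<rho> y)}"
    proof
      fix w assume w: "w \<in> ?S"
      have uo: "(u \<in> swp \<rho> x a b y) = (u \<in> \<rho> y)" for y using swp_other 3 by blast
      have "w \<noteq> a"
      proof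
        assume wa: "w = a"
        then have "flips \<rho> x a u" using w a' uo unfolding flips_def by auto
        then show False using hA[of u] uu[of a] w wa 3 by blast
      qed
      moreover have "w \<noteq> b"
      proof
        assume wb: "w = b"
        then have "flips \<rho> x b u" using w b' uo unfolding flips_def by auto
        then show False using hB[of u] uu[of b] w wb 3 by blast
      qed
      ultimately show "w \<in> {w \<in> dcls u. \<forall>y\<in>Q. (w \<in> \<rho> y) = (u \<in> \<rho> y)}"
        using w uo swp_other[of w a b \<rho> x] by auto
    qed
    then have "card ?S \<le> card {w \<in> dcls u. \<forall>y\<in>Q. (w \<in> \<rho> y) = (u \<in> \<rho> y)}"
      using fin_dcls[OF u] by (intro card_mono) auto
    also have "\<dots> \<le> ?M" using v u unfolding valid_def by blast
    finally show ?thesis .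
  qed
qed

text \<open>After the exchange \<open>a\<close> sees different colours on its edges to
  \<open>x\<close> and \<open>y\<close>. The vertex \<open>b\<close> was unsatisfied anyway, and no
  other vertex outside is affected.\<close>

lemma swp_improves:
  assumes x: "x \<in> Q" "a \<in> fwd x" "b \<in> fwd x" "(a \<in> \<rho> x) \<noteq> (b \<in> \<rho> x)"
    and y: "y \<in> Q" "y \<noteq> x" "y \<in> N a" "(a \<in> \<rho> y) = (a \<in> \<rho> x)"
    and ns: "\<not> fsat (F \<union> Q) (pt \<rho>) a" "\<not> fsat (F \<union> Q) (pt \<rho>) b"
  shows "unsat (swp \<rho> x a b) \<subset> unsat \<rho>"
proof -
  let ?\<rho> = "swp \<rho> x a b"
  have aW: "a \<in> V - F - Q" "x \<in> N a" using fwdD x by auto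
  have 1: "fsat (F \<union> Q) (pt ?\<rho>) w = fsat (F \<union> Q) (pt \<rho>) w" if w: "w \<in> V - F - Q" "w \<noteq> a" "w \<noteq> b" for w
  proof -
    have "pt ?\<rho> w u = pt \<rho> w u" if "u \<in> F \<union> Q" for u
      using that w swp_other[OF w(2,3), of \<rho> x] unfolding pt_def by auto
    then show ?thesis unfolding fsat_def by auto
  qed
  have c: "pt ?\<rho> a x \<noteq> pt ?\<rho> a y"
    using pt_code'[OF x(1) aW(1)] pt_code'[OF y(1) aW(1)] swp_a[of a \<rho> x b, OF x(4)] y by simp
  have "x \<in> N a \<inter> (F \<union> Q) - F1" "y \<in> N a \<inter> (F \<union> Q) - F1" using aW x y QF by auto
  then have fa: "fsat (F \<union> Q) (pt ?\<rho>) a" using c unfolding fsat_def by metis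
  have "unsat ?\<rho> \<subseteq> unsat \<rho>"
  proof
    fix w assume w: "w \<in> unsat ?\<rho>"
    have wV: "w \<in> V - F - Q" "w \<in> \<Union>(fwd ` Q)" using w fwdD unfolding unsat_def by auto
    consider "w = a" | "w = b" | "w \<noteq> a" "w \<noteq> b" by blast
    then show "w \<in> unsat \<rho>" using w wV ns 1[of w] unfolding unsat_def by cases auto
  qed
  moreover have "a \<in> unsat \<rho>" using ns x unfolding unsat_def by auto
  moreover have "a \<notin> unsat ?\<rho>" using fa unfolding unsat_def by auto
  ultimately show ?thesis by blast
qed

text \<open>An obstructing \<open>w\<close> has a code that differs from that of \<open>a\<close> in
  exactly one place, so it obstructs at most one \<open>x\<close>.\<close>

lemma flips_count: assumes "finite Y" shows "card {x\<in>Q. \<exists>w\<in>Y. flips \<rho> x a w} \<le> card Y"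
proof -
  have "{x\<in>Q. \<exists>w\<in>Y. flips \<rho> x a w} = (\<Union>w\<in>Y. {x\<in>Q. flips \<rho> x a w})" by blast
  also have "card \<dots> \<le> (\<Sum>w\<in>Y. card {x\<in>Q. flips \<rho> x a w})" by (rule card_UN_le[OF assms])
  also have "\<dots> \<le> (\<Sum>w\<in>Y. 1)"
  proof (rule sum_mono)
    fix w assume "w \<in> Y"
    have "x = x'" if "x \<in> Q" "x' \<in> Q" "flips \<rho> x a w" "flips \<rho> x' a w" for x x'
      using that unfolding flips_def by blast
    then show "card {x\<in>Q. flips \<rho> x a w} \<le> 1" using Q by (intro card_le_Suc0_iff_eq[THEN iffD2, folded One_nat_def]) auto
  qed
  finally show ?thesis by simp
qed

text \<open>Each of the other members of the two classes obstructs at most one exchange, and by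
  \<open>few\<close> there are fewer of them than candidates \<open>x\<close> in
  \<open>Q \<inter> N b\<close>. An unobstructed exchange contradicts minimality.\<close>

lemma two_classes:
  assumes v: "valid \<rho>" and min: "\<And>\<rho>'. valid \<rho>' \<Longrightarrow> \<not> unsat \<rho>' \<subset> unsat \<rho>"
    and a: "a \<in> V - F - Q" "Q \<subseteq> N a" "\<And>y. y \<in> Q \<Longrightarrow> (a \<in> \<rho> y) = k"
    and b: "b \<in> V - F - Q" "\<And>y. y \<in> Q \<inter> N b \<Longrightarrow> (b \<in> \<rho> y) \<noteq> k"
    and ne: "dcls a \<noteq> dcls b" and fin: "finite (dcls a)" "finite (dcls b)"
    and ns: "\<not> fsat (F \<union> Q) (pt \<rho>) a" "\<not> fsat (F \<union> Q) (pt \<rho>) b"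
    and few: "card (dcls a) + card (dcls b) < card (Q \<inter> N b) + 2"
  shows False
proof -
  let ?A = "{x\<in>Q. \<exists>w\<in>dcls a - {a}. flips \<rho> x a w}" and ?B = "{x\<in>Q. \<exists>w\<in>dcls b - {b}. flips \<rho> x b w}"
  have aa: "a \<in> dcls a" "b \<in> dcls b" using dcls_refl a b by auto
  then have ca: "card (dcls a - {a}) + 1 = card (dcls a)" "card (dcls b - {b}) + 1 = card (dcls b)"
    using card_Suc_Diff1[OF fin(1) aa(1)] card_Suc_Diff1[OF fin(2) aa(2)] by simp_all
  have "card ?A \<le> card (dcls a - {a})" "card ?B \<le> card (dcls b - {b})"
    by (rule flips_count; use fin in simp)+
  then have "card (?A \<union> ?B) < card (Q \<inter> N b)" using few ca card_Un_le[of ?A ?B] by linarith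
  then have "\<not> Q \<inter> N b \<subseteq> ?A \<union> ?B" using Q card_mono[of "?A \<union> ?B" "Q \<inter> N b"] by auto
  then obtain x where x: "x \<in> Q" "x \<in> N b" "x \<notin> ?A" "x \<notin> ?B" by blast
  have ax: "a \<in> fwd x" "b \<in> fwd x" using x a b touched by auto
  have d: "(a \<in> \<rho> x) \<noteq> (b \<in> \<rho> x)" using x a(3) b(2) by auto
  have "\<not> Q \<subseteq> {x}" using Q card_mono[of "{x}" Q] by auto
  then obtain y where y: "y \<in> Q" "y \<noteq> x" by blast
  have "valid (swp \<rho> x a b)" by (rule swp_valid[OF v x(1) ax d]) (use x in auto)
  moreover have "unsat (swp \<rho> x a b) \<subset> unsat \<rho>"
    by (rule swp_improves[OF x(1) ax d y _ _ ns]) (use y a x in auto)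
  ultimately show False using min by blast
qed

text \<open>In an unsatisfiable tree component every vertex sees only one colour on its edges to \<open>F \<union> Q\<close>.
  Exchanging the colours of the edges from some \<open>x \<in> Q\<close> to two such vertices of opposite colours satisfies
  one of them; a count shows that for some \<open>x\<close> the classes stay small.\<close>
lemma minimal_satK:
  assumes v: "valid \<rho>" and min: "\<And>\<rho>'. valid \<rho>' \<Longrightarrow> \<not> unsat \<rho>' \<subset> unsat \<rho>"
    and e_le: "\<And>v x. v \<in> V - F - Q \<Longrightarrow> x \<in> Q \<Longrightarrow> card (fwd x) \<le> \<delta> F v"
    and z: "z \<in> servers" and K: "tcomp (F \<union> Q) K"
  shows "satK (F \<union> Q) (pt \<rho>) K"
proof (rule ccontr)
  assume ns: "\<not> satK (F \<union> Q) (pt \<rho>) K"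
  let ?n = "card Q"
  note KD = tcompD[OF K]
  have F0FQ: "F0 \<subseteq> F \<union> Q" using F by blast
  have KW: "K \<subseteq> V - F - Q" using KD(1) by blast
  have nf: "\<not> fsat (F \<union> Q) (pt \<rho>) u" if "u \<in> K" for u using satK_root[OF K F0FQ that pt_symc] ns by blast
  define Lf where "Lf = {u\<in>K. \<delta> (F \<union> Q) u = 1}"
  have pos: "\<forall>u\<in>K. 1 \<le> \<delta> (F \<union> Q) u" using \<delta>_pos KW by blast
  have Lf: "u \<in> V - F - Q" "u \<in> K" "Q \<subseteq> N u" "\<delta> F u = ?n + 1" "N u \<inter> F \<noteq> {}" "N u \<inter> Q = Q" "N u \<inter> Q \<noteq> {}" "finite (dcls u)"
    "card (dcls u) \<le> ?n" if u: "u \<in> Lf" for u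
  proof -
    have 1: "u \<in> V - F - Q" "\<delta> (F \<union> Q) u \<le> 1" "u \<in> K" using u KW unfolding Lf_def by auto
    show "u \<in> V - F - Q" "u \<in> K" using 1 by auto
    show 2: "Q \<subseteq> N u" "\<delta> F u = ?n + 1" "N u \<inter> F \<noteq> {}" using leaf[OF 1(1,2)] by auto
    show "N u \<inter> Q = Q" using 2 by blast
    have "Q \<noteq> {}" using Q(3) by auto
    then show 3: "N u \<inter> Q \<noteq> {}" using 2(1) by blast
    show "finite (dcls u)" by (rule fin_dcls[OF 1(1) 3])
    have "card (dcls u) \<le> card (cls F C u - Q)"
      using fin_cls[OF 2(3)] by (intro card_mono) (auto simp: dcls_def)
    then show "card (dcls u) \<le> ?n" using inv1W[OF 1(1) 2(3)] 2(2) Q(3) by simp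
  qed
  have mono: "\<exists>k. \<forall>y\<in>Q \<inter> N u. (u \<in> \<rho> y) = k" if u: "u \<in> K" for u
  proof (rule ccontr)
    assume "\<not> ?thesis"
    then obtain y y' where y: "y \<in> Q \<inter> N u" "y' \<in> Q \<inter> N u" "u \<in> \<rho> y" "u \<notin> \<rho> y'" by blast
    have uW: "u \<in> V - F - Q" using u KW by blast
    have "pt \<rho> u y" "\<not> pt \<rho> u y'" using pt_code'[OF _ uW] y by auto
    then have "fsat (F \<union> Q) (pt \<rho>) u" using y QF unfolding fsat_def by auto
    then show False using nf u by blast
  qed
  \<comment> \<open>At a leaf the bound in \<open>valid\<close> equals 1.\<close>
  have distinct: "w = u" if u: "u \<in> Lf" "w \<in> dcls u" "\<And>y. y \<in> Q \<Longrightarrow> (w \<in> \<rho> y) = (u \<in> \<rho> y)" for u w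
  proof -
    let ?S = "{w\<in>dcls u. \<forall>y\<in>Q. (w \<in> \<rho> y) = (u \<in> \<rho> y)}"
    have "card ?S \<le> max 1 (\<delta> F u - 1 - card (N u \<inter> Q))" using v Lf[OF u(1)] unfolding valid_def by blast
    also have "\<dots> = 1" using Lf(4,6)[OF u(1)] by simp
    finally have "card ?S \<le> 1" .
    moreover have "u \<in> ?S" "w \<in> ?S" using u dcls_refl Lf[OF u(1)] by auto
    moreover have "finite ?S" using Lf(8)[OF u(1)] by simp
    ultimately show ?thesis by (metis (no_types, lifting) One_nat_def card_le_Suc0_iff_eq)
  qed
  obtain z0 where z0: "z0 \<in> Q" using z by (auto simp: servers_def)
  have e_small: "card (fwd x) \<le> ?n + 1" if "u \<in> Lf" "x \<in> Q" for u x using e_le[OF Lf(1)] Lf(4) that by metis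
  obtain a where a: "a \<in> Lf"
    using tcomp_leaf[OF K] pos unfolding Lf_def by (metis (mono_tags, lifting) le_antisym mem_Collect_eq)
  have monoL: "\<exists>k. \<forall>y\<in>Q. (u \<in> \<rho> y) = k" if "u \<in> Lf" for u using mono[OF Lf(2)[OF that]] Lf(3)[OF that] by blast
  \<comment> \<open>Leaves of opposite colours are candidates for an exchange, contrary to
    minimality.\<close>
  have same_colour: "(a \<in> \<rho> y) = (b \<in> \<rho> y)" if ab: "a \<in> Lf" "b \<in> Lf" and y: "y \<in> Q" for a b y
  proof (rule ccontr)
    assume dif: "\<not> ?thesis"
    obtain k where k: "\<And>y. y \<in> Q \<Longrightarrow> (a \<in> \<rho> y) = k" using monoL[OF ab(1)] by blast
    have kb: "\<And>y. y \<in> Q \<Longrightarrow> (b \<in> \<rho> y) \<noteq> k" using monoL[OF ab(2)] dif y k by blast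
    note LA = Lf[OF ab(1)] and LB = Lf[OF ab(2)]
    have "z0 \<in> N a \<inter> Q" "z0 \<in> N b \<inter> Q" using LA(3) LB(3) z0 by auto
    then have fw: "dcls a \<subseteq> fwd z0" "dcls b \<subseteq> fwd z0"
      using dcls_fwd[OF touched[OF LA(1)] z0] dcls_fwd[OF touched[OF LB(1)] z0] by auto
    show False
    proof (cases "dcls a = dcls b")
      case False
      then have disj: "dcls a \<inter> dcls b = {}" using dcls_eq by blast
      have "card (dcls a) + card (dcls b) = card (dcls a \<union> dcls b)"
        using disj LA LB by (simp add: card_Un_disjoint)
      also have "\<dots> \<le> card (fwd z0)" using fw fin_fwd z0 by (intro card_mono) auto
      also have "\<dots> \<le> ?n + 1" using e_small ab z0 by blast
      also have "?n = card (Q \<inter> N b)" using LB by (simp add: Int_commute)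
      finally have "card (dcls a) + card (dcls b) < card (Q \<inter> N b) + 2" by simp
      then show False
        by (intro two_classes[OF v min LA(1,3) k LB(1) _ False LA(8) LB(8) nf[OF LA(2)] nf[OF LB(2)]]) (use kb in auto)
    next
      case True
      let ?Y = "dcls a - {a, b}"
      have ne: "a \<noteq> b" using dif by auto
      have cY: "card ?Y + 2 \<le> ?n"
      proof -
        have "{a, b} \<subseteq> dcls a" using dcls_refl LA LB True by auto
        then have "card (dcls a) = card ?Y + 2" using LA(8) ne
          by (metis card_2_iff card_Diff_subset card_mono finite_subset le_add_diff_inverse2)
        then show ?thesis using LA(9) by linarith
      qed
      let ?B = "{x\<in>Q. \<exists>w\<in>?Y. flips \<rho> x a w \<or> flips \<rho> x b w}"
      have "?B = (\<Union>w\<in>?Y. {x\<in>Q. flips \<rho> x a w \<or> flips \<rho> x b w})" by blast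
      then have "card ?B = card (\<Union>w\<in>?Y. {x\<in>Q. flips \<rho> x a w \<or> flips \<rho> x b w})" by (rule arg_cong)
      also have "\<dots> \<le> (\<Sum>w\<in>?Y. card {x\<in>Q. flips \<rho> x a w \<or> flips \<rho> x b w})"
        by (rule card_UN_le[OF finite_Diff[OF LA(8)]])
      also have "\<dots> \<le> (\<Sum>w\<in>?Y. 1)"
      proof (rule sum_mono)
        fix w assume w: "w \<in> ?Y"
        have "0 < card ?Y" using w LA(8) by (metis card_gt_0_iff empty_iff finite_Diff)
        then have n3: "3 \<le> ?n" using cY by linarith
        \<comment> \<open>The codes of \<open>a\<close> and \<open>b\<close> are opposite, so a code
          differing from one of them in a single place differs from the other in
          \<open>card Q - 1\<close> places, which is at least 2.\<close>
        have "x = x'" if h: "x \<in> Q" "x' \<in> Q" "flips \<rho> x a w \<or> flips \<rho> x b w" "flips \<rho> x' a w \<or> flips \<rho> x' b w" for x x'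
        proof (rule ccontr)
          assume xx: "x \<noteq> x'"
          have "\<not> Q \<subseteq> {x, x'}" using n3 Q card_mono[of "{x, x'}" Q] xx by auto
          then obtain y where y: "y \<in> Q" "y \<noteq> x" "y \<noteq> x'" by blast
          show False using h xx y k[of x] k[of x'] k[of y] kb[of x] kb[of x'] kb[of y] unfolding flips_def by blast
        qed
        then show "card {x\<in>Q. flips \<rho> x a w \<or> flips \<rho> x b w} \<le> 1"
          using Q by (intro card_le_Suc0_iff_eq[THEN iffD2, folded One_nat_def]) auto
      qed
      finally have "card ?B < ?n" using cY by simp
      then have "\<not> Q \<subseteq> ?B" using Q card_mono[of ?B Q] by auto
      then obtain x where x: "x \<in> Q" "x \<notin> ?B" by blast
      have ax: "a \<in> fwd x" "b \<in> fwd x" using x LA LB touched by auto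
      have d: "(a \<in> \<rho> x) \<noteq> (b \<in> \<rho> x)" using x k kb by auto
      have "\<not> Q \<subseteq> {x}" using Q card_mono[of "{x}" Q] by auto
      then obtain y where y: "y \<in> Q" "y \<noteq> x" by blast
      have "valid (swp \<rho> x a b)" by (rule swp_valid[OF v x(1) ax d]) (use x True in auto)
      moreover have "unsat (swp \<rho> x a b) \<subset> unsat \<rho>"
        by (rule swp_improves[OF x(1) ax d y _ _ nf[OF LA(2)] nf[OF LB(2)]]) (use y LA k x in auto)
      ultimately show False using min by blast
    qed
  qed
  obtain k where k: "\<And>y. y \<in> Q \<Longrightarrow> (a \<in> \<rho> y) = k" using monoL[OF a] by blast
  note LA = Lf[OF a]
  have "card (N a - (F \<union> Q)) = 1" using a unfolding Lf_def \<delta>_def by simp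
  then obtain u where u: "N a - (F \<union> Q) = {u}" by (auto simp: card_1_singleton_iff)
  have uK: "u \<in> K" using KD(4)[OF LA(2)] u by blast
  have uW: "u \<in> V - F - Q" using uK KW by blast
  have au: "A a u" using u ND by blast
  \<comment> \<open>Otherwise \<open>a\<close> and \<open>u\<close> would lack the same colour, and
    the edge joining them could provide it.\<close>
  have edge: False if "y \<in> Q" "y \<in> N u" "(u \<in> \<rho> y) = k" for y
  proof -
    have "pt \<rho> a z0 = pt \<rho> u y" using pt_code'[OF z0 LA(1)] pt_code'[OF that(1) uW] k[OF z0] that by simp
    moreover have "z0 \<in> N a \<inter> (F \<union> Q) - F1" "y \<in> N u \<inter> (F \<union> Q) - F1" using z0 LA that QF by auto
    ultimately show False using satK_edge[OF K F0FQ LA(2) uK au pt_symc] ns by blast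
  qed
  have uL: "u \<notin> Lf"
  proof
    assume "u \<in> Lf"
    then show False using edge[OF z0] Lf(3) z0 same_colour[OF a] k by blast
  qed
  then have k2: "2 \<le> \<delta> (F \<union> Q) u" using pos uK unfolding Lf_def by force
  have leaves: "\<delta> (F \<union> Q) u \<le> card Lf" unfolding Lf_def by (rule tcomp_leaves[OF K uK k2 pos])
  have Lfw: "Lf \<subseteq> fwd x" if "x \<in> Q" for x using Lf that touched by blast
  show False
  proof (cases "N u \<inter> Q = {}")
    case True
    have zQ: "z \<in> Q" using z by (simp add: servers_def)
    have "?n + 1 \<le> \<delta> (F \<union> Q) u" using \<delta>_n[OF uW] \<delta>_Q[of u] uW True by simp
    \<comment> \<open>There are so many leaves that all outside neighbours of the server
      \<open>z\<close> are leaves. Then they all have the same colour, whereas a server uses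
      both.\<close>
    then have "card (fwd z) \<le> card Lf" using leaves e_small[OF a zQ] by linarith
    then have eq: "Lf = fwd z" using Lfw[OF zQ] fin_fwd[OF zQ] by (intro card_seteq) auto
    have "\<rho> z \<subseteq> fwd z" "card (\<rho> z) = q z" using v zQ unfolding valid_def by auto
    moreover have "w \<in> \<rho> z \<longleftrightarrow> k" if "w \<in> fwd z" for w using same_colour[OF a _ zQ, of w] k[OF zQ] eq that by blast
    ultimately have "\<rho> z = (if k then fwd z else {})" "card (\<rho> z) = q z" by auto
    then have "q z = 0 \<or> q z = card (fwd z)" by (cases k) auto
    then show False using z by (auto simp: servers_def)
  next
    case False
    then obtain x where x: "x \<in> Q" "x \<in> N u" by blast
    have fu: "finite (dcls u)" using fin_dcls uW False by blast
    have du: "\<delta> (F \<union> Q) w = \<delta> (F \<union> Q) u" if w: "w \<in> dcls u" for w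
      using dcls_\<delta>[OF w] dcls_N[OF w] \<delta>_Q[of w] \<delta>_Q[of u] uW dcls_sub[of u] w by (metis DiffD1 add_right_cancel subsetD)
    have disj: "dcls u \<inter> Lf = {}" using du k2 unfolding Lf_def by force
    have ne: "dcls a \<noteq> dcls u" using disj a dcls_refl[OF LA(1)] by blast
    then have disj2: "dcls a \<inter> dcls u = {}" using dcls_eq by blast
    have disj3: "dcls a \<inter> (Lf - {a}) = {}"
    proof (rule ccontr)
      assume "\<not> ?thesis"
      then obtain w where w: "w \<in> dcls a" "w \<in> Lf" "w \<noteq> a" by blast
      then show False using distinct[OF a w(1)] same_colour[OF a w(2)] by blast
    qed
    \<comment> \<open>Three disjoint sets inside \<open>fwd x\<close>: the many leaves leave so
      little room for the classes of \<open>a\<close> and \<open>u\<close> that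
      \<open>two_classes\<close> applies.\<close>
    have sub: "dcls a \<union> (dcls u \<union> (Lf - {a})) \<subseteq> fwd x"
      using dcls_fwd[of a x] dcls_fwd[of u x] touched[OF LA(1), of x] touched[OF uW, of x] x Lfw[OF x(1)] LA(6) by blast
    have fL: "finite Lf" using KD(2) by (simp add: Lf_def)
    have "card (dcls a) + (card (dcls u) + card (Lf - {a})) = card (dcls a) + card (dcls u \<union> (Lf - {a}))"
      using fL fu disj by (subst card_Un_disjoint) auto
    also have "\<dots> = card (dcls a \<union> (dcls u \<union> (Lf - {a})))"
      using fL fu LA(8) disj2 disj3 by (subst card_Un_disjoint) auto
    also have "\<dots> \<le> card (fwd x)" using sub fin_fwd x by (intro card_mono) auto
    also have "\<dots> \<le> ?n + 1" using e_small a x by blast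
    finally have "card (dcls a) + (card (dcls u) + card (Lf - {a})) \<le> ?n + 1" .
    moreover have "card (Lf - {a}) + 1 = card Lf" using card_Suc_Diff1[OF fL a] by simp
    moreover have "?n + 1 \<le> \<delta> (F \<union> Q) u + card (Q \<inter> N u)" using \<delta>_n[OF uW] \<delta>_Q[of u] uW by (simp add: Int_commute)
    ultimately have few: "card (dcls a) + card (dcls u) < card (Q \<inter> N u) + 2" using leaves by linarith
    show False
      by (rule two_classes[OF v min LA(1,3) k uW _ ne LA(8) fu nf[OF LA(2)] nf[OF uK] few]) (use edge in auto)
  qed
qed

theorem class_step:
  assumes q_le: "\<And>x. x \<in> Q \<Longrightarrow> q x \<le> card (fwd x)"
    and e_le: "\<And>v x. v \<in> V - F - Q \<Longrightarrow> x \<in> Q \<Longrightarrow> card (fwd x) \<le> \<delta> F v"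
    and "servers \<noteq> {}"
    and hall: "\<And>v. v \<in> V - F - Q \<Longrightarrow> 0 < dem v \<Longrightarrow> N v \<inter> Q \<noteq> {} \<Longrightarrow> N v \<inter> servers \<noteq> {} \<and>
       (\<forall>x\<in>N v \<inter> servers. dem v * (card (fwd x) - card (dcls ` fwd x)) \<le> card (N v \<inter> servers) * (card (dcls v) - 1))"
  shows "\<exists>C'. symc C' \<and> agree F C C' \<and> (\<forall>x\<in>Q. \<forall>y\<in>Q. C' x y = R x y) \<and>
     (\<forall>x\<in>Q. card {w\<in>fwd x. C' x w} = q x) \<and> inv1 (F \<union> Q) C' \<and> inv2 (F \<union> Q) C'"
proof -
  obtain z where z: "z \<in> servers" using assms(3) by blast
  have "\<exists>\<rho>. valid \<rho>" by (rule exists_valid[OF q_le hall])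
  then obtain \<rho> where \<rho>: "valid \<rho>" and least: "\<And>\<rho>'. valid \<rho>' \<Longrightarrow> card (unsat \<rho>) \<le> card (unsat \<rho>')"
    using ex_has_least_nat[of valid _ "\<lambda>\<rho>. card (unsat \<rho>)"] by blast
  have "finite (unsat r)" for r using Q fin_fwd by (auto simp: unsat_def)
  then have min: "\<not> unsat \<rho>' \<subset> unsat \<rho>" if "valid \<rho>'" for \<rho>'
    using least[OF that] psubset_card_mono by (metis not_le)
  have "inv2 (F \<union> Q) (pt \<rho>)" unfolding inv2_def using minimal_satK[OF \<rho> min e_le z] by blast
  moreover have "card {w\<in>fwd x. pt \<rho> x w} = q x" if x: "x \<in> Q" for x
  proof -
    have "{w\<in>fwd x. pt \<rho> x w} = \<rho> x" using pt_code[OF x] \<rho> x fwdD unfolding valid_def by blast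
    then show ?thesis using \<rho> x unfolding valid_def by simp
  qed
  moreover have "pt \<rho> x y = R x y" if "x \<in> Q" "y \<in> Q" for x y using that QF unfolding pt_def by auto
  ultimately show ?thesis using pt_symc pt_agree valid_inv1[OF \<rho>] by blast
qed

end

text \<open>Here \<open>k\<close> is the size of a class, \<open>M + 1\<close> the \<delta> of its
  members, \<open>i\<close> the number of their neighbours in \<open>Q\<close>, and \<open>e\<close>
  the number of outside neighbours of a server; the 2 stands for two classes among these. With
  \<open>t = M - k\<close> at most \<open>i - t\<close> splits are demanded, and
  \<open>(i - t) * (M - 1) \<le> i * (k - 1)\<close>.\<close>

lemma hall_arith:
  fixes k M i e :: nat
  assumes "k \<le> M" "i \<le> M" "e \<le> M + 1"
  shows "(k - max 1 (M - i)) * (e - 2) \<le> i * (k - 1)" "1 \<le> i \<Longrightarrow> k - max 1 (M - i) \<le> i"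
proof -
  show "k - max 1 (M - i) \<le> i" if "1 \<le> i" using assms that by auto
  show "(k - max 1 (M - i)) * (e - 2) \<le> i * (k - 1)"
  proof (cases "i = M")
    case True
    have "(k - 1) * (e - 2) \<le> (k - 1) * i" using assms True by (intro mult_le_mono2) linarith
    then show ?thesis using True by (simp add: mult.commute)
  next
    case False
    define t where "t = M - k"
    have kt: "M = k + t" using assms by (simp add: t_def)
    have iM: "i \<le> M - 1" using False assms by linarith
    have d: "k - max 1 (M - i) \<le> i - t" using iM kt by auto
    have "(k - max 1 (M - i)) * (e - 2) \<le> (i - t) * (M - 1)" using d assms by (intro mult_le_mono) auto
    also have "\<dots> \<le> i * (k - 1)"
    proof (cases "t \<le> i \<and> 1 \<le> k")
      case True
      then obtain j l where j: "i = t + j" and l: "k = l + 1" using le_Suc_ex by (metis add.commute)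
      have "j \<le> l" using iM kt j l by linarith
      have "(i - t) * (M - 1) = j * (l + t)" using j l kt by simp
      also have "\<dots> = j * l + j * t" by (rule distrib_left)
      also have "\<dots> \<le> j * l + l * t" using \<open>j \<le> l\<close> by simp
      also have "\<dots> = i * (k - 1)" using j l by (simp add: algebra_simps)
      finally show ?thesis .
    next
      case False
      then have "i \<le> t" using iM kt by linarith
      then show ?thesis by simp
    qed
    finally show ?thesis .
  qed
qed

text \<open>If all pairs were twins, the one edge between \<open>a\<close> and \<open>b\<close>
  would force all others.\<close>

lemma nontwin_triple:
  assumes sym: "\<And>x y. L x y \<Longrightarrow> L y x" and ab: "a \<in> Q" "b \<in> Q" "a \<noteq> b" "L a b" and ce: "c \<in> Q" "e \<in> Q" "c \<noteq> e" "\<not> L c e"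
  shows "\<exists>x\<in>Q. \<exists>y\<in>Q. \<exists>z\<in>Q. x \<noteq> y \<and> z \<noteq> x \<and> z \<noteq> y \<and> L x z \<noteq> L y z"
proof (rule ccontr)
  assume "\<not> ?thesis"
  then have h: "L x z = L y z" if "x \<in> Q" "y \<in> Q" "z \<in> Q" "x \<noteq> y" "z \<noteq> x" "z \<noteq> y" for x y z using that by blast
  have b: "L z b" if "z \<in> Q" "z \<noteq> b" for z using h[of a z b] that ab by (cases "z = a") auto
  have "L z y" if "z \<in> Q" "y \<in> Q" "z \<noteq> y" for z y
  proof (cases "y = b \<or> z = b")
    case True then show ?thesis using b sym that by blast
  next
    case False then show ?thesis using h[of b z y] b[of y] sym that ab by blast
  qed
  then show False using ce by blast
qed

section \<open>Fixing a class with several members\<close>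

context extension
begin

lemma bij_cls:
  assumes "aut \<phi>" "pres C' \<phi>" "agree F C C'" "\<forall>u\<in>F. \<phi> u = u" "F \<subseteq> V" and x: "x \<in> V - F" "N x \<inter> F \<noteq> {}"
  shows "bij_betw \<phi> (cls F C x) (cls F C x)"
proof -
  have im: "\<phi> ` cls F C x \<subseteq> cls F C x"
  proof
    fix y assume "y \<in> \<phi> ` cls F C x"
    then obtain w where w: "w \<in> cls F C x" "y = \<phi> w" by blast
    have "w \<in> V - F" using w cls_sub by blast
    then have "\<phi> w \<in> cls F C w" by (rule aut_cls[OF assms(1-5)])
    then show "y \<in> cls F C x" using w cls_eq by metis
  qed
  have inj: "inj_on \<phi> (cls F C x)" using aut_inj[OF assms(1)] cls_sub[of F C x] unfolding inj_on_def by blast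
  have "\<phi> ` cls F C x = cls F C x" using endo_inj_surj[OF fin_cls[OF x(2)] im inj] .
  then show ?thesis using inj by (simp add: bij_betw_def)
qed

lemma class_good:
  assumes g: "good F C" and Q: "Q \<subseteq> V - F" and C': "symc C'" "agree F C C'"
    and inv: "inv1 (F \<union> Q) C'" "inv2 (F \<union> Q) C'" and s: "\<And>x. x \<in> Q \<Longrightarrow> sat C' x"
    and fx: "\<And>\<phi> C2. aut \<phi> \<Longrightarrow> symc C2 \<Longrightarrow> agree (F \<union> Q) C' C2 \<Longrightarrow> agree F C C2 \<Longrightarrow> pres C2 \<phi> \<Longrightarrow> \<forall>u\<in>F. \<phi> u = u
       \<Longrightarrow> \<forall>x\<in>Q. \<phi> x = x"
  shows "good (F \<union> Q) C'"
proof -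
  note G = g[unfolded good_def]
  have "fixing (F \<union> Q) C'"
    unfolding fixing_def
  proof (intro allI impI)
    fix \<phi> C2 assume h: "aut \<phi> \<and> symc C2 \<and> agree (F \<union> Q) C' C2 \<and> pres C2 \<phi> \<and> (\<forall>v\<in>F0. \<phi> v = v)"
    have ag2: "agree F C C2" using h C'(2) unfolding agree_def by auto
    have 1: "\<forall>v\<in>F. \<phi> v = v" using G h ag2 unfolding fixing_def by blast
    then have "\<forall>x\<in>Q. \<phi> x = x" using fx[of \<phi> C2] h ag2 by blast
    then show "\<forall>v\<in>F \<union> Q. \<phi> v = v" using 1 by blast
  qed
  moreover have "\<forall>v\<in>F \<union> Q - F0. sat C' v"
    using G s agree_sat[OF C'(2)] by blast
  ultimately show ?thesis unfolding good_def using G Q C'(1) inv by blast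
qed

lemma quota_sat:
  assumes "x \<in> V - F" "F0 \<subseteq> F" "Q \<subseteq> V - F" "1 \<le> card {w\<in>N x - F - Q. C x w}" "card {w\<in>N x - F - Q. C x w} < card (N x - F - Q)"
  shows "sat C x"
proof -
  have "{w\<in>N x - F - Q. C x w} \<noteq> {}" "{w\<in>N x - F - Q. C x w} \<noteq> N x - F - Q" using assms(4,5) by (metis card.empty not_one_le_zero, metis less_irrefl)
  then obtain a b where "a \<in> N x - F - Q" "C x a" "b \<in> N x - F - Q" "\<not> C x b" by blast
  then show ?thesis using F1_sub assms(2) unfolding sat_def by blast
qed

text \<open>As \<phi> maps \<open>F\<close> and \<open>Q\<close> to themselves, it preserves the
  number of red edges from a member of \<open>Q\<close> to the outside, which is the label
  \<open>q\<close>.\<close>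

lemma rigid_fixes:
  assumes rig: "rigid_labels Q A R q" and \<phi>: "aut \<phi>" "pres C2 \<phi>" "bij_betw \<phi> Q Q" "\<forall>u\<in>F. \<phi> u = u"
    and Q: "Q \<subseteq> V - F" and C': "\<And>x y. x \<in> Q \<Longrightarrow> y \<in> Q \<Longrightarrow> C' x y = R x y"
    "\<And>x. x \<in> Q \<Longrightarrow> card {w\<in>N x - F - Q. C' x w} = q x" and ag: "agree (F \<union> Q) C' C2" and FV: "F \<subseteq> V"
  shows "\<forall>x\<in>Q. \<phi> x = x"
proof -
  have \<phi>Q: "\<phi> ` Q = Q" using \<phi>(3) by (simp add: bij_betw_def)
  have \<phi>in: "\<phi> x \<in> Q \<longleftrightarrow> x \<in> Q" if "x \<in> V" for x
    using \<phi>Q aut_inj[OF \<phi>(1) that] Q by (metis DiffD1 image_iff subsetD)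
  have \<phi>F: "\<phi> x \<in> F \<longleftrightarrow> x \<in> F" if "x \<in> V" for x
    using \<phi>(4) aut_inj[OF \<phi>(1) that, of "\<phi> x"] FV by (metis subsetD)
  have q: "q (\<phi> x) = q x" if x: "x \<in> Q" for x
  proof -
    have xV: "x \<in> V" "\<phi> x \<in> Q" using x Q \<phi>in by auto
    have "{w\<in>N (\<phi> x) - F - Q. C' (\<phi> x) w} = \<phi> ` {w\<in>N x - F - Q. C' x w}"
    proof
      show "\<phi> ` {w\<in>N x - F - Q. C' x w} \<subseteq> {w\<in>N (\<phi> x) - F - Q. C' (\<phi> x) w}"
      proof
        fix y assume "y \<in> \<phi> ` {w\<in>N x - F - Q. C' x w}"
        then obtain w where w: "y = \<phi> w" "w \<in> N x - F - Q" "C' x w" by blast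
        have wV: "w \<in> V" using w N_V by blast
        have y: "y \<in> N (\<phi> x) - F - Q" using w aut_N[OF \<phi>(1) xV(1)] \<phi>in[OF wV] \<phi>F[OF wV] by blast
        have "C2 (\<phi> x) (\<phi> w) = C2 x w" using presD[OF \<phi>(2)] w ND by blast
        moreover have "C2 x w = C' x w" using agreeD[OF ag] x w ND by blast
        moreover have "C2 (\<phi> x) y = C' (\<phi> x) y" using agreeD[OF ag] xV y ND by blast
        ultimately show "y \<in> {w\<in>N (\<phi> x) - F - Q. C' (\<phi> x) w}" using y w by blast
      qed
      show "{w\<in>N (\<phi> x) - F - Q. C' (\<phi> x) w} \<subseteq> \<phi> ` {w\<in>N x - F - Q. C' x w}"
      proof
        fix y assume y: "y \<in> {w\<in>N (\<phi> x) - F - Q. C' (\<phi> x) w}"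
        then obtain w where w: "y = \<phi> w" "w \<in> N x" using aut_inv_cases[OF \<phi>(1) xV(1), of y] by blast
        have wV: "w \<in> V" using w N_V by blast
        have w2: "w \<in> N x - F - Q" using w y \<phi>in[OF wV] \<phi>F[OF wV] by blast
        have "C2 (\<phi> x) (\<phi> w) = C2 x w" using presD[OF \<phi>(2)] w ND by blast
        moreover have "C2 x w = C' x w" using agreeD[OF ag] x w ND by blast
        moreover have "C2 (\<phi> x) y = C' (\<phi> x) y" using agreeD[OF ag] xV y ND by blast
        ultimately show "y \<in> \<phi> ` {w\<in>N x - F - Q. C' x w}" using y w w2 by blast
      qed
    qed
    then have "card {w\<in>N (\<phi> x) - F - Q. C' (\<phi> x) w} = card (\<phi> ` {w\<in>N x - F - Q. C' x w})" by (rule arg_cong)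
    also have "\<dots> = card {w\<in>N x - F - Q. C' x w}"
      by (rule card_image) (use aut_inj[OF \<phi>(1)] N_V(1) in \<open>unfold inj_on_def, blast\<close>)
    finally show ?thesis using C'(2)[OF x] C'(2)[OF xV(2)] by simp
  qed
  have R: "A (\<phi> x) (\<phi> y) = A x y \<and> (A x y \<longrightarrow> R (\<phi> x) (\<phi> y) = R x y)" if xy: "x \<in> Q" "y \<in> Q" for x y
  proof -
    have V: "x \<in> V" "y \<in> V" "\<phi> x \<in> Q" "\<phi> y \<in> Q" using xy Q \<phi>in by auto
    have "R (\<phi> x) (\<phi> y) = R x y" if a: "A x y"
    proof -
      have a': "A (\<phi> x) (\<phi> y)" using a aut_A[OF \<phi>(1) V(1,2)] by simp
      have "C2 (\<phi> x) (\<phi> y) = C2 x y" by (rule presD[OF \<phi>(2) a])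
      then show ?thesis using agreeD[OF ag _ a] agreeD[OF ag _ a'] C'(1) xy V by auto
    qed
    then show ?thesis using aut_A[OF \<phi>(1) V(1,2)] by auto
  qed
  show ?thesis using rig \<phi>(3) R q unfolding rigid_labels_def by blast
qed

end

context class_step
begin

text \<open>If the outside neighbours of \<open>x\<close> meet two classes, this is
  \<open>hall_arith\<close>. If they form a single class, the second factors agree and
  \<open>dem v \<le> card (N v \<inter> Q)\<close> suffices.\<close>

lemma hall_full:
  assumes inv: "inv1 F C" and Qatt: "\<And>x. x \<in> Q \<Longrightarrow> N x \<inter> F \<noteq> {}"
    and e_le: "\<And>v x. v \<in> V - F - Q \<Longrightarrow> x \<in> Q \<Longrightarrow> card (fwd x) \<le> \<delta> F v"
    and v: "v \<in> V - F - Q" "0 < dem v" "N v \<inter> Q \<noteq> {}" and x: "x \<in> Q" "x \<in> N v"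
  shows "dem v * (card (fwd x) - card (dcls ` fwd x)) \<le> card (N v \<inter> Q) * (card (dcls v) - 1)"
proof -
  let ?M = "\<delta> F v - 1" and ?i = "card (N v \<inter> Q)" and ?k = "card (dcls v)"
  have vx: "v \<in> fwd x" using touched v x by blast
  have k2: "2 \<le> ?k" using v(2) unfolding dem_def by simp
  have "?k \<le> ?M"
  proof (rule new_class_bound[OF inv _ _ fin_dcls[OF v(1,3)] _ _ Qatt[OF x(1)] k2])
    show "dcls v \<subseteq> cls F C v" by (auto simp: dcls_def)
    show "dcls v \<subseteq> N x" using dcls_fwd[OF vx x(1)] by (auto simp: fwd_def)
  qed (use v x Q in auto)
  moreover have "?i \<le> ?M" using N_Q_le[of v] \<delta>_n[OF v(1)] by linarith
  moreover have "card (fwd x) \<le> ?M + 1" using e_le[OF v(1) x(1)] by linarith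
  ultimately have ar: "dem v * (card (fwd x) - 2) \<le> ?i * (?k - 1)" "1 \<le> ?i \<Longrightarrow> dem v \<le> ?i"
    unfolding dem_def using hall_arith[of ?k ?M ?i "card (fwd x)"] by auto
  have i1: "1 \<le> ?i" using v(3) Q by (simp add: Suc_le_eq card_gt_0_iff)
  have fx: "finite (fwd x)" using fin_fwd x by auto
  show ?thesis
  proof (cases "2 \<le> card (dcls ` fwd x)")
    case True
    then have "dem v * (card (fwd x) - card (dcls ` fwd x)) \<le> dem v * (card (fwd x) - 2)" by (intro mult_le_mono2) auto
    then show ?thesis using ar(1) by linarith
  next
    case False
    have "dcls v \<in> dcls ` fwd x" using vx by blast
    moreover have "finite (dcls ` fwd x)" using fx by blast
    ultimately have "card (dcls ` fwd x) \<noteq> 0" by auto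
    then have c1: "card (dcls ` fwd x) = 1" using False by linarith
    then obtain D where "dcls ` fwd x = {D}" by (auto simp: card_1_singleton_iff)
    then have "dcls w = dcls v" if "w \<in> fwd x" for w using that vx by (metis image_eqI singletonD)
    then have "fwd x \<subseteq> dcls v" using dcls_refl fwdD by blast
    then have "fwd x = dcls v" using dcls_fwd[OF vx x(1)] by blast
    then show ?thesis using c1 ar(2)[OF i1] mult_le_mono1 by simp
  qed
qed

end

context extension
begin

text \<open>The hard case is a clique of \<delta> - 1 vertices. Each member has just two outside
  edges, of different colours if it is a server, so the numbers of red edges separate nothing and
  the middle vertices of a threshold graph can be exchanged. Then either one member can give up
  being a server, or the small classes outside tell the members apart.\<close>

lemma multi_step:
  assumes g: "good F C" and x0: "x0 \<in> V - F" "N x0 \<inter> F \<noteq> {}" and two: "2 \<le> card (cls F C x0)"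
    and min: "\<And>v. v \<in> V - F \<Longrightarrow> N v \<inter> F \<noteq> {} \<Longrightarrow> \<delta> F x0 \<le> \<delta> F v"
  shows "\<exists>C'. agree F C C' \<and> good (F \<union> cls F C x0) C'"
proof -
  note G = g[unfolded good_def]
  have F0F: "F0 \<subseteq> F" and FV: "F \<subseteq> V" and symC: "symc C" and inv: "inv1 F C" using G by auto
  define Q where "Q = cls F C x0"
  define n where "n = card Q"
  define \<delta>0 where "\<delta>0 = \<delta> F x0"
  define e where "e = (\<lambda>x. card (N x - F - Q))"
  have finQ: "finite Q" unfolding Q_def by (rule fin_cls[OF x0(2)])
  have QVF: "Q \<subseteq> V - F" unfolding Q_def by (rule cls_sub)
  have Q\<delta>: "\<delta> F x = \<delta>0" if "x \<in> Q" for x using cls_\<delta> that x0 unfolding Q_def \<delta>0_def by blast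
  have Qatt: "N x \<inter> F \<noteq> {}" if "x \<in> Q" for x using cls_N[of x F C x0] that x0(2) unfolding Q_def by simp
  have n2: "2 \<le> n" using two unfolding n_def Q_def .
  have "n \<le> max 1 (\<delta>0 - 1)" using inv x0 unfolding inv1_def n_def Q_def \<delta>0_def by blast
  then have n1: "n + 1 \<le> \<delta>0" using n2 by linarith
  have d0: "\<delta>0 < d" using \<delta>_attached[of x0 F] x0 unfolding \<delta>0_def by blast
  \<comment> \<open>Unattached vertices have \<delta> = \<open>d\<close>, so the minimality among
    attached vertices extends to all.\<close>
  have W\<delta>: "\<delta>0 \<le> \<delta> F v" if "v \<in> V - F - Q" for v
  proof (cases "N v \<inter> F = {}")
    case True
    then have "\<delta> F v = d" using \<delta>_add[of v F] that by auto
    then show ?thesis using d0 by simp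
  next
    case False then show ?thesis using min that unfolding \<delta>0_def by blast
  qed
  have he: "card {y\<in>Q. A x y} + e x = \<delta>0" if x: "x \<in> Q" for x
  proof -
    have f: "finite (N x)" using fin_N x QVF by blast
    have "N x - F = {y\<in>Q. A x y} \<union> (N x - F - Q)" using QVF by (auto simp: N_def)
    then have "card (N x - F) = card ({y\<in>Q. A x y} \<union> (N x - F - Q))" by (rule arg_cong)
    also have "\<dots> = card {y\<in>Q. A x y} + card (N x - F - Q)"
      by (rule card_Un_disjoint) (use f finQ in auto)
    finally have "card (N x - F) = card {y\<in>Q. A x y} + card (N x - F - Q)" .
    then show ?thesis using Q\<delta>[OF x] unfolding e_def \<delta>_def by simp
  qed
  have CS: "class_step V A d F0 F1 F Q C R" if "\<And>x y. R x y = R y x" for R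
  proof (unfold_locales)
    fix v assume v: "v \<in> V - F - Q"
    show "card Q + 1 \<le> \<delta> F v" using W\<delta>[OF v] n1 unfolding n_def by linarith
    assume a: "N v \<inter> F \<noteq> {}"
    have "card (cls F C v - Q) \<le> card (cls F C v)" using fin_cls[OF a] by (intro card_mono) auto
    also have "\<dots> \<le> max 1 (\<delta> F v - 1)" using inv v a unfolding inv1_def by blast
    finally show "card (cls F C v - Q) \<le> max 1 (\<delta> F v - 1)" .
  qed (use F0F FV symC finQ QVF n2 n1 d0 that in \<open>auto simp: n_def\<close>)
  have finish: "\<exists>C'. agree F C C' \<and> good (F \<union> Q) C'"
    if Rs: "\<And>x y. R x y = R y x" and q_le: "\<And>x. x \<in> Q \<Longrightarrow> q x \<le> e x"
      and S: "{x\<in>Q. 1 \<le> q x \<and> q x < e x} \<noteq> {}"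
      and hall: "\<And>v. v \<in> V - F - Q \<Longrightarrow> 0 < class_step.dem V A F Q C v \<Longrightarrow> N v \<inter> Q \<noteq> {} \<Longrightarrow>
         N v \<inter> {x\<in>Q. 1 \<le> q x \<and> q x < e x} \<noteq> {} \<and> (\<forall>x\<in>N v \<inter> {x\<in>Q. 1 \<le> q x \<and> q x < e x}.
           class_step.dem V A F Q C v * (e x - card (class_step.dcls V A F Q C ` (N x - F - Q)))
           \<le> card (N v \<inter> {x\<in>Q. 1 \<le> q x \<and> q x < e x}) * (card (class_step.dcls V A F Q C v) - 1))"
      and nons: "\<And>C' x. symc C' \<Longrightarrow> (\<forall>x\<in>Q. \<forall>y\<in>Q. C' x y = R x y) \<Longrightarrow> (\<forall>x\<in>Q. card {w\<in>N x - F - Q. C' x w} = q x) \<Longrightarrow>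
         x \<in> Q \<Longrightarrow> \<not> (1 \<le> q x \<and> q x < e x) \<Longrightarrow> sat C' x"
      and fx: "\<And>C' \<phi> C2. (\<forall>x\<in>Q. \<forall>y\<in>Q. C' x y = R x y) \<Longrightarrow> (\<forall>x\<in>Q. card {w\<in>N x - F - Q. C' x w} = q x) \<Longrightarrow>
         aut \<phi> \<Longrightarrow> symc C2 \<Longrightarrow> agree (F \<union> Q) C' C2 \<Longrightarrow> agree F C C2 \<Longrightarrow> pres C2 \<phi> \<Longrightarrow> \<forall>u\<in>F. \<phi> u = u \<Longrightarrow> bij_betw \<phi> Q Q
       \<Longrightarrow> \<forall>x\<in>Q. \<phi> x = x" for R q
  proof -
    interpret S: class_step V A d F0 F1 F Q C R q by (rule CS[OF Rs])
    have fwd: "S.fwd x = N x - F - Q" for x unfolding S.fwd_def ..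
    have serv: "S.servers = {x\<in>Q. 1 \<le> q x \<and> q x < e x}" unfolding S.servers_def fwd e_def ..
    have "\<exists>C'. symc C' \<and> agree F C C' \<and> (\<forall>x\<in>Q. \<forall>y\<in>Q. C' x y = R x y) \<and>
       (\<forall>x\<in>Q. card {w\<in>S.fwd x. C' x w} = q x) \<and> inv1 (F \<union> Q) C' \<and> inv2 (F \<union> Q) C'"
    proof (rule S.class_step)
      show "q x \<le> card (S.fwd x)" if "x \<in> Q" for x using q_le[OF that] unfolding fwd e_def .
      show "card (S.fwd x) \<le> \<delta> F v" if "v \<in> V - F - Q" "x \<in> Q" for v x
        using he[OF that(2)] W\<delta>[OF that(1)] unfolding fwd e_def by linarith
      show "S.servers \<noteq> {}" using S unfolding serv .
      show "N v \<inter> S.servers \<noteq> {} \<and> (\<forall>x\<in>N v \<inter> S.servers. S.dem v * (card (S.fwd x) - card (S.dcls ` S.fwd x))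
          \<le> card (N v \<inter> S.servers) * (card (S.dcls v) - 1))"
        if "v \<in> V - F - Q" "0 < S.dem v" "N v \<inter> Q \<noteq> {}" for v
        unfolding serv fwd e_def[symmetric] using hall[OF that] unfolding e_def .
    qed
    then obtain C' where C': "symc C'" "agree F C C'" "\<forall>x\<in>Q. \<forall>y\<in>Q. C' x y = R x y"
       "\<forall>x\<in>Q. card {w\<in>N x - F - Q. C' x w} = q x" "inv1 (F \<union> Q) C'" "inv2 (F \<union> Q) C'" unfolding fwd by blast
    have "good (F \<union> Q) C'"
    proof (rule class_good[OF g QVF C'(1,2,5,6)])
      fix x assume x: "x \<in> Q"
      show "sat C' x"
      proof (cases "1 \<le> q x \<and> q x < e x")
        case True
        show ?thesis by (rule quota_sat[of x F Q]) (use x QVF F0F C'(4) True in \<open>auto simp: e_def\<close>)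
      next
        case False then show ?thesis using nons[OF C'(1,3,4) x] by blast
      qed
    next
      fix \<phi> C2 assume h: "aut \<phi>" "symc C2" "agree (F \<union> Q) C' C2" "agree F C C2" "pres C2 \<phi>" "\<forall>u\<in>F. \<phi> u = u"
      have "bij_betw \<phi> Q Q" unfolding Q_def by (rule bij_cls[OF h(1,5,4,6) FV x0])
      then show "\<forall>x\<in>Q. \<phi> x = x" using fx[OF C'(3,4) h] by blast
    qed
    then show ?thesis using C'(2) by blast
  qed
  have all_servers: "\<exists>C'. agree F C C' \<and> good (F \<union> Q) C'"
    if Rs: "\<And>x y. R x y = R y x" and q: "\<And>x. x \<in> Q \<Longrightarrow> 1 \<le> q x \<and> q x < e x"
      and fx: "\<And>C' \<phi> C2. (\<forall>x\<in>Q. \<forall>y\<in>Q. C' x y = R x y) \<Longrightarrow> (\<forall>x\<in>Q. card {w\<in>N x - F - Q. C' x w} = q x) \<Longrightarrow>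
         aut \<phi> \<Longrightarrow> symc C2 \<Longrightarrow> agree (F \<union> Q) C' C2 \<Longrightarrow> agree F C C2 \<Longrightarrow> pres C2 \<phi> \<Longrightarrow> \<forall>u\<in>F. \<phi> u = u \<Longrightarrow> bij_betw \<phi> Q Q
       \<Longrightarrow> \<forall>x\<in>Q. \<phi> x = x" for R q
  proof (rule finish[OF Rs _ _ _ _ fx])
    interpret S: class_step V A d F0 F1 F Q C R q by (rule CS[OF Rs])
    have SQ: "{x\<in>Q. 1 \<le> q x \<and> q x < e x} = Q" using q by blast
    show "{x\<in>Q. 1 \<le> q x \<and> q x < e x} \<noteq> {}" unfolding SQ using n2 unfolding n_def by auto
    fix v assume v: "v \<in> V - F - Q" "0 < S.dem v" "N v \<inter> Q \<noteq> {}"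
    have "S.dem v * (e x - card (S.dcls ` (N x - F - Q))) \<le> card (N v \<inter> Q) * (card (S.dcls v) - 1)" if x: "x \<in> N v \<inter> Q" for x
    proof -
      have "S.dem v * (card (S.fwd x) - card (S.dcls ` S.fwd x)) \<le> card (N v \<inter> Q) * (card (S.dcls v) - 1)"
      proof (rule S.hall_full[OF inv Qatt _ v])
        show "card (S.fwd x) \<le> \<delta> F v" if "v \<in> V - F - Q" "x \<in> Q" for v x
          using he[OF that(2)] W\<delta>[OF that(1)] unfolding S.fwd_def e_def by linarith
      qed (use x in auto)
      then show ?thesis unfolding S.fwd_def e_def .
    qed
    then show "N v \<inter> {x\<in>Q. 1 \<le> q x \<and> q x < e x} \<noteq> {} \<and> (\<forall>x\<in>N v \<inter> {x\<in>Q. 1 \<le> q x \<and> q x < e x}.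
           S.dem v * (e x - card (S.dcls ` (N x - F - Q)))
           \<le> card (N v \<inter> {x\<in>Q. 1 \<le> q x \<and> q x < e x}) * (card (S.dcls v) - 1))"
      unfolding SQ using v(3) by blast
  next
    show "q x \<le> e x" if "x \<in> Q" for x using q[OF that] by linarith
    show "sat C' x" if "x \<in> Q" "\<not> (1 \<le> q x \<and> q x < e x)" for C' x using q[OF that(1)] that(2) by blast
  qed
  have rigid_fx: "\<forall>x\<in>Q. \<phi> x = x" if "rigid_labels Q A R q" "\<forall>x\<in>Q. \<forall>y\<in>Q. C' x y = R x y" "\<forall>x\<in>Q. card {w\<in>N x - F - Q. C' x w} = q x"
         "aut \<phi>" "agree (F \<union> Q) C' C2" "pres C2 \<phi>" "\<forall>u\<in>F. \<phi> u = u" "bij_betw \<phi> Q Q" for R q C' \<phi> C2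
    by (rule rigid_fixes[OF that(1,4,6,8,7) QVF _ _ that(5) FV]) (use that in blast)+
  show ?thesis
  proof (cases "\<forall>a\<in>Q. \<forall>b\<in>Q. a \<noteq> b \<longrightarrow> A a b")
    case False
    have "\<exists>R q. (\<forall>x y. R x y = R y x) \<and> (\<forall>x\<in>Q. 1 \<le> q x \<and> q x < e x) \<and> rigid_labels Q A R q"
    proof (rule threshold_labels[OF finQ A_sym A_irr he])
      show "card Q + 1 \<le> \<delta>0" "2 \<le> card Q" using n1 n2 by (auto simp: n_def)
      show "(\<forall>x\<in>Q. \<forall>y\<in>Q. \<not> A x y) \<or> (\<exists>x\<in>Q. \<exists>y\<in>Q. \<exists>z\<in>Q. x \<noteq> y \<and> z \<noteq> x \<and> z \<noteq> y \<and> A x z \<noteq> A y z)"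
        using nontwin_triple[where L = A and Q = Q, OF A_sym] False A_irr by metis
    qed
    then obtain R q where R: "\<forall>x y. R x y = R y x" "\<forall>x\<in>Q. 1 \<le> q x \<and> q x < e x" "rigid_labels Q A R q" by blast
    show ?thesis unfolding Q_def[symmetric]
      by (rule all_servers[of R q]) (use R rigid_fx[OF R(3)] in blast)+
  next
    case compl: True
    then have hQ: "card {y\<in>Q. A x y} = n - 1" if "x \<in> Q" for x
    proof -
      have "{y\<in>Q. A x y} = Q - {x}" using compl that A_irr by auto
      then show ?thesis using that finQ by (simp add: n_def)
    qed
    show ?thesis
    proof (cases "n + 2 \<le> \<delta>0")
      case True
      have "\<exists>R q. (\<forall>x y. R x y = R y x) \<and> (\<forall>x\<in>Q. 1 \<le> q x \<and> q x < e x) \<and> rigid_labels Q A R q"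
        by (rule threshold_labels[OF finQ A_sym A_irr he]) (use True n2 in \<open>auto simp: n_def\<close>)
      then obtain R q where R: "\<forall>x y. R x y = R y x" "\<forall>x\<in>Q. 1 \<le> q x \<and> q x < e x" "rigid_labels Q A R q" by blast
      show ?thesis unfolding Q_def[symmetric]
        by (rule all_servers[of R q]) (use R rigid_fx[OF R(3)] in blast)+
    next
      case False
      then have n\<delta>: "\<delta>0 = n + 1" using n1 by linarith
      have e2: "e x = 2" if "x \<in> Q" for x using he[OF that] hQ[OF that] n\<delta> n2 by linarith
      interpret S0: class_step V A d F0 F1 F Q C "\<lambda>_ _. False" "\<lambda>_. 1" by (rule CS) simp
      \<comment> \<open>With two outside edges at \<open>x\<close>, a class that still has to be
        split consists of precisely the two outside neighbours of \<open>x\<close>.\<close>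
      have small: "card (S0.dcls v) = 2 \<and> S0.dcls v = N x - F - Q" if v: "v \<in> V - F - Q" "0 < S0.dem v" "x \<in> N v" "x \<in> Q" for v x
      proof -
        have vx: "v \<in> S0.fwd x" using S0.touched v by blast
        have sub: "S0.dcls v \<subseteq> S0.fwd x" using S0.dcls_fwd[OF vx v(4)] .
        have fx: "finite (S0.fwd x)" using S0.fin_fwd v by blast
        have "2 \<le> card (S0.dcls v)" using v(2) unfolding S0.dem_def by linarith
        moreover have "card (S0.fwd x) = 2" using e2[OF v(4)] unfolding S0.fwd_def e_def .
        ultimately have c: "card (S0.dcls v) = card (S0.fwd x)" "card (S0.dcls v) = 2" using card_mono[OF fx sub] by auto
        then have "S0.dcls v = S0.fwd x" using card_subset_eq[OF fx sub] by blast
        then show ?thesis using c unfolding S0.fwd_def by blast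
      qed
      \<comment> \<open>A bad \<open>z\<close> is the only vertex that can split some class outside,
        so it has to remain a server.\<close>
      define bad where "bad = (\<lambda>z. \<exists>v\<in>V - F - Q. 0 < S0.dem v \<and> N v \<inter> Q = {z})"
      show ?thesis
      proof (cases "\<exists>z\<in>Q. \<not> bad z")
        case True
        then obtain z where z: "z \<in> Q" "\<not> bad z" by blast
        obtain R where R: "\<forall>x y. R x y = R y x" "\<forall>q. (\<forall>x\<in>Q. q x = q z \<longrightarrow> x = z) \<longrightarrow> rigid_labels Q A R q"
          using threshold_complete[where L = A, OF finQ A_sym A_irr _ z(1)] compl n2 unfolding n_def by blast
        \<comment> \<open>Both outside edges of \<open>z\<close> get the same colour, which singles
          out \<open>z\<close>. It is opposite to the colour of some edge from \<open>z\<close>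
          inside \<open>Q\<close>, so \<open>z\<close> sees both colours nevertheless.\<close>
        define q where "q = (\<lambda>x. if x = z then (if \<exists>y\<in>Q. y \<noteq> z \<and> R z y then 0 else 2) else 1 :: nat)"
        have rig: "rigid_labels Q A R q" using R(2) by (auto simp: q_def)
        have SQ: "{x\<in>Q. 1 \<le> q x \<and> q x < e x} = Q - {z}" using e2 z by (auto simp: q_def)
        have "\<not> Q \<subseteq> {z}" using n2 finQ card_mono[of "{z}" Q] unfolding n_def by auto
        then obtain y0 where y0: "y0 \<in> Q" "y0 \<noteq> z" by blast
        show ?thesis unfolding Q_def[symmetric]
        proof (rule finish[of R q])
          show "R x y = R y x" for x y using R(1) by blast
          show "q x \<le> e x" if "x \<in> Q" for x using e2[OF that] by (auto simp: q_def)
          show "{x\<in>Q. 1 \<le> q x \<and> q x < e x} \<noteq> {}" unfolding SQ using y0 by blast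
        next
          fix v assume v: "v \<in> V - F - Q" "0 < S0.dem v" "N v \<inter> Q \<noteq> {}"
          have ne: "N v \<inter> (Q - {z}) \<noteq> {}" using v z(2) unfolding bad_def by blast
          have "S0.dem v * (e x - card (S0.dcls ` (N x - F - Q))) \<le> card (N v \<inter> (Q - {z})) * (card (S0.dcls v) - 1)"
            if x: "x \<in> N v \<inter> (Q - {z})" for x
          proof -
            have sm: "card (S0.dcls v) = 2" using small[OF v(1,2), of x] x by blast
            then have "S0.dem v \<le> 1" unfolding S0.dem_def by linarith
            moreover have "1 \<le> card (S0.dcls ` (N x - F - Q))"
            proof -
              have "v \<in> N x - F - Q" using v x N_sym by blast
              moreover have "finite (N x - F - Q)" using fin_N x QVF by blast
              ultimately show ?thesis by (simp add: Suc_le_eq card_gt_0_iff) blast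
            qed
            then have "e x - card (S0.dcls ` (N x - F - Q)) \<le> 1" using e2[of x] x by auto
            ultimately have "S0.dem v * (e x - card (S0.dcls ` (N x - F - Q))) \<le> 1 * 1" by (rule mult_le_mono)
            moreover have "1 \<le> card (N v \<inter> (Q - {z}))" using ne finQ by (simp add: Suc_le_eq card_gt_0_iff)
            ultimately show ?thesis using sm by simp
          qed
          then show "N v \<inter> {x\<in>Q. 1 \<le> q x \<and> q x < e x} \<noteq> {} \<and> (\<forall>x\<in>N v \<inter> {x\<in>Q. 1 \<le> q x \<and> q x < e x}.
             S0.dem v * (e x - card (S0.dcls ` (N x - F - Q)))
             \<le> card (N v \<inter> {x\<in>Q. 1 \<le> q x \<and> q x < e x}) * (card (S0.dcls v) - 1))"
            unfolding SQ using ne by blast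
        next
          fix C' x assume h: "symc C'" "\<forall>x\<in>Q. \<forall>y\<in>Q. C' x y = R x y" "\<forall>x\<in>Q. card {w\<in>N x - F - Q. C' x w} = q x"
            "x \<in> Q" "\<not> (1 \<le> q x \<and> q x < e x)"
          have xz: "x = z" using h(4,5) SQ by blast
          have c2: "card (N z - F - Q) = 2" using e2[OF z(1)] by (simp add: e_def)
          have FQ: "w \<notin> F1" if "w \<in> Q" for w using that QVF F0F F1_sub by blast
          have inN: "y \<in> N z" if "y \<in> Q" "y \<noteq> z" for y
          proof (rule NI)
            show "A z y" using compl that z by auto
          qed
          have F1F: "F1 \<subseteq> F" using F1_sub F0F by blast
          show "sat C' x"
          proof (cases "\<exists>y\<in>Q. y \<noteq> z \<and> R z y")
            case True
            then obtain y where y: "y \<in> Q" "y \<noteq> z" "R z y" by blast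
            have "card {w\<in>N z - F - Q. C' z w} = 0" using h(3) z True by (auto simp: q_def)
            then have "{w\<in>N z - F - Q. C' z w} \<noteq> N z - F - Q" using c2 by (metis zero_neq_numeral)
            then obtain w where "w \<in> N z - F - Q" "\<not> C' z w" by blast
            moreover have "C' z y" using h(2) z y by blast
            ultimately show ?thesis using inN[OF y(1,2)] FQ[OF y(1)] F1F unfolding xz sat_def by blast
          next
            case False
            have "card {w\<in>N z - F - Q. C' z w} = 2" using h(3) z False by (auto simp: q_def)
            then have "{w\<in>N z - F - Q. C' z w} \<noteq> {}" by (metis card.empty zero_neq_numeral)
            then obtain w where "w \<in> N z - F - Q" "C' z w" by blast
            moreover have "\<not> C' z y0" using h(2) z y0 False by blast
            ultimately show ?thesis using inN[OF y0] FQ[OF y0(1)] F1F unfolding xz sat_def by blast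
          qed
        next
          show "\<forall>x\<in>Q. \<phi> x = x" if "\<forall>x\<in>Q. \<forall>y\<in>Q. C' x y = R x y" "\<forall>x\<in>Q. card {w\<in>N x - F - Q. C' x w} = q x"
            "aut \<phi>" "symc C2" "agree (F \<union> Q) C' C2" "agree F C C2" "pres C2 \<phi>" "\<forall>u\<in>F. \<phi> u = u" "bij_betw \<phi> Q Q" for C' \<phi> C2
            by (rule rigid_fx[OF rig that(1,2,3,5,7,8,9)])
        qed
      next
        case False
        have \<delta>3: "\<delta> F v = 3 \<and> n = 2" if v: "v \<in> V - F - Q" "0 < S0.dem v" "N v \<inter> Q = {x}" "x \<in> Q" for v x
        proof -
          have "card (S0.dcls v) = 2" using small[OF v(1,2)] v by blast
          then have "\<delta> F v \<le> 3" using v(2) v(3) unfolding S0.dem_def by auto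
          then show ?thesis using W\<delta>[OF v(1)] n\<delta> n2 by linarith
        qed
        show ?thesis unfolding Q_def[symmetric]
        proof (rule all_servers[of "\<lambda>_ _. False" "\<lambda>_. 1"])
          fix C' \<phi> C2 assume h: "aut \<phi>" "agree F C C2" "pres C2 \<phi>" "\<forall>u\<in>F. \<phi> u = u" "bij_betw \<phi> Q Q"
          show "\<forall>x\<in>Q. \<phi> x = x"
          proof (rule ccontr)
            \<comment> \<open>If \<phi> moved \<open>x\<close>, it would carry the pair beyond
              \<open>x\<close> into the class of the pair beyond \<open>\<phi> x\<close>. Together
              these are four vertices in one class for \<open>F\<close>, where \<delta> = 3 allows
              only two.\<close>
            assume "\<not> ?thesis"
            then obtain x where x: "x \<in> Q" "\<phi> x \<noteq> x" by blast
            let ?y = "\<phi> x"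
            have y: "?y \<in> Q" using h(5) x by (auto simp: bij_betw_def)
            obtain v where v: "v \<in> V - F - Q" "0 < S0.dem v" "N v \<inter> Q = {x}" using False x unfolding bad_def by blast
            obtain w where w: "w \<in> V - F - Q" "0 < S0.dem w" "N w \<inter> Q = {?y}" using False y unfolding bad_def by blast
            have sv: "card (S0.dcls v) = 2" "S0.dcls v = N x - F - Q" using small[OF v(1,2), of x] v x by auto
            have sw: "card (S0.dcls w) = 2" "S0.dcls w = N ?y - F - Q" using small[OF w(1,2), of ?y] w y by auto
            have vN: "v \<in> N x" using v(3) N_sym by blast
            have pv: "\<phi> v \<in> cls F C v" using aut_cls[OF h(1,3,2,4) FV, of v] v(1) by blast
            have "\<phi> v \<in> N ?y" using aut_N[OF h(1), of x] x QVF vN by blast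
            moreover have "\<phi> v \<notin> Q"
            proof
              assume "\<phi> v \<in> Q"
              then have "\<phi> v \<in> \<phi> ` Q" using h(5) by (simp add: bij_betw_def)
              then obtain u where u: "\<phi> u = \<phi> v" "u \<in> Q" by (metis imageE)
              then have "u = v" using aut_inj[OF h(1), of u v] QVF v(1) by blast
              then show False using u v(1) by blast
            qed
            ultimately have "\<phi> v \<in> S0.dcls w" using pv cls_sub unfolding sw(2) by blast
            then have "cls F C (\<phi> v) = cls F C w" unfolding S0.dcls_def using cls_eq by blast
            then have cl: "cls F C w = cls F C v" using cls_eq[OF pv] by blast
            have "S0.dcls v \<inter> S0.dcls w = {}"
            proof (rule ccontr)
              assume "S0.dcls v \<inter> S0.dcls w \<noteq> {}"
              then obtain u where "u \<in> S0.dcls v" "u \<in> S0.dcls w" by blast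
              then show False using S0.dcls_N[of u] v(3) w(3) x(2) by (metis singletonD singletonI)
            qed
            moreover have "finite (S0.dcls v)" "finite (S0.dcls w)" using sv(1) sw(1) by (metis card.infinite zero_neq_numeral)+
            ultimately have "card (S0.dcls v \<union> S0.dcls w) = 4" using sv(1) sw(1) by (simp add: card_Un_disjoint)
            moreover have sub: "S0.dcls v \<union> S0.dcls w \<subseteq> cls F C v" using cl unfolding S0.dcls_def by blast
            have \<delta>v: "\<delta> F v = 3" "n = 2" using \<delta>3[OF v(1,2,3) x(1)] by auto
            then have "\<delta> F v < d" using d0 n\<delta> by linarith
            then have a: "N v \<inter> F \<noteq> {}" using \<delta>_attached[of v F] v(1) by blast
            have "card (S0.dcls v \<union> S0.dcls w) \<le> card (cls F C v)" using sub fin_cls[OF a] by (intro card_mono) auto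
            moreover have "card (cls F C v) \<le> 2" using inv v(1) a \<delta>v(1) unfolding inv1_def by fastforce
            ultimately show False by linarith
          qed
        qed (use e2 in auto)
      qed
    qed
  qed
qed

subsection \<open>Existence of extensions\<close>

text \<open>Partial colourings ordered by extension become sets ordered by inclusion, to which
  \<open>subset_Zorn\<close> applies. As every vertex has a neighbour, \<open>F\<close> can be
  recovered.\<close>

definition enc :: "'a set \<Rightarrow> ('a \<Rightarrow> 'a \<Rightarrow> bool) \<Rightarrow> ('a \<times> 'a \<times> bool) set" where
  "enc F C = {(u, v, C u v) | u v. u \<in> F \<and> A u v}"

lemma enc_le:
  assumes "F \<subseteq> V" shows "enc F C \<subseteq> enc F' C' \<longleftrightarrow> F \<subseteq> F' \<and> agree F C C'"
proof
  assume h: "enc F C \<subseteq> enc F' C'"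
  have m: "u \<in> F' \<and> C' u v = C u v" if "u \<in> F" "A u v" for u v
  proof -
    have "(u, v, C u v) \<in> enc F' C'" using h that unfolding enc_def by blast
    then show ?thesis unfolding enc_def by auto
  qed
  have "u \<in> F'" if "u \<in> F" for u
  proof -
    have "card (N u) = d" using card_N assms that by blast
    then have "N u \<noteq> {}" using d3 by auto
    then show ?thesis using m that ND by blast
  qed
  then show "F \<subseteq> F' \<and> agree F C C'" using m unfolding agree_def by blast
next
  assume h: "F \<subseteq> F' \<and> agree F C C'"
  show "enc F C \<subseteq> enc F' C'"
  proof
    fix p assume "p \<in> enc F C"
    then obtain u v where p: "p = (u, v, C u v)" "u \<in> F" "A u v" unfolding enc_def by blast
    then have "C' u v = C u v" "u \<in> F'" using h unfolding agree_def by auto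
    then show "p \<in> enc F' C'" using p unfolding enc_def by auto
  qed
qed

text \<open>Each instance of the two invariants involves only finitely many vertices of the union,
  and these lie in a single member of the chain.\<close>

lemma good_union:
  assumes P: "\<And>F C. (F, C) \<in> P \<Longrightarrow> good F C" and ne: "P \<noteq> {}"
    and ch: "\<And>F C F' C'. (F, C) \<in> P \<Longrightarrow> (F', C') \<in> P \<Longrightarrow> F \<subseteq> F' \<and> agree F C C' \<or> F' \<subseteq> F \<and> agree F' C' C"
  shows "\<exists>U D. good U D \<and> (\<forall>(F, C)\<in>P. F \<subseteq> U \<and> agree F C D)"
proof -
  define U where "U = \<Union>(fst ` P)"
  define D where "D = (\<lambda>u v. \<exists>(F, C)\<in>P. (u \<in> F \<or> v \<in> F) \<and> C u v)"
  have sy: "symc C" if "(F, C) \<in> P" for F C using P[OF that] unfolding good_def by blast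
  have FU: "F \<subseteq> U" if "(F, C) \<in> P" for F C using that unfolding U_def by force
  have ag: "agree F C D" if FC: "(F, C) \<in> P" for F C
    unfolding agree_def
  proof (intro ballI allI impI)
    fix u v assume u: "u \<in> F" "A u v"
    have "C u v" if d: "D u v"
    proof -
      obtain F' C' where F': "(F', C') \<in> P" "u \<in> F' \<or> v \<in> F'" "C' u v" using d unfolding D_def by blast
      consider "F \<subseteq> F'" "agree F C C'" | "agree F' C' C" using ch[OF FC F'(1)] by blast
      then show ?thesis
      proof cases
        case 1
        then show ?thesis using agreeD[OF 1(2) u] F'(3) by simp
      next
        case 2
        show ?thesis
        proof (cases "u \<in> F'")
          case True then show ?thesis using agreeD[OF 2 True u(2)] F'(3) by simp
        next
          case False
          then have "v \<in> F'" using F'(2) by blast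
          then show ?thesis using agreeD2[OF 2 sy[OF F'(1)] sy[OF FC], of v u] u F'(3) by blast
        qed
      qed
    qed
    moreover have "D u v" if "C u v" using FC u that unfolding D_def by blast
    ultimately show "D u v = C u v" by blast
  qed
  have fin_sub: "\<exists>F C. (F, C) \<in> P \<and> B \<subseteq> F" if "finite B" "B \<subseteq> U" for B
    using that
  proof (induction B rule: finite_induct)
    case empty
    then show ?case using ne by (metis all_not_in_conv empty_subsetI surj_pair)
  next
    case (insert b B)
    then obtain F C where 1: "(F, C) \<in> P" "B \<subseteq> F" by blast
    obtain F' C' where 2: "(F', C') \<in> P" "b \<in> F'" using insert.prems unfolding U_def by auto
    have "F \<subseteq> F' \<or> F' \<subseteq> F" using ch[OF 1(1) 2(1)] by blast
    then show ?case using 1 2 by blast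
  qed
  have symD: "symc D" unfolding symc_def
  proof (intro allI)
    fix u v
    have "D v u" if "D u v" for u v using that sy unfolding D_def symc_def by blast
    then show "D u v = D v u" by blast
  qed
  have UV: "U \<subseteq> V" using P unfolding U_def good_def by fastforce
  have "inv1 U D"
    unfolding inv1_def
  proof (intro ballI impI)
    fix v assume v: "v \<in> V - U" "N v \<inter> U \<noteq> {}"
    have "finite (N v \<inter> U)" using fin_N v by blast
    then obtain F C where FC: "(F, C) \<in> P" "N v \<inter> U \<subseteq> F" using fin_sub[of "N v \<inter> U"] by blast
    have e: "N v \<inter> U = N v \<inter> F" using FC FU by blast
    have "cls U D v \<subseteq> cls F C v"
    proof
      fix w assume w: "w \<in> cls U D v"
      have 1: "N w \<inter> U = N v \<inter> U" "\<And>u. u \<in> N v \<inter> U \<Longrightarrow> D u w = D u v" "w \<in> V - U" using w unfolding cls_def by auto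
      have 2: "N w \<inter> F = N v \<inter> F" using 1(1) e FU[OF FC(1)] by blast
      have "C u w = C u v" if u: "u \<in> N v \<inter> F" for u
      proof -
        have "A u w" "A u v" using u 2 ND A_sym by blast+
        then have "D u w = C u w" "D u v = C u v" using agreeD[OF ag[OF FC(1)]] u by blast+
        then show ?thesis using 1(2) u e by blast
      qed
      then show "w \<in> cls F C v" using 1(3) 2 FU[OF FC(1)] unfolding cls_def by blast
    qed
    moreover have a: "N v \<inter> F \<noteq> {}" using v(2) e by simp
    ultimately have "card (cls U D v) \<le> card (cls F C v)" using fin_cls by (intro card_mono) auto
    also have "\<dots> \<le> max 1 (\<delta> F v - 1)" using P[OF FC(1)] v(1) a FU[OF FC(1)] unfolding good_def inv1_def by blast
    also have "\<delta> F v = \<delta> U v"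
    proof -
      have "N v - F = N v - U" using e by blast
      then show ?thesis by (simp only: \<delta>_def)
    qed
    finally show "card (cls U D v) \<le> max 1 (\<delta> U v - 1)" .
  qed
  moreover have "inv2 U D"
    unfolding inv2_def
  proof (intro allI impI)
    fix K assume K: "tcomp U K"
    note KD = tcompD[OF K]
    have KV: "v \<in> V" if "v \<in> K" for v using KD(1) that by blast
    have "finite ((\<Union>v\<in>K. N v) \<inter> U)" using KD(2) fin_N KV by auto
    then obtain F C where FC: "(F, C) \<in> P" "(\<Union>v\<in>K. N v) \<inter> U \<subseteq> F" using fin_sub[of "(\<Union>v\<in>K. N v) \<inter> U"] by blast
    have e: "N v - F = N v - U" if "v \<in> K" for v using FC that FU[OF FC(1)] by blast
    have s: "(\<Sum>v\<in>K. \<delta> F v) = (\<Sum>v\<in>K. \<delta> U v)" using e by (intro sum.cong) (auto simp: \<delta>_def)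
    have "K \<subseteq> V - F" using KD(1) FU[OF FC(1)] by blast
    moreover have "\<forall>v\<in>K. N v - F \<subseteq> K" using KD(4) e by metis
    ultimately have "tcomp F K" unfolding tcomp_def using KD(2,3,5,6) s by metis
    then have "satK F C K" using P[OF FC(1)] unfolding good_def inv2_def by blast
    then obtain C1 where C1: "symc C1" "\<forall>u\<in>F. \<forall>v\<in>K. A u v \<longrightarrow> C1 u v = C u v" "\<forall>v\<in>K. sat C1 v" unfolding satK_def by blast
    have "C1 u v = D u v" if u: "u \<in> U" "v \<in> K" "A u v" for u v
    proof -
      have "u \<in> F" using u FC(2) NI[OF A_sym[OF u(3)]] by blast
      then show ?thesis using C1(2) u agreeD[OF ag[OF FC(1)]] by blast
    qed
    then show "satK U D K" using C1 unfolding satK_def by blast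
  qed
  moreover have "fixing U D"
    unfolding fixing_def
  proof (intro allI impI ballI)
    fix \<phi> C' v assume h: "aut \<phi> \<and> symc C' \<and> agree U D C' \<and> pres C' \<phi> \<and> (\<forall>v\<in>F0. \<phi> v = v)" and v: "v \<in> U"
    obtain F C where FC: "(F, C) \<in> P" "v \<in> F" using v unfolding U_def by auto
    have "agree F C C'" using h ag[OF FC(1)] FU[OF FC(1)] unfolding agree_def by blast
    then show "\<phi> v = v" using P[OF FC(1)] h FC(2) unfolding good_def fixing_def by blast
  qed
  moreover have "sat D v" if v: "v \<in> U - F0" for v
  proof -
    obtain F C where FC: "(F, C) \<in> P" "v \<in> F" using v unfolding U_def by auto
    then have "sat C v" using P[OF FC(1)] v unfolding good_def by blast
    then show ?thesis using agree_sat[OF ag[OF FC(1)] FC(2)] by blast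
  qed
  moreover have "F0 \<subseteq> U"
  proof -
    obtain F C where FC: "(F, C) \<in> P" using ne by auto
    then show ?thesis using P[OF FC] FU[OF FC] unfolding good_def by blast
  qed
  ultimately have "good U D" using UV symD unfolding good_def by blast
  then show ?thesis using FU ag by blast
qed

theorem extension:
  assumes "symc C0" "inv1 F0 C0" "inv2 F0 C0"
  shows "\<exists>C. symc C \<and> agree F0 C0 C \<and> (\<forall>\<phi>. aut \<phi> \<and> pres C \<phi> \<and> (\<forall>v\<in>F0. \<phi> v = v) \<longrightarrow> (\<forall>v\<in>V. \<phi> v = v))
    \<and> (\<forall>v\<in>V - F0. sat C v)"
proof -
  define \<A> where "\<A> = {enc F C | F C. good F C \<and> agree F0 C0 C}"
  have g0: "good F0 C0" using assms F0_sub unfolding good_def fixing_def by blast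
  have "\<exists>M\<in>\<A>. \<forall>X\<in>\<A>. M \<subseteq> X \<longrightarrow> X = M"
  proof (rule subset_Zorn)
    fix \<C> assume ch: "subset.chain \<A> \<C>"
    show "\<exists>U\<in>\<A>. \<forall>X\<in>\<C>. X \<subseteq> U"
    proof (cases "\<C> = {}")
      case True
      have "agree F0 C0 C0" by (simp add: agree_def)
      then show ?thesis using g0 True unfolding \<A>_def by blast
    next
      case False
      define P where "P = {(F, C). good F C \<and> agree F0 C0 C \<and> enc F C \<in> \<C>}"
      have sub: "\<C> \<subseteq> \<A>" and tot: "\<And>X Y. X \<in> \<C> \<Longrightarrow> Y \<in> \<C> \<Longrightarrow> X \<subseteq> Y \<or> Y \<subseteq> X" using ch unfolding subset_chain_def by blast+
      have PD: "good F C" "agree F0 C0 C" "enc F C \<in> \<C>" "F \<subseteq> V" "F0 \<subseteq> F" if "(F, C) \<in> P" for F C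
        using that unfolding P_def good_def by auto
      obtain X where "X \<in> \<C>" using False by blast
      then obtain F1' C1' where ne: "(F1', C1') \<in> P" using sub unfolding P_def \<A>_def by blast
      have "\<exists>U D. good U D \<and> (\<forall>(F, C)\<in>P. F \<subseteq> U \<and> agree F C D)"
      proof (rule good_union)
        show "good F C" if "(F, C) \<in> P" for F C using PD(1)[OF that] .
        show "P \<noteq> {}" using ne by blast
        show "F \<subseteq> F' \<and> agree F C C' \<or> F' \<subseteq> F \<and> agree F' C' C" if h: "(F, C) \<in> P" "(F', C') \<in> P" for F C F' C'
          using tot[OF PD(3)[OF h(1)] PD(3)[OF h(2)]] enc_le[OF PD(4)[OF h(1)]] enc_le[OF PD(4)[OF h(2)]] by blast
      qed
      then obtain U D where U: "good U D" "\<And>F C. (F, C) \<in> P \<Longrightarrow> F \<subseteq> U \<and> agree F C D" by blast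
      have "agree F0 C0 D" using U(2)[OF ne] PD(2,5)[OF ne] unfolding agree_def by auto
      then have "enc U D \<in> \<A>" using U(1) unfolding \<A>_def by blast
      moreover have "X \<subseteq> enc U D" if X: "X \<in> \<C>" for X
      proof -
        obtain F C where "X = enc F C" "(F, C) \<in> P" using sub X unfolding P_def \<A>_def by blast
        then show ?thesis using U(2) enc_le PD(4) by metis
      qed
      ultimately show ?thesis by blast
    qed
  qed
  then obtain M where M: "M \<in> \<A>" "\<And>X. X \<in> \<A> \<Longrightarrow> M \<subseteq> X \<Longrightarrow> X = M" by blast
  then obtain F C where FC: "good F C" "agree F0 C0 C" and M_eq: "M = enc F C" unfolding \<A>_def by blast
  have max: "X = enc F C" if "X \<in> \<A>" "enc F C \<subseteq> X" for X using M(2) that unfolding M_eq by blast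
  note G = FC(1)[unfolded good_def]
  \<comment> \<open>Otherwise connectedness provides an attached vertex outside \<open>F\<close>,
    and the class of one with least \<delta> can be added by \<open>single_step\<close> or
    \<open>multi_step\<close>.\<close>
  have "F = V"
  proof (rule ccontr)
    assume "F \<noteq> V"
    then obtain u v where "u \<in> F" "v \<in> V - F" "A u v" using conn[of F] G F0_ne by blast
    then have ex: "v \<in> V - F \<and> N v \<inter> F \<noteq> {}" using N_sym NI by blast
    obtain x where x: "x \<in> V - F \<and> N x \<inter> F \<noteq> {}" and min: "\<And>v. v \<in> V - F \<and> N v \<inter> F \<noteq> {} \<Longrightarrow> \<delta> F x \<le> \<delta> F v"
      using ex_has_least_nat[of "\<lambda>v. v \<in> V - F \<and> N v \<inter> F \<noteq> {}" v "\<delta> F"] ex by blast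
    have xc: "x \<in> cls F C x" using x cls_refl by blast
    have fc: "finite (cls F C x)" using fin_cls x by blast
    have "\<exists>X C'. agree F C C' \<and> good (F \<union> X) C' \<and> x \<in> X"
    proof (cases "2 \<le> card (cls F C x)")
      case True
      then show ?thesis using multi_step[OF FC(1) _ _ True] x min xc by blast
    next
      case False
      then have "card (cls F C x) = 1" using xc fc by (metis One_nat_def Suc_1 card_eq_0_iff empty_iff less_2_cases_iff not_le)
      then have "cls F C x = {x}" using xc by (metis card_1_singletonE singletonD)
      then show ?thesis using single_step[OF FC(1), of x] x min by blast
    qed
    then obtain X C' where X: "agree F C C'" "good (F \<union> X) C'" "x \<in> X" by blast
    have XV: "F \<union> X \<subseteq> V" and F0F: "F0 \<subseteq> F" using X(2) G unfolding good_def by blast+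
    have "agree F0 C0 C'" using FC(2) X(1) F0F unfolding agree_def by auto
    then have "enc (F \<union> X) C' \<in> \<A>" using X(2) unfolding \<A>_def by blast
    moreover have "enc F C \<subseteq> enc (F \<union> X) C'" using X(1) enc_le G by blast
    ultimately have "enc (F \<union> X) C' = enc F C" using max by blast
    then have "F \<union> X \<subseteq> F" using enc_le[OF XV, of C' F C] by blast
    then show False using X(3) x by blast
  qed
  moreover have "agree V C C" by (simp add: agree_def)
  ultimately show ?thesis using G FC(2) unfolding fixing_def by blast
qed

end

subsection \<open>Starts\<close>

context rgraph
begin

definition distinguishes :: "('a \<Rightarrow> 'a \<Rightarrow> bool) \<Rightarrow> bool" where
  "distinguishes C \<longleftrightarrow> symc C \<and> (\<forall>\<phi>. aut \<phi> \<and> pres C \<phi> \<longrightarrow> (\<forall>v\<in>V. \<phi> v = v))"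

text \<open>For recognising the initial set, all other vertices may be supposed to have edges of
  both colours outside \<open>F1\<close>, as the extension provides these. The second invariant is
  replaced by a simple sufficient condition: every vertex that could be a leaf is satisfied by the
  edges to \<open>F0\<close>.\<close>

lemma start:
  assumes F: "F1 \<subseteq> F0" "F0 \<subseteq> V" "F0 \<noteq> {}" "3 \<le> d" and few: "\<And>v. v \<in> V - F0 \<Longrightarrow> card (N v \<inter> F1) + 3 \<le> d"
    and sym: "symc C0"
    and inv1: "\<And>v. v \<in> V - F0 \<Longrightarrow> N v \<inter> F0 \<noteq> {} \<Longrightarrow> card (cls F0 C0 v) \<le> max 1 (\<delta> F0 v - 1)"
    and inv2: "\<And>v. v \<in> V - F0 \<Longrightarrow> \<delta> F0 v \<le> 1 \<Longrightarrow> (\<exists>f\<in>N v \<inter> F0 - F1. C0 v f) \<and> (\<exists>f\<in>N v \<inter> F0 - F1. \<not> C0 v f)"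
    and fix0: "\<And>C \<phi>. symc C \<Longrightarrow> agree F0 C0 C \<Longrightarrow> (\<And>v. v \<in> V - F0 \<Longrightarrow> \<exists>a\<in>N v - F1. C v a) \<Longrightarrow>
       (\<And>v. v \<in> V - F0 \<Longrightarrow> \<exists>a\<in>N v - F1. \<not> C v a) \<Longrightarrow> aut \<phi> \<Longrightarrow> pres C \<phi> \<Longrightarrow> \<forall>v\<in>F0. \<phi> v = v"
  shows "\<exists>C. distinguishes C"
proof -
  interpret E: extension V A d F0 F1 by unfold_locales (use F few in auto)
  have "E.inv1 F0 C0" unfolding E.inv1_def using inv1 by blast
  moreover have "E.inv2 F0 C0"
    unfolding E.inv2_def
  proof (intro allI impI)
    fix K assume K: "E.tcomp F0 K"
    obtain v where v: "v \<in> K" "\<delta> F0 v \<le> 1" using E.tcomp_leaf[OF K] by blast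
    then have "v \<in> V - F0" using E.tcompD(1)[OF K] by blast
    then have "E.fsat F0 C0 v" using inv2[OF _ v(2)] unfolding E.fsat_def by blast
    then show "E.satK F0 C0 K" using E.satK_root[OF K _ v(1) sym] by blast
  qed
  ultimately obtain C where C: "symc C" "agree F0 C0 C" "\<And>\<phi>. aut \<phi> \<Longrightarrow> pres C \<phi> \<Longrightarrow> \<forall>v\<in>F0. \<phi> v = v \<Longrightarrow> \<forall>v\<in>V. \<phi> v = v"
    "\<And>v. v \<in> V - F0 \<Longrightarrow> E.sat C v" using E.extension[OF sym] by blast
  have "\<forall>v\<in>F0. \<phi> v = v" if "aut \<phi>" "pres C \<phi>" for \<phi>
    by (rule fix0[OF C(1,2) _ _ that]) (use C(4) in \<open>auto simp: E.sat_def\<close>)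
  then show ?thesis unfolding distinguishes_def using C(1,3) by blast
qed

section \<open>Invariants of automorphisms that preserve the colouring\<close>

definition rdeg :: "('a \<Rightarrow> 'a \<Rightarrow> bool) \<Rightarrow> 'a \<Rightarrow> nat" where "rdeg C v = card {u\<in>N v. C v u}"

lemma aut_red: assumes "aut \<phi>" "pres C \<phi>" "v \<in> V"
  shows "{u\<in>N (\<phi> v). C (\<phi> v) u} = \<phi> ` {u\<in>N v. C v u}"
proof
  show "\<phi> ` {u\<in>N v. C v u} \<subseteq> {u\<in>N (\<phi> v). C (\<phi> v) u}"
    using aut_N[OF assms(1,3)] presD[OF assms(2)] ND by blast
  show "{u\<in>N (\<phi> v). C (\<phi> v) u} \<subseteq> \<phi> ` {u\<in>N v. C v u}"
  proof
    fix w assume w: "w \<in> {u\<in>N (\<phi> v). C (\<phi> v) u}"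
    then obtain u where "u \<in> N v" "w = \<phi> u" using aut_N[OF assms(1,3)] by auto
    then show "w \<in> \<phi> ` {u\<in>N v. C v u}" using w presD[OF assms(2), of v u] ND by blast
  qed
qed

lemma aut_rdeg: assumes "aut \<phi>" "pres C \<phi>" "v \<in> V" shows "rdeg C (\<phi> v) = rdeg C v"
proof -
  have "inj_on \<phi> {u\<in>N v. C v u}" using aut_inj[OF assms(1)] N_V(1) unfolding inj_on_def by blast
  then show ?thesis unfolding rdeg_def aut_red[OF assms] by (rule card_image)
qed

lemma aut_allred: assumes "aut \<phi>" "pres C \<phi>" "v \<in> V"
  shows "(\<forall>u\<in>N (\<phi> v). C (\<phi> v) u) \<longleftrightarrow> (\<forall>u\<in>N v. C v u)" "(\<forall>u\<in>N (\<phi> v). \<not> C (\<phi> v) u) \<longleftrightarrow> (\<forall>u\<in>N v. \<not> C v u)"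
proof -
  have e: "C (\<phi> v) (\<phi> u) = C v u" if "u \<in> N v" for u using presD[OF assms(2)] ND that by blast
  show "(\<forall>u\<in>N (\<phi> v). C (\<phi> v) u) \<longleftrightarrow> (\<forall>u\<in>N v. C v u)" "(\<forall>u\<in>N (\<phi> v). \<not> C (\<phi> v) u) \<longleftrightarrow> (\<forall>u\<in>N v. \<not> C v u)"
    unfolding aut_N[OF assms(1,3)] using e by auto
qed

lemma aut_N_mem: assumes "aut \<phi>" "u \<in> V" "v \<in> V" shows "\<phi> u \<in> N (\<phi> v) \<longleftrightarrow> u \<in> N v"
  using aut_A[OF assms(1,3,2)] by (simp add: N_def)

lemma aut_pres_C: assumes "pres C \<phi>" "u \<in> N v" shows "C (\<phi> v) (\<phi> u) = C v u"
  using presD[OF assms(1)] ND assms(2) by blast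

lemma cls_single:
  assumes v: "v \<in> V - F" and s: "s \<in> N v \<inter> F" and one: "\<And>w. w \<in> N s - F \<Longrightarrow> N w \<inter> F = N v \<inter> F \<Longrightarrow> C s w = C s v \<Longrightarrow> w = v"
  shows "card (cls F C v) \<le> max 1 k"
proof -
  have "cls F C v \<subseteq> {v}"
  proof
    fix w assume w: "w \<in> cls F C v"
    have "N w \<inter> F = N v \<inter> F" "C s w = C s v" "w \<notin> F" using w s unfolding cls_def by auto
    moreover from this have "w \<in> N s" using s N_sym by blast
    ultimately show "w \<in> {v}" using one by blast
  qed
  then have "card (cls F C v) \<le> card {v}" by (intro card_mono) auto
  then show ?thesis by simp
qed

text \<open>All edges at \<open>r\<close> are red, all other edges at \<open>c\<close> blue. So
  \<open>r\<close> is the only vertex without blue edges, and \<open>c\<close> is the only other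
  vertex without a red edge apart from one to \<open>r\<close>; this is why \<open>F1\<close> is
  \<open>{r}\<close>. The bounds on the number of common neighbours come from the class bound: the
  common neighbours have \<delta> = \<open>d - 2\<close>, the other neighbours of either end
  \<delta> = \<open>d - 1\<close>.\<close>

lemma start_edge:
  assumes rc: "A r c" and d: "4 \<le> d" and t: "1 \<le> card (N r \<inter> N c)" "card (N r \<inter> N c) + 3 \<le> d"
  shows "\<exists>C. distinguishes C"
proof -
  define C0 where "C0 = (\<lambda>u v. u = r \<or> v = r)"
  have ne: "r \<noteq> c" using rc A_irr by blast
  have rV: "r \<in> V" "c \<in> V" using rc A_V A_sym by blast+
  have cN: "c \<in> N r" "r \<in> N c" using rc NI A_sym by blast+
  show ?thesis
  proof (rule start[of "{r}" "{r, c}" C0])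
    show "symc C0" unfolding symc_def C0_def by blast
    fix v assume v: "v \<in> V - {r, c}"
    have "card (N v \<inter> {r}) \<le> card {r}" by (intro card_mono) auto
    then show "card (N v \<inter> {r}) + 3 \<le> d" using d by simp
    have "card (N v \<inter> {r, c}) \<le> card {r, c}" by (intro card_mono) auto
    also have "\<dots> = 2" using ne by simp
    finally have \<delta>2: "2 \<le> \<delta> {r, c} v" using \<delta>_add[of v "{r, c}"] v d by simp
    then show "(\<exists>f\<in>N v \<inter> {r, c} - {r}. C0 v f) \<and> (\<exists>f\<in>N v \<inter> {r, c} - {r}. \<not> C0 v f)" if "\<delta> {r, c} v \<le> 1"
      using that by linarith
    assume att: "N v \<inter> {r, c} \<noteq> {}"
    show "card (cls {r, c} C0 v) \<le> max 1 (\<delta> {r, c} v - 1)"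
    proof (cases "r \<in> N v \<and> c \<in> N v")
      case True
      have "cls {r, c} C0 v \<subseteq> N r \<inter> N c"
      proof
        fix w assume "w \<in> cls {r, c} C0 v"
        then have "N w \<inter> {r, c} = N v \<inter> {r, c}" by (rule cls_N)
        then have "r \<in> N w" "c \<in> N w" using True by blast+
        then show "w \<in> N r \<inter> N c" using N_sym by blast
      qed
      then have "card (cls {r, c} C0 v) \<le> card (N r \<inter> N c)" using fin_N rV by (intro card_mono) auto
      moreover have "N v \<inter> {r, c} = {r, c}" using True by blast
      then have "\<delta> {r, c} v = d - 2" using \<delta>_add[of v "{r, c}"] v ne by simp
      ultimately show ?thesis using t by linarith
    next
      case False
      define s where "s = (if r \<in> N v then r else c)"
      define s' where "s' = (if r \<in> N v then c else r)"
      have s: "s \<in> N v" "s' \<notin> N v" "{s, s'} = {r, c}" "s \<noteq> s'" using False att ne by (auto simp: s_def s'_def)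
      have sV: "s \<in> V" "s' \<in> N s" "N r \<inter> N c = N s \<inter> N s'" using rV cN by (auto simp: s_def s'_def)
      have "cls {r, c} C0 v \<subseteq> N s - (N r \<inter> N c) - {s'}"
      proof
        fix w assume w: "w \<in> cls {r, c} C0 v"
        have "N w \<inter> {r, c} = N v \<inter> {r, c}" using cls_N[OF w] .
        then have "s \<in> N w" "s' \<notin> N w" using s by blast+
        then have "w \<in> N s" "w \<notin> N s'" using N_sym by blast+
        moreover have "w \<notin> {r, c}" using w cls_sub by blast
        ultimately show "w \<in> N s - (N r \<inter> N c) - {s'}" using s(3) sV(3) by blast
      qed
      then have "card (cls {r, c} C0 v) \<le> card (N s - (N r \<inter> N c) - {s'})" using fin_N sV by (intro card_mono) auto
      also have "\<dots> = card (N s - (N r \<inter> N c)) - 1"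
        by (rule card_Diff_singleton) (use sV N_irr in auto)
      also have "card (N s - (N r \<inter> N c)) = card (N s) - card (N r \<inter> N c)"
        unfolding sV(3) using fin_N sV(1) by (intro card_Diff_subset) auto
      finally have "card (cls {r, c} C0 v) \<le> d - card (N r \<inter> N c) - 1" using card_N sV by simp
      moreover have "N v \<inter> {r, c} = {s}" using s by blast
      then have "\<delta> {r, c} v = d - 1" using \<delta>_add[of v "{r, c}"] v by simp
      ultimately show ?thesis using t by linarith
    qed
  next
    fix C \<phi> assume C: "symc C" "agree {r, c} C0 C" and s1: "\<And>v. v \<in> V - {r, c} \<Longrightarrow> \<exists>a\<in>N v - {r}. C v a"
      and s2: "\<And>v. v \<in> V - {r, c} \<Longrightarrow> \<exists>a\<in>N v - {r}. \<not> C v a" and \<phi>: "aut \<phi>" "pres C \<phi>"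
    have Cr: "C r u" if "u \<in> N r" for u using agreeD[OF C(2), of r u] that ND by (auto simp: C0_def)
    have Cc: "C c u \<longleftrightarrow> u = r" if "u \<in> N c" for u using agreeD[OF C(2), of c u] that ND ne by (auto simp: C0_def)
    have "N c \<noteq> {r}" using card_N[of c] rV d by auto
    then obtain w where w: "w \<in> N c" "w \<noteq> r" using cN by blast
    have V: "\<phi> r \<in> V" "\<phi> c \<in> V" using aut_V[OF \<phi>(1)] rV by auto
    have r: "\<phi> r = r"
    proof (rule ccontr)
      assume n: "\<phi> r \<noteq> r"
      have all: "\<forall>u\<in>N (\<phi> r). C (\<phi> r) u" using aut_allred(1)[OF \<phi> rV(1)] Cr by blast
      show False
      proof (cases "\<phi> r = c")
        case True then show ?thesis using all w Cc by auto
      next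
        case False then show ?thesis using s2[of "\<phi> r"] all V n by blast
      qed
    qed
    have "\<phi> c = c"
    proof (rule ccontr)
      assume n: "\<phi> c \<noteq> c"
      have "\<phi> c \<noteq> r" using r ne aut_inj[OF \<phi>(1) rV(2,1)] by auto
      then obtain a where a: "a \<in> N (\<phi> c) - {r}" "C (\<phi> c) a" using s1[of "\<phi> c"] n V by blast
      then obtain b where b: "b \<in> N c" "a = \<phi> b" using aut_N[OF \<phi>(1) rV(2)] by auto
      then have "C c b" using aut_pres_C[OF \<phi>(2) b(1)] a by simp
      then have "b = r" using Cc b by blast
      then show False using a b r by simp
    qed
    then show "\<forall>v\<in>{r, c}. \<phi> v = v" using r by blast
  qed (use rV d in auto)
qed

lemma fix_allred:
  assumes "aut \<phi>" "pres C \<phi>" "r \<in> V" "\<And>u. u \<in> N r \<Longrightarrow> C r u" "\<And>v. v \<in> V \<Longrightarrow> v \<noteq> r \<Longrightarrow> \<exists>a\<in>N v. \<not> C v a"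
  shows "\<phi> r = r"
  using aut_allred(1)[OF assms(1-3)] assms(4,5) aut_V[OF assms(1,3)] by blast

lemma fix_allblue:
  assumes "aut \<phi>" "pres C \<phi>" "r \<in> V" "\<And>u. u \<in> N r \<Longrightarrow> \<not> C r u" "\<And>v. v \<in> V \<Longrightarrow> v \<noteq> r \<Longrightarrow> \<exists>a\<in>N v. C v a"
  shows "\<phi> r = r"
  using aut_allred(2)[OF assms(1-3)] assms(4,5) aut_V[OF assms(1,3)] by blast

lemma agreeN: "agree F C0 C \<Longrightarrow> u \<in> F \<Longrightarrow> v \<in> N u \<Longrightarrow> C u v = C0 u v"
  using agreeD ND by blast

lemma inter_mem: "M \<inter> F = S \<Longrightarrow> x \<in> F \<Longrightarrow> x \<in> M \<longleftrightarrow> x \<in> S" by blast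

definition tri_free :: bool where "tri_free \<longleftrightarrow> (\<forall>u v. A u v \<longrightarrow> N u \<inter> N v = {})"

lemma tri_freeD: "tri_free \<Longrightarrow> u \<in> N v \<Longrightarrow> w \<in> N u \<Longrightarrow> w \<notin> N v"
  unfolding tri_free_def using ND by blast

lemma cls_bound:
  assumes "finite B" "\<And>w. w \<in> V - F \<Longrightarrow> N w \<inter> F = N v \<inter> F \<Longrightarrow> w \<in> B"
  shows "card (cls F C v) \<le> card B"
  using assms by (intro card_mono) (auto simp: cls_def)

text \<open>The vertex \<open>r\<close> has only red edges, \<open>b\<close> only blue ones, and
  \<open>c\<close> no red edge but the one to \<open>r\<close>. The lower bound on the number of
  common neighbours keeps the classes at \<open>r\<close> alone and at \<open>b\<close> alone small,
  the upper bound the class at both, from which \<open>c\<close> has been removed.\<close>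

lemma start_c4:
  assumes tf: tri_free and d: "4 \<le> d" and V: "r \<in> V" "b \<in> V" and rb: "r \<noteq> b" "b \<notin> N r"
    and i0: "2 \<le> card (N r \<inter> N b)" "card (N r \<inter> N b) + 2 \<le> d"
  shows "\<exists>C. distinguishes C"
proof -
  have "N r \<inter> N b \<noteq> {}" using i0 by auto
  then obtain c where c: "c \<in> N r" "c \<in> N b" by blast
  define C0 where "C0 = (\<lambda>u v. u = r \<or> v = r)"
  let ?F = "{r, b, c}"
  have cV: "c \<in> V" using c N_V by blast
  have ne: "r \<noteq> c" "b \<noteq> c" using c N_irr by blast+
  have sym: "r \<in> N c" "b \<in> N c" "r \<notin> N b" using c rb N_sym by blast+
  have card_NF: "\<delta> ?F v + card (N v \<inter> ?F) = d" if "v \<in> V" for v using \<delta>_add[OF that] .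
  have cases: "N v \<inter> ?F = {} \<or> N v \<inter> ?F = {r} \<or> N v \<inter> ?F = {b} \<or> N v \<inter> ?F = {c} \<or> N v \<inter> ?F = {r, b}" for v
  proof -
    have "r \<notin> N v \<and> b \<notin> N v" if "c \<in> N v"
      using tri_freeD[OF tf, of c v] that sym by blast
    then show ?thesis by blast
  qed
  show ?thesis
  proof (rule start[of "{r}" ?F C0])
    show "symc C0" unfolding symc_def C0_def by blast
    fix v assume v: "v \<in> V - ?F"
    have "card (N v \<inter> {r}) \<le> card {r}" by (intro card_mono) auto
    then show "card (N v \<inter> {r}) + 3 \<le> d" using d by simp
    have "card (N v \<inter> ?F) \<le> 2" using cases[of v] by (elim disjE) (simp_all add: card_insert_if)
    then have \<delta>2: "2 \<le> \<delta> ?F v" using card_NF[of v] v d by auto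
    then show "(\<exists>f\<in>N v \<inter> ?F - {r}. C0 v f) \<and> (\<exists>f\<in>N v \<inter> ?F - {r}. \<not> C0 v f)" if "\<delta> ?F v \<le> 1"
      using that by linarith
    assume att: "N v \<inter> ?F \<noteq> {}"
    consider "N v \<inter> ?F = {r}" | "N v \<inter> ?F = {b}" | "N v \<inter> ?F = {c}" | "N v \<inter> ?F = {r, b}" using cases[of v] att by blast
    then show "card (cls ?F C0 v) \<le> max 1 (\<delta> ?F v - 1)"
    proof cases
      case 1
      have "card (cls ?F C0 v) \<le> card (N r - N r \<inter> N b)"
      proof (rule cls_bound)
        fix w assume "N w \<inter> ?F = N v \<inter> ?F"
        then have e: "N w \<inter> ?F = {r}" using 1 by (rule trans)
        have "r \<in> N w" "b \<notin> N w" using inter_mem[OF e, of r] inter_mem[OF e, of b] rb by auto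
        then show "w \<in> N r - N r \<inter> N b" using N_sym by blast
      qed (use fin_N V in auto)
      also have "\<dots> = d - card (N r \<inter> N b)" using fin_N card_N V by (subst card_Diff_subset) auto
      finally show ?thesis using card_NF[of v] 1 v i0 by simp
    next
      case 2
      have "card (cls ?F C0 v) \<le> card (N b - N r \<inter> N b)"
      proof (rule cls_bound)
        fix w assume "N w \<inter> ?F = N v \<inter> ?F"
        then have e: "N w \<inter> ?F = {b}" using 2 by (rule trans)
        have "b \<in> N w" "r \<notin> N w" using inter_mem[OF e, of r] inter_mem[OF e, of b] rb by auto
        then show "w \<in> N b - N r \<inter> N b" using N_sym by blast
      qed (use fin_N V in auto)
      also have "\<dots> = d - card (N r \<inter> N b)" using fin_N card_N V by (subst card_Diff_subset) auto
      finally show ?thesis using card_NF[of v] 2 v i0 by simp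
    next
      case 3
      have "card (cls ?F C0 v) \<le> card (N c - {r, b})"
      proof (rule cls_bound)
        fix w assume w: "w \<in> V - ?F" "N w \<inter> ?F = N v \<inter> ?F"
        have e: "N w \<inter> ?F = {c}" using w(2) 3 by (rule trans)
        have "c \<in> N w" using inter_mem[OF e, of c] by auto
        then show "w \<in> N c - {r, b}" using N_sym w by blast
      qed (use fin_N cV in auto)
      also have "\<dots> = d - 2" using card_N[OF cV] sym rb by (subst card_Diff_subset) auto
      finally show ?thesis using card_NF[of v] 3 v by simp
    next
      case 4
      have "card (cls ?F C0 v) \<le> card (N r \<inter> N b - {c})"
      proof (rule cls_bound)
        fix w assume w: "w \<in> V - ?F" "N w \<inter> ?F = N v \<inter> ?F"
        have e: "N w \<inter> ?F = {r, b}" using w(2) 4 by (rule trans)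
        have "r \<in> N w" "b \<in> N w" using inter_mem[OF e, of r] inter_mem[OF e, of b] by auto
        then show "w \<in> N r \<inter> N b - {c}" using N_sym w by blast
      qed (use fin_N V in auto)
      also have "\<dots> = card (N r \<inter> N b) - 1" using c by (intro card_Diff_singleton) auto
      finally show ?thesis using card_NF[of v] 4 v i0 rb by simp
    qed
  next
    fix C \<phi> assume C: "symc C" "agree ?F C0 C" and s1: "\<And>v. v \<in> V - ?F \<Longrightarrow> \<exists>a\<in>N v - {r}. C v a"
      and s2: "\<And>v. v \<in> V - ?F \<Longrightarrow> \<exists>a\<in>N v - {r}. \<not> C v a" and \<phi>: "aut \<phi>" "pres C \<phi>"
    have Cr: "C r u" if "u \<in> N r" for u using agreeN[OF C(2) _ that] by (simp add: C0_def)
    have Cb: "\<not> C b u" if "u \<in> N b" for u using agreeN[OF C(2) _ that] rb sym that by (auto simp: C0_def)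
    have Cc: "C c u \<longleftrightarrow> u = r" if "u \<in> N c" for u using agreeN[OF C(2) _ that] ne by (auto simp: C0_def)
    have r: "\<phi> r = r"
    proof (rule fix_allred[OF \<phi> V(1) Cr])
      fix v assume v: "v \<in> V" "v \<noteq> r"
      consider "v = b" | "v = c" | "v \<in> V - ?F" using v by blast
      then show "\<exists>a\<in>N v. \<not> C v a"
      proof cases
        case 1 then show ?thesis using c Cb by blast
      next
        case 2 then show ?thesis using Cc sym rb by blast
      next
        case 3 then show ?thesis using s2 by blast
      qed
    qed
    have b: "\<phi> b = b"
    proof (rule fix_allblue[OF \<phi> V(2) Cb])
      fix v assume v: "v \<in> V" "v \<noteq> b"
      consider "v = r" | "v = c" | "v \<in> V - ?F" using v by blast
      then show "\<exists>a\<in>N v. C v a"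
      proof cases
        case 1 then show ?thesis using c Cr by blast
      next
        case 2 then show ?thesis using Cc sym by blast
      next
        case 3 then show ?thesis using s1 by blast
      qed
    qed
    have "\<phi> c = c"
    proof (rule ccontr)
      assume n: "\<phi> c \<noteq> c"
      have "\<phi> c \<noteq> r" "\<phi> c \<noteq> b" using r b ne aut_inj[OF \<phi>(1) cV] V by metis+
      then obtain a where a: "a \<in> N (\<phi> c) - {r}" "C (\<phi> c) a" using s1[of "\<phi> c"] n aut_V[OF \<phi>(1) cV] by blast
      then obtain e where e: "e \<in> N c" "a = \<phi> e" using aut_N[OF \<phi>(1) cV] by auto
      then have "C c e" using aut_pres_C[OF \<phi>(2) e(1)] a by simp
      then have "e = r" using Cc e by blast
      then show False using a e r by simp
    qed
    then show "\<forall>v\<in>?F. \<phi> v = v" using r b by blast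
  qed (use V cV d in auto)
qed

section \<open>Starts in cubic graphs\<close>

lemma start_cubic:
  assumes d: "d = 3" and F: "F0 \<subseteq> V" "F0 \<noteq> {}" and sym: "symc C0"
    and out: "\<And>s v w. s \<in> F0 \<Longrightarrow> v \<in> N s - F0 \<Longrightarrow> w \<in> N s - F0 \<Longrightarrow> v = w"
    and two: "\<And>v s s'. v \<in> V - F0 \<Longrightarrow> s \<in> N v \<inter> F0 \<Longrightarrow> s' \<in> N v \<inter> F0 \<Longrightarrow> s \<noteq> s' \<Longrightarrow> C0 v s \<noteq> C0 v s'"
    and fix0: "\<And>C \<phi>. symc C \<Longrightarrow> agree F0 C0 C \<Longrightarrow> (\<And>v. v \<in> V - F0 \<Longrightarrow> \<exists>a\<in>N v. C v a) \<Longrightarrow>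
       (\<And>v. v \<in> V - F0 \<Longrightarrow> \<exists>a\<in>N v. \<not> C v a) \<Longrightarrow> aut \<phi> \<Longrightarrow> pres C \<phi> \<Longrightarrow> \<forall>v\<in>F0. \<phi> v = v"
  shows "\<exists>C. distinguishes C"
\<comment> \<open>For \<open>d = 3\<close> no vertex outside \<open>F0\<close> may have neighbours
  in \<open>F1\<close>, so \<open>F1\<close> is empty. By \<open>out\<close> all classes are
  singletons, and by \<open>two\<close> a vertex with two neighbours in \<open>F0\<close> sees both
  colours.\<close>
proof (rule start[of "{}" F0 C0])
  fix v assume v: "v \<in> V - F0"
  show "card (N v \<inter> {}) + 3 \<le> d" using d by simp
  show "card (cls F0 C0 v) \<le> max 1 (\<delta> F0 v - 1)" if att: "N v \<inter> F0 \<noteq> {}"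
  proof -
    obtain s where s: "s \<in> N v \<inter> F0" using att by blast
    show ?thesis
    proof (rule cls_single[OF v s])
      fix w assume "w \<in> N s - F0"
      moreover have "v \<in> N s - F0" using s v N_sym by blast
      ultimately show "w = v" using out s by blast
    qed
  qed
  assume "\<delta> F0 v \<le> 1"
  then have "2 \<le> card (N v \<inter> F0)" using \<delta>_add[of v F0] v d by auto
  then have "\<not> card (N v \<inter> F0) \<le> Suc 0" by simp
  moreover have "finite (N v \<inter> F0)" using fin_N v by blast
  ultimately obtain s s' where s: "s \<in> N v \<inter> F0" "s' \<in> N v \<inter> F0" "s \<noteq> s'"
    using card_le_Suc0_iff_eq[of "N v \<inter> F0"] by blast
  then have "C0 v s \<noteq> C0 v s'" using two v by blast
  then show "(\<exists>f\<in>N v \<inter> F0 - {}. C0 v f) \<and> (\<exists>f\<in>N v \<inter> F0 - {}. \<not> C0 v f)" using s by blast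
next
  fix C \<phi> assume h: "symc C" "agree F0 C0 C" "\<And>v. v \<in> V - F0 \<Longrightarrow> \<exists>a\<in>N v - {}. C v a" "\<And>v. v \<in> V - F0 \<Longrightarrow> \<exists>a\<in>N v - {}. \<not> C v a"
    "aut \<phi>" "pres C \<phi>"
  show "\<forall>v\<in>F0. \<phi> v = v" by (rule fix0[OF h(1,2) _ _ h(5,6)]) (use h(3,4) in auto)
qed (use F sym d in auto)

lemma card3: assumes "d = 3" "v \<in> V" "a \<in> N v" "b \<in> N v" "a \<noteq> b" shows "\<exists>p. N v = {a, b, p} \<and> p \<noteq> a \<and> p \<noteq> b"
proof -
  have "card (N v - {a, b}) = 1" using card_N[OF assms(2)] assms by (subst card_Diff_subset) auto
  then obtain p where "N v - {a, b} = {p}" by (auto simp: card_1_singleton_iff)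
  then have "N v = {a, b, p}" "p \<noteq> a" "p \<noteq> b" using assms by blast+
  then show ?thesis by blast
qed

text \<open>The neighbours of a vertex \<open>r\<close> with only red edges are told apart by their
  red edges that do not lead to \<open>r\<close>.\<close>

lemma red_other:
  assumes "aut \<phi>" "pres C \<phi>" "\<phi> r = r" "r \<in> V" "a \<in> N v" "a \<noteq> r" "C v a"
  shows "\<exists>a\<in>N (\<phi> v). a \<noteq> r \<and> C (\<phi> v) a"
proof
  show "\<phi> a \<in> N (\<phi> v)" using assms(1,5) aut_N N_V by blast
  have "\<phi> a \<noteq> r" using aut_inj[OF assms(1), of a r] assms N_V by metis
  then show "\<phi> a \<noteq> r \<and> C (\<phi> v) (\<phi> a)" using aut_pres_C[OF assms(2,5)] assms(7) by simp
qed

definition ecol :: "'a set set \<Rightarrow> 'a \<Rightarrow> 'a \<Rightarrow> bool" where "ecol E u v \<longleftrightarrow> {u, v} \<in> E"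

lemma ecol_symc: "symc (ecol E)" unfolding symc_def ecol_def by (simp add: insert_commute)

text \<open>Only \<open>r\<close> has no blue edge, and of its neighbours only \<open>x1\<close> has
  a second red edge. Then \<open>c\<close> is the neighbour of \<open>r\<close> adjacent to
  \<open>x1\<close>, and \<open>x2\<close> remains. If \<open>p1 = p2\<close>, this vertex sees both
  colours.\<close>

lemma start_diamond:
  assumes d: "d = 3" and rc: "A r c" and t: "N r \<inter> N c = {x1, x2}" "x1 \<noteq> x2" "\<not> A x1 x2"
  shows "\<exists>C. distinguishes C"
proof -
  have V: "r \<in> V" "c \<in> V" "x1 \<in> V" "x2 \<in> V" using rc A_V A_sym t N_V by blast+
  have n: "x1 \<in> N r" "x2 \<in> N r" "x1 \<in> N c" "x2 \<in> N c" "c \<in> N r" "r \<in> N c"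
    "r \<in> N x1" "r \<in> N x2" "c \<in> N x1" "c \<in> N x2" using t rc NI A_sym N_sym by blast+
  have ne: "r \<noteq> c" "x1 \<noteq> r" "x1 \<noteq> c" "x2 \<noteq> r" "x2 \<noteq> c" using n N_irr by blast+
  have x12: "x1 \<notin> N x2" "x2 \<notin> N x1" using t(3) ND A_sym by blast+
  obtain o1 where o1: "N r = {x1, x2, o1}" using card3[OF d V(1) n(1,2) t(2)] by metis
  have Nr: "N r = {x1, x2, c}" using o1 n(5) ne by simp
  obtain o2 where o2: "N c = {x1, x2, o2}" using card3[OF d V(2) n(3,4) t(2)] by metis
  have Nc: "N c = {x1, x2, r}" using o2 n(6) ne by simp
  obtain p1 where p1: "N x1 = {r, c, p1}" "p1 \<noteq> r" "p1 \<noteq> c" using card3[OF d V(3) n(7,9) ne(1)] by metis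
  obtain p2 where p2: "N x2 = {r, c, p2}" "p2 \<noteq> r" "p2 \<noteq> c" using card3[OF d V(4) n(8,10) ne(1)] by metis
  have p: "p1 \<noteq> x1" "p1 \<noteq> x2" "p2 \<noteq> x1" "p2 \<noteq> x2" using p1 p2 x12 N_irr by blast+
  let ?F = "{r, c, x1, x2}"
  let ?C = "ecol {{r, c}, {r, x1}, {r, x2}, {x1, p1}}"
  have cr: "?C r c" "?C r x1" "?C r x2" "?C c r" "\<not> ?C c x1" "\<not> ?C c x2" "?C x1 r" "\<not> ?C x1 c" "?C x1 p1" "?C x2 r" "\<not> ?C x2 c" "\<not> ?C x2 p2"
    using ne t(2) p p1(2,3) p2(2,3) unfolding ecol_def by (auto simp: doubleton_eq_iff)
  have Nout: "N r - ?F = {}" "N c - ?F = {}" "N x1 - ?F \<subseteq> {p1}" "N x2 - ?F \<subseteq> {p2}" using Nr Nc p1(1) p2(1) by auto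
  have key: "s = x1 \<and> v = p1 \<or> s = x2 \<and> v = p2" if "s \<in> ?F" "v \<in> N s - ?F" for s v
  proof -
    from that(1) consider "s = r" | "s = c" | "s = x1" | "s = x2" by blast
    then show ?thesis by cases (use that(2) Nout in blast)+
  qed
  show ?thesis
  proof (rule start_cubic[OF d, of ?F ?C])
    show "v = w" if "s \<in> ?F" "v \<in> N s - ?F" "w \<in> N s - ?F" for s v w using key[OF that(1,2)] key[OF that(1,3)] t(2) by auto
    show "?C v s \<noteq> ?C v s'" if h: "v \<in> V - ?F" "s \<in> N v \<inter> ?F" "s' \<in> N v \<inter> ?F" "s \<noteq> s'" for v s s'
    proof -
      have "v \<in> N s - ?F" "v \<in> N s' - ?F" using h N_sym by blast+
      then have "(s = x1 \<and> v = p1 \<or> s = x2 \<and> v = p2) \<and> (s' = x1 \<and> v = p1 \<or> s' = x2 \<and> v = p2)"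
        using key h(2,3) by blast
      then have "s = x1 \<and> s' = x2 \<and> v = p1 \<and> v = p2 \<or> s = x2 \<and> s' = x1 \<and> v = p1 \<and> v = p2" using h(4) by blast
      then show ?thesis using cr(9,12) symcD[OF ecol_symc] by metis
    qed
    fix C \<phi> assume C: "agree ?F ?C C" and s1: "\<And>v. v \<in> V - ?F \<Longrightarrow> \<exists>a\<in>N v. C v a"
      and s2: "\<And>v. v \<in> V - ?F \<Longrightarrow> \<exists>a\<in>N v. \<not> C v a" and \<phi>: "aut \<phi>" "pres C \<phi>"
    have e: "C u v = ?C u v" if "u \<in> ?F" "v \<in> N u" for u v by (rule agreeN[OF C that])
    have r: "\<phi> r = r"
    proof (rule fix_allred[OF \<phi> V(1)])
      show "C r u" if "u \<in> N r" for u using e[of r u] that Nr cr by auto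
      show "\<exists>a\<in>N v. \<not> C v a" if "v \<in> V" "v \<noteq> r" for v
        using that s2[of v] e[of c x1] e[of x1 c] e[of x2 c] cr n by auto
    qed
    have im: "\<phi> x \<in> {x1, x2, c}" if "x \<in> N r" for x
    proof -
      have "\<phi> x \<in> N r" using aut_N_mem[OF \<phi>(1) N_V(1)[OF that] V(1)] r that by simp
      then show ?thesis unfolding Nr .
    qed
    have "\<exists>a\<in>N (\<phi> x1). a \<noteq> r \<and> C (\<phi> x1) a"
      by (rule red_other[OF \<phi> r V(1), of p1]) (use p1 e[of x1 p1] cr in auto)
    moreover have "\<not> C c x1" "\<not> C c x2" "\<not> C x2 c" "\<not> C x2 p2"
      using e[of c x1] e[of c x2] e[of x2 c] e[of x2 p2] cr n p2(1) by auto
    then have "\<not> (\<exists>a\<in>N c. a \<noteq> r \<and> C c a)" "\<not> (\<exists>a\<in>N x2. a \<noteq> r \<and> C x2 a)" unfolding Nc p2(1) by blast+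
    ultimately have "\<phi> x1 \<noteq> c" "\<phi> x1 \<noteq> x2" by metis+
    then have x1: "\<phi> x1 = x1" using im[OF n(1)] by blast
    have "\<phi> c \<in> N x1" using aut_N_mem[OF \<phi>(1) V(2,3)] x1 n by simp
    then have c: "\<phi> c = c" using im[OF n(5)] N_irr x12 by blast
    have "\<phi> x2 \<noteq> x1" "\<phi> x2 \<noteq> c" using x1 c aut_inj[OF \<phi>(1) V(4)] V t(2) ne by metis+
    then have "\<phi> x2 = x2" using im[OF n(2)] by blast
    then show "\<forall>v\<in>?F. \<phi> v = v" using r x1 c by blast
  qed (use V ecol_symc in auto)
qed

text \<open>As no edge lies in two triangles, the third neighbours \<open>p\<close>,
  \<open>pc\<close> and \<open>pw\<close> are distinct, and \<open>p\<close> is adjacent to neither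
  \<open>c\<close> nor \<open>w\<close>. Hence the pair \<open>c\<close>, \<open>w\<close> is
  preserved once \<open>r\<close> is fixed, and only \<open>w\<close> has a second red edge.\<close>

lemma start_triangle:
  assumes d: "d = 3" and tr: "A r c" "A r w" "A c w" and t: "\<And>u v. A u v \<Longrightarrow> card (N u \<inter> N v) \<le> 1"
  shows "\<exists>C. distinguishes C"
proof -
  have V: "r \<in> V" "c \<in> V" "w \<in> V" using tr A_V A_sym by blast+
  have n: "c \<in> N r" "w \<in> N r" "r \<in> N c" "w \<in> N c" "r \<in> N w" "c \<in> N w" using tr NI A_sym by blast+
  have ne: "r \<noteq> c" "r \<noteq> w" "c \<noteq> w" using n N_irr by blast+
  obtain p where p: "N r = {c, w, p}" "p \<noteq> c" "p \<noteq> w" using card3[OF d V(1) n(1,2) ne(3)] by metis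
  obtain pc where pc: "N c = {r, w, pc}" "pc \<noteq> r" "pc \<noteq> w" using card3[OF d V(2) n(3,4) ne(2)] by metis
  obtain pw where pw: "N w = {r, c, pw}" "pw \<noteq> r" "pw \<noteq> c" using card3[OF d V(3) n(5,6) ne(1)] by metis
  have one: "x = y" if "A u v" "x \<in> N u \<inter> N v" "y \<in> N u \<inter> N v" for u v x y
    using t[OF that(1)] that fin_N[OF A_V[OF that(1)]] by (metis One_nat_def card_le_Suc0_iff_eq finite_Int)
  have dis: "p \<noteq> pc" "p \<noteq> pw" "pc \<noteq> pw"
    using one[OF tr(1), of w p] one[OF tr(2), of c p] one[OF tr(3), of r pc] p pc pw n by auto
  have nF: "p \<noteq> r" "pc \<noteq> c" "pw \<noteq> w" using p pc pw N_irr by blast+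
  let ?F = "{r, c, w}"
  let ?C = "ecol {{r, c}, {r, w}, {r, p}, {w, pw}}"
  have cr: "?C r c" "?C r w" "?C r p" "?C c r" "\<not> ?C c w" "\<not> ?C c pc" "?C w r" "\<not> ?C w c" "?C w pw"
    using ne dis nF p(2,3) pc(2,3) pw(2,3) unfolding ecol_def by (auto simp: doubleton_eq_iff)
  have Nout: "N r - ?F \<subseteq> {p}" "N c - ?F \<subseteq> {pc}" "N w - ?F \<subseteq> {pw}" using p(1) pc(1) pw(1) by auto
  have key: "s = r \<and> v = p \<or> s = c \<and> v = pc \<or> s = w \<and> v = pw" if "s \<in> ?F" "v \<in> N s - ?F" for s v
  proof -
    from that(1) consider "s = r" | "s = c" | "s = w" by blast
    then show ?thesis by cases (use that(2) Nout in blast)+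
  qed
  show ?thesis
  proof (rule start_cubic[OF d, of ?F ?C])
    show "v = u" if "s \<in> ?F" "v \<in> N s - ?F" "u \<in> N s - ?F" for s v u using key[OF that(1,2)] key[OF that(1,3)] ne by auto
    show "?C v s \<noteq> ?C v s'" if h: "v \<in> V - ?F" "s \<in> N v \<inter> ?F" "s' \<in> N v \<inter> ?F" "s \<noteq> s'" for v s s'
    proof -
      have "v \<in> N s - ?F" "v \<in> N s' - ?F" using h N_sym by blast+
      then show ?thesis using key[of s v] key[of s' v] h(2-4) dis by blast
    qed
    fix C \<phi> assume C: "agree ?F ?C C" and s1: "\<And>v. v \<in> V - ?F \<Longrightarrow> \<exists>a\<in>N v. C v a"
      and s2: "\<And>v. v \<in> V - ?F \<Longrightarrow> \<exists>a\<in>N v. \<not> C v a" and \<phi>: "aut \<phi>" "pres C \<phi>"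
    have e: "C u v = ?C u v" if "u \<in> ?F" "v \<in> N u" for u v by (rule agreeN[OF C that])
    have r: "\<phi> r = r"
    proof (rule fix_allred[OF \<phi> V(1)])
      show "C r u" if "u \<in> N r" for u using e[of r u] that p(1) cr by auto
      show "\<exists>a\<in>N v. \<not> C v a" if "v \<in> V" "v \<noteq> r" for v
        using that s2[of v] e[of c w] e[of w c] cr n by auto
    qed
    have im: "\<phi> x \<in> {c, w}" if "x \<in> {c, w}" for x
    proof -
      define y where "y = (if x = c then w else c)"
      have xy: "x \<in> N r" "y \<in> N r" "y \<in> N x" "x \<in> V" "y \<in> V" using that n ne V by (auto simp: y_def)
      have "\<phi> x \<in> N r" "\<phi> y \<in> N r" "\<phi> y \<in> N (\<phi> x)"
        using xy aut_N_mem[OF \<phi>(1)] r V(1) by metis+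
      moreover have "c \<notin> N p" "w \<notin> N p" "p \<notin> N p" using p(2,3) pc(1) pw(1) dis nF N_sym N_irr by blast+
      ultimately show ?thesis unfolding p(1) by auto
    qed
    have "\<exists>a\<in>N (\<phi> w). a \<noteq> r \<and> C (\<phi> w) a"
      by (rule red_other[OF \<phi> r V(1), of pw]) (use pw e[of w pw] cr in auto)
    moreover have "\<not> C c w" "\<not> C c pc" using e[of c w] e[of c pc] cr n pc(1) by auto
    then have "\<not> (\<exists>a\<in>N c. a \<noteq> r \<and> C c a)" unfolding pc(1) by blast
    ultimately have "\<phi> w \<noteq> c" by metis
    then have w: "\<phi> w = w" using im[of w] by blast
    then have "\<phi> c \<noteq> w" using aut_inj[OF \<phi>(1) V(2,3)] ne by auto
    then have "\<phi> c = c" using im[of c] by blast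
    then show "\<forall>v\<in>?F. \<phi> v = v" using r w by blast
  qed (use V ecol_symc in auto)
qed

text \<open>Once \<open>c\<close> is recognised by its red edges, \<open>c'\<close> is fixed as its
  only twin, because \<open>p3 \<noteq> p1\<close> rules out a third vertex with these neighbours.
  The red edge of \<open>c'\<close> leads to \<open>y1\<close>; finally \<open>y2\<close> has a red
  edge not leading to \<open>c\<close>, and \<open>y3\<close> has none.\<close>

lemma start_twins:
  assumes d: "d = 3" and tf: tri_free and cc: "c \<in> V" "c' \<in> V" "c \<noteq> c'" "N c = {y1, y2, y3}" "N c' = {y1, y2, y3}" "y1 \<noteq> y2" "y1 \<noteq> y3" "y2 \<noteq> y3"
    and p: "N y1 = {c, c', p1}" "N y2 = {c, c', p2}" "N y3 = {c, c', p3}" "p3 \<noteq> p1" "p3 \<noteq> p2"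
  shows "\<exists>C. distinguishes C"
proof -
  have yV: "y1 \<in> V" "y2 \<in> V" "y3 \<in> V" using cc(4) N_V(1)[of _ c] by auto
  have yy: "y \<notin> N y'" if "y \<in> N c" "y' \<in> N c" for y y' using tri_freeD[OF tf that(2)] that(1) by blast
  have cp: "q \<noteq> c \<and> q \<noteq> c'" if "y \<in> V" "N y = {c, c', q}" for y q
  proof -
    have c3: "card (N y) = 3" using card_N that(1) d by simp
    have "card {c, c'} = 2" using cc(3) by simp
    moreover have "N y = {c, c'}" if "q = c \<or> q = c'" using that \<open>N y = {c, c', q}\<close> by auto
    ultimately show ?thesis using c3 by auto
  qed
  have np: "p1 \<noteq> c" "p1 \<noteq> c'" "p2 \<noteq> c" "p2 \<noteq> c'" "p3 \<noteq> c" "p3 \<noteq> c'" using cp yV p by blast+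
  have pp: "p1 \<in> N y1" "p2 \<in> N y2" "p3 \<in> N y3" using p by auto
  have py: "p1 \<notin> {y1, y2, y3}" "p2 \<notin> {y1, y2, y3}" "p3 \<notin> {y1, y2, y3}" using yy pp unfolding cc(4) by blast+
  have ny: "c \<noteq> y1" "c \<noteq> y2" "c \<noteq> y3" "c' \<noteq> y1" "c' \<noteq> y2" "c' \<noteq> y3" using cc(4,5) N_irr[of c] N_irr[of c'] by auto
  let ?F = "{c, c', y1, y2, y3}"
  let ?C = "ecol {{c, y1}, {c, y2}, {c, y3}, {c', y1}, {y2, p2}}"
  have cr: "?C c y1" "?C c y2" "?C c y3" "?C c' y1" "\<not> ?C c' y2" "\<not> ?C c' y3" "?C y1 c" "?C y2 c" "?C y3 c"
    "\<not> ?C y1 p1" "\<not> ?C y2 c'" "?C y2 p2" "\<not> ?C y3 c'" "\<not> ?C y3 p3"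
    using cc(3,6-8) np py ny p(4,5) unfolding ecol_def by (auto simp: doubleton_eq_iff)
  have Nout: "N c - ?F = {}" "N c' - ?F = {}" "N y1 - ?F \<subseteq> {p1}" "N y2 - ?F \<subseteq> {p2}" "N y3 - ?F \<subseteq> {p3}" using cc(4,5) p(1-3) by auto
  have key: "s = y1 \<and> v = p1 \<or> s = y2 \<and> v = p2 \<or> s = y3 \<and> v = p3" if "s \<in> ?F" "v \<in> N s - ?F" for s v
  proof -
    from that(1) consider "s = c" | "s = c'" | "s = y1" | "s = y2" | "s = y3" by blast
    then show ?thesis by cases (use that(2) Nout in blast)+
  qed
  show ?thesis
  proof (rule start_cubic[OF d, of ?F ?C])
    show "v = w" if "s \<in> ?F" "v \<in> N s - ?F" "w \<in> N s - ?F" for s v w using key[OF that(1,2)] key[OF that(1,3)] cc(6-8) by auto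
    show "?C v s \<noteq> ?C v s'" if h: "v \<in> V - ?F" "s \<in> N v \<inter> ?F" "s' \<in> N v \<inter> ?F" "s \<noteq> s'" for v s s'
    proof -
      have "v \<in> N s - ?F" "v \<in> N s' - ?F" using h N_sym by blast+
      then have "(s = y1 \<and> v = p1 \<or> s = y2 \<and> v = p2 \<or> s = y3 \<and> v = p3) \<and> (s' = y1 \<and> v = p1 \<or> s' = y2 \<and> v = p2 \<or> s' = y3 \<and> v = p3)"
        using key h(2,3) by blast
      then have "s = y1 \<and> s' = y2 \<and> v = p1 \<and> v = p2 \<or> s = y2 \<and> s' = y1 \<and> v = p1 \<and> v = p2" using h(4) p(4,5) by blast
      then show ?thesis using cr(10,12) symcD[OF ecol_symc] by metis
    qed
    fix C \<phi> assume C: "agree ?F ?C C" and s1: "\<And>v. v \<in> V - ?F \<Longrightarrow> \<exists>a\<in>N v. C v a"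
      and s2: "\<And>v. v \<in> V - ?F \<Longrightarrow> \<exists>a\<in>N v. \<not> C v a" and \<phi>: "aut \<phi>" "pres C \<phi>"
    have e: "C u v = ?C u v" if "u \<in> ?F" "v \<in> N u" for u v by (rule agreeN[OF C that])
    have c: "\<phi> c = c"
    proof (rule fix_allred[OF \<phi> cc(1)])
      show "C c u" if "u \<in> N c" for u using e[of c u] that cc(4) cr by auto
      show "\<exists>a\<in>N v. \<not> C v a" if v: "v \<in> V" "v \<noteq> c" for v
      proof -
        consider "v = c'" | "v = y1" | "v = y2" | "v = y3" | "v \<in> V - ?F" using v by blast
        then show ?thesis
        proof cases
          case 1 then show ?thesis using e[of c' y2] cr cc(5) by auto
        next
          case 2 then show ?thesis using e[of y1 p1] cr pp by auto
        next
          case 3 then show ?thesis using e[of y2 c'] cr p(2) by auto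
        next
          case 4 then show ?thesis using e[of y3 c'] cr p(3) by auto
        next
          case 5 then show ?thesis using s2 by blast
        qed
      qed
    qed
    have Nc: "\<phi> ` N c = N c" using aut_N[OF \<phi>(1) cc(1)] c by simp
    have "N (\<phi> c') = \<phi> ` N c" unfolding aut_N[OF \<phi>(1) cc(2)] cc(4,5) ..
    then have "N (\<phi> c') = N c" using Nc by (rule trans)
    then have "y1 \<in> N (\<phi> c')" "y3 \<in> N (\<phi> c')" unfolding cc(4) by blast+
    then have "\<phi> c' \<in> N y1" "\<phi> c' \<in> N y3" using N_sym by blast+
    then have "\<phi> c' = c \<or> \<phi> c' = c'" unfolding p(1,3) using p(4) by blast
    then have c': "\<phi> c' = c'" using c aut_inj[OF \<phi>(1) cc(2,1)] cc(3) by auto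
    have im: "\<phi> y \<in> {y1, y2, y3}" if "y \<in> {y1, y2, y3}" for y using Nc that cc(4) by blast
    have "C c' (\<phi> y1) = C c' y1" using aut_pres_C[OF \<phi>(2), of y1 c'] c' cc(5) by simp
    moreover have "C c' y1" "\<not> C c' y2" "\<not> C c' y3" using e[of c' y1] e[of c' y2] e[of c' y3] cr cc(5) by auto
    ultimately have y1: "\<phi> y1 = y1" using im[of y1] by auto
    have "\<exists>a\<in>N (\<phi> y2). a \<noteq> c \<and> C (\<phi> y2) a"
      by (rule red_other[OF \<phi> c cc(1), of p2]) (use pp np e[of y2 p2] cr in auto)
    moreover have "\<not> C y3 c'" "\<not> C y3 p3" using e[of y3 c'] e[of y3 p3] cr p(3) by auto
    then have "\<not> (\<exists>a\<in>N y3. a \<noteq> c \<and> C y3 a)" unfolding p(3) by blast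
    ultimately have "\<phi> y2 \<noteq> y3" by metis
    moreover have "\<phi> y2 \<noteq> y1" using y1 aut_inj[OF \<phi>(1) yV(2,1)] cc(6) by auto
    ultimately have y2: "\<phi> y2 = y2" using im[of y2] by blast
    have "\<phi> y3 \<noteq> y1" "\<phi> y3 \<noteq> y2" using y1 y2 aut_inj[OF \<phi>(1) yV(3)] yV cc(7,8) by metis+
    then have "\<phi> y3 = y3" using im[of y3] by blast
    then show "\<forall>v\<in>?F. \<phi> v = v" using c c' y1 y2 by blast
  qed (use cc yV ecol_symc in auto)
qed

text \<open>The outer neighbours of opposite vertices of the 4-cycle differ because there are no
  twins, those of adjacent ones because there are no triangles. So no outside vertex has two
  neighbours on the cycle. The vertex \<open>r\<close> has only red edges, \<open>b\<close> only
  blue ones, and \<open>c'\<close> a second red edge.\<close>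

lemma start_cubic_c4:
  assumes d: "d = 3" and tf: tri_free and nt: "\<And>u v. u \<in> V \<Longrightarrow> v \<in> V \<Longrightarrow> N u = N v \<Longrightarrow> u = v"
    and V: "r \<in> V" "b \<in> V" and rb: "r \<noteq> b" and c: "c \<in> N r \<inter> N b" "c' \<in> N r \<inter> N b" "c \<noteq> c'"
  shows "\<exists>C. distinguishes C"
proof -
  have cV: "c \<in> V" "c' \<in> V" using c N_V by blast+
  have n: "r \<in> N c" "b \<in> N c" "r \<in> N c'" "b \<in> N c'" "c \<in> N r" "c' \<in> N r" "c \<in> N b" "c' \<in> N b" using c N_sym by blast+
  have nrb: "b \<notin> N r" "r \<notin> N b" using tri_freeD[OF tf n(5,2)] tri_freeD[OF tf n(7,1)] by blast+
  have ncc: "c' \<notin> N c" "c \<notin> N c'" using tri_freeD[OF tf n(1,6)] tri_freeD[OF tf n(3,5)] by blast+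
  obtain r' where r': "N r = {c, c', r'}" "r' \<noteq> c" "r' \<noteq> c'" using card3[OF d V(1) n(5,6) c(3)] by metis
  obtain b' where b': "N b = {c, c', b'}" "b' \<noteq> c" "b' \<noteq> c'" using card3[OF d V(2) n(7,8) c(3)] by metis
  obtain p where p: "N c = {r, b, p}" "p \<noteq> r" "p \<noteq> b" using card3[OF d cV(1) n(1,2) rb] by metis
  obtain p' where p': "N c' = {r, b, p'}" "p' \<noteq> r" "p' \<noteq> b" using card3[OF d cV(2) n(3,4) rb] by metis
  have dis: "r' \<noteq> b'" "p \<noteq> p'" using nt[OF V] nt[OF cV] r' b' p p' rb c(3) by auto
  have ne: "r \<noteq> c" "r \<noteq> c'" "b \<noteq> c" "b \<noteq> c'" using n N_irr by blast+
  have nF: "r' \<noteq> r" "r' \<noteq> b" "b' \<noteq> b" "b' \<noteq> r" "p \<noteq> c" "p \<noteq> c'" "p' \<noteq> c" "p' \<noteq> c'"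
    using r'(1) b'(1) p(1) p'(1) N_irr nrb ncc by blast+
  have rp: "r' \<noteq> p" "r' \<noteq> p'" "b' \<noteq> p" "b' \<noteq> p'"
    using tri_freeD[OF tf n(5)] tri_freeD[OF tf n(6)] tri_freeD[OF tf n(7)] tri_freeD[OF tf n(8)] r'(1) b'(1) p(1) p'(1) by auto
  let ?F = "{r, b, c, c'}"
  let ?C = "ecol {{r, c}, {r, c'}, {r, r'}, {c', p'}}"
  have cr: "?C r c" "?C r c'" "?C r r'" "\<not> ?C b c" "\<not> ?C b c'" "\<not> ?C b b'" "?C c r" "\<not> ?C c b" "\<not> ?C c p" "?C c' r" "\<not> ?C c' b" "?C c' p'"
    using ne nF rb c(3) p(2,3) p'(2,3) r'(2,3) b'(2,3) dis rp unfolding ecol_def by (auto simp: doubleton_eq_iff)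
  have Nout: "N r - ?F \<subseteq> {r'}" "N b - ?F \<subseteq> {b'}" "N c - ?F \<subseteq> {p}" "N c' - ?F \<subseteq> {p'}" using r'(1) b'(1) p(1) p'(1) by auto
  have key: "s = r \<and> v = r' \<or> s = b \<and> v = b' \<or> s = c \<and> v = p \<or> s = c' \<and> v = p'" if "s \<in> ?F" "v \<in> N s - ?F" for s v
  proof -
    from that(1) consider "s = r" | "s = b" | "s = c" | "s = c'" by blast
    then show ?thesis by cases (use that(2) Nout in blast)+
  qed
  show ?thesis
  proof (rule start_cubic[OF d, of ?F ?C])
    show "v = u" if "s \<in> ?F" "v \<in> N s - ?F" "u \<in> N s - ?F" for s v u using key[OF that(1,2)] key[OF that(1,3)] ne rb c(3) by auto
    show "?C v s \<noteq> ?C v s'" if h: "v \<in> V - ?F" "s \<in> N v \<inter> ?F" "s' \<in> N v \<inter> ?F" "s \<noteq> s'" for v s s'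
    proof -
      have "v \<in> N s - ?F" "v \<in> N s' - ?F" using h N_sym by blast+
      then show ?thesis using key[of s v] key[of s' v] h(2-4) dis rp by blast
    qed
    fix C \<phi> assume C: "agree ?F ?C C" and s1: "\<And>v. v \<in> V - ?F \<Longrightarrow> \<exists>a\<in>N v. C v a"
      and s2: "\<And>v. v \<in> V - ?F \<Longrightarrow> \<exists>a\<in>N v. \<not> C v a" and \<phi>: "aut \<phi>" "pres C \<phi>"
    have e: "C u v = ?C u v" if "u \<in> ?F" "v \<in> N u" for u v by (rule agreeN[OF C that])
    have r: "\<phi> r = r"
    proof (rule fix_allred[OF \<phi> V(1)])
      show "C r u" if "u \<in> N r" for u using e[of r u] that r'(1) cr by auto
      show "\<exists>a\<in>N v. \<not> C v a" if "v \<in> V" "v \<noteq> r" for v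
        using that s2[of v] e[of b c] e[of c b] e[of c' b] cr n by auto
    qed
    have b: "\<phi> b = b"
    proof (rule fix_allblue[OF \<phi> V(2)])
      show "\<not> C b u" if "u \<in> N b" for u using e[of b u] that b'(1) cr by auto
      show "\<exists>a\<in>N v. C v a" if "v \<in> V" "v \<noteq> b" for v
        using that s1[of v] e[of r c] e[of c r] e[of c' r] cr n by auto
    qed
    have im: "\<phi> x \<in> {c, c'}" if "x \<in> {c, c'}" for x
    proof -
      have "x \<in> N r" "x \<in> N b" "x \<in> V" using that n cV by auto
      then have "\<phi> x \<in> N r" "\<phi> x \<in> N b" using aut_N_mem[OF \<phi>(1)] r b V by metis+
      then show ?thesis unfolding r'(1) b'(1) using dis by blast
    qed
    have "\<exists>a\<in>N (\<phi> c'). a \<noteq> r \<and> C (\<phi> c') a"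
      by (rule red_other[OF \<phi> r V(1), of p']) (use p' e[of c' p'] cr in auto)
    moreover have "\<not> C c b" "\<not> C c p" using e[of c b] e[of c p] cr n p(1) by auto
    then have "\<not> (\<exists>a\<in>N c. a \<noteq> r \<and> C c a)" unfolding p(1) by blast
    ultimately have "\<phi> c' \<noteq> c" by metis
    then have c': "\<phi> c' = c'" using im[of c'] by blast
    then have "\<phi> c \<noteq> c'" using aut_inj[OF \<phi>(1) cV] c(3) by auto
    then have "\<phi> c = c" using im[of c] by blast
    then show "\<forall>v\<in>?F. \<phi> v = v" using r b c' by blast
  qed (use V cV ecol_symc in auto)
qed

end

text \<open>This and the next lemma replace \<open>hall_arith\<close> in
  \<open>start_c4_big\<close>, where one member of \<open>Q\<close> is no server and only
  \<open>s \<ge> i - 1\<close> servers are available. Here the vertices to be split have no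
  neighbour in \<open>F\<close>, so that \<delta> = \<open>D + 2\<close>; \<open>c\<close> is the
  number of classes among the outside neighbours of a server.\<close>

lemma hall_arith_free:
  fixes k D i c s :: nat
  assumes "k \<le> D" "i \<le> D" "0 < k - (D + 1 - i)" "1 \<le> c" "k < D \<Longrightarrow> 2 \<le> c" "i \<le> s + 1"
  shows "(k - (D + 1 - i)) * (D - c) \<le> s * (k - 1)"
proof (cases "k = D")
  case True
  have "k - (D + 1 - i) \<le> s" "D - c \<le> k - 1" using assms True by linarith+
  then show ?thesis by (rule mult_le_mono)
next
  case False
  define t where "t = D - k - 1"
  define j where "j = k - (D + 1 - i)"
  define m where "m = k - j - 1"
  have kD: "k < D" "D + 1 - i < k" using assms False by auto
  have "j + D + 1 = k + i" "t + k + 1 = D" "m + j + 1 = k" using assms(2) kD unfolding t_def m_def j_def by auto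
  then have e: "D - 2 = j + m + t" "j + t + 1 \<le> s" "k - 1 = j + m" using assms(6) by linarith+
  have "D - c \<le> D - 2" using assms(1,5) False by linarith
  then have "j * (D - c) \<le> j * (j + m + t)" unfolding e(1) by (rule mult_le_mono2)
  also have "\<dots> \<le> (j + t + 1) * (j + m)" by (simp add: algebra_simps)
  also have "\<dots> \<le> s * (k - 1)" unfolding e(3) using e(2) by (rule mult_le_mono1)
  finally show ?thesis unfolding j_def .
qed

text \<open>For vertices with one neighbour in \<open>F\<close>, \<delta> is only
  \<open>D + 1\<close>; here \<open>k < D\<close> makes up for the missing server.\<close>

lemma hall_arith_missing:
  fixes k D i c s :: nat
  assumes "k < D" "i \<le> D" "0 < k - max 1 (D - i)" "2 \<le> c" "i \<le> s + 1"
  shows "(k - max 1 (D - i)) * (D - c) \<le> s * (k - 1)" "1 \<le> s"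
proof -
  show "1 \<le> s" using assms by (cases "i = D") auto
  show "(k - max 1 (D - i)) * (D - c) \<le> s * (k - 1)"
  proof (cases "i = D")
    case True
    have "(k - 1) * (D - c) \<le> (k - 1) * s" by (rule mult_le_mono2) (use assms True in linarith)
    then show ?thesis using True by (simp add: mult.commute)
  next
    case False
    define t where "t = D - k - 1"
    define j where "j = k - (D - i)"
    define m where "m = k - j - 1"
    have mx: "max 1 (D - i) = D - i" using False assms(2) by simp
    have iD: "i < D" "D - i < k" using False assms(2,3) mx by auto
    have "j + D = k + i" "t + k + 1 = D" "m + j + 1 = k" using assms(1) iD unfolding t_def m_def j_def by auto
    then have e: "D - 2 = j + m + t" "j + t \<le> s" "k - 1 = j + m" using assms(5) by linarith+
    have "D - c \<le> D - 2" using assms(4) by linarith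
    then have "j * (D - c) \<le> j * (j + m + t)" unfolding e(1) by (rule mult_le_mono2)
    also have "\<dots> \<le> (j + t) * (j + m)" by (simp add: algebra_simps)
    also have "\<dots> \<le> s * (k - 1)" unfolding e(3) using e(2) by (rule mult_le_mono1)
    finally show ?thesis unfolding j_def mx .
  qed
qed

context rgraph
begin

text \<open>The common neighbours of \<open>r\<close> and \<open>b\<close> other than
  \<open>c\<close> exceed the class bound by one, so they are made part of the initial set. There
  are \<open>d - 1\<close> common neighbours; they are independent, and each has
  \<open>d - 2\<close> edges apart from those to \<open>r\<close> and \<open>b\<close>. To differ,
  their numbers of red edges among these must be 0, ..., \<open>d - 2\<close>. The value 0 goes to
  \<open>c\<close> and \<open>d - 2\<close> to \<open>z0\<close>, which is therefore no
  server.\<close>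

lemma start_c4_big:
  assumes tf: tri_free and d: "4 \<le> d" and V: "r \<in> V" "b \<in> V" and rb: "r \<noteq> b"
    and i0: "card (N r \<inter> N b) + 1 = d"
  shows "\<exists>C. distinguishes C"
proof -
  define X where "X = N r \<inter> N b"
  have finX: "finite X" using fin_N V by (simp add: X_def)
  have cX: "card X = d - 1" using i0 by (simp add: X_def)
  have "\<exists>c z0. c \<in> X \<and> z0 \<in> X \<and> c \<noteq> z0 \<and> ((\<forall>x\<in>X. N x = N c) \<or> N z0 \<noteq> N c)"
  proof (cases "\<exists>x\<in>X. \<exists>y\<in>X. N x \<noteq> N y")
    case True then show ?thesis by metis
  next
    case False
    have "\<not> card X \<le> Suc 0" using cX d by simp
    then obtain x y where "x \<in> X" "y \<in> X" "x \<noteq> y" using card_le_Suc0_iff_eq[OF finX] by blast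
    then show ?thesis using False by blast
  qed
  then obtain c z0 where cz: "c \<in> X" "z0 \<in> X" "c \<noteq> z0" "(\<forall>x\<in>X. N x = N c) \<or> N z0 \<noteq> N c" by blast
  \<comment> \<open>All members of \<open>Q\<close> but \<open>z0\<close> will be servers; the class \<open>N c - {r, b}\<close> cannot do without a server
    that is no twin of \<open>c\<close>, unless all members of \<open>X\<close> are twins.\<close>
  define Q where "Q = X - {c}"
  define F where "F = {r, b, c}"
  define C0 where "C0 = (\<lambda>u v. u = r \<or> v = r)"
  define D where "D = d - 2"
  have XV: "x \<in> V" "x \<in> N r" "x \<in> N b" "r \<in> N x" "b \<in> N x" if "x \<in> X" for x
    using that N_V N_sym unfolding X_def by blast+
  note cV = XV[OF cz(1)]
  have nX: "x \<notin> X" if "y \<in> X" "x \<in> N y" for x y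
    using tri_freeD[OF tf XV(2)[OF that(1)]] that by (auto simp: X_def)
  have bN: "b \<notin> N r" "r \<notin> N b" using tri_freeD[OF tf cV(2,5)] tri_freeD[OF tf cV(3,4)] by auto
  have ne: "r \<notin> X" "b \<notin> X" using bN unfolding X_def using N_irr by blast+
  have rc: "r \<noteq> c" "b \<noteq> c" using ne cz(1) by auto
  have QX: "x \<in> X" "x \<noteq> c" if "x \<in> Q" for x using that by (auto simp: Q_def)
  have finQ: "finite Q" using finX by (simp add: Q_def)
  have cQ: "card Q = D" using cX cz(1) finX d unfolding Q_def D_def by simp
  have QVF: "Q \<subseteq> V - F" using QX XV ne unfolding F_def by blast
  have zQ: "z0 \<in> Q" using cz by (auto simp: Q_def)
  have fwd: "N x - F - Q = N x - {r, b}" if "x \<in> X" for x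
    using nX[OF that] cz(1) unfolding F_def Q_def by blast
  have fwd_card: "card (N x - {r, b}) = D" if "x \<in> X" for x
    using card_N[of x] XV[OF that] rb unfolding D_def by (subst card_Diff_subset) auto
  have W: "v \<notin> N r \<or> v \<notin> N b" "v \<in> N c \<Longrightarrow> v \<notin> N r \<and> v \<notin> N b" if v: "v \<in> V - F - Q" for v
  proof -
    show "v \<notin> N r \<or> v \<notin> N b" using v unfolding Q_def X_def F_def by blast
    show "v \<notin> N r \<and> v \<notin> N b" if "v \<in> N c" using tri_freeD[OF tf cV(2) that] tri_freeD[OF tf cV(3) that] by blast
  qed
  have NF: "N v \<inter> F = {} \<or> N v \<inter> F = {r} \<or> N v \<inter> F = {b} \<or> N v \<inter> F = {c}" if v: "v \<in> V - F - Q" for v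
  proof -
    have s: "r \<in> N v \<longleftrightarrow> v \<in> N r" "b \<in> N v \<longleftrightarrow> v \<in> N b" "c \<in> N v \<longleftrightarrow> v \<in> N c" by (rule N_sym)+
    have "\<not> (r \<in> N v \<and> b \<in> N v)" "\<not> (r \<in> N v \<and> c \<in> N v)" "\<not> (b \<in> N v \<and> c \<in> N v)"
      unfolding s using W[OF v] by blast+
    then show ?thesis unfolding F_def by blast
  qed
  have \<delta>W: "d - 1 \<le> \<delta> F v" if v: "v \<in> V - F - Q" for v
  proof -
    have "card (N v \<inter> F) \<le> 1" using NF[OF v] by (elim disjE) simp_all
    then show ?thesis using \<delta>_add[of v F] v by auto
  qed
  have symC0: "symc C0" unfolding symc_def C0_def by blast
  have FV: "F \<subseteq> V" using V cV unfolding F_def by blast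
  have few: "card (N v \<inter> {r}) + 3 \<le> d" for v
  proof -
    have "card (N v \<inter> {r}) \<le> card {r}" by (intro card_mono) auto
    then show ?thesis using d by simp
  qed
  interpret E: extension V A d F "{r}"
    by unfold_locales (use FV few d in \<open>auto simp: F_def\<close>)
  have D2: "2 \<le> D" using d by (simp add: D_def)
  have "\<not> Q \<subseteq> {z0}" using cQ D2 card_mono[of "{z0}" Q] by auto
  then obtain z1 where z1: "z1 \<in> Q" "z1 \<noteq> z0" by blast
  obtain q where q: "bij_betw q Q {1..D}" "q z0 = D"
  proof -
    have "\<exists>q. bij_betw q Q {1..card Q} \<and> q z0 = D \<and> q z1 = 1"
      by (rule bij_prescribed_pair[OF finQ zQ z1(1) z1(2)[symmetric]]) (use cQ D2 in auto)
    then show ?thesis using that cQ by auto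
  qed
  have q_range: "1 \<le> q x \<and> q x \<le> D" if "x \<in> Q" for x using q(1) that by (auto simp: bij_betw_def)
  have q_inj: "x = y" if "x \<in> Q" "y \<in> Q" "q x = q y" for x y using q(1) that by (auto simp: bij_betw_def inj_on_def)
  interpret S: class_step V A d F "{r}" F Q C0 "\<lambda>_ _. False" q
  proof unfold_locales
    fix v assume v: "v \<in> V - F - Q"
    show "card Q + 1 \<le> \<delta> F v" using \<delta>W[OF v] cQ d unfolding D_def by linarith
    assume att: "N v \<inter> F \<noteq> {}"
    have "card (N v \<inter> F) = 1" using NF[OF v] att by (elim disjE) simp_all
    then have \<delta>1: "\<delta> F v = d - 1" using \<delta>_add[of v F] v by simp
    consider "N v \<inter> F = {r}" | "N v \<inter> F = {b}" | "N v \<inter> F = {c}" using NF[OF v] att by blast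
    then have "card (cls F C0 v - Q) \<le> max 1 (d - 2)"
    proof cases
      case 1
      have "cls F C0 v - Q \<subseteq> N r - X"
      proof
        fix w assume w: "w \<in> cls F C0 v - Q"
        then have e: "N w \<inter> F = {r}" using cls_N[of w F C0 v] 1 by auto
        have "r \<in> N w" using inter_mem[OF e, of r] by (auto simp: F_def)
        moreover have "w \<notin> X" using w cls_sub[of F C0 v] unfolding Q_def F_def by blast
        ultimately show "w \<in> N r - X" using N_sym by blast
      qed
      then have "card (cls F C0 v - Q) \<le> card (N r - X)" using fin_N V by (intro card_mono) auto
      also have "\<dots> = d - card X" using finX card_N V by (subst card_Diff_subset) (auto simp: X_def)
      finally show ?thesis using cX d by simp
    next
      case 2
      have "cls F C0 v - Q \<subseteq> N b - X"
      proof
        fix w assume w: "w \<in> cls F C0 v - Q"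
        then have e: "N w \<inter> F = {b}" using cls_N[of w F C0 v] 2 by auto
        have "b \<in> N w" using inter_mem[OF e, of b] by (auto simp: F_def)
        moreover have "w \<notin> X" using w cls_sub[of F C0 v] unfolding Q_def F_def by blast
        ultimately show "w \<in> N b - X" using N_sym by blast
      qed
      then have "card (cls F C0 v - Q) \<le> card (N b - X)" using fin_N V by (intro card_mono) auto
      also have "\<dots> = d - card X" using finX card_N V by (subst card_Diff_subset) (auto simp: X_def)
      finally show ?thesis using cX d by simp
    next
      case 3
      have "cls F C0 v - Q \<subseteq> N c - {r, b}"
      proof
        fix w assume w: "w \<in> cls F C0 v - Q"
        then have e: "N w \<inter> F = {c}" using cls_N[of w F C0 v] 3 by auto
        have "c \<in> N w" using inter_mem[OF e, of c] by (auto simp: F_def)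
        moreover have "w \<notin> {r, b}" using w cls_sub[of F C0 v] unfolding F_def by blast
        ultimately show "w \<in> N c - {r, b}" using N_sym by blast
      qed
      then have "card (cls F C0 v - Q) \<le> card (N c - {r, b})" using fin_N cV by (intro card_mono) auto
      then show ?thesis using fwd_card[OF cz(1)] unfolding D_def by simp
    qed
    then show "card (cls F C0 v - Q) \<le> max 1 (\<delta> F v - 1)" using \<delta>1 by (simp add: numeral_2_eq_2)
  qed (use FV symC0 finQ QVF cQ D2 D_def d in auto)
  have Sfwd: "S.fwd x = N x - {r, b}" if "x \<in> Q" for x unfolding S.fwd_def using fwd QX that by blast
  have Scard: "card (S.fwd x) = D" if "x \<in> Q" for x using Sfwd[OF that] fwd_card QX that by simp
  have serv: "S.servers = Q - {z0}"
    unfolding S.servers_def using Scard q_range q(2) q_inj zQ by (auto simp: order_less_le)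
  have "\<exists>C'. symc C' \<and> agree F C0 C' \<and> (\<forall>x\<in>Q. \<forall>y\<in>Q. C' x y = False) \<and>
     (\<forall>x\<in>Q. card {w\<in>S.fwd x. C' x w} = q x) \<and> E.inv1 (F \<union> Q) C' \<and> E.inv2 (F \<union> Q) C'"
  proof (rule S.class_step)
    show "q x \<le> card (S.fwd x)" if "x \<in> Q" for x using Scard q_range that by simp
    show "card (S.fwd x) \<le> \<delta> F v" if "v \<in> V - F - Q" "x \<in> Q" for v x
      using Scard[OF that(2)] \<delta>W[OF that(1)] unfolding D_def by linarith
    show "S.servers \<noteq> {}" unfolding serv using z1 by blast
    fix v assume v: "v \<in> V - F - Q" "0 < S.dem v" "N v \<inter> Q \<noteq> {}"
    define k where "k = card (S.dcls v)"
    define i where "i = card (N v \<inter> Q)"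
    define s where "s = card (N v \<inter> S.servers)"
    obtain x0 where x0: "x0 \<in> N v" "x0 \<in> Q" using v(3) by blast
    have vn: "v \<notin> N r" "v \<notin> N b" using tri_freeD[OF tf XV(2)[OF QX(1)[OF x0(2)]]] tri_freeD[OF tf XV(3)[OF QX(1)[OF x0(2)]]] x0 N_sym by blast+
    have iD: "i \<le> D" using S.N_Q_le[of v] cQ unfolding i_def by simp
    have is1: "i \<le> s + 1" and iz: "z0 \<notin> N v \<Longrightarrow> s = i"
    proof -
      have e: "N v \<inter> S.servers = N v \<inter> Q - {z0}" unfolding serv by blast
      show "i \<le> s + 1" unfolding s_def i_def e by (auto simp: card_Diff_singleton_if)
      show "s = i" if "z0 \<notin> N v" unfolding s_def i_def e using that by simp
    qed
    have kD: "k \<le> D \<and> (k = D \<longrightarrow> S.dcls v = S.fwd x)" if x: "x \<in> N v" "x \<in> Q" for x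
    proof -
      have "v \<in> S.fwd x" using S.touched[OF v(1)] x by blast
      then have sub: "S.dcls v \<subseteq> S.fwd x" using S.dcls_fwd x by blast
      have "card (S.dcls v) \<le> card (S.fwd x)" using sub S.fin_fwd x by (intro card_mono) auto
      moreover have "S.dcls v = S.fwd x" if "card (S.dcls v) = card (S.fwd x)"
        using card_subset_eq[OF S.fin_fwd[OF x(2)] sub that] .
      ultimately show ?thesis unfolding k_def using Scard[OF x(2)] by auto
    qed
    have cc: "1 \<le> card (S.dcls ` S.fwd x) \<and> (k < D \<longrightarrow> 2 \<le> card (S.dcls ` S.fwd x))" if x: "x \<in> N v" "x \<in> Q" for x
    proof -
      have vx: "v \<in> S.fwd x" using S.touched[OF v(1)] x by blast
      have fi: "finite (S.dcls ` S.fwd x)" using S.fin_fwd x by blast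
      have 1: "1 \<le> card (S.dcls ` S.fwd x)" using vx fi by (simp add: Suc_le_eq card_gt_0_iff) blast
      have "k = D" if "card (S.dcls ` S.fwd x) = 1"
      proof -
        from that obtain B where "S.dcls ` S.fwd x = {B}" by (auto simp: card_1_singleton_iff)
        then have "S.dcls w = S.dcls v" if "w \<in> S.fwd x" for w using that vx by (metis image_eqI singletonD)
        then have "S.fwd x \<subseteq> S.dcls v" using S.dcls_refl S.fwdD by blast
        then have "S.fwd x = S.dcls v" using S.dcls_fwd[OF vx x(2)] by blast
        then show ?thesis using Scard[OF x(2)] unfolding k_def by simp
      qed
      then show ?thesis using 1 by linarith
    qed
    have "1 \<le> s \<and> (\<forall>x\<in>N v \<inter> S.servers. S.dem v * (D - card (S.dcls ` S.fwd x)) \<le> s * (k - 1))"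
    proof (cases "v \<in> N c")
      case False
      have "N v \<inter> F = {}" using vn False N_sym[of v] unfolding F_def by blast
      then have "\<delta> F v = d" using \<delta>_add[of v F] v(1) by simp
      then have dem: "S.dem v = k - (D + 1 - i)"
        using iD D2 unfolding S.dem_def k_def[symmetric] i_def[symmetric] D_def by auto
      have "1 \<le> s" using v(2) dem kD[OF x0] is1 by linarith
      moreover have "S.dem v * (D - card (S.dcls ` S.fwd x)) \<le> s * (k - 1)" if "x \<in> N v \<inter> S.servers" for x
      proof -
        have x: "x \<in> N v" "x \<in> Q" using that serv by auto
        show ?thesis unfolding dem
          by (rule hall_arith_free) (use kD[OF x] cc[OF x] iD is1 v(2) dem in auto)
      qed
      ultimately show ?thesis by blast
    next
      case True
      have "N v \<inter> F = {c}" using vn True N_sym[of v] unfolding F_def by blast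
      then have "\<delta> F v = d - 1" using \<delta>_add[of v F] v(1) by simp
      then have dem: "S.dem v = k - max 1 (D - i)"
        unfolding S.dem_def k_def[symmetric] i_def[symmetric] D_def by auto
      show ?thesis
      proof (cases "z0 \<in> N v")
        case zn: False
        have si: "s = i" using iz zn by blast
        have i1: "1 \<le> i" using v(3) finQ unfolding i_def by (simp add: Suc_le_eq card_gt_0_iff)
        have "S.dem v * (D - card (S.dcls ` S.fwd x)) \<le> s * (k - 1)" if "x \<in> N v \<inter> S.servers" for x
        proof -
          have x: "x \<in> N v" "x \<in> Q" using that serv by auto
          note ar = hall_arith[of k D i D, folded dem]
          show ?thesis
          proof (cases "k < D")
            case True
            then have "S.dem v * (D - card (S.dcls ` S.fwd x)) \<le> S.dem v * (D - 2)" using cc[OF x] by (intro mult_le_mono2) auto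
            also have "\<dots> \<le> i * (k - 1)" by (rule ar(1)) (use kD[OF x] iD in auto)
            finally show ?thesis unfolding si .
          next
            case False
            show ?thesis unfolding si
              by (rule mult_le_mono) (use ar(2) kD[OF x] iD i1 cc[OF x] False in auto)
          qed
        qed
        then show ?thesis using si i1 by blast
      next
        case zv: True
        show ?thesis
        proof (cases "\<forall>x\<in>X. N x = N c")
          case tw: True
          have "N v \<inter> Q = Q"
          proof -
            have "x \<in> N v" if "x \<in> Q" for x using tw QX[OF that] \<open>v \<in> N c\<close> N_sym by blast
            then show ?thesis by blast
          qed
          then have iD': "i = D" using cQ by (simp add: i_def)
          have "S.dem v * (D - card (S.dcls ` S.fwd x)) \<le> s * (k - 1)" if "x \<in> N v \<inter> S.servers" for x
          proof -
            have x: "x \<in> N v" "x \<in> Q" using that serv by auto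
            have "(k - 1) * (D - card (S.dcls ` S.fwd x)) \<le> (k - 1) * s"
              by (rule mult_le_mono2) (use cc[OF x] is1 iD' in linarith)
            then show ?thesis unfolding dem iD' by (simp add: mult.commute)
          qed
          moreover have "1 \<le> s" using is1 iD' D2 by linarith
          ultimately show ?thesis by blast
        next
          case False
          then have zc: "N z0 \<noteq> N c" using cz(4) by blast
          \<comment> \<open>A class of \<open>D\<close> vertices adjacent to both \<open>c\<close>
            and \<open>z0\<close> would make these two twins.\<close>
          have "k \<noteq> D"
          proof
            assume kD': "k = D"
            have "S.dcls v \<subseteq> N c - {r, b}"
            proof
              fix w assume w: "w \<in> S.dcls v"
              have "N w \<inter> F = {c}" using w \<open>N v \<inter> F = {c}\<close> unfolding S.dcls_def cls_def by auto
              then have "c \<in> N w" by blast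
              moreover have "w \<notin> {r, b}" using w S.dcls_sub[of v] unfolding F_def by blast
              ultimately show "w \<in> N c - {r, b}" using N_sym by blast
            qed
            then have "S.dcls v = N c - {r, b}"
              using fwd_card[OF cz(1)] kD' fin_N cV(1) unfolding k_def by (intro card_subset_eq) auto
            moreover have "S.dcls v = N z0 - {r, b}" using kD[OF zv zQ] kD' Sfwd[OF zQ] by simp
            ultimately have "N z0 - {r, b} = N c - {r, b}" by simp
            moreover have "{r, b} \<subseteq> N z0" "{r, b} \<subseteq> N c" using XV[OF cz(2)] cV by auto
            ultimately show False using zc by blast
          qed
          then have kl: "k < D" using kD[OF x0] by linarith
          note ar = hall_arith_missing[OF kl iD _ _ is1, folded dem]
          have "S.dem v * (D - card (S.dcls ` S.fwd x)) \<le> s * (k - 1)" if "x \<in> N v \<inter> S.servers" for x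
          proof -
            have x: "x \<in> N v" "x \<in> Q" using that serv by auto
            show ?thesis by (rule ar(1)) (use v(2) cc[OF x] kl in auto)
          qed
          moreover have "1 \<le> s" by (rule ar(2)[of 2]) (use v(2) in auto)
          ultimately show ?thesis by blast
        qed
      qed
    qed
    then have s1: "1 \<le> s" and hl: "\<And>x. x \<in> N v \<inter> S.servers \<Longrightarrow> S.dem v * (D - card (S.dcls ` S.fwd x)) \<le> s * (k - 1)" by blast+
    have "N v \<inter> S.servers \<noteq> {}" using s1 unfolding s_def by auto
    moreover have "S.dem v * (card (S.fwd x) - card (S.dcls ` S.fwd x)) \<le> card (N v \<inter> S.servers) * (card (S.dcls v) - 1)"
      if x: "x \<in> N v \<inter> S.servers" for x
    proof -
      have "x \<in> Q" using x serv by blast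
      then show ?thesis using hl[OF x] Scard unfolding s_def k_def by simp
    qed
    ultimately show "N v \<inter> S.servers \<noteq> {} \<and> (\<forall>x\<in>N v \<inter> S.servers. S.dem v * (card (S.fwd x) - card (S.dcls ` S.fwd x))
      \<le> card (N v \<inter> S.servers) * (card (S.dcls v) - 1))" by blast
  qed
  then obtain C' where C': "symc C'" "agree F C0 C'" "\<And>x. x \<in> Q \<Longrightarrow> card {w\<in>S.fwd x. C' x w} = q x"
     "E.inv1 (F \<union> Q) C'" "E.inv2 (F \<union> Q) C'" by blast
  \<comment> \<open>From here on \<open>F \<union> Q\<close> is the initial set; each member of
    \<open>Q\<close> has a red edge to \<open>r\<close> and a blue one to \<open>b\<close>.\<close>
  interpret E': extension V A d "F \<union> Q" "{r}"
    by unfold_locales (use FV QVF few d in \<open>auto simp: F_def\<close>)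
  obtain C where C: "symc C" "agree (F \<union> Q) C' C" "\<And>\<phi>. aut \<phi> \<Longrightarrow> pres C \<phi> \<Longrightarrow> \<forall>v\<in>F \<union> Q. \<phi> v = v \<Longrightarrow> \<forall>v\<in>V. \<phi> v = v"
    "\<And>v. v \<in> V - (F \<union> Q) \<Longrightarrow> E'.sat C v" using E'.extension[OF C'(1,4,5)] by blast
  have "\<forall>v\<in>F \<union> Q. \<phi> v = v" if \<phi>: "aut \<phi>" "pres C \<phi>" for \<phi>
  proof -
    have s1: "\<exists>a\<in>N v - {r}. C v a" and s2: "\<exists>a\<in>N v - {r}. \<not> C v a" if "v \<in> V - (F \<union> Q)" for v
      using C(4)[OF that] unfolding E'.sat_def by blast+
    have CF: "C u v = C0 u v" if "u \<in> F" "v \<in> N u" for u v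
      using agreeN[OF C(2), of u v] agreeN[OF C'(2), of u v] that by auto
    have Cr: "C r u" if "u \<in> N r" for u using CF[OF _ that] by (simp add: C0_def F_def)
    have Cb: "\<not> C b u" if "u \<in> N b" for u using CF[OF _ that] rb bN that by (auto simp: C0_def F_def)
    have Cc: "C c u \<longleftrightarrow> u = r" if "u \<in> N c" for u using CF[OF _ that] rc by (auto simp: C0_def F_def)
    have CQ: "C x r" "\<not> C x b" "C x w = C' x w" if "x \<in> Q" "w \<in> N x" for x w
      using Cr[of x] Cb[of x] symcD[OF C(1)] XV[OF QX(1)[OF that(1)]] agreeN[OF C(2) _ that(2)] that by auto
    have r: "\<phi> r = r"
    proof (rule fix_allred[OF \<phi> V(1) Cr])
      fix v assume v: "v \<in> V" "v \<noteq> r"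
      consider "v = b" | "v = c" | "v \<in> Q" | "v \<in> V - (F \<union> Q)" using v unfolding F_def by blast
      then show "\<exists>a\<in>N v. \<not> C v a"
      proof cases
        case 1 then show ?thesis using cV Cb by blast
      next
        case 2 then show ?thesis using Cc cV rb by blast
      next
        case 3 then show ?thesis using CQ(2) XV[OF QX(1)[OF 3]] by blast
      next
        case 4 then show ?thesis using s2 by blast
      qed
    qed
    have b: "\<phi> b = b"
    proof (rule fix_allblue[OF \<phi> V(2) Cb])
      fix v assume v: "v \<in> V" "v \<noteq> b"
      consider "v = r" | "v = c" | "v \<in> Q" | "v \<in> V - (F \<union> Q)" using v unfolding F_def by blast
      then show "\<exists>a\<in>N v. C v a"
      proof cases
        case 1 then show ?thesis using cV Cr by blast
      next
        case 2 then show ?thesis using Cc cV by blast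
      next
        case 3 then show ?thesis using CQ(1) XV[OF QX(1)[OF 3]] by blast
      next
        case 4 then show ?thesis using s1 by blast
      qed
    qed
    have rX: "rdeg C x = q x + 1" if x: "x \<in> Q" for x
    proof -
      have "{u\<in>N x. C x u} = insert r {w\<in>S.fwd x. C' x w}"
        using CQ[OF x] XV[OF QX(1)[OF x]] Sfwd[OF x] by auto
      moreover have "r \<notin> {w\<in>S.fwd x. C' x w}" using Sfwd[OF x] by blast
      moreover have "finite {w\<in>S.fwd x. C' x w}" using S.fin_fwd[OF x] by simp
      ultimately show ?thesis using C'(3)[OF x] unfolding rdeg_def by simp
    qed
    have rc1: "rdeg C c = 1"
    proof -
      have "{u\<in>N c. C c u} = {r}" using Cc cV by blast
      then show ?thesis unfolding rdeg_def by simp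
    qed
    have im: "\<phi> x \<in> X" if "x \<in> X" for x
      using aut_N_mem[OF \<phi>(1) XV(1)[OF that] V(1)] aut_N_mem[OF \<phi>(1) XV(1)[OF that] V(2)] r b that unfolding X_def by auto
    have c: "\<phi> c = c"
    proof (rule ccontr)
      assume "\<phi> c \<noteq> c"
      then have "\<phi> c \<in> Q" using im[OF cz(1)] by (simp add: Q_def)
      then show False using rX[of "\<phi> c"] aut_rdeg[OF \<phi> cV(1)] rc1 q_range[of "\<phi> c"] by simp
    qed
    have "\<phi> x = x" if x: "x \<in> Q" for x
    proof -
      have "\<phi> x \<noteq> c" using c aut_inj[OF \<phi>(1), of x c] XV(1) QX[OF x] cV(1) by metis
      then have px: "\<phi> x \<in> Q" using im[OF QX(1)[OF x]] by (simp add: Q_def)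
      then have "q (\<phi> x) = q x" using rX[OF px] rX[OF x] aut_rdeg[OF \<phi> XV(1)[OF QX(1)[OF x]]] by simp
      then show ?thesis using q_inj px x by blast
    qed
    then show ?thesis using r b c unfolding F_def by blast
  qed
  then show ?thesis unfolding distinguishes_def using C(1,3) by blast
qed

text \<open>The walk may be injective or run around a cycle, so double rays and cycles are treated
  together. The vertex \<open>u 0\<close> has only red edges, and apart from \<open>u 1\<close> and
  \<open>u (-1)\<close> all other vertices of the walk have only blue ones. The direction is marked
  at \<open>u 1\<close>, where only the edge to \<open>u 2\<close> is blue.\<close>

lemma start_walk:
  fixes u :: "int \<Rightarrow> 'a"
  assumes d: "3 \<le> d" and uV: "\<And>i. u i \<in> V"
    and nb: "\<And>i. N (u i) \<inter> range u = {u (i - 1), u (i + 1)}" and nbk: "\<And>i. u (i - 1) \<noteq> u (i + 1)"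
    and one: "\<And>v x y. v \<notin> range u \<Longrightarrow> x \<in> N v \<inter> range u \<Longrightarrow> y \<in> N v \<inter> range u \<Longrightarrow> x = y"
    and far: "u 2 \<noteq> u (-1)" "u (-2) \<noteq> u 1"
  shows "\<exists>C. distinguishes C"
proof -
  let ?F = "range u"
  define C0 where "C0 = (\<lambda>v w. v = u 0 \<or> w = u 0 \<or> (v = u 1 \<and> w \<noteq> u 2) \<or> (w = u 1 \<and> v \<noteq> u 2))"
  have nbi: "x = u (i - 1) \<or> x = u (i + 1)" if "x \<in> N (u i)" "x \<in> ?F" for x i using nb[of i] that by blast
  have adj: "u (i - 1) \<in> N (u i)" "u (i + 1) \<in> N (u i)" for i using nb[of i] by blast+
  have step: "u i \<noteq> u (i + 1)" for i using adj(2)[of i] N_irr by metis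
  have ne: "u 1 \<noteq> u 0" "u (-1) \<noteq> u 0" "u 2 \<noteq> u 1" "u 2 \<noteq> u 0" "u 1 \<noteq> u (-1)" "u (-2) \<noteq> u 0" "u (-2) \<noteq> u (-1)"
    using step[of 0] step[of "-1"] step[of 1] nbk[of 1] nbk[of 0] nbk[of "-1"] step[of "-2"] by auto
  have ad: "u 1 \<in> N (u 0)" "u (-1) \<in> N (u 0)" "u 0 \<in> N (u 1)" "u 2 \<in> N (u 1)" "u 0 \<in> N (u (-1))" "u (-2) \<in> N (u (-1))"
    using adj[of 0] adj[of 1] adj[of "-1"] by auto
  have sym0: "symc C0" unfolding symc_def C0_def by blast
  show ?thesis
  proof (rule start[of "{}" ?F C0])
    fix v assume v: "v \<in> V - ?F"
    have le1: "card (N v \<inter> ?F) \<le> 1"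
    proof -
      have "finite (N v \<inter> ?F)" using fin_N v by blast
      moreover have "\<forall>x\<in>N v \<inter> ?F. \<forall>y\<in>N v \<inter> ?F. x = y" using one[of v] v by blast
      ultimately show ?thesis using card_le_Suc0_iff_eq[of "N v \<inter> ?F"] by simp
    qed
    show "card (N v \<inter> {}) + 3 \<le> d" using d by simp
    have \<delta>: "d - 1 \<le> \<delta> ?F v" using le1 \<delta>_add[of v ?F] v by auto
    then show "(\<exists>f\<in>N v \<inter> ?F - {}. C0 v f) \<and> (\<exists>f\<in>N v \<inter> ?F - {}. \<not> C0 v f)" if "\<delta> ?F v \<le> 1" using that d by linarith
    assume att: "N v \<inter> ?F \<noteq> {}"
    then obtain i where i: "u i \<in> N v" by blast
    have "card (cls ?F C0 v) \<le> card (N (u i) - {u (i - 1), u (i + 1)})"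
    proof (rule cls_bound)
      fix w assume w: "w \<in> V - ?F" "N w \<inter> ?F = N v \<inter> ?F"
      then have "u i \<in> N w" using i by blast
      then have "w \<in> N (u i)" using N_sym by blast
      then show "w \<in> N (u i) - {u (i - 1), u (i + 1)}" using w(1) by blast
    qed (use fin_N uV in auto)
    also have "\<dots> = d - 2" using card_N[OF uV] adj[of i] nbk[of i] by (subst card_Diff_subset) auto
    finally show "card (cls ?F C0 v) \<le> max 1 (\<delta> ?F v - 1)" using \<delta> by linarith
  next
    fix C \<phi> assume C: "symc C" "agree ?F C0 C" and s1': "\<And>v. v \<in> V - ?F \<Longrightarrow> \<exists>a\<in>N v - {}. C v a"
      and s2': "\<And>v. v \<in> V - ?F \<Longrightarrow> \<exists>a\<in>N v - {}. \<not> C v a" and \<phi>: "aut \<phi>" "pres C \<phi>"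
    have s1: "\<exists>a\<in>N v. C v a" if "v \<in> V - ?F" for v using s1'[OF that] by blast
    have s2: "\<exists>a\<in>N v. \<not> C v a" if "v \<in> V - ?F" for v using s2'[OF that] by blast
    have e: "C (u i) w = C0 (u i) w" if "w \<in> N (u i)" for i w by (rule agreeN[OF C(2) _ that]) simp
    define B where "B = ?F - {u 0, u 1, u (-1)}"
    have blue: "\<not> C x w" if x: "x \<in> B" "w \<in> N x" for x w
    proof -
      obtain i where i: "x = u i" "u i \<noteq> u 0" "u i \<noteq> u 1" "u i \<noteq> u (-1)" using x unfolding B_def by blast
      have "w \<noteq> u 0"
      proof
        assume "w = u 0"
        then have "u i \<in> N (u 0)" using x i N_sym by blast
        then show False using nbi[of "u i" 0] i by auto
      qed
      moreover have "u i = u 2" if "w = u 1"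
      proof -
        have "u i \<in> N (u 1)" using x i that N_sym by blast
        then show ?thesis using nbi[of "u i" 1] i by auto
      qed
      ultimately show ?thesis using e[of w i] x i unfolding C0_def by auto
    qed
    have red: "\<exists>a\<in>N v. C v a" if v: "v \<in> V - B" for v
    proof -
      consider "v \<in> V - ?F" | "v = u 0" | "v = u 1" | "v = u (-1)" using v unfolding B_def by blast
      then show ?thesis
      proof cases
        case 1 then show ?thesis by (rule s1)
      next
        case 2 then show ?thesis using e[OF ad(1)] ad(1) unfolding C0_def by blast
      next
        case 3 then show ?thesis using e[OF ad(3)] ad(3) unfolding C0_def by blast
      next
        case 4 then show ?thesis using e[OF ad(5)] ad(5) unfolding C0_def by blast
      qed
    qed
    have BV: "B \<subseteq> V" using uV unfolding B_def by blast
    have \<phi>B: "\<phi> x \<in> B" if x: "x \<in> B" for x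
    proof -
      have xV: "x \<in> V" using x BV by blast
      have "\<forall>w\<in>N x. \<not> C x w" using blue[OF x] by blast
      then have "\<forall>w\<in>N (\<phi> x). \<not> C (\<phi> x) w" using aut_allred(2)[OF \<phi> xV] by blast
      then show ?thesis using red[of "\<phi> x"] aut_V[OF \<phi>(1) xV] by blast
    qed
    have u0: "\<phi> (u 0) = u 0"
    proof (rule fix_allred[OF \<phi> uV])
      show "C (u 0) w" if "w \<in> N (u 0)" for w using e[OF that] unfolding C0_def by blast
      fix v assume v: "v \<in> V" "v \<noteq> u 0"
      consider "v \<in> V - ?F" | "v \<in> B" | "v = u 1" | "v = u (-1)" using v unfolding B_def by blast
      then show "\<exists>a\<in>N v. \<not> C v a"
      proof cases
        case 1 then show ?thesis by (rule s2)
      next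
        case 2
        then have "N v \<noteq> {}" using adj unfolding B_def by blast
        then show ?thesis using blue[OF 2] by blast
      next
        case 3
        have "\<not> C0 (u 1) (u 2)" using ne unfolding C0_def by auto
        then show ?thesis using e[OF ad(4)] ad(4) 3 by blast
      next
        case 4
        have "\<not> C0 (u (-1)) (u (-2))" using ne far unfolding C0_def by auto
        then show ?thesis using e[OF ad(6)] ad(6) 4 by blast
      qed
    qed
    \<comment> \<open>The image of \<open>x\<close> has two neighbours on the walk,
      \<open>u 0\<close> and the all-blue \<open>\<phi> y\<close>, so by \<open>one\<close> it lies
      on the walk itself.\<close>
    have pm: "\<phi> x \<in> {u 1, u (-1)}" if x: "x \<in> N (u 0)" "y \<in> N x" "y \<in> B" for x y
    proof -
      have V: "x \<in> V" "y \<in> V" using x N_V by blast+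
      have 1: "\<phi> x \<in> N (u 0)" using aut_N_mem[OF \<phi>(1) V(1) uV] x(1) u0 by metis
      have 2: "\<phi> y \<in> N (\<phi> x)" using aut_N_mem[OF \<phi>(1) V(2,1)] x(2) by blast
      have 3: "\<phi> y \<in> B" by (rule \<phi>B[OF x(3)])
      have "\<phi> x \<in> ?F"
      proof (rule ccontr)
        assume "\<phi> x \<notin> ?F"
        moreover have "u 0 \<in> N (\<phi> x)" using 1 N_sym by blast
        ultimately have "u 0 = \<phi> y" using one[of "\<phi> x" "u 0" "\<phi> y"] 2 3 unfolding B_def by blast
        then have "u 0 \<in> B" using 3 by simp
        then show False by (simp add: B_def)
      qed
      then show ?thesis using nbi[OF 1] by auto
    qed
    have B2: "u 2 \<in> B" "u (-2) \<in> B" using ne far unfolding B_def by auto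
    have p1: "\<phi> (u 1) \<in> {u 1, u (-1)}" by (rule pm[OF ad(1,4) B2(1)])
    have m1: "\<phi> (u (-1)) \<in> {u 1, u (-1)}" by (rule pm[OF ad(2,6) B2(2)])
    have u1: "\<phi> (u 1) = u 1"
    proof (rule ccontr)
      assume "\<phi> (u 1) \<noteq> u 1"
      then have m: "\<phi> (u 1) = u (-1)" using p1 by blast
      \<comment> \<open>This is where \<open>3 \<le> d\<close> enters: \<open>u 1\<close> has a
        third neighbour, joined to it in red, whereas the only red edge at \<open>u (-1)\<close>
        leads to \<open>u 0\<close>.\<close>
      have "\<not> N (u 1) \<subseteq> {u 0, u 2}" using card_N[OF uV, of 1] d card_mono[of "{u 0, u 2}" "N (u 1)"] ne by auto
      then obtain w where w: "w \<in> N (u 1)" "w \<noteq> u 0" "w \<noteq> u 2" by blast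
      have "C (u 1) w" using e[OF w(1)] w unfolding C0_def by blast
      then obtain a where a: "a \<in> N (u (-1))" "a \<noteq> u 0" "C (u (-1)) a"
        using red_other[OF \<phi> u0 uV w(1,2)] unfolding m by blast
      have "a \<noteq> u 1" using nbi[of "u 1" "-1"] a(1) ne far by auto
      then show False using e[OF a(1)] a ne unfolding C0_def by auto
    qed
    have m1: "\<phi> (u (-1)) = u (-1)" using m1 u1 aut_inj[OF \<phi>(1) uV uV, of "-1" 1] ne by auto
    have go: "\<phi> s = s" if x: "\<phi> (u i) = u i" "{u (i - 1), u (i + 1)} = {p, s}" "\<phi> p = p" "p \<noteq> s" for i p s
    proof (cases "s \<in> B")
      case True
      have "s = u (i - 1) \<or> s = u (i + 1)" "p = u (i - 1) \<or> p = u (i + 1)" using x(2) by blast+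
      then have ps: "s \<in> N (u i)" "s \<in> V" "p \<in> V" using adj[of i] uV by auto
      have "\<phi> s \<in> N (u i)" using aut_N_mem[OF \<phi>(1) ps(2) uV, of i] ps(1) x(1) by simp
      moreover have "\<phi> s \<in> ?F" using \<phi>B[OF True] unfolding B_def by blast
      ultimately have "\<phi> s \<in> {p, s}" using nb[of i] x(2) by blast
      moreover have "\<phi> s \<noteq> p" using aut_inj[OF \<phi>(1) ps(2,3)] x(3,4) by auto
      ultimately show ?thesis by blast
    next
      case False
      have "s \<in> ?F" using x(2) by blast
      then have "s = u 0 \<or> s = u 1 \<or> s = u (-1)" using False unfolding B_def by blast
      then show ?thesis using u0 u1 m1 by auto
    qed
    have up: "\<phi> (u (int n)) = u (int n) \<and> \<phi> (u (int n + 1)) = u (int n + 1)" for n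
    proof (induction n)
      case 0 then show ?case using u0 u1 by simp
    next
      case (Suc n)
      have "\<phi> (u (int n + 2)) = u (int n + 2)"
        by (rule go[of "int n + 1" "u (int n)"]) (use Suc nbk[of "int n + 1"] in \<open>auto simp: add.commute\<close>)
      then show ?case using Suc by (simp add: algebra_simps)
    qed
    have down: "\<phi> (u (- int n)) = u (- int n) \<and> \<phi> (u (- int n - 1)) = u (- int n - 1)" for n
    proof (induction n)
      case 0 then show ?case using u0 m1 by simp
    next
      case (Suc n)
      have i: "- int n - 1 - 1 = - int n - 2" "- int n - 1 + 1 = - int n" "- int (Suc n) = - int n - 1" by simp_all
      have "\<phi> (u (- int n - 2)) = u (- int n - 2)"
      proof (rule go[of "- int n - 1" "u (- int n)"])
        show "{u (- int n - 1 - 1), u (- int n - 1 + 1)} = {u (- int n), u (- int n - 2)}" unfolding i by blast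
        show "u (- int n) \<noteq> u (- int n - 2)" using nbk[of "- int n - 1"] unfolding i by simp
      qed (use Suc in auto)
      then show ?case using Suc unfolding i(3) i(1) by blast
    qed
    show "\<forall>v\<in>?F. \<phi> v = v"
    proof
      fix v assume "v \<in> ?F"
      then obtain i where i: "v = u i" by blast
      show "\<phi> v = v" unfolding i using up[of "nat i"] down[of "nat (- i)"] by (cases "0 \<le> i") auto
    qed
  qed (use uV d sym0 in auto)
qed

section \<open>Nonbacktracking walks and short cycles\<close>

definition cyc :: "nat \<Rightarrow> (nat \<Rightarrow> 'a) \<Rightarrow> bool" where
  "cyc k f \<longleftrightarrow> 3 \<le> k \<and> inj_on f {..<k} \<and> (\<forall>i. i + 1 < k \<longrightarrow> A (f i) (f (i + 1))) \<and> A (f (k - 1)) (f 0)"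

lemma chord_cyc:
  fixes u :: "int \<Rightarrow> 'a"
  assumes adj: "\<And>i. A (u i) (u (i + 1))" and inj: "inj_on u {s..t}" and st: "s + 2 \<le> t" and a: "A (u s) (u t)"
  shows "cyc (nat (t - s) + 1) (\<lambda>i. u (s + int i))"
  unfolding cyc_def
proof (intro conjI allI impI)
  show "3 \<le> nat (t - s) + 1" using st by linarith
  show "inj_on (\<lambda>i. u (s + int i)) {..<nat (t - s) + 1}"
  proof (rule inj_onI)
    fix i j assume h: "i \<in> {..<nat (t - s) + 1}" "j \<in> {..<nat (t - s) + 1}" "u (s + int i) = u (s + int j)"
    have "s + int i = s + int j" by (rule inj_onD[OF inj h(3)]) (use h st in auto)
    then show "i = j" by simp
  qed
  show "A (u (s + int i)) (u (s + int (i + 1)))" for i using adj[of "s + int i"] by (simp add: algebra_simps)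
  show "A (u (s + int (nat (t - s) + 1 - 1))) (u (s + int 0))" using a A_sym st by simp
qed

lemma apex_cyc:
  fixes u :: "int \<Rightarrow> 'a"
  assumes adj: "\<And>i. A (u i) (u (i + 1))" and inj: "inj_on u {s..t}" and st: "s < t" and v: "v \<notin> range u" "A v (u s)" "A v (u t)"
  shows "cyc (nat (t - s) + 2) (\<lambda>i. if i = 0 then v else u (s + int i - 1))"
  unfolding cyc_def
proof (intro conjI allI impI)
  show "3 \<le> nat (t - s) + 2" using st by linarith
  show "inj_on (\<lambda>i. if i = 0 then v else u (s + int i - 1)) {..<nat (t - s) + 2}"
  proof (rule inj_onI)
    fix i j assume h: "i \<in> {..<nat (t - s) + 2}" "j \<in> {..<nat (t - s) + 2}"
      "(if i = 0 then v else u (s + int i - 1)) = (if j = 0 then v else u (s + int j - 1))"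
    show "i = j"
    proof (cases "i = 0 \<or> j = 0")
      case True then show ?thesis using h(3) v(1) by (auto split: if_splits)
    next
      case False
      then have "u (s + int i - 1) = u (s + int j - 1)" using h(3) by simp
      then have "s + int i - 1 = s + int j - 1" by (rule inj_onD[OF inj]) (use h st False in auto)
      then show "i = j" by simp
    qed
  qed
  show "A (if i = 0 then v else u (s + int i - 1)) (if i + 1 = 0 then v else u (s + int (i + 1) - 1))" for i
    using v(2) adj[of "s + int i - 1"] by (auto simp: algebra_simps)
  show "A (if nat (t - s) + 2 - 1 = 0 then v else u (s + int (nat (t - s) + 2 - 1) - 1)) (if 0 = (0::nat) then v else u (s + int 0 - 1))"
    using v(3) A_sym st by simp
qed

text \<open>By \<open>rep\<close> any two points of the walk bound a segment that neither a chord
  nor an outside vertex adjacent to both ends can close to a cycle. This covers a double ray in a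
  forest as well as a shortest cycle, where the shorter arc is taken.\<close>

lemma walk_props:
  fixes u :: "int \<Rightarrow> 'a"
  assumes adj: "\<And>i. A (u i) (u (i + 1))"
    and per: "\<And>s t. u s = u t \<Longrightarrow> u (s + 1) = u (t + 1) \<and> u (s - 1) = u (t - 1)"
    and rep: "\<And>x y. x \<in> range u \<Longrightarrow> y \<in> range u \<Longrightarrow> x \<noteq> y \<Longrightarrow> \<exists>s t. s < t \<and> inj_on u {s..t} \<and> {x, y} = {u s, u t} \<and>
      (\<forall>f. \<not> cyc (nat (t - s) + 1) f) \<and> (\<forall>f. \<not> cyc (nat (t - s) + 2) f)"
  shows "N (u i) \<inter> range u = {u (i - 1), u (i + 1)}"
    "\<And>v x y. v \<notin> range u \<Longrightarrow> x \<in> N v \<inter> range u \<Longrightarrow> y \<in> N v \<inter> range u \<Longrightarrow> x = y"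
proof -
  show "N (u i) \<inter> range u = {u (i - 1), u (i + 1)}"
  proof
    have "A (u i) (u (i + 1))" "A (u i) (u (i - 1))" using adj[of i] A_sym[OF adj[of "i - 1"]] by auto
    then show "{u (i - 1), u (i + 1)} \<subseteq> N (u i) \<inter> range u" using NI by blast
    show "N (u i) \<inter> range u \<subseteq> {u (i - 1), u (i + 1)}"
    proof
      fix y assume y: "y \<in> N (u i) \<inter> range u"
      then have ne: "u i \<noteq> y" using N_irr by blast
      obtain s t where st: "s < t" "inj_on u {s..t}" "{u i, y} = {u s, u t}" "\<forall>f. \<not> cyc (nat (t - s) + 1) f"
        using rep[of "u i" y] y ne by blast
      have "A (u s) (u t)" using st(3) y ND A_sym by (auto simp: doubleton_eq_iff)
      then have "\<not> s + 2 \<le> t" using chord_cyc[OF adj st(2)] st(4) by blast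
      then have t: "t = s + 1" using st(1) by linarith
      consider "u i = u s" "y = u t" | "u i = u t" "y = u s" using st(3) by (auto simp: doubleton_eq_iff)
      then show "y \<in> {u (i - 1), u (i + 1)}"
      proof cases
        case 1 then show ?thesis using per[of i s] t by simp
      next
        case 2 then show ?thesis using per[of i t] t by simp
      qed
    qed
  qed
  show "x = y" if v: "v \<notin> range u" "x \<in> N v \<inter> range u" "y \<in> N v \<inter> range u" for v x y
  proof (rule ccontr)
    assume "x \<noteq> y"
    then obtain s t where st: "s < t" "inj_on u {s..t}" "{x, y} = {u s, u t}" "\<forall>f. \<not> cyc (nat (t - s) + 2) f"
      using rep[of x y] v by blast
    have "A v (u s)" "A v (u t)" using st(3) v ND by (auto simp: doubleton_eq_iff)
    then show False using apex_cyc[OF adj st(2,1) v(1)] st(4) by blast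
  qed
qed

lemma nonbacktracking_walk:
  assumes d: "2 \<le> d" and xy: "A x y"
  shows "\<exists>u :: int \<Rightarrow> 'a. u 0 = x \<and> u 1 = y \<and> (\<forall>i. A (u i) (u (i + 1))) \<and> (\<forall>i. u (i - 1) \<noteq> u (i + 1))"
proof -
  define step where "step = (\<lambda>(a, b). (b, SOME c. c \<in> N b \<and> c \<noteq> a))"
  have step: "A b (snd (step (a, b))) \<and> snd (step (a, b)) \<noteq> a \<and> fst (step (a, b)) = b" if "A a b" for a b
  proof -
    have "card (N b) = d" using card_N A_V A_sym that by blast
    then have "\<not> N b \<subseteq> {a}" using d card_mono[of "{a}" "N b"] by auto
    then have "\<exists>c. c \<in> N b \<and> c \<noteq> a" by blast
    then have "(SOME c. c \<in> N b \<and> c \<noteq> a) \<in> N b \<and> (SOME c. c \<in> N b \<and> c \<noteq> a) \<noteq> a" by (rule someI_ex)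
    then show ?thesis unfolding step_def using ND by auto
  qed
  have walk: "\<exists>w :: nat \<Rightarrow> 'a. w 0 = a \<and> w 1 = b \<and> (\<forall>n. A (w n) (w (n + 1))) \<and> (\<forall>n. w n \<noteq> w (n + 2))" if ab: "A a b" for a b
  proof -
    define w where "w = (\<lambda>n. fst ((step ^^ n) (a, b)))"
    have inv: "A (fst ((step ^^ n) (a, b))) (snd ((step ^^ n) (a, b)))" for n
    proof (induction n)
      case 0 then show ?case using ab by simp
    next
      case (Suc n)
      then show ?case using step[of "fst ((step ^^ n) (a, b))" "snd ((step ^^ n) (a, b))"] by simp
    qed
    have s: "snd ((step ^^ n) (a, b)) = w (n + 1)" for n
      using step[OF inv[of n]] unfolding w_def by simp
    have "A (w n) (w (n + 1))" for n using inv[of n] unfolding s by (simp add: w_def)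
    moreover have "w n \<noteq> w (n + 2)" for n
      using step[OF inv[of n]] s[of "n + 1"] unfolding w_def by auto
    moreover have "w 0 = a" "w 1 = b" using s[of 0] by (auto simp: w_def)
    ultimately show ?thesis by blast
  qed
  obtain f :: "nat \<Rightarrow> 'a" where f: "f 0 = x" "f 1 = y" "\<And>n. A (f n) (f (n + 1))" "\<And>n. f n \<noteq> f (n + 2)" using walk[OF xy] by blast
  obtain g :: "nat \<Rightarrow> 'a" where g: "g 0 = y" "g 1 = x" "\<And>n. A (g n) (g (n + 1))" "\<And>n. g n \<noteq> g (n + 2)" using walk[OF A_sym[OF xy]] by blast
  \<comment> \<open>Two one-sided walks leave the edge between \<open>x\<close> and \<open>y\<close>
    in opposite directions; both descriptions are valid at 0 and 1.\<close>
  define u where "u = (\<lambda>i :: int. if 0 \<le> i then f (nat i) else g (nat (1 - i)))"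
  have uf: "u i = f (nat i)" if "0 \<le> i" for i using that by (simp add: u_def)
  have ug: "u i = g (nat (1 - i))" if "i \<le> 1" for i
  proof -
    from that consider "i = 1" | "i = 0" | "i < 0" by linarith
    then show ?thesis by cases (use f g in \<open>auto simp: u_def\<close>)
  qed
  have "A (u i) (u (i + 1))" for i
  proof (cases "0 \<le> i")
    case True
    then have "nat (i + 1) = nat i + 1" by simp
    then show ?thesis using f(3)[of "nat i"] uf[of i] uf[of "i + 1"] True by simp
  next
    case False
    then have "nat (1 - i) = nat (1 - (i + 1)) + 1" by simp
    then show ?thesis using A_sym[OF g(3)[of "nat (1 - (i + 1))"]] ug[of i] ug[of "i + 1"] False by simp
  qed
  moreover have "u (i - 1) \<noteq> u (i + 1)" for i
  proof (cases "1 \<le> i")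
    case True
    then have "nat (i + 1) = nat (i - 1) + 2" by simp
    then show ?thesis using f(4)[of "nat (i - 1)"] uf[of "i - 1"] uf[of "i + 1"] True by simp
  next
    case False
    then have "nat (1 - (i - 1)) = nat (1 - (i + 1)) + 2" by simp
    moreover have "i - 1 \<le> 1" "i + 1 \<le> 1" using False by auto
    ultimately show ?thesis using g(4)[of "nat (1 - (i + 1))"] ug[of "i - 1"] ug[of "i + 1"] by metis
  qed
  moreover have "u 0 = x" "u 1 = y" using f by (simp_all add: u_def)
  ultimately show ?thesis by blast
qed

text \<open>The induction makes the segment before a coincidence injective, so the coincidence would
  close a cycle.\<close>

lemma acyclic_inj:
  fixes u :: "int \<Rightarrow> 'a"
  assumes adj: "\<And>i. A (u i) (u (i + 1))" and nbk: "\<And>i. u (i - 1) \<noteq> u (i + 1)" and ac: "\<And>k f. \<not> cyc k f"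
  shows "inj u"
proof -
  have "u s \<noteq> u (s + int n)" if "0 < n" for s n
    using that
  proof (induction n arbitrary: s rule: less_induct)
    case (less n)
    show ?case
    proof
      assume eq: "u s = u (s + int n)"
      have "n \<noteq> 1" using eq adj[of s] A_irr by auto
      moreover have "n \<noteq> 2" using eq nbk[of "s + 1"] by (auto simp: algebra_simps)
      ultimately have n3: "3 \<le> n" using less.prems by linarith
      have inj: "inj_on u {s..s + int n - 1}"
      proof (rule inj_onI)
        fix a b assume ab: "a \<in> {s..s + int n - 1}" "b \<in> {s..s + int n - 1}" "u a = u b"
        have *: False if "a < b" "a \<in> {s..s + int n - 1}" "b \<in> {s..s + int n - 1}" "u a = u b" for a b
        proof -
          have "nat (b - a) < n" "0 < nat (b - a)" "a + int (nat (b - a)) = b" using that by auto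
          then show ?thesis using less.IH[of "nat (b - a)" a] that(4) by simp
        qed
        show "a = b" using *[of a b] *[of b a] ab by (metis linorder_cases)
      qed
      have "A (u s) (u (s + int n - 1))" using adj[of "s + int n - 1"] eq A_sym by simp
      then show False using chord_cyc[OF adj inj] n3 ac by force
    qed
  qed
  then have *: "u a \<noteq> u b" if "a < b" for a b using that by (metis zle_iff_zadd zless_iff_Suc_zadd zero_less_Suc)
  show ?thesis by (rule injI) (metis * linorder_cases)
qed

lemma start_girth:
  assumes d: "3 \<le> d" and ne: "V \<noteq> {}" and g: "\<And>k f. cyc k f \<Longrightarrow> 5 \<le> k"
  shows "\<exists>C. distinguishes C"
proof (cases "\<exists>k f. cyc k f")
  case False
  obtain x where x: "x \<in> V" using ne by blast
  have "N x \<noteq> {}" using card_N[OF x] d by auto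
  then obtain y where "A x y" using ND by blast
  then obtain u :: "int \<Rightarrow> 'a" where u: "\<And>i. A (u i) (u (i + 1))" "\<And>i. u (i - 1) \<noteq> u (i + 1)"
    using nonbacktracking_walk[of x y] d by auto
  have inj: "inj u" by (rule acyclic_inj[OF u]) (use False in blast)
  have rep: "\<exists>s t. s < t \<and> inj_on u {s..t} \<and> {x, y} = {u s, u t} \<and>
      (\<forall>f. \<not> cyc (nat (t - s) + 1) f) \<and> (\<forall>f. \<not> cyc (nat (t - s) + 2) f)"
    if xy: "x \<in> range u" "y \<in> range u" "x \<noteq> y" for x y
  proof -
    obtain i j where ij: "x = u i" "y = u j" "i \<noteq> j" using xy by blast
    have "inj_on u {s..t}" for s t using inj by (rule inj_on_subset) simp
    then show ?thesis using ij False
      by (intro exI[of _ "min i j"] exI[of _ "max i j"]) (auto simp: min_def max_def)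
  qed
  have per: "u (s + 1) = u (t + 1) \<and> u (s - 1) = u (t - 1)" if "u s = u t" for s t using inj that by (simp add: inj_eq)
  have wp1: "N (u i) \<inter> range u = {u (i - 1), u (i + 1)}" for i
    by (rule walk_props(1)[where u = u, OF u(1)]; (rule per | rule rep); assumption)
  have wp2: "x = y" if "v \<notin> range u" "x \<in> N v \<inter> range u" "y \<in> N v \<inter> range u" for v x y
    by (rule walk_props(2)[where u = u, OF u(1) _ _ that]; (rule per | rule rep); assumption)
  show ?thesis
  proof (rule start_walk[OF d])
    show "u i \<in> V" for i using u(1) A_V by blast
    show "N (u i) \<inter> range u = {u (i - 1), u (i + 1)}" for i by (rule wp1)
    show "u (i - 1) \<noteq> u (i + 1)" for i by (rule u(2))
    show "x = y" if "v \<notin> range u" "x \<in> N v \<inter> range u" "y \<in> N v \<inter> range u" for v x y by (rule wp2[OF that])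
  qed (use inj in \<open>auto simp: inj_eq\<close>)
next
  case True
  define k where "k = (LEAST k. \<exists>f. cyc k f)"
  have "\<exists>f. cyc k f" unfolding k_def using True by (rule LeastI_ex)
  then obtain f where f: "cyc k f" by blast
  have least: "\<not> cyc m h" if "m < k" for m h using not_less_Least[of m "\<lambda>k. \<exists>f. cyc k f"] that unfolding k_def by blast
  have k5: "5 \<le> k" using g f by blast
  define u where "u = (\<lambda>i. f (nat (i mod int k)))"
  have mod: "nat (i mod int k) < k" for i using k5 by (simp add: nat_less_iff)
  have adjf: "A (f i) (f (i + 1))" if "i + 1 < k" for i using f that unfolding cyc_def by blast
  have adj: "A (u i) (u (i + 1))" for i
  proof -
    define m where "m = nat (i mod int k)"
    have im: "i mod int k = int m" using k5 by (simp add: m_def)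
    have e: "(i + 1) mod int k = (int m + 1) mod int k" using im by (metis mod_add_left_eq)
    show ?thesis
    proof (cases "m + 1 < k")
      case True
      then have "(i + 1) mod int k = int (m + 1)" unfolding e by simp
      then have "u (i + 1) = f (m + 1)" unfolding u_def by (simp only: nat_int)
      then show ?thesis using adjf[OF True] unfolding u_def im by simp
    next
      case False
      then have mk: "m + 1 = k" using mod[of i] unfolding m_def by linarith
      then have "int m + 1 = int k" by linarith
      then have "(i + 1) mod int k = 0" unfolding e by simp
      moreover have "m = k - 1" using mk by simp
      moreover have "A (f (k - 1)) (f 0)" using f unfolding cyc_def by blast
      ultimately show ?thesis unfolding u_def im by simp
    qed
  qed
  have ueq: "u s = u t \<longleftrightarrow> s mod int k = t mod int k" for s t
  proof
    assume "u s = u t"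
    moreover have "inj_on f {..<k}" using f unfolding cyc_def by blast
    ultimately have "nat (s mod int k) = nat (t mod int k)" using mod unfolding u_def by (auto dest: inj_onD)
    then show "s mod int k = t mod int k" using k5 by (simp add: nat_eq_iff)
  qed (simp add: u_def)
  have uinj: "s = t" if "u s = u t" "\<bar>s - t\<bar> < int k" for s t
  proof -
    have "int k dvd s - t" using that(1) ueq by (simp add: mod_eq_dvd_iff)
    then show ?thesis using that(2) by (metis abs_of_nat dvd_imp_le_int eq_iff_diff_eq_0 leD)
  qed
  have per: "u (s + 1) = u (t + 1) \<and> u (s - 1) = u (t - 1)" if "u s = u t" for s t
  proof -
    have "s mod int k = t mod int k" using that ueq by simp
    then show ?thesis unfolding ueq by (metis mod_add_left_eq mod_diff_left_eq)
  qed
  have rep: "\<exists>s t. s < t \<and> inj_on u {s..t} \<and> {x, y} = {u s, u t} \<and>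
      (\<forall>f. \<not> cyc (nat (t - s) + 1) f) \<and> (\<forall>f. \<not> cyc (nat (t - s) + 2) f)"
    if xy: "x \<in> range u" "y \<in> range u" "x \<noteq> y" for x y
  proof -
    have ar: "\<exists>s t. s < t \<and> 2 * (t - s) \<le> int k \<and> {x, y} = {u s, u t}"
    proof -
      have r: "\<exists>a. 0 \<le> a \<and> a < int k \<and> z = u a" if "z \<in> range u" for z
      proof -
        from that obtain i where "z = u i" by blast
        then have "z = u (i mod int k)" unfolding u_def by simp
        then show ?thesis using k5 by (intro exI[of _ "i mod int k"]) simp
      qed
      obtain a b where ab: "0 \<le> a" "a < int k" "x = u a" "0 \<le> b" "b < int k" "y = u b" using r xy by metis
      have sh: "u (z + int k) = u z" for z unfolding ueq by simp
      have main: "\<exists>s t. s < t \<and> 2 * (t - s) \<le> int k \<and> {u a, u b} = {u s, u t}"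
        if "0 \<le> a" "a < b" "b < int k" for a b
      proof (cases "2 * (b - a) \<le> int k")
        case True then show ?thesis using that by blast
      next
        case False
        then show ?thesis using that sh[of a] by (intro exI[of _ b] exI[of _ "a + int k"]) (auto simp: insert_commute)
      qed
      have "a \<noteq> b" using ab xy by auto
      then consider "a < b" | "b < a" by linarith
      then show ?thesis
      proof cases
        case 1 then show ?thesis using main[of a b] ab by simp
      next
        case 2 then show ?thesis using main[of b a] ab by (simp add: insert_commute)
      qed
    qed
    then obtain s t where st: "s < t" "2 * (t - s) \<le> int k" "{x, y} = {u s, u t}" by blast
    have "inj_on u {s..t}"
    proof (rule inj_onI)
      fix a b assume "a \<in> {s..t}" "b \<in> {s..t}" "u a = u b"
      then show "a = b" using uinj[of a b] st by auto
    qed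
    moreover have "0 \<le> t - s" using st(1) by simp
    then obtain m where m: "t - s = int m" using zero_le_imp_eq_int by blast
    \<comment> \<open>The origin of the length 5: an outside vertex adjacent to both ends of an arc
      of length \<open>m \<le> k div 2\<close> gives a cycle of length \<open>m + 2\<close>, which
      is guaranteed to be shorter than \<open>k\<close> only for \<open>5 \<le> k\<close>.\<close>
    have "2 * m \<le> k" using st(2) unfolding m by linarith
    then have "nat (t - s) + 2 < k" "nat (t - s) + 1 < k" unfolding m nat_int using k5 by linarith+
    ultimately show ?thesis using st(1,3) least by blast
  qed
  have wp1: "N (u i) \<inter> range u = {u (i - 1), u (i + 1)}" for i
    by (rule walk_props(1)[where u = u, OF adj]; (rule per | rule rep); assumption)
  have wp2: "x = y" if "v \<notin> range u" "x \<in> N v \<inter> range u" "y \<in> N v \<inter> range u" for v x y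
    by (rule walk_props(2)[where u = u, OF adj _ _ that]; (rule per | rule rep); assumption)
  show ?thesis
  proof (rule start_walk[OF d])
    show "u i \<in> V" for i using adj A_V by blast
    show "N (u i) \<inter> range u = {u (i - 1), u (i + 1)}" for i by (rule wp1)
    show "u (i - 1) \<noteq> u (i + 1)" for i using uinj[of "i - 1" "i + 1"] k5 by auto
    show "x = y" if "v \<notin> range u" "x \<in> N v \<inter> range u" "y \<in> N v \<inter> range u" for v x y by (rule wp2[OF that])
    show "u 2 \<noteq> u (-1)" using uinj[of 2 "-1"] k5 by auto
    show "u (-2) \<noteq> u 1" using uinj[of "-2" 1] k5 by auto
  qed
qed

section \<open>Starts containing cliques, and explicit colourings\<close>

lemma start_clique:
  assumes d: "3 \<le> d" and Q: "finite Q" "Q \<subseteq> V" "4 \<le> card Q" and zu: "z \<in> Q" "u \<in> Q" "u \<noteq> z"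
    and pairs: "\<And>x y. x \<in> Q \<Longrightarrow> y \<in> Q \<Longrightarrow> x \<noteq> y \<Longrightarrow> x \<noteq> z \<Longrightarrow> y \<noteq> z \<Longrightarrow> A x y"
    and nz: "\<And>x y. x \<in> Q \<Longrightarrow> y \<in> Q \<Longrightarrow> x \<noteq> z \<Longrightarrow> y \<noteq> z \<Longrightarrow> \<not> A x z \<Longrightarrow> \<not> A y z \<Longrightarrow> x = y"
    and out: "\<And>x v w. x \<in> Q \<Longrightarrow> v \<in> N x - Q \<Longrightarrow> w \<in> N x - Q \<Longrightarrow> v = w" and zo: "N z - Q \<noteq> {}"
    and few: "\<And>v. v \<in> V - Q \<Longrightarrow> card (N v \<inter> Q) + 2 \<le> d"
    and pr: "\<And>\<phi>. aut \<phi> \<Longrightarrow> \<phi> u = u \<Longrightarrow> \<phi> ` Q = Q"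
  shows "\<exists>C. distinguishes C"
proof -
  define n where "n = card Q"
  define a where "a = (n + 1) div 2"
  have a: "2 \<le> a" "a < n" using Q(3) by (auto simp: a_def n_def)
  obtain p where p: "bij_betw p Q {1..n}" "p u = 1" "p z = a"
    using bij_prescribed_pair[OF Q(1) zu(2,1,3), of 1 a] a unfolding n_def by auto
  interpret T: threshold_order Q n p "(\<noteq>)" by unfold_locales (use p Q in \<open>auto simp: n_def\<close>)
  have thr: "T.thr x y \<longleftrightarrow> x \<noteq> y \<and> p x + p y > n + 1" for x y unfolding T.thr_def by simp
  \<comment> \<open>Label 1 makes all edges at \<open>u\<close> blue; \<open>z\<close> has a middle
    label and is the only member of \<open>Q\<close> with red edges leaving \<open>Q\<close>. The
    threshold order is built on \<open>\<noteq>\<close> instead of \<open>A\<close>, because one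
    pair containing \<open>z\<close> may be nonadjacent; both vertices of such a pair are shown to
    be fixed.\<close>
  define C0 where "C0 = (\<lambda>x y. if x \<in> Q \<and> y \<in> Q then T.thr x y else x = z \<or> y = z)"
  have sym0: "symc C0" unfolding symc_def C0_def using T.thr_sym by auto
  show ?thesis
  proof (rule start[of "{}" Q C0])
    fix v assume v: "v \<in> V - Q"
    show "card (N v \<inter> {}) + 3 \<le> d" using d by simp
    have "2 \<le> \<delta> Q v" using few[OF v] \<delta>_add[of v Q] v by auto
    then show "(\<exists>f\<in>N v \<inter> Q - {}. C0 v f) \<and> (\<exists>f\<in>N v \<inter> Q - {}. \<not> C0 v f)" if "\<delta> Q v \<le> 1" using that by linarith
    assume att: "N v \<inter> Q \<noteq> {}"
    then obtain s where s: "s \<in> N v \<inter> Q" by blast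
    show "card (cls Q C0 v) \<le> max 1 (\<delta> Q v - 1)"
    proof (rule cls_single[OF v s])
      fix w assume "w \<in> N s - Q"
      moreover have "v \<in> N s - Q" using s v N_sym by blast
      ultimately show "w = v" using out s by blast
    qed
  next
    fix C \<phi> assume C: "symc C" "agree Q C0 C" and s1: "\<And>v. v \<in> V - Q \<Longrightarrow> \<exists>a\<in>N v - {}. C v a" and \<phi>: "aut \<phi>" "pres C \<phi>"
    have e: "C x y = C0 x y" if "x \<in> Q" "y \<in> N x" for x y by (rule agreeN[OF C(2) that])
    obtain w where w: "w \<in> N z - Q" using zo by blast
    have Czw: "C z w" using e[of z w] w zu unfolding C0_def by auto
    have un: "p ` Q = {1..n}" using p(1) by (simp add: bij_betw_def)
    have "n \<in> p ` Q" unfolding un using a by simp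
    then obtain t where t: "t \<in> Q" "p t = n" by (metis imageE)
    have tz: "t \<noteq> z" using t(2) p(3) a by auto
    \<comment> \<open>The vertex \<open>y\<close> is to be a red neighbour of the top vertex
      \<open>t\<close>, so its label is at least 2 and different from that of
      \<open>z\<close>.\<close>
    define b where "b = (if a = 2 then 3 else 2::nat)"
    have "b \<in> p ` Q" unfolding un using Q(3) by (auto simp: b_def n_def)
    then obtain y where y: "y \<in> Q" "p y = b" by (metis imageE)
    have yz: "y \<noteq> z" "y \<noteq> t" "2 \<le> p y" using y(2) p(3) t(2) Q(3) by (auto simp: b_def n_def split: if_splits)
    have u: "\<phi> u = u"
    proof (rule fix_allblue[OF \<phi>])
      show "u \<in> V" using zu Q by blast
      show "\<not> C u x" if x: "x \<in> N u" for x
      proof (cases "x \<in> Q")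
        case True
        have "p x \<le> n" using T.p_range[OF True] by simp
        then have "\<not> T.thr u x" using p(2) thr by auto
        then show ?thesis using e[OF zu(2) x] True zu by (simp add: C0_def)
      next
        case False
        then show ?thesis using e[OF zu(2) x] zu by (auto simp: C0_def)
      qed
      fix v assume v: "v \<in> V" "v \<noteq> u"
      have two: "2 \<le> p v" if "v \<in> Q"
      proof -
        have "p v \<noteq> 1" using T.p_inj[OF that zu(2)] p(2) v(2) by auto
        then show ?thesis using T.p_range[OF that] by linarith
      qed
      consider "v \<notin> Q" | "v = z" | "v \<in> Q" "v \<noteq> z" "v \<noteq> t" | "v = t" by blast
      then show "\<exists>x\<in>N v. C v x"
      proof cases
        case 1 then show ?thesis using s1[of v] v by auto
      next
        case 2 then show ?thesis using Czw w by blast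
      next
        case 3
        have "A v t" using pairs 3 t tz by blast
        moreover have "T.thr v t" using thr 3 t two by auto
        ultimately show ?thesis using e[of v t] 3 t NI by (auto simp: C0_def)
      next
        case 4
        have "A t y" using pairs t y tz yz by blast
        moreover have "T.thr t y" using thr t yz y by auto
        ultimately show ?thesis using e[of t y] t y 4 NI by (auto simp: C0_def)
      qed
    qed
    have \<phi>Q: "\<phi> ` Q = Q" by (rule pr[OF \<phi>(1) u])
    have QV: "x \<in> V" if "x \<in> Q" for x using that Q by blast
    have inj: "inj_on \<phi> Q" using aut_inj[OF \<phi>(1)] QV unfolding inj_on_def by blast
    have bij: "bij_betw \<phi> Q Q" using inj \<phi>Q by (simp add: bij_betw_def)
    have \<phi>in: "\<phi> x \<in> Q" if "x \<in> Q" for x using \<phi>Q that by blast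
    have \<phi>z: "\<phi> z = z"
    proof -
      have wV: "w \<in> V" using w N_V by blast
      have nw: "\<phi> w \<notin> Q"
      proof
        assume "\<phi> w \<in> Q"
        then obtain x where "x \<in> Q" "\<phi> x = \<phi> w" using \<phi>Q by (metis imageE)
        then show False using aut_inj[OF \<phi>(1), of x w] QV wV w by blast
      qed
      have "\<phi> w \<in> N (\<phi> z)" using aut_N_mem[OF \<phi>(1) wV QV[OF zu(1)]] w by blast
      then have "C (\<phi> z) (\<phi> w) = (\<phi> z = z \<or> \<phi> w = z)" using e[OF \<phi>in[OF zu(1)]] nw by (simp add: C0_def)
      moreover have "C (\<phi> z) (\<phi> w)" using aut_pres_C[OF \<phi>(2), of w z] w Czw by simp
      ultimately show ?thesis using nw zu by auto
    qed
    have nzx: "\<phi> x = x" if "x \<in> Q" "x \<noteq> z" "\<not> A x z" for x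
    proof -
      have "\<phi> x \<noteq> z" using inj_onD[OF inj, of x z] \<phi>z that zu by auto
      moreover have "\<not> A (\<phi> x) z" using aut_A[OF \<phi>(1), of x z] \<phi>z that QV zu by auto
      ultimately show ?thesis using nz[of "\<phi> x" x] \<phi>in that by blast
    qed
    have thr_pres: "T.thr (\<phi> x) (\<phi> y) = T.thr x y" if xy: "x \<in> Q" "y \<in> Q" "x \<noteq> y" for x y
    proof (cases "A x y")
      case True
      then have "y \<in> N x" "\<phi> y \<in> N (\<phi> x)" using NI aut_N_mem[OF \<phi>(1)] QV xy by blast+
      then show ?thesis using e[of x y] e[of "\<phi> x" "\<phi> y"] aut_pres_C[OF \<phi>(2), of y x] xy \<phi>in by (simp add: C0_def)
    next
      case False
      then have "x = z \<or> y = z" using pairs xy by blast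
      then have "\<phi> x = x" "\<phi> y = y" using nzx \<phi>z xy False A_sym by metis+
      then show ?thesis by simp
    qed
    have "rigid_labels Q (\<noteq>) T.thr (\<lambda>x. if x = z then 1 else 0 :: nat)"
      by (rule T.rigid_thr[OF zu(1)]) (use p(3) in \<open>auto simp: a_def\<close>)
    moreover have "\<forall>x\<in>Q. \<forall>y\<in>Q. (\<phi> x \<noteq> \<phi> y) = (x \<noteq> y) \<and> (x \<noteq> y \<longrightarrow> T.thr (\<phi> x) (\<phi> y) = T.thr x y)"
      using thr_pres inj by (auto dest: inj_onD)
    moreover have "\<forall>x\<in>Q. (if \<phi> x = z then 1 else 0 :: nat) = (if x = z then 1 else 0)"
      using \<phi>z inj zu(1) by (metis inj_onD)
    ultimately show "\<forall>v\<in>Q. \<phi> v = v" using bij unfolding rigid_labels_def by blast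
  qed (use Q d zu sym0 in auto)
qed

text \<open>All edges at \<open>r\<close> are red, and \<open>w\<close> has a single red edge, to
  \<open>x\<close>. The red edges at \<open>x\<close> split the \<open>d - 2\<close> vertices of
  \<open>M\<close>, whose \<delta> is \<open>d - 3\<close>, into two parts that may have at most
  \<open>max 1 (d - 4)\<close> members each. This is possible for \<open>d = 4\<close> and for
  \<open>6 \<le> d\<close>, but not for \<open>d = 5\<close>.\<close>

lemma start_cocktail:
  assumes d: "d = 4 \<or> 6 \<le> d" and rw: "r \<in> V" "w \<in> V" "r \<noteq> w" "N w = N r" and V_eq: "V = insert r (insert w (N r))"
    and x: "x \<in> N r" "x' \<in> N r" "N x = insert r (insert w (N r - {x, x'}))" "x \<noteq> x'"
  shows "\<exists>C. distinguishes C"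
proof -
  have wr: "w \<notin> N r" "r \<notin> N r" using rw(4) N_irr by blast+
  have xV: "x \<in> V" using x N_V by blast
  have ne: "x \<noteq> r" "x \<noteq> w" using x wr by blast+
  define M where "M = N r - {x, x'}"
  have fM: "finite M" using fin_N rw by (simp add: M_def)
  have cM: "card M = d - 2" unfolding M_def using card_N[OF rw(1)] x by (subst card_Diff_subset) auto
  define k where "k = (if d = 4 then 1 else 2::nat)"
  have k: "k < card M" "1 \<le> k" "k \<le> max 1 (d - 4)" "d - 2 - k \<le> max 1 (d - 4)" using d cM by (auto simp: k_def)
  obtain S where S: "S \<subseteq> M" "card S = k" "finite S" using obtain_subset_with_card_n[of k M] k(1) by (metis less_imp_le)
  define C0 where "C0 = (\<lambda>a b. a = r \<or> b = r \<or> {a, b} = {w, x} \<or> (a = x \<and> b \<in> S) \<or> (b = x \<and> a \<in> S))"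
  let ?F = "{r, w, x}"
  have sym0: "symc C0" unfolding symc_def C0_def by (auto simp: insert_commute)
  have vN: "v \<in> N r" "v \<noteq> x" "r \<in> N v" "w \<in> N v" if "v \<in> V - ?F" for v
    using that V_eq rw(4) N_sym by blast+
  have "M - S \<noteq> {}" using k S cM card_mono[OF S(3), of M] by auto
  then obtain y where y: "y \<in> M" "y \<notin> S" by blast
  show ?thesis
  proof (rule start[of "{}" ?F C0])
    fix v assume v: "v \<in> V - ?F"
    show "card (N v \<inter> {}) + 3 \<le> d" using d by auto
    show "(\<exists>f\<in>N v \<inter> ?F - {}. C0 v f) \<and> (\<exists>f\<in>N v \<inter> ?F - {}. \<not> C0 v f)"
    proof -
      have "C0 v r" "\<not> C0 v w" using vN[OF v] v rw ne S wr by (auto simp: C0_def doubleton_eq_iff M_def)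
      then show ?thesis using vN[OF v] by blast
    qed
    show "card (cls ?F C0 v) \<le> max 1 (\<delta> ?F v - 1)"
    proof (cases "v \<in> M")
      case False
      then have vx: "v = x'" using vN[OF v] by (simp add: M_def)
      have "cls ?F C0 v \<subseteq> {x'}"
      proof
        fix u assume u: "u \<in> cls ?F C0 v"
        have "x \<notin> N v" using x vx N_sym[of x v] wr rw(4) by auto
        then have "x \<notin> N u" using u unfolding cls_def by auto
        then have "u \<notin> N x" using N_sym by blast
        moreover have "u \<in> V - ?F" using u cls_sub by blast
        ultimately show "u \<in> {x'}" using x(3) vN[of u] by blast
      qed
      then have "card (cls ?F C0 v) \<le> card {x'}" by (intro card_mono) auto
      then show ?thesis by simp
    next
      case True
      then have "v \<in> N x" using x(3) by (simp add: M_def)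
      then have xv: "x \<in> N v" using N_sym by blast
      then have "N v \<inter> ?F = ?F" using vN[OF v] by blast
      then have \<delta>: "\<delta> ?F v = d - 3" using \<delta>_add[of v ?F] v rw(3) ne by simp
      have sub: "cls ?F C0 v \<subseteq> (if v \<in> S then S else M - S)"
      proof
        fix u assume u: "u \<in> cls ?F C0 v"
        then have uV: "u \<in> V - ?F" using cls_sub by blast
        have "x \<in> N u" using u xv unfolding cls_def by auto
        then have "u \<in> M" using x(3) uV N_sym[of x u] by (auto simp: M_def)
        moreover have "C0 x u = C0 x v" using u xv unfolding cls_def by auto
        then have "u \<in> S \<longleftrightarrow> v \<in> S" using uV v ne by (auto simp: C0_def doubleton_eq_iff)
        ultimately show "u \<in> (if v \<in> S then S else M - S)" by auto
      qed
      then have "card (cls ?F C0 v) \<le> card (if v \<in> S then S else M - S)" using fM S by (intro card_mono) auto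
      also have "\<dots> \<le> max 1 (d - 4)" using S k cM fM by (auto simp: card_Diff_subset)
      finally show ?thesis unfolding \<delta> by simp
    qed
  next
    fix C \<phi> assume C: "symc C" "agree ?F C0 C" and s2: "\<And>v. v \<in> V - ?F \<Longrightarrow> \<exists>a\<in>N v - {}. \<not> C v a" and \<phi>: "aut \<phi>" "pres C \<phi>"
    have e: "C a b = C0 a b" if "a \<in> ?F" "b \<in> N a" for a b by (rule agreeN[OF C(2) that])
    have yx: "y \<in> N x" "y \<in> N w" "y \<in> N r" using y x(3) rw(4) by (auto simp: M_def)
    have yne: "y \<noteq> r" "y \<noteq> w" "y \<noteq> x" using yx wr N_irr by blast+
    have r: "\<phi> r = r"
    proof (rule fix_allred[OF \<phi> rw(1)])
      show "C r b" if "b \<in> N r" for b using e[OF _ that] by (simp add: C0_def)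
      fix v assume v: "v \<in> V" "v \<noteq> r"
      consider "v = w" | "v = x" | "v \<in> V - ?F" using v by blast
      then show "\<exists>a\<in>N v. \<not> C v a"
      proof cases
        case 1
        have "\<not> C0 w y" using yne rw ne y by (auto simp: C0_def doubleton_eq_iff)
        then show ?thesis using e[of w y] yx 1 by auto
      next
        case 2
        have "\<not> C0 x y" using yne rw ne y by (auto simp: C0_def doubleton_eq_iff)
        then show ?thesis using e[of x y] yx 2 by auto
      next
        case 3 then show ?thesis using s2 by auto
      qed
    qed
    have w: "\<phi> w = w"
    proof -
      have "\<phi> w \<noteq> r" using r aut_inj[OF \<phi>(1) rw(2,1)] rw(3) by auto
      moreover have "\<phi> w \<notin> N r" using aut_N_mem[OF \<phi>(1) rw(2,1)] r wr by simp
      ultimately show ?thesis using V_eq aut_V[OF \<phi>(1) rw(2)] by auto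
    qed
    have "\<phi> x = x"
    proof -
      have 1: "x \<in> N w" using x rw(4) by simp
      have 2: "\<phi> x \<in> N w" using aut_N_mem[OF \<phi>(1) xV rw(2)] w 1 by simp
      have "C w (\<phi> x) = C w x" using aut_pres_C[OF \<phi>(2) 1] w by simp
      then have "C0 w (\<phi> x)" using e[of w x] e[of w "\<phi> x"] 1 2 by (simp add: C0_def)
      moreover have "\<phi> x \<noteq> r" using r aut_inj[OF \<phi>(1) xV rw(1)] ne by auto
      moreover have "w \<notin> S" using S wr by (auto simp: M_def)
      ultimately show ?thesis using rw(3) ne by (auto simp: C0_def doubleton_eq_iff)
    qed
    then show "\<forall>v\<in>?F. \<phi> v = v" using r w by blast
  qed (use rw xV d sym0 in auto)
qed

text \<open>The colouring is given outright: a threshold graph on the vertices other than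
  \<open>z\<close>, whose exchangeable middle pair is broken up by colouring all edges at
  \<open>z\<close> red except the one to \<open>z'\<close>.\<close>

lemma start_complete:
  assumes d: "5 \<le> d" and z: "z \<in> V" and V_eq: "V = insert z (N z)" and compl: "\<And>x y. x \<in> V \<Longrightarrow> y \<in> V \<Longrightarrow> x \<noteq> y \<Longrightarrow> A x y"
  shows "\<exists>C. distinguishes C"
proof -
  define Q where "Q = N z"
  have Q: "finite Q" "card Q = d" "z \<notin> Q" "V = insert z Q" using fin_N card_N z V_eq N_irr by (auto simp: Q_def)
  define a where "a = (d + 1) div 2"
  have a: "3 \<le> a" "a < d" "a + 2 \<le> d" using d by (auto simp: a_def)
  obtain p where p: "bij_betw p Q {1..d}" using Q ex_bij_betw_finite_nat[OF Q(1)]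
    by (metis card_atLeastAtMost diff_Suc_1 finite_atLeastAtMost finite_same_card_bij)
  interpret T: threshold_order Q d p A by unfold_locales (use p Q A_sym A_irr in auto)
  have cQ: "A x y" if "x \<in> Q" "y \<in> Q" "x \<noteq> y" for x y using compl that Q(4) by blast
  have un: "p ` Q = {1..d}" using p by (simp add: bij_betw_def)
  have "a \<in> p ` Q" unfolding un using a by simp
  then obtain z' where z': "z' \<in> Q" "p z' = a" by (metis imageE)
  have NQ: "N x = insert z (Q - {x})" if "x \<in> Q" for x
  proof
    show "N x \<subseteq> insert z (Q - {x})" using N_V(1) N_irr Q(4) by blast
    show "insert z (Q - {x}) \<subseteq> N x" using compl that Q(3,4) NI by blast
  qed
  define C where "C = (\<lambda>x y. if x = z then y \<noteq> z' else if y = z then x \<noteq> z' else T.thr x y)"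
  have sym: "symc C" unfolding symc_def C_def using T.thr_sym by auto
  have rQ: "rdeg C x = T.rd x + (if x = z' then 0 else 1)" if x: "x \<in> Q" for x
  proof -
    have e: "{u\<in>N x. C x u} = (if x = z' then {} else {z}) \<union> {u\<in>Q. T.thr x u}"
      using x Q(3) N_irr unfolding NQ[OF x] C_def T.thr_def by (auto simp: A_irr)
    have "{z} \<inter> {u\<in>Q. T.thr x u} = {}" using Q(3) by blast
    then show ?thesis unfolding rdeg_def e T.rd_def using Q(1) by (auto simp: card_insert_if)
  qed
  have rz: "rdeg C z = d - 1"
  proof -
    have "{u\<in>N z. C z u} = Q - {z'}" unfolding Q_def[symmetric] C_def by auto
    then show ?thesis unfolding rdeg_def using Q z' by simp
  qed
  have rdp: "T.rd x = (if p x \<le> a then p x - 1 else p x - 2)" if "x \<in> Q" for x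
  proof -
    have "2 * p x \<le> d + 1 \<longleftrightarrow> p x \<le> a" unfolding a_def by linarith
    then show ?thesis using T.rd_complete[OF that cQ] by simp
  qed
  have "\<forall>v\<in>V. \<phi> v = v" if \<phi>: "aut \<phi>" "pres C \<phi>" for \<phi>
  proof -
    have QV: "x \<in> V" if "x \<in> Q" for x using that Q(4) by blast
    \<comment> \<open>Apart from \<open>z\<close> only the vertex with the last label has red degree \<open>d - 1\<close>, and the unique blue
      neighbours of these two have different red degrees.\<close>
    have \<phi>z: "\<phi> z = z"
    proof (rule ccontr)
      assume n: "\<phi> z \<noteq> z"
      define x where "x = \<phi> z"
      have x: "x \<in> Q" using n aut_V[OF \<phi>(1) z] Q(4) unfolding x_def by blast
      have r: "rdeg C x = d - 1" using aut_rdeg[OF \<phi> z] rz x_def by simp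
      have xz: "x \<noteq> z'" using r rQ[OF x] rdp[OF x] z' a by auto
      then have px: "p x = d" using r rQ[OF x] rdp[OF x] a T.p_range[OF x] by (auto split: if_splits)
      have zz: "z' \<in> N z" using z' Q_def by simp
      have "\<not> C z z'" by (simp add: C_def)
      then have b: "\<not> C x (\<phi> z')" using aut_pres_C[OF \<phi>(2) zz] x_def by simp
      have "\<phi> z' \<in> N x" using aut_N_mem[OF \<phi>(1) QV[OF z'(1)] z] zz x_def by simp
      moreover have "C x z" using xz x Q(3) by (auto simp: C_def)
      ultimately have y: "\<phi> z' \<in> Q" "\<phi> z' \<noteq> x" using b unfolding NQ[OF x] by auto
      have "\<not> T.thr x (\<phi> z')" using b y(1) x Q(3) by (auto simp: C_def split: if_splits)
      then have "p (\<phi> z') \<le> 1" using cQ[OF x y(1)] y(2) px unfolding T.thr_def by auto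
      \<comment> \<open>In contrast, \<open>z'\<close> has red degree \<open>a - 1\<close>, which is
        at least 2 because \<open>5 \<le> d\<close>.\<close>
      then have "rdeg C (\<phi> z') \<le> 1" using rQ[OF y(1)] rdp[OF y(1)] a by auto
      moreover have "rdeg C (\<phi> z') = a - 1" using aut_rdeg[OF \<phi> QV[OF z'(1)]] rQ[OF z'(1)] rdp[OF z'(1)] z'(2) by simp
      ultimately show False using a by linarith
    qed
    have \<phi>Q: "\<phi> ` Q = Q" using aut_N[OF \<phi>(1) z] \<phi>z unfolding Q_def by simp
    have inj: "inj_on \<phi> Q" using aut_inj[OF \<phi>(1)] QV unfolding inj_on_def by blast
    have \<phi>in: "\<phi> x \<in> Q" if "x \<in> Q" for x using \<phi>Q that by blast
    have "rigid_labels Q A T.thr (\<lambda>x. if C z x then 0 else 1 :: nat)"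
      by (rule T.rigid_thr[OF z'(1) _ cQ]) (use z'(2) in \<open>auto simp: a_def C_def\<close>)
    moreover have "\<forall>x\<in>Q. (if C z (\<phi> x) then 0 else 1 :: nat) = (if C z x then 0 else 1)"
    proof
      fix x assume "x \<in> Q"
      then have "C z (\<phi> x) = C z x" using aut_pres_C[OF \<phi>(2), of x z] \<phi>z unfolding Q_def by simp
      then show "(if C z (\<phi> x) then 0 else 1 :: nat) = (if C z x then 0 else 1)" by simp
    qed
    moreover have "\<forall>x\<in>Q. \<forall>y\<in>Q. A (\<phi> x) (\<phi> y) = A x y \<and> (A x y \<longrightarrow> T.thr (\<phi> x) (\<phi> y) = T.thr x y)"
    proof (intro ballI)
      fix x y assume xy: "x \<in> Q" "y \<in> Q"
      have "T.thr (\<phi> x) (\<phi> y) = T.thr x y" if "A x y"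
      proof -
        have "C (\<phi> x) (\<phi> y) = C x y" by (rule presD[OF \<phi>(2) that])
        moreover have "x \<noteq> z" "y \<noteq> z" "\<phi> x \<noteq> z" "\<phi> y \<noteq> z" using xy \<phi>in Q(3) by blast+
        ultimately show ?thesis by (simp add: C_def)
      qed
      then show "A (\<phi> x) (\<phi> y) = A x y \<and> (A x y \<longrightarrow> T.thr (\<phi> x) (\<phi> y) = T.thr x y)"
        using aut_A[OF \<phi>(1)] QV xy by blast
    qed
    moreover have "bij_betw \<phi> Q Q" using inj \<phi>Q by (simp add: bij_betw_def)
    ultimately have "\<forall>x\<in>Q. \<phi> x = x" unfolding rigid_labels_def by blast
    then show ?thesis using \<phi>z Q(4) by blast
  qed
  then show ?thesis unfolding distinguishes_def using sym by blast
qed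

subsection \<open>Existence of a start\<close>

lemma start_bipartite:
  assumes d: "4 \<le> d" and V_eq: "V = X \<union> Y" "X \<inter> Y = {}" and X: "X \<noteq> {}" "\<And>x. x \<in> X \<Longrightarrow> N x = Y" and Y: "\<And>y. y \<in> Y \<Longrightarrow> N y = X"
  shows "\<exists>C. distinguishes C"
proof -
  have cY: "card Y = d" "finite Y" using X card_N fin_N V_eq by blast+
  then have "Y \<noteq> {}" using d by auto
  then have cX: "card X = d" "finite X" using Y card_N fin_N V_eq by blast+
  \<comment> \<open>As no vertex of \<open>X\<close> has label 1, the vertices of \<open>Y\<close>
    with labels 1 and 2 would have the same red neighbours; the exception in \<open>rel\<close>
    separates them.\<close>
  have "card ({0..d} - {1}) = card X" using d cX by simp
  then obtain f where f: "bij_betw f X ({0..d} - {1})" by (metis cX(2) finite_Diff finite_atLeastAtMost finite_same_card_bij)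
  have "card {1..d} = card Y" using cY by simp
  then obtain g where g: "bij_betw g Y {1..d}" by (metis cY(2) finite_atLeastAtMost finite_same_card_bij)
  have fi: "f ` X = {0..d} - {1}" "inj_on f X" using f by (auto simp: bij_betw_def)
  have gi: "g ` Y = {1..d}" "inj_on g Y" using g by (auto simp: bij_betw_def)
  have exf: "\<exists>x\<in>X. f x = i" if "i \<le> d" "i \<noteq> 1" for i
  proof -
    have "i \<in> f ` X" unfolding fi using that by simp
    then show ?thesis by (metis imageE)
  qed
  have exg: "\<exists>y\<in>Y. g y = j" if "1 \<le> j" "j \<le> d" for j
  proof -
    have "j \<in> g ` Y" unfolding gi using that by simp
    then show ?thesis by (metis imageE)
  qed
  have fr: "f x \<le> d \<and> f x \<noteq> 1" if "x \<in> X" for x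
  proof -
    have "f x \<in> {0..d} - {1}" using bij_betwE[OF f] that by blast
    then show ?thesis by simp
  qed
  have gr: "1 \<le> g y \<and> g y \<le> d" if "y \<in> Y" for y
  proof -
    have "g y \<in> {1..d}" using bij_betwE[OF g] that by blast
    then show ?thesis by simp
  qed
  have f_inj: "x = x'" if "x \<in> X" "x' \<in> X" "f x = f x'" for x x' using inj_onD[OF fi(2)] that by blast
  have g_inj: "x = x'" if "x \<in> Y" "x' \<in> Y" "g x = g x'" for x x' using inj_onD[OF gi(2)] that by blast
  \<comment> \<open>Up to one edge the red neighbourhoods are nested; there is a vertex without red edges in \<open>X\<close> but not
    in \<open>Y\<close>, so that the sides cannot be interchanged.\<close>
  define rel where "rel = (\<lambda>x y. g y \<le> f x \<and> \<not> (f x = d \<and> g y = 1))"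
  define C where "C = (\<lambda>u v. (u \<in> X \<and> v \<in> Y \<and> rel u v) \<or> (v \<in> X \<and> u \<in> Y \<and> rel v u))"
  have sym: "symc C" unfolding symc_def C_def by blast
  have CX: "C x y \<longleftrightarrow> rel x y" "C y x \<longleftrightarrow> rel x y" if "x \<in> X" "y \<in> Y" for x y using that V_eq(2) unfolding C_def by blast+
  \<comment> \<open>The exception in \<open>rel\<close> lowers the red degree of the vertex with
    label \<open>d\<close> to that of the vertex with label \<open>d - 1\<close>.\<close>
  define h where "h = (\<lambda>i. if i = d then d - 1 else i)"
  have rX: "rdeg C x = h (f x)" if x: "x \<in> X" for x
  proof -
    have "g ` {y\<in>Y. rel x y} = (if f x = d then {2..d} else {1..f x})" (is "?l = ?r")
    proof
      show "?l \<subseteq> ?r"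
      proof
        fix j assume "j \<in> ?l"
        then obtain y where y: "y \<in> Y" "g y \<le> f x" "\<not> (f x = d \<and> g y = 1)" "j = g y" unfolding rel_def by blast
        have "1 \<le> g y" "g y \<le> d" using gr[OF y(1)] by auto
        then show "j \<in> ?r" using y by (cases "f x = d") auto
      qed
      show "?r \<subseteq> ?l"
      proof
        fix j assume j: "j \<in> ?r"
        then have "1 \<le> j" "j \<le> d" using fr[OF x] by (auto split: if_splits)
        then obtain y where y: "y \<in> Y" "g y = j" using exg by blast
        have "rel x y" using j y unfolding rel_def by (auto split: if_splits)
        then show "j \<in> ?l" using y by blast
      qed
    qed
    moreover have "card (g ` {y\<in>Y. rel x y}) = card {y\<in>Y. rel x y}" by (rule card_image) (rule inj_on_subset[OF gi(2)], blast)
    moreover have "{u\<in>N x. C x u} = {y\<in>Y. rel x y}" using X(2)[OF x] CX(1)[OF x] by blast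
    ultimately show ?thesis unfolding rdeg_def h_def by (auto split: if_splits)
  qed
  obtain x0 where x0: "x0 \<in> X" "f x0 = 0" using exf[of 0] by auto
  obtain xd where xd: "xd \<in> X" "f xd = d" using exf[of d] d by auto
  obtain x2 where x2: "x2 \<in> X" "f x2 = 2" using exf[of 2] d by auto
  obtain yd where yd: "yd \<in> Y" "g yd = d" using exg[of d] d by auto
  obtain y2 where y2: "y2 \<in> Y" "g y2 = 2" using exg[of 2] d by auto
  have "\<forall>v\<in>V. \<phi> v = v" if \<phi>: "aut \<phi>" "pres C \<phi>" for \<phi>
  proof -
    have XV: "x \<in> V" if "x \<in> X" for x using that V_eq by blast
    have YV: "y \<in> V" if "y \<in> Y" for y using that V_eq by blast
    have p0: "\<phi> x0 = x0"
    proof (rule fix_allblue[OF \<phi> XV[OF x0(1)]])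
      show "\<not> C x0 u" if "u \<in> N x0" for u
      proof -
        have u: "u \<in> Y" using that X(2)[OF x0(1)] by simp
        show ?thesis unfolding CX(1)[OF x0(1) u] using gr[OF u] x0(2) by (simp add: rel_def)
      qed
      fix v assume v: "v \<in> V" "v \<noteq> x0"
      show "\<exists>a\<in>N v. C v a"
      proof (cases "v \<in> X")
        case True
        have "f v \<noteq> 0" using f_inj[OF True x0(1)] x0(2) v(2) by auto
        then have "2 \<le> f v" using fr[OF True] by linarith
        then have "C v y2" unfolding CX(1)[OF True y2(1)] using y2(2) by (simp add: rel_def)
        then show ?thesis using y2(1) X(2)[OF True] by blast
      next
        case False
        then have y: "v \<in> Y" using v V_eq by blast
        define x where "x = (if g v = 1 then x2 else xd)"
        have x: "x \<in> X" using x2 xd by (simp add: x_def)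
        have "C v x" unfolding CX(2)[OF x y] using gr[OF y] x2 xd d by (auto simp: rel_def x_def)
        then show ?thesis using x Y[OF y] by blast
      qed
    qed
    have \<phi>Y: "\<phi> ` Y = Y" using aut_N[OF \<phi>(1) XV[OF x0(1)]] p0 X(2)[OF x0(1)] by simp
    have YY: "\<phi> y \<in> Y" if "y \<in> Y" for y using \<phi>Y that by blast
    have XX: "\<phi> x \<in> X" if x: "x \<in> X" for x
    proof (rule ccontr)
      assume "\<phi> x \<notin> X"
      then have "\<phi> x \<in> \<phi> ` Y" using aut_V[OF \<phi>(1) XV[OF x]] V_eq \<phi>Y by blast
      then obtain y where "y \<in> Y" "\<phi> x = \<phi> y" by blast
      then show False using aut_inj[OF \<phi>(1) XV[OF x] YV] x V_eq(2) by blast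
    qed
    have C\<phi>: "rel (\<phi> x) (\<phi> y) = rel x y" if "x \<in> X" "y \<in> Y" for x y
      using aut_pres_C[OF \<phi>(2), of y x] that X(2)[OF that(1)] CX(1) XX YY by simp
    have hf: "h (f (\<phi> x)) = h (f x)" if "x \<in> X" for x
      using aut_rdeg[OF \<phi> XV[OF that]] rX[OF that] rX[OF XX[OF that]] by simp
    \<comment> \<open>The only red neighbour of \<open>yd\<close> is \<open>xd\<close>. If \<phi>
      moved \<open>xd\<close>, then \<open>\<phi> yd\<close> would not be joined to
      \<open>xd\<close> in red and so would have label 1. But then its only red neighbour would be
      \<open>x2\<close>, whose label 2 is not \<open>d - 1\<close> as
      \<open>4 \<le> d\<close>.\<close>
    have pd: "\<phi> xd = xd"
    proof (rule ccontr)
      assume n: "\<phi> xd \<noteq> xd"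
      have "f (\<phi> xd) \<noteq> d" using f_inj[OF XX[OF xd(1)] xd(1)] xd(2) n by auto
      then have fd: "f (\<phi> xd) = d - 1" using hf[OF xd(1)] xd(2) by (simp add: h_def)
      have only: "x = \<phi> xd" if "x \<in> X" "rel x (\<phi> yd)" for x
      proof -
        have "C (\<phi> yd) x" using CX(2)[OF that(1) YY[OF yd(1)]] that(2) by simp
        then have "x \<in> {u\<in>N (\<phi> yd). C (\<phi> yd) u}" using Y[OF YY[OF yd(1)]] that(1) by simp
        then obtain u where u: "u \<in> N yd" "C yd u" "x = \<phi> u" using aut_red[OF \<phi> YV[OF yd(1)]] by auto
        then have uX: "u \<in> X" using Y[OF yd(1)] by simp
        then have "d \<le> f u" using u(2) CX(2)[OF uX yd(1)] yd(2) by (simp add: rel_def)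
        then have "u = xd" using f_inj[OF uX xd(1)] fr[OF uX] xd(2) by simp
        then show ?thesis using u(3) by simp
      qed
      have "\<not> rel xd (\<phi> yd)" using only[OF xd(1)] n by auto
      then have "g (\<phi> yd) = 1" using gr[OF YY[OF yd(1)]] xd(2) by (auto simp: rel_def)
      then have "rel x2 (\<phi> yd)" using x2(2) d by (simp add: rel_def)
      then have "x2 = \<phi> xd" using only x2(1) by blast
      then show False using fd x2(2) d by simp
    qed
    have px: "\<phi> x = x" if x: "x \<in> X" for x
    proof (cases "x = xd")
      case False
      have "\<phi> x \<noteq> xd" using aut_inj[OF \<phi>(1) XV[OF x] XV[OF xd(1)]] pd False by auto
      then have "f (\<phi> x) \<noteq> d" "f x \<noteq> d" using f_inj[OF XX[OF x] xd(1)] f_inj[OF x xd(1)] xd(2) False by auto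
      then have "f (\<phi> x) = f x" using hf[OF x] by (simp add: h_def)
      then show ?thesis using f_inj[OF XX[OF x] x] by blast
    qed (use pd in simp)
    have py: "\<phi> y = y" if y: "y \<in> Y" for y
    proof -
      have r: "rel x (\<phi> y) = rel x y" if "x \<in> X" for x using C\<phi>[OF that y] px[OF that] by simp
      have one: "g (\<phi> y) = 1 \<longleftrightarrow> g y = 1" using r[OF xd(1)] gr[OF y] gr[OF YY[OF y]] xd(2) by (auto simp: rel_def)
      have "g (\<phi> y) = g y"
      proof (cases "g y = 1")
        case True then show ?thesis using one by simp
      next
        case False
        obtain a where a: "a \<in> X" "f a = g y" using exf[of "g y"] gr[OF y] False by auto
        obtain b where b: "b \<in> X" "f b = g (\<phi> y)" using exf[of "g (\<phi> y)"] gr[OF YY[OF y]] False one by auto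
        have "g (\<phi> y) \<le> g y" using r[OF a(1)] a(2) False by (auto simp: rel_def)
        moreover have "g y \<le> g (\<phi> y)" using r[OF b(1)] b(2) False one by (auto simp: rel_def)
        ultimately show ?thesis by simp
      qed
      then show ?thesis using g_inj[OF YY[OF y] y] by blast
    qed
    show ?thesis using px py V_eq by blast
  qed
  then show ?thesis unfolding distinguishes_def using sym by blast
qed

lemma closed_V: assumes "S \<subseteq> V" "S \<noteq> {}" "\<And>x. x \<in> S \<Longrightarrow> N x \<subseteq> S" shows "S = V"
proof (rule ccontr)
  assume "S \<noteq> V"
  then obtain u v where "u \<in> S" "v \<in> V - S" "A u v" using conn[OF assms(1,2)] by blast
  then show False using assms(3) NI by blast
qed

lemma N_eqI: assumes "v \<in> V" "S \<subseteq> N v" "d \<le> card S" shows "N v = S"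
  using card_seteq[OF fin_N[OF assms(1)] assms(2)] card_N[OF assms(1)] assms(3) by simp

text \<open>By \<open>start_edge\<close> every edge in a triangle lies in at least
  \<open>d - 2\<close> of them. So either all edges at some \<open>r\<close> lie in triangles and
  only few pairs in its neighbourhood are nonadjacent, or every vertex in a triangle has just one
  edge in no triangle, and its other edges span a clique on \<open>d\<close> vertices.\<close>

lemma triangle_case:
  assumes d: "4 \<le> d" and tri: "c0 \<in> N r0" "N r0 \<inter> N c0 \<noteq> {}"
    and noK: "(\<And>x y. x \<in> V \<Longrightarrow> y \<in> V \<Longrightarrow> x \<noteq> y \<Longrightarrow> A x y) \<Longrightarrow> 5 \<le> d"
  shows "\<exists>C. distinguishes C"
proof (rule ccontr)
  assume nd: "\<not> ?thesis"
  have T: "d \<le> card (N u \<inter> N v) + 2" if "v \<in> N u" "N u \<inter> N v \<noteq> {}" for u v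
  proof (rule ccontr)
    assume "\<not> ?thesis"
    then have "card (N u \<inter> N v) + 3 \<le> d" by simp
    moreover have "1 \<le> card (N u \<inter> N v)" using that fin_N N_V by (metis One_nat_def Suc_leI card_gt_0_iff finite_Int)
    ultimately show False using start_edge[OF ND[OF that(1)] d] nd by blast
  qed
  show False
  proof (cases "\<exists>r c. c \<in> N r \<and> N r \<inter> N c \<noteq> {} \<and> (\<forall>x\<in>N r. N r \<inter> N x \<noteq> {})")
    case True
    then obtain r where r: "N r \<noteq> {}" "\<And>x. x \<in> N r \<Longrightarrow> N r \<inter> N x \<noteq> {}" by blast
    have rV: "r \<in> V" using r N_V by blast
    have fr: "finite (N r)" "card (N r) = d" using fin_N card_N rV by auto
    have xV: "x \<in> V" "r \<in> N x" "x \<noteq> r" if "x \<in> N r" for x using that N_V N_sym N_irr by blast+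
    have t: "d \<le> card (N r \<inter> N x) + 2" if "x \<in> N r" for x by (rule T[OF that r(2)[OF that]])
    \<comment> \<open>Two nonneighbours of \<open>x\<close> inside \<open>N r\<close> would leave at
      most \<open>d - 3\<close> common neighbours.\<close>
    have nn1: "y = y'" if x: "x \<in> N r" and y: "y \<in> N r" "y \<noteq> x" "y \<notin> N x" and y': "y' \<in> N r" "y' \<noteq> x" "y' \<notin> N x" for x y y'
    proof (rule ccontr)
      assume "y \<noteq> y'"
      then have c3: "card {x, y, y'} = 3" using y y' by auto
      have "N r \<inter> N x \<subseteq> N r - {x, y, y'}" using y y' N_irr by blast
      then have "card (N r \<inter> N x) \<le> card (N r - {x, y, y'})" using fr by (intro card_mono) auto
      also have "\<dots> = d - 3" using c3 fr x y y' by (subst card_Diff_subset) auto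
      finally show False using t[OF x] d by linarith
    qed
    define Q where "Q = insert r (N r)"
    have Q: "finite Q" "card Q = d + 1" "Q \<subseteq> V" "Q \<noteq> {}" using fr N_irr[of r] rV xV by (auto simp: Q_def)
    show False
    proof (cases "\<forall>x\<in>N r. \<forall>y\<in>N r. x \<noteq> y \<longrightarrow> y \<in> N x")
      case True
      have Nx: "N x = Q - {x}" if "x \<in> Q" for x
      proof -
        have "Q - {x} \<subseteq> N x"
        proof
          fix y assume "y \<in> Q - {x}"
          with that consider "x = r" "y \<in> N r" | "x \<in> N r" "y = r" | "x \<in> N r" "y \<in> N r" "x \<noteq> y"
            unfolding Q_def by blast
          then show "y \<in> N x"
          proof cases
            case 1 then show ?thesis by simp
          next
            case 2 then show ?thesis using xV by simp
          next
            case 3 then show ?thesis using True by blast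
          qed
        qed
        moreover have "card (Q - {x}) = d" using Q that by simp
        ultimately show ?thesis using N_eqI[of x "Q - {x}"] Q(3) that by auto
      qed
      then have "Q = V" using closed_V[OF Q(3,4)] by blast
      then have compl: "A x y" if "x \<in> V" "y \<in> V" "x \<noteq> y" for x y using Nx that ND by blast
      show False using start_complete[OF noK[OF compl] rV _ compl] \<open>Q = V\<close> nd unfolding Q_def by blast
    next
      case False
      then obtain x y where xy: "x \<in> N r" "y \<in> N r" "x \<noteq> y" "y \<notin> N x" by blast
      have yx: "x \<notin> N y" using xy N_sym by blast
      have adjx: "s \<in> N x" "s \<in> N y" "x \<in> N s" "y \<in> N s" if "s \<in> N r" "s \<noteq> x" "s \<noteq> y" for s
        using nn1[OF xy(1,2) xy(3)[symmetric] xy(4) that(1,2)] nn1[OF xy(2,1,3) yx that(1,3)] that N_sym by blast+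
      show False
      \<comment> \<open>With a single nonadjacent pair the closed neighbourhood of \<open>r\<close>
        is a start. With two pairs, the whole graph will turn out to consist of \<open>N r\<close>,
        \<open>r\<close> and a twin of \<open>r\<close>.\<close>
      proof (cases "\<forall>s\<in>N r. \<forall>t\<in>N r. s \<noteq> t \<longrightarrow> t \<notin> N s \<longrightarrow> {s, t} = {x, y}")
        case all: True
        have NQ: "N s = Q - {s}" if s: "s \<in> N r" "s \<noteq> x" "s \<noteq> y" for s
        proof -
          have "t \<in> N s" if "t \<in> N r" "t \<noteq> s" for t using all s that by (auto simp: doubleton_eq_iff)
          then have "Q - {s} \<subseteq> N s" using xV s unfolding Q_def by blast
          moreover have "card (Q - {s}) = d" using Q s by (simp add: Q_def)
          ultimately show ?thesis using N_eqI[of s "Q - {s}"] xV s by auto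
        qed
        have "\<exists>C. distinguishes C"
        proof (rule start_clique[of Q x r])
          show "x \<in> Q" "r \<in> Q" "r \<noteq> x" using xy xV by (auto simp: Q_def)
          show "A s t" if "s \<in> Q" "t \<in> Q" "s \<noteq> t" "s \<noteq> x" "t \<noteq> x" for s t
          proof -
            from that(1-3) consider "s = r" "t \<in> N r" | "t = r" "s \<in> N r" | "s \<in> N r" "t \<in> N r" unfolding Q_def by blast
            then show ?thesis
            proof cases
              case 1 then show ?thesis using ND by blast
            next
              case 2 then show ?thesis using ND A_sym by blast
            next
              case 3 then show ?thesis using all that ND by (metis doubleton_eq_iff)
            qed
          qed
          show "s = t" if "s \<in> Q" "t \<in> Q" "s \<noteq> x" "t \<noteq> x" "\<not> A s x" "\<not> A t x" for s t
          proof -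
            have "s = y" if "s \<in> Q" "s \<noteq> x" "\<not> A s x" for s
              using that adjx(3)[of s] ND[of x s] xy(1) ND[of x r] unfolding Q_def by blast
            then show ?thesis using that by metis
          qed
          show "v = w" if s: "s \<in> Q" "v \<in> N s - Q" "w \<in> N s - Q" for s v w
          proof -
            have sr: "s \<in> N r" using s unfolding Q_def by blast
            have "card (insert r (N r \<inter> N s)) = card (N r \<inter> N s) + 1" using fr N_irr by simp
            then have c: "d \<le> card (insert r (N r \<inter> N s)) + 1" using t[OF sr] by simp
            have sub: "insert r (N r \<inter> N s) \<subseteq> N s" using xV[OF sr] by blast
            have "N s - Q \<subseteq> N s - insert r (N r \<inter> N s)" unfolding Q_def by blast
            then have "card (N s - Q) \<le> card (N s - insert r (N r \<inter> N s))" using fin_N xV[OF sr] by (intro card_mono) auto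
            also have "\<dots> = d - card (insert r (N r \<inter> N s))" using sub card_N xV[OF sr] fr by (subst card_Diff_subset) auto
            finally have "card (N s - Q) \<le> Suc 0" using c by simp
            moreover have "finite (N s - Q)" using fin_N xV[OF sr] by blast
            ultimately show ?thesis using card_le_Suc0_iff_eq[of "N s - Q"] s by blast
          qed
          show "N x - Q \<noteq> {}"
          proof
            assume "N x - Q = {}"
            then have "N x \<subseteq> insert r (N r - {x, y})" using xy N_irr unfolding Q_def by blast
            then have "card (N x) \<le> card (insert r (N r - {x, y}))" using fr by (intro card_mono) auto
            also have "\<dots> \<le> card (N r - {x, y}) + 1" using fr by (simp add: card_insert_if)
            also have "card (N r - {x, y}) = d - 2" using fr xy by (subst card_Diff_subset) auto
            finally show False using card_N xV[OF xy(1)] d by simp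
          qed
          show "card (N v \<inter> Q) + 2 \<le> d" if v: "v \<in> V - Q" for v
          proof -
            have "N v \<inter> Q \<subseteq> {x, y}"
            proof
              fix s assume s: "s \<in> N v \<inter> Q"
              then have "v \<in> N s" using N_sym by blast
              then show "s \<in> {x, y}" using NQ[of s] s v unfolding Q_def by blast
            qed
            then have "card (N v \<inter> Q) \<le> card {x, y}" by (intro card_mono) auto
            then show ?thesis using d xy by simp
          qed
          show "\<phi> ` Q = Q" if "aut \<phi>" "\<phi> r = r" for \<phi>
            using aut_N[OF that(1) rV] that(2) unfolding Q_def by simp
        qed (use Q d in auto)
        then show False using nd by blast
      next
        case False
        then obtain s s' where ss: "s \<in> N r" "s' \<in> N r" "s \<noteq> s'" "s' \<notin> N s" "{s, s'} \<noteq> {x, y}" by blast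
        have s's: "s \<notin> N s'" using ss N_sym by blast
        have mx: "a = y" if "a \<in> N r" "a \<noteq> x" "a \<notin> N x" for a using nn1[OF xy(1) that xy(2) xy(3)[symmetric] xy(4)] .
        have my: "a = x" if "a \<in> N r" "a \<noteq> y" "a \<notin> N y" for a using nn1[OF xy(2) that xy(1,3) yx] .
        have dis: "s \<noteq> x" "s \<noteq> y" "s' \<noteq> x" "s' \<noteq> y"
        proof -
          show "s \<noteq> x" using mx[OF ss(2)] ss(3-5) by blast
          show "s \<noteq> y" using my[OF ss(2)] ss(3-5) by blast
          show "s' \<noteq> x" using mx[OF ss(1)] ss(3,5) s's by blast
          show "s' \<noteq> y" using my[OF ss(1)] ss(3,5) s's by blast
        qed
        have o1: "v = v'" if "a \<in> N r" "b \<in> N r" "a \<noteq> b" "b \<notin> N a" "v \<in> N a - Q" "v' \<in> N a - Q" for a b v v'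
        proof -
          have sub: "insert r (N r \<inter> N a) \<subseteq> N a" using xV[OF that(1)] by blast
          have "card (insert r (N r \<inter> N a)) = card (N r \<inter> N a) + 1" using fr N_irr by simp
          then have c: "d \<le> card (insert r (N r \<inter> N a)) + 1" using t[OF that(1)] by simp
          have "N a - Q \<subseteq> N a - insert r (N r \<inter> N a)" unfolding Q_def by blast
          then have "card (N a - Q) \<le> card (N a - insert r (N r \<inter> N a))" using fin_N xV[OF that(1)] by (intro card_mono) auto
          also have "\<dots> = d - card (insert r (N r \<inter> N a))" using sub card_N xV[OF that(1)] fr by (subst card_Diff_subset) auto
          finally have "card (N a - Q) \<le> Suc 0" using c by simp
          moreover have "finite (N a - Q)" using fin_N xV[OF that(1)] by blast
          ultimately show ?thesis using card_le_Suc0_iff_eq[of "N a - Q"] that(5,6) by blast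
        qed
        \<comment> \<open>Inside \<open>Q\<close> the two vertices have at most \<open>d - 3\<close>
          common neighbours: \<open>r\<close> and the members of \<open>N r\<close> outside the two
          pairs.\<close>
        have share: "\<exists>v. v \<in> N a - Q \<and> v \<in> N b - Q"
          if a: "a \<in> N r" "a' \<in> N r" "a' \<notin> N a" and b: "b \<in> N r" "b' \<in> N r" "b' \<notin> N b" and ab: "b \<in> N a" and c4: "card {a, a', b, b'} = 4" for a a' b b'
        proof (rule ccontr)
          assume n: "\<not> ?thesis"
          have "r \<in> N a \<inter> N b" using xV a b by blast
          then have t2: "d \<le> card (N a \<inter> N b) + 2" using T[OF ab] by blast
          have "N a \<inter> N b \<subseteq> insert r (N r - {a, a', b, b'})" using n a(3) b(3) N_irr unfolding Q_def by blast
          then have "card (N a \<inter> N b) \<le> card (insert r (N r - {a, a', b, b'}))" using fr by (intro card_mono) auto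
          also have "\<dots> \<le> card (N r - {a, a', b, b'}) + 1" using fr by (simp add: card_insert_if)
          also have "card (N r - {a, a', b, b'}) = d - 4" using c4 fr a b by (subst card_Diff_subset) auto
          finally show False using t2 d by linarith
        qed
        have c4: "card {x, y, s, s'} = 4" "card {x, y, s', s} = 4" "card {y, x, s, s'} = 4" using dis xy ss by auto
        obtain w where w: "w \<in> N x - Q" "w \<in> N s - Q"
          using share[OF xy(1,2,4) ss(1,2,4) adjx(1)[OF ss(1) dis(1,2)] c4(1)] by blast
        obtain w1 where w1: "w1 \<in> N x - Q" "w1 \<in> N s' - Q"
          using share[OF xy(1,2,4) ss(2,1) s's adjx(1)[OF ss(2) dis(3,4)] c4(2)] by blast
        obtain w2 where w2: "w2 \<in> N y - Q" "w2 \<in> N s - Q"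
          using share[OF xy(2,1) yx ss(1,2,4) adjx(2)[OF ss(1) dis(1,2)] c4(3)] by blast
        \<comment> \<open>Each of the four vertices has at most one neighbour outside
          \<open>Q\<close>, so the shared neighbours coincide.\<close>
        have "w1 = w" by (rule o1[OF xy(1,2,3,4) w1(1) w(1)])
        moreover have "w2 = w" by (rule o1[OF ss(1,2,3,4) w2(2) w(2)])
        ultimately have wN: "x \<in> N w" "y \<in> N w" "s \<in> N w" "s' \<in> N w" using w w1 w2 N_sym by blast+
        have wV: "w \<in> V" "w \<notin> Q" using w N_V by blast+
        have rw: "r \<notin> N w" "w \<noteq> r" "w \<notin> N r" using wV(2) N_sym unfolding Q_def by blast+
        have Nx: "N x = insert r (insert w (N r - {x, y}))"
        proof (rule N_eqI)
          show "insert r (insert w (N r - {x, y})) \<subseteq> N x" using adjx(1) xV[OF xy(1)] w by blast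
          have "card (N r - {x, y}) = d - 2" using fr xy by (subst card_Diff_subset) auto
          then show "d \<le> card (insert r (insert w (N r - {x, y})))" using rw fr N_irr[of r] by simp
        qed (use xV xy in auto)
        have "s \<in> N x \<inter> N w" using wN adjx(1)[OF ss(1) dis(1,2)] by blast
        then have t2: "d \<le> card (N x \<inter> N w) + 2" using T[of w x] w by blast
        have "N x \<inter> N w \<subseteq> N r - {x, y}" unfolding Nx using rw N_irr[of w] by blast
        moreover have "card (N r - {x, y}) = d - 2" using fr xy by (subst card_Diff_subset) auto
        ultimately have "N x \<inter> N w = N r - {x, y}" using t2 fr by (intro card_seteq) auto
        then have "N r \<subseteq> N w" using wN by blast
        then have Nw: "N w = N r" using N_eqI[OF wV(1)] fr by simp
        have wv: "w \<in> N v" if "v \<in> N r" for v using that Nw N_sym by blast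
        have Nv: "N v = insert r (insert w (N r \<inter> N v))" if "v \<in> N r" for v
        proof (rule N_eqI)
          show "insert r (insert w (N r \<inter> N v)) \<subseteq> N v" using wv xV that by blast
          show "d \<le> card (insert r (insert w (N r \<inter> N v)))" using t[OF that] rw fr N_irr[of r] by simp
        qed (use xV that in auto)
        have VQ: "insert r (insert w (N r)) = V"
        proof (rule closed_V)
          show "insert r (insert w (N r)) \<subseteq> V" using rV wV xV by blast
          show "N v \<subseteq> insert r (insert w (N r))" if "v \<in> insert r (insert w (N r))" for v using that Nw Nv by blast
        qed simp
        \<comment> \<open>For \<open>d = 5\<close> the fifth vertex of \<open>N r\<close> would be
          adjacent to the other four and to \<open>r\<close> and \<open>w\<close>, one neighbour too
          many.\<close>
        have "d \<noteq> 5"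
        proof
          assume d5: "d = 5"
          have "card (N r - {x, y, s, s'}) = 1" using fr c4(1) xy ss d5 by (subst card_Diff_subset) auto
          then obtain v where v: "N r - {x, y, s, s'} = {v}" by (auto simp: card_1_singleton_iff)
          then have vr: "v \<in> N r" "v \<noteq> x" "v \<noteq> y" "v \<noteq> s" "v \<noteq> s'" by blast+
          have "{x, y, s, s'} \<subseteq> N v"
          proof -
            have "s \<in> N v" using nn1[OF ss(1,2) ss(3)[symmetric] ss(4) vr(1,4)] vr N_sym by blast
            moreover have "s' \<in> N v" using nn1[OF ss(2,1,3) s's vr(1,5)] vr N_sym by blast
            ultimately show ?thesis using adjx[OF vr(1,2,3)] by blast
          qed
          then have "{r, w, x, y, s, s'} \<subseteq> N v" using wv xV vr by blast
          then have "card {r, w, x, y, s, s'} \<le> card (N v)" using fin_N xV vr by (intro card_mono) auto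
          moreover have "card {r, w, x, y, s, s'} = 6"
          proof -
            have "r \<notin> {x, y, s, s'}" "w \<notin> {x, y, s, s'}" using xy ss N_irr[of r] rw by blast+
            then show ?thesis using c4(1) rw by simp
          qed
          ultimately show False using card_N xV vr d5 by simp
        qed
        then have d': "d = 4 \<or> 6 \<le> d" using d by linarith
        show False using start_cocktail[OF d' rV wV(1) rw(2)[symmetric] Nw VQ[symmetric] xy(1,2) Nx xy(3)] nd by blast
      qed
    qed
  next
    case False
    then have B: "\<exists>p\<in>N r. N r \<inter> N p = {}" if "c \<in> N r" "N r \<inter> N c \<noteq> {}" for r c using that by blast
    define r where "r = r0"
    obtain c where c: "c \<in> N r" "N r \<inter> N c \<noteq> {}" using tri r_def by blast
    obtain p where p: "p \<in> N r" "N r \<inter> N p = {}" using B[OF c] by blast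
    have rV: "r \<in> V" using c N_V by blast
    have fr: "finite (N r)" "card (N r) = d" using fin_N card_N rV by auto
    have xV: "x \<in> V" "r \<in> N x" "x \<noteq> r" if "x \<in> N r" for x using that N_V N_sym N_irr by blast+
    have pc: "p \<noteq> c" using p c by blast
    have np: "p \<notin> N x" if "x \<in> N r" for x using that p N_sym by blast
    \<comment> \<open>Neither \<open>x\<close> nor \<open>p\<close> is a common neighbour, so the
      lower bound \<open>d - 2\<close> is attained.\<close>
    have full: "N r \<inter> N x = N r - {x, p}" if x: "x \<in> N r" "x \<noteq> p" "N r \<inter> N x \<noteq> {}" for x
    proof -
      have "N r \<inter> N x \<subseteq> N r - {x, p}" using np[OF x(1)] N_irr by blast
      moreover have "card (N r - {x, p}) = d - 2" using fr x p by (subst card_Diff_subset) auto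
      ultimately show ?thesis using T[OF x(1,3)] fr by (intro card_seteq) auto
    qed
    have full': "N r \<inter> N x = N r - {x, p}" if x: "x \<in> N r" "x \<noteq> p" for x
    proof (cases "x = c")
      case True then show ?thesis using full c pc by blast
    next
      case False
      then have "x \<in> N c" using full[OF c(1) pc[symmetric] c(2)] x by blast
      then have "c \<in> N r \<inter> N x" using c N_sym by blast
      then show ?thesis using full x by blast
    qed
    define Q where "Q = insert r (N r - {p})"
    have Q: "finite Q" "card Q = d" "Q \<subseteq> V"
      using fr N_irr[of r] rV xV p d by (auto simp: Q_def card_Diff_singleton)
    have adj: "t \<in> N s" if "s \<in> Q" "t \<in> Q" "s \<noteq> t" for s t
    proof -
      from that consider "s = r" "t \<in> N r" | "t = r" "s \<in> N r" | "s \<in> N r - {p}" "t \<in> N r - {p}" unfolding Q_def by blast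
      then show ?thesis
      proof cases
        case 1 then show ?thesis by simp
      next
        case 2 then show ?thesis using xV by simp
      next
        case 3 then show ?thesis using full'[of s] that by blast
      qed
    qed
    have one: "card (N s - Q) = 1" if s: "s \<in> Q" for s
    proof -
      have e: "N s - Q = N s - (Q - {s})" using N_irr by blast
      have "card (N s - (Q - {s})) = card (N s) - card (Q - {s})" using adj s Q by (intro card_Diff_subset) auto
      also have "\<dots> = d - (d - 1)" using card_N Q s by auto
      finally show ?thesis unfolding e using d by simp
    qed
    have "\<exists>C. distinguishes C"
    proof (rule start_clique[of Q c r])
      show "c \<in> Q" "r \<in> Q" "r \<noteq> c" using c pc xV by (auto simp: Q_def)
      show "A s t" if "s \<in> Q" "t \<in> Q" "s \<noteq> t" for s t using adj[OF that] ND by blast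
      show "s = t" if "s \<in> Q" "s \<noteq> c" "\<not> A s c" for s t using adj[OF that(1) \<open>c \<in> Q\<close> that(2)] that(3) ND by blast
      show "v = w" if s: "s \<in> Q" "v \<in> N s - Q" "w \<in> N s - Q" for s v w
        using one[OF s(1)] s(2,3) by (metis card_1_singletonE singletonD)
      show "N c - Q \<noteq> {}" using one[OF \<open>c \<in> Q\<close>] by (metis card.empty zero_neq_one)
      show "card (N v \<inter> Q) + 2 \<le> d" if v: "v \<in> V - Q" for v
      proof -
        \<comment> \<open>If \<open>s\<close> and \<open>s'\<close> differ, \<open>v\<close> has to
          be the neighbour of \<open>s\<close> whose edge to \<open>s\<close> lies in no triangle,
          but \<open>s'\<close> completes a triangle on this edge.\<close>
        have "s = s'" if ss: "s \<in> N v \<inter> Q" "s' \<in> N v \<inter> Q" for s s'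
        proof (rule ccontr)
          assume ne: "s \<noteq> s'"
          have c3: "\<exists>q\<in>Q. q \<noteq> a \<and> q \<noteq> b" for a b
          proof -
            have "card {a, b} \<le> 2" by (simp add: card_insert_if)
            then have "\<not> Q \<subseteq> {a, b}" using Q(2) d card_mono[of "{a, b}" Q] by auto
            then show ?thesis by blast
          qed
          have s's: "s' \<in> N s" using adj ss ne by blast
          obtain q where q: "q \<in> Q" "q \<noteq> s" "q \<noteq> s'" using c3 by blast
          have "q \<in> N s \<inter> N s'" using adj q ss by blast
          then obtain ps where ps: "ps \<in> N s" "N s \<inter> N ps = {}" using B[OF s's] by blast
          have "ps \<notin> Q"
          proof
            assume "ps \<in> Q"
            obtain q where q: "q \<in> Q" "q \<noteq> s" "q \<noteq> ps" using c3 by blast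
            then have "q \<in> N s \<inter> N ps" using adj ss \<open>ps \<in> Q\<close> by blast
            then show False using ps by blast
          qed
          moreover have "v \<in> N s - Q" using ss v N_sym by blast
          ultimately have "ps = v" using one[of s] ss ps(1) by (metis DiffI IntD2 card_1_singletonE singletonD)
          then show False using ps(2) ss s's by blast
        qed
        then have "card (N v \<inter> Q) \<le> Suc 0" using Q by (subst card_le_Suc0_iff_eq) auto
        then show ?thesis using d by simp
      qed
      show "\<phi> ` Q = Q" if \<phi>: "aut \<phi>" "\<phi> r = r" for \<phi>
      proof -
        have Nr: "\<phi> ` N r = N r" using aut_N[OF \<phi>(1) rV] \<phi>(2) by simp
        \<comment> \<open>Among the neighbours of \<open>r\<close> only \<open>p\<close> has no
          common neighbour with \<open>r\<close>.\<close>
        have "\<phi> p = p"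
        proof (rule ccontr)
          assume n: "\<phi> p \<noteq> p"
          have pr: "\<phi> p \<in> N r" using Nr p(1) by blast
          have "card (N r - {\<phi> p, p}) = d - 2" using fr pr p n by (subst card_Diff_subset) auto
          then have "card (N r \<inter> N (\<phi> p)) \<noteq> 0" using d unfolding full'[OF pr n] by linarith
          then have "N r \<inter> N (\<phi> p) \<noteq> {}" by (metis card.empty)
          then obtain b where b: "b \<in> N r" "b \<in> N (\<phi> p)" by blast
          then obtain a where a: "a \<in> N r" "b = \<phi> a" using Nr by blast
          have "a \<in> N p" using b(2) a aut_N_mem[OF \<phi>(1) xV(1)[OF a(1)] xV(1)[OF p(1)]] by blast
          then show False using a p by blast
        qed
        moreover have "inj_on \<phi> (N r)" using aut_inj[OF \<phi>(1)] xV(1) unfolding inj_on_def by blast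
        ultimately have "\<phi> ` (N r - {p}) = N r - {p}"
          using Nr p(1) by (metis image_insert inj_on_image_set_diff insert_absorb image_empty Diff_subset empty_subsetI insert_subset)
        then show ?thesis using \<phi>(2) unfolding Q_def by simp
      qed
    qed (use Q d in auto)
    then show False using nd by blast
  qed
qed

lemma girth_5:
  assumes tf: tri_free and c4: "\<And>r b c c'. r \<noteq> b \<Longrightarrow> c \<in> N r \<inter> N b \<Longrightarrow> c' \<in> N r \<inter> N b \<Longrightarrow> c = c'" and k: "cyc k f"
  shows "5 \<le> k"
proof (rule ccontr)
  assume "\<not> 5 \<le> k"
  have inj: "f i = f j \<Longrightarrow> i < k \<Longrightarrow> j < k \<Longrightarrow> i = j" for i j using k unfolding cyc_def by (auto dest: inj_onD)
  have st: "f (i + 1) \<in> N (f i)" if "i + 1 < k" for i using k that NI unfolding cyc_def by blast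
  have cl: "f 0 \<in> N (f (k - 1))" "3 \<le> k" using k NI unfolding cyc_def by blast+
  consider "k = 3" | "k = 4" using cl \<open>\<not> 5 \<le> k\<close> by linarith
  then show False
  proof cases
    case 1
    have "f 1 \<in> N (f 0)" "f 2 \<in> N (f 1)" "f 0 \<in> N (f 2)" using st[of 0] st[of 1] cl 1 by (auto simp: numeral_2_eq_2)
    then show False using tri_freeD[OF tf, of "f 1" "f 0" "f 2"] N_sym by blast
  next
    case 2
    have n: "f 1 \<in> N (f 0)" "f 2 \<in> N (f 1)" "f 3 \<in> N (f 2)" "f 0 \<in> N (f 3)"
      using st[of 0] st[of 1] st[of 2] cl 2 by (auto simp: numeral_2_eq_2 numeral_3_eq_3)
    then have "f 1 \<in> N (f 0) \<inter> N (f 2)" "f 3 \<in> N (f 0) \<inter> N (f 2)" using N_sym by blast+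
    moreover have "f 0 \<noteq> f 2" "f 1 \<noteq> f 3" using inj[of 0 2] inj[of 1 3] 2 by auto
    ultimately show False using c4[of "f 0" "f 2" "f 1" "f 3"] by blast
  qed
qed

text \<open>By \<open>start_c4\<close> and \<open>start_c4_big\<close>, vertices with two common
  neighbours are twins. Then the neighbours of twins have two common neighbours and are twins as
  well, so a single pair forces a complete bipartite graph. Without such pairs there are no cycles
  of length less than 5.\<close>

lemma triangle_free_case:
  assumes d: "4 \<le> d" and tf: tri_free and ne: "V \<noteq> {}"
  shows "\<exists>C. distinguishes C"
proof (rule ccontr)
  assume nd: "\<not> ?thesis"
  have twin: "N r = N b" if rb: "r \<noteq> b" "c \<in> N r \<inter> N b" "c' \<in> N r \<inter> N b" "c \<noteq> c'" for r b c c'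
  proof -
    have V: "r \<in> V" "b \<in> V" using rb N_V by blast+
    have f: "finite (N r \<inter> N b)" using fin_N V by blast
    have nb: "b \<notin> N r" using tri_freeD[OF tf, of c r b] rb N_sym by blast
    have "card {c, c'} \<le> card (N r \<inter> N b)" using rb f by (intro card_mono) auto
    then have c2: "2 \<le> card (N r \<inter> N b)" using rb by simp
    have "\<not> card (N r \<inter> N b) + 2 \<le> d" using start_c4[OF tf d V rb(1) nb c2] nd by blast
    moreover have "card (N r \<inter> N b) + 1 \<noteq> d" using start_c4_big[OF tf d V rb(1)] nd by blast
    ultimately have c: "d \<le> card (N r \<inter> N b)" by linarith
    show ?thesis using N_eqI[OF V(1) Int_lower1 c] N_eqI[OF V(2) Int_lower2 c] by simp
  qed
  show False
  proof (cases "\<exists>r b c c'. r \<noteq> b \<and> c \<in> N r \<inter> N b \<and> c' \<in> N r \<inter> N b \<and> c \<noteq> c'")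
    case True
    then obtain r b c0 where rb: "r \<noteq> b" "N r = N b" "c0 \<in> N r" using twin by blast
    have Nc: "N x = N c0" if "x \<in> N r" for x
    proof (cases "x = c0")
      case False
      have "r \<in> N x \<inter> N c0" "b \<in> N x \<inter> N c0" using that rb N_sym by blast+
      then show ?thesis using twin False rb(1) by blast
    qed simp
    have rV: "r \<in> V" "c0 \<in> V" using rb N_V by blast+
    have Ny: "N y = N r" if "y \<in> N c0" for y
    proof (rule N_eqI)
      show "y \<in> V" using that N_V by blast
      show "N r \<subseteq> N y" using Nc that N_sym by blast
    qed (use card_N rV in simp)
    have "N r \<union> N c0 = V"
    proof (rule closed_V)
      show "N r \<union> N c0 \<subseteq> V" using N_V by blast
      show "N r \<union> N c0 \<noteq> {}" using rb by blast
      show "N x \<subseteq> N r \<union> N c0" if "x \<in> N r \<union> N c0" for x using that Nc Ny by blast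
    qed
    moreover have "N r \<inter> N c0 = {}" using tri_freeD[OF tf rb(3)] by blast
    ultimately show False using start_bipartite[OF d, of "N r" "N c0"] Nc Ny rb(3) nd by blast
  next
    case False
    have "5 \<le> k" if k: "cyc k f" for k f using girth_5[OF tf _ k] False by blast
    then show False using start_girth[OF _ ne] d nd by auto
  qed
qed

lemma cubic_case:
  assumes d: "d = 3" and ne: "V \<noteq> {}"
    and noK: "\<not> (\<forall>x\<in>V. \<forall>y\<in>V. x \<noteq> y \<longrightarrow> A x y)"
    and noB: "\<And>X Y. V = X \<union> Y \<Longrightarrow> X \<inter> Y = {} \<Longrightarrow> X \<noteq> {} \<Longrightarrow> (\<And>x. x \<in> X \<Longrightarrow> N x = Y) \<Longrightarrow> (\<And>y. y \<in> Y \<Longrightarrow> N y = X) \<Longrightarrow> False"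
  shows "\<exists>C. distinguishes C"
proof (cases tri_free)
  case tf: True
  show ?thesis
  proof (cases "\<exists>u\<in>V. \<exists>v\<in>V. u \<noteq> v \<and> N u = N v")
    case True
    then obtain u v where uv: "u \<in> V" "v \<in> V" "u \<noteq> v" "N u = N v" by blast
    have "card (N u) = 3" using card_N uv d by simp
    then obtain y1 y2 y3 where y: "N u = {y1, y2, y3}" "y1 \<noteq> y2" "y1 \<noteq> y3" "y2 \<noteq> y3" by (auto simp: card_3_iff)
    have yN: "u \<in> N y \<and> v \<in> N y \<and> y \<in> V" if "y \<in> N u" for y using that uv(4) N_sym N_V by blast
    have ex: "\<exists>p. N y = {u, v, p} \<and> p \<noteq> u \<and> p \<noteq> v" if "y \<in> N u" for y using card3[OF d _ _ _ uv(3)] yN[OF that] by blast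
    have yi: "y1 \<in> N u" "y2 \<in> N u" "y3 \<in> N u" using y(1) by auto
    obtain p1 where p1: "N y1 = {u, v, p1}" "p1 \<noteq> u" "p1 \<noteq> v" using ex[OF yi(1)] by metis
    obtain p2 where p2: "N y2 = {u, v, p2}" using ex[OF yi(2)] by metis
    obtain p3 where p3: "N y3 = {u, v, p3}" using ex[OF yi(3)] by metis
    have Nv: "N v = {y1, y2, y3}" using uv(4) y(1) by simp
    have perm: "{y1, y2, y3} = {y1, y3, y2}" "{y1, y2, y3} = {y2, y3, y1}" by auto
    \<comment> \<open>If the three third neighbours are not all equal, one of them differs from both
      others, as \<open>start_twins\<close> requires up to the order of the
      \<open>y\<close>.\<close>
    consider "p1 = p2 \<and> p1 = p3" | "p3 \<noteq> p1" "p3 \<noteq> p2" | "p2 \<noteq> p1" "p2 \<noteq> p3" | "p1 \<noteq> p2" "p1 \<noteq> p3" by metis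
    then show ?thesis
    proof cases
      case 1
      have "y1 \<in> N p1" "y2 \<in> N p1" "y3 \<in> N p1" using p1(1) p2 p3 1 N_sym by blast+
      moreover have "p1 \<in> V" using p1(1) N_V by blast
      ultimately have Np: "N p1 = {y1, y2, y3}" using N_eqI[of p1 "{y1, y2, y3}"] y d by auto
      have cl: "N x = {u, v, p1}" if "x \<in> N u" for x using that p1(1) p2 p3 1 unfolding y(1) by auto
      have cl2: "N x = N u" if "x \<in> {u, v, p1}" for x using that Np y(1) uv(4) by auto
      have "N u \<union> {u, v, p1} = V"
      proof (rule closed_V)
        show "N u \<union> {u, v, p1} \<subseteq> V" using N_V uv \<open>p1 \<in> V\<close> by blast
        show "N x \<subseteq> N u \<union> {u, v, p1}" if "x \<in> N u \<union> {u, v, p1}" for x using that cl cl2 by blast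
      qed auto
      moreover have "N u \<inter> {u, v, p1} = {}"
        using tri_freeD[OF tf yi(1)] p1(1) by blast
      ultimately show ?thesis using noB[of "N u" "{u, v, p1}"] cl cl2 yi(1) by blast
    next
      case 2
      show ?thesis by (rule start_twins[OF d tf uv(1-3) y(1) Nv y(2-4) p1(1) p2 p3 2])
    next
      case 3
      show ?thesis by (rule start_twins[OF d tf uv(1-3) y(1)[unfolded perm(1)] Nv[unfolded perm(1)] y(3,2) y(4)[symmetric] p1(1) p3 p2 3])
    next
      case 4
      show ?thesis by (rule start_twins[OF d tf uv(1-3) y(1)[unfolded perm(2)] Nv[unfolded perm(2)] y(4) y(2)[symmetric] y(3)[symmetric] p2 p3 p1(1) 4])
    qed
  next
    case nt: False
    show ?thesis
    proof (cases "\<exists>r b c c'. r \<noteq> b \<and> c \<in> N r \<inter> N b \<and> c' \<in> N r \<inter> N b \<and> c \<noteq> c'")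
      case True
      then obtain r b c c' where h: "r \<noteq> b" "c \<in> N r \<inter> N b" "c' \<in> N r \<inter> N b" "c \<noteq> c'" by blast
      have "r \<in> V" "b \<in> V" using h N_V by blast+
      then show ?thesis using start_cubic_c4[OF d tf _ _ _ h] nt by blast
    next
      case False
      have "5 \<le> k" if k: "cyc k f" for k f using girth_5[OF tf _ k] False by blast
      then show ?thesis using start_girth[OF _ ne] d by auto
    qed
  qed
next
  case False
  then obtain u v w where uvw: "A u v" "w \<in> N u" "w \<in> N v" unfolding tri_free_def by blast
  show ?thesis
  proof (cases "\<exists>r c. A r c \<and> 2 \<le> card (N r \<inter> N c)")
    case True
    then obtain r c where rc: "A r c" "2 \<le> card (N r \<inter> N c)" by blast
    have V: "r \<in> V" "c \<in> V" using rc A_V A_sym by blast+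
    have n: "c \<in> N r" "r \<in> N c" using rc NI A_sym by blast+
    have "N r \<inter> N c \<subseteq> N r - {c}" using N_irr by blast
    then have "card (N r \<inter> N c) \<le> card (N r - {c})" using fin_N V by (intro card_mono) auto
    also have "\<dots> = 2" using card_N V n d by simp
    finally have "card (N r \<inter> N c) = 2" using rc by simp
    then obtain x1 x2 where x: "N r \<inter> N c = {x1, x2}" "x1 \<noteq> x2" by (auto simp: card_2_iff)
    show ?thesis
    proof (cases "A x1 x2")
      case False then show ?thesis using start_diamond[OF d rc(1) x False] by blast
    next
      case True
      have xn: "x1 \<in> N r" "x2 \<in> N r" "x1 \<in> N c" "x2 \<in> N c" using x by blast+
      have adj: "b \<in> N a" if "a \<in> {r, c, x1, x2}" "b \<in> {r, c, x1, x2}" "a \<noteq> b" for a b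
      proof -
        have "x1 \<in> N x2" "x2 \<in> N x1" using True NI A_sym by blast+
        moreover have "r \<in> N x1" "r \<in> N x2" "c \<in> N x1" "c \<in> N x2" using xn N_sym by blast+
        ultimately show ?thesis using that n xn by auto
      qed
      have c4: "card {r, c, x1, x2} = 4"
      proof -
        have "r \<notin> {c, x1, x2}" "c \<notin> {x1, x2}" using n xn N_irr by blast+
        then show ?thesis using x(2) by simp
      qed
      have "{r, c, x1, x2} = V"
      proof (rule closed_V)
        show "{r, c, x1, x2} \<subseteq> V" using V xn N_V by blast
        show "N a \<subseteq> {r, c, x1, x2}" if a: "a \<in> {r, c, x1, x2}" for a
        proof -
          have "card ({r, c, x1, x2} - {a}) = card {r, c, x1, x2} - 1" by (rule card_Diff_singleton[OF a])
          then have c3: "d \<le> card ({r, c, x1, x2} - {a})" unfolding c4 d by simp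
          have sub: "{r, c, x1, x2} - {a} \<subseteq> N a" using adj a by blast
          have aV: "a \<in> V" using a V xn N_V by blast
          have "N a = {r, c, x1, x2} - {a}" by (rule N_eqI[OF aV sub c3])
          then show ?thesis by blast
        qed
      qed simp
      then have "\<forall>a\<in>V. \<forall>b\<in>V. a \<noteq> b \<longrightarrow> A a b" using adj ND by blast
      then show ?thesis using noK by blast
    qed
  next
    case False
    have one: "card (N u \<inter> N v) \<le> 1" if "A u v" for u v
    proof -
      have "\<not> 2 \<le> card (N u \<inter> N v)" using False that by blast
      then show ?thesis by simp
    qed
    show ?thesis by (rule start_triangle[OF d, of u v w]) (use uvw ND one in auto)
  qed
qed

lemma cycle_case:
  assumes d: "d = 2" and ne: "V \<noteq> {}"
    and small: "\<And>(n :: nat) f. 3 \<le> n \<Longrightarrow> n \<le> 5 \<Longrightarrow> bij_betw f {..<n} V \<Longrightarrow>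
      (\<And>i j. i < n \<Longrightarrow> j < n \<Longrightarrow> A (f i) (f j) \<longleftrightarrow> j = (i + 1) mod n \<or> i = (j + 1) mod n) \<Longrightarrow> False"
  shows "\<exists>C. distinguishes C"
proof -
  obtain x where x: "x \<in> V" using ne by blast
  have "N x \<noteq> {}" using card_N[OF x] d by auto
  then obtain y where "A x y" using ND by blast
  then obtain u :: "int \<Rightarrow> 'a" where adj: "\<And>i. A (u i) (u (i + 1))" and nbk: "\<And>i. u (i - 1) \<noteq> u (i + 1)"
    using nonbacktracking_walk[of x y] d by auto
  have uV: "u i \<in> V" for i using adj A_V by blast
  have Nu: "N (u i) = {u (i - 1), u (i + 1)}" for i
  proof (rule N_eqI[OF uV])
    have "A (u (i - 1)) (u i)" using adj[of "i - 1"] by simp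
    then show "{u (i - 1), u (i + 1)} \<subseteq> N (u i)" using adj[of i] A_sym NI by blast
    show "d \<le> card {u (i - 1), u (i + 1)}" using nbk[of i] d by simp
  qed
  have ru: "range u = V" by (rule closed_V) (use uV Nu in auto)
  have step: "u i \<noteq> u (i + 1)" for i using adj[of i] A_irr by metis
  \<comment> \<open>The walk never runs back along itself: a reflected segment shrinks by two at a
    time until it is a loop or an immediate reversal.\<close>
  have refl: "\<not> (u s = u (s + int n) \<and> u (s + 1) = u (s + int n - 1))" if "0 < n" for n s
    using that
  proof (induction n arbitrary: s rule: less_induct)
    case (less n)
    show ?case
    proof
      assume h: "u s = u (s + int n) \<and> u (s + 1) = u (s + int n - 1)"
      have h1: "u s = u (s + int n)" and h2: "u (s + 1) = u (s + int n - 1)" using h by blast+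
      have i0: "s + 1 - 1 = s" "s + 1 + 1 = s + 2" by simp_all
      have nb1: "u s \<noteq> u (s + 2)" using nbk[of "s + 1"] unfolding i0 .
      have "n \<noteq> 1"
      proof
        assume "n = 1"
        then have "u s = u (s + 1)" using h1 by (simp only: of_nat_1)
        then show False using step by blast
      qed
      moreover have "n \<noteq> 2"
      proof
        assume "n = 2"
        then have "u s = u (s + 2)" using h1 by (simp only: of_nat_numeral)
        then show False using nb1 by blast
      qed
      ultimately have n3: "3 \<le> n" using less.prems by linarith
      then have i: "int (n - 2) = int n - 2" by simp
      have i2: "s + 1 + 1 = s + 2" "s + int n - 1 - 1 = s + int n - 2" "s + int n - 1 + 1 = s + int n" by simp_all
      have "u (s + 2) \<in> N (u (s + 1))" using Nu[of "s + 1"] unfolding i2 by blast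
      then have "u (s + 2) \<in> {u (s + int n - 2), u (s + int n)}" using Nu[of "s + int n - 1"] unfolding h2 i2 by simp
      then have "u (s + 2) = u (s + int n - 2)" using nb1 h1 by auto
      then have "u (s + 1) = u (s + 1 + int (n - 2)) \<and> u (s + 1 + 1) = u (s + 1 + int (n - 2) - 1)"
        using h2 unfolding i by (simp add: algebra_simps)
      then show False using less.IH[of "n - 2" "s + 1"] n3 by auto
    qed
  qed
  have per1: "u (s + 1) = u (t + 1) \<and> u (s - 1) = u (t - 1)" if st: "u s = u t" "s < t" for s t
  proof -
    have e: "{u (s - 1), u (s + 1)} = {u (t - 1), u (t + 1)}" using Nu[of s] Nu[of t] st(1) by simp
    have "u (s + 1) \<noteq> u (t - 1)" using refl[of "nat (t - s)" s] st by auto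
    then show ?thesis using e nbk[of s] by (metis doubleton_eq_iff)
  qed
  have per: "u (s + 1) = u (t + 1) \<and> u (s - 1) = u (t - 1)" if "u s = u t" for s t
  proof (cases s t rule: linorder_cases)
    case less then show ?thesis by (rule per1[OF that])
  next
    case equal then show ?thesis by blast
  next
    case greater then show ?thesis using per1[OF that[symmetric]] by metis
  qed
  have shift: "u (s + k) = u (t + k)" if "u s = u t" for s t k
  proof (induction k rule: int_induct[where k = 0])
    case base then show ?case using that by simp
  next
    case (step1 i) then show ?case using per[of "s + i" "t + i"] by (simp add: algebra_simps)
  next
    case (step2 i) then show ?case using per[of "s + i" "t + i"] by (simp add: algebra_simps)
  qed
  show ?thesis
  proof (cases "inj_on u {-1..4}")
    case inj: True
    have dis: "u i \<noteq> u j" if "i \<in> {-1..4}" "j \<in> {-1..4}" "i \<noteq> j" for i j using inj_onD[OF inj] that by blast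
    \<comment> \<open>The vertex \<open>u 1\<close> in the middle of the red path is the only one
      without blue edges, and the single red edge beyond \<open>u 2\<close> marks the direction. The
      pattern needs six distinct vertices \<open>u (-1)\<close>, ..., \<open>u 4\<close>, hence the
      exclusion of shorter cycles.\<close>
    let ?E = "{{u 0, u 1}, {u 1, u 2}, {u 3, u 4}}"
    define C where "C = ecol ?E"
    have sym: "symc C" unfolding C_def by (rule ecol_symc)
    have N5: "u (-1) \<in> N (u 0)" "u 0 \<in> N (u 1)" "u 2 \<in> N (u 1)" "u 3 \<in> N (u 2)" "u 2 \<in> N (u 3)" "u 4 \<in> N (u 3)" "u 5 \<in> N (u 4)"
      using Nu[of 0] Nu[of 1] Nu[of 2] Nu[of 3] Nu[of 4] by auto
    have ne: "u (-1) \<noteq> u 0" "u (-1) \<noteq> u 1" "u (-1) \<noteq> u 2" "u (-1) \<noteq> u 3" "u (-1) \<noteq> u 4" "u 0 \<noteq> u 1" "u 0 \<noteq> u 2" "u 0 \<noteq> u 3" "u 0 \<noteq> u 4"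
      "u 1 \<noteq> u 2" "u 1 \<noteq> u 3" "u 1 \<noteq> u 4" "u 2 \<noteq> u 3" "u 2 \<noteq> u 4" "u 3 \<noteq> u 4"
      by (rule dis; simp)+
    have n5: "u 5 \<noteq> u 3" "u 5 \<noteq> u 4" using nbk[of 4] step[of 4] by auto
    have nred: "\<not> C v w" if "v \<notin> {u 0, u 1, u 2, u 3, u 4}" for v w
      using that unfolding C_def ecol_def by (auto simp: doubleton_eq_iff)
    have col: "C (u 1) (u 0)" "C (u 1) (u 2)" "C (u 3) (u 4)" "\<not> C (u 0) (u (-1))" "\<not> C (u 2) (u 3)" "\<not> C (u 3) (u 2)" "\<not> C (u 4) (u 5)"
      using ne n5 unfolding C_def ecol_def by (auto simp: doubleton_eq_iff)
    have "\<forall>v\<in>V. \<phi> v = v" if \<phi>: "aut \<phi>" "pres C \<phi>" for \<phi>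
    proof -
      have f1: "\<phi> (u 1) = u 1"
      proof (rule fix_allred[OF \<phi> uV])
        show "C (u 1) w" if "w \<in> N (u 1)" for w using that col Nu[of 1] by auto
        fix v assume v: "v \<in> V" "v \<noteq> u 1"
        consider "v = u 0" | "v = u 2" | "v = u 3" | "v = u 4" | "v \<notin> {u 0, u 1, u 2, u 3, u 4}" using v by blast
        then show "\<exists>a\<in>N v. \<not> C v a"
        proof cases
          case 5
          obtain i where "v = u i" using v ru by blast
          then have "N v \<noteq> {}" using Nu[of i] by blast
          then show ?thesis using nred[OF 5] by blast
        qed (use N5 col in blast)+
      qed
      have im: "\<phi> a \<in> N (\<phi> b)" if "a \<in> N b" for a b using aut_N_mem[OF \<phi>(1)] that N_V by blast
      have inj\<phi>: "\<phi> (u i) \<noteq> \<phi> (u j)" if "u i \<noteq> u j" for i j using aut_inj[OF \<phi>(1) uV uV] that by blast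
      have f02: "\<phi> (u 0) \<in> {u 0, u 2}" "\<phi> (u 2) \<in> {u 0, u 2}" using im[OF N5(2)] im[OF N5(3)] f1 Nu[of 1] by auto
      have f2: "\<phi> (u 2) = u 2"
      proof (rule ccontr)
        assume "\<phi> (u 2) \<noteq> u 2"
        then have "\<phi> (u 2) = u 0" using f02 by blast
        then have "\<phi> (u 3) \<in> {u (-1), u 1}" using im[OF N5(4)] Nu[of 0] by simp
        moreover have "\<phi> (u 3) \<noteq> u 1" using inj\<phi>[OF ne(11)] f1 by auto
        ultimately have "\<phi> (u 3) = u (-1)" by blast
        then have "C (u (-1)) (\<phi> (u 4))" using aut_pres_C[OF \<phi>(2) N5(6)] col(3) by simp
        moreover have "u (-1) \<notin> {u 0, u 1, u 2, u 3, u 4}" using ne by blast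
        ultimately show False using nred by blast
      qed
      have go: "\<phi> (u k) = u k" if "\<phi> (u i) = u i" "{u (i - 1), u (i + 1)} = {u j, u k}" "\<phi> (u j) = u j" "u j \<noteq> u k" for i j k
      proof -
        have "u k \<in> N (u i)" using Nu[of i] that(2) by blast
        then have "\<phi> (u k) \<in> N (u i)" using im that(1) by metis
        then have "\<phi> (u k) \<in> {u j, u k}" using Nu[of i] that(2) by simp
        moreover have "\<phi> (u k) \<noteq> u j" using inj\<phi>[OF that(4)] that(3) by auto
        ultimately show ?thesis by blast
      qed
      have up: "\<phi> (u (1 + int n)) = u (1 + int n) \<and> \<phi> (u (2 + int n)) = u (2 + int n)" for n
      proof (induction n)
        case 0 then show ?case using f1 f2 by simp
      next
        case (Suc n)
        have i: "2 + int n - 1 = 1 + int n" "2 + int n + 1 = 3 + int n" "1 + int (Suc n) = 2 + int n" "2 + int (Suc n) = 3 + int n" by simp_all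
        have "\<phi> (u (3 + int n)) = u (3 + int n)"
        proof (rule go[of "2 + int n" "1 + int n"])
          show "{u (2 + int n - 1), u (2 + int n + 1)} = {u (1 + int n), u (3 + int n)}" unfolding i ..
          show "u (1 + int n) \<noteq> u (3 + int n)" using nbk[of "2 + int n"] unfolding i .
        qed (use Suc in auto)
        then show ?case using Suc unfolding i(3,4) by blast
      qed
      have down: "\<phi> (u (2 - int n)) = u (2 - int n) \<and> \<phi> (u (1 - int n)) = u (1 - int n)" for n
      proof (induction n)
        case 0 then show ?case using f1 f2 by simp
      next
        case (Suc n)
        have i: "1 - int n - 1 = - int n" "1 - int n + 1 = 2 - int n" "2 - int (Suc n) = 1 - int n" "1 - int (Suc n) = - int n" by simp_all
        have "\<phi> (u (- int n)) = u (- int n)"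
        proof (rule go[of "1 - int n" "2 - int n"])
          show "{u (1 - int n - 1), u (1 - int n + 1)} = {u (2 - int n), u (- int n)}" unfolding i by blast
          show "u (2 - int n) \<noteq> u (- int n)" using nbk[of "1 - int n"] unfolding i by simp
        qed (use Suc in auto)
        then show ?case using Suc unfolding i(3,4) by blast
      qed
      have "\<phi> (u i) = u i" for i
      proof (cases "1 \<le> i")
        case True then show ?thesis using up[of "nat (i - 1)"] by simp
      next
        case False then show ?thesis using down[of "nat (1 - i)"] by simp
      qed
      then show ?thesis using ru by blast
    qed
    then show ?thesis unfolding distinguishes_def using sym by blast
  next
    case False
    then obtain i j where ij: "i \<in> {-1..4}" "j \<in> {-1..4}" "u i = u j" "i \<noteq> j" unfolding inj_on_def by blast
    define a where "a = min i j"
    define b where "b = max i j"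
    have ab: "u a = u b" "a < b" "b - a \<le> 5" using ij unfolding a_def b_def by (auto simp: min_def max_def)
    have "u 0 = u (b - a)" using shift[OF ab(1), of "- a"] by simp
    then have ex: "0 < nat (b - a) \<and> u 0 = u (int (nat (b - a)))" using ab by simp
    define n where "n = (LEAST n. 0 < n \<and> u 0 = u (int n))"
    have n: "0 < n" "u 0 = u (int n)" unfolding n_def using LeastI[of "\<lambda>n. 0 < n \<and> u 0 = u (int n)", OF ex] by auto
    have "n \<le> nat (b - a)" unfolding n_def by (rule Least_le[of "\<lambda>n. 0 < n \<and> u 0 = u (int n)", OF ex])
    then have n5: "n \<le> 5" using ab by linarith
    have least: "\<not> (0 < m \<and> u 0 = u (int m))" if "m < n" for m using not_less_Least that unfolding n_def by blast
    have "n \<noteq> 1" using n(2) step[of 0] by auto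
    moreover have "n \<noteq> 2" using n(2) nbk[of 1] by auto
    ultimately have n3: "3 \<le> n" using n(1) by linarith
    define f where "f = (\<lambda>i :: nat. u (int i))"
    have inj: "i = j" if h: "i < n" "j < n" "f i = f j" for i j
    proof -
      have *: False if "i < j" "j < n" "u (int i) = u (int j)" for i j
      proof -
        have "u 0 = u (int (j - i))" using shift[OF that(3), of "- int i"] that(1) by (simp add: of_nat_diff)
        moreover have "0 < j - i" "j - i < n" using that(1,2) by auto
        ultimately show False using least by blast
      qed
      show ?thesis using *[of i j] *[of j i] h unfolding f_def by (metis linorder_neqE_nat)
    qed
    have un: "u (int i + 1) = f ((i + 1) mod n)" if "i < n" for i
    proof (cases "i + 1 = n")
      case True
      then have e: "int i + 1 = int n" "(i + 1) mod n = 0" by simp_all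
      show ?thesis unfolding e f_def using n(2) by simp
    next
      case False
      then show ?thesis using that by (simp add: f_def add.commute)
    qed
    have pred: "\<exists>j<n. u (int i - 1) = f j" if "i < n" for i
    proof (cases "i = 0")
      case True
      have "u (-1) = u (int n - 1)" using per[OF n(2)] by simp
      then show ?thesis using True n by (intro exI[of _ "n - 1"]) (simp add: f_def of_nat_diff)
    next
      case False
      then show ?thesis using that by (intro exI[of _ "i - 1"]) (simp add: f_def of_nat_diff)
    qed
    have "f ` {..<n} = V"
    proof (rule closed_V)
      show "f ` {..<n} \<subseteq> V" using uV unfolding f_def by blast
      show "f ` {..<n} \<noteq> {}" using n by auto
      show "N v \<subseteq> f ` {..<n}" if "v \<in> f ` {..<n}" for v
      proof -
        from that obtain i where i: "v = f i" "i < n" by blast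
        have "u (int i + 1) \<in> f ` {..<n}" using un[OF i(2)] n by simp
        moreover have "u (int i - 1) \<in> f ` {..<n}" using pred[OF i(2)] by auto
        ultimately show ?thesis using Nu[of "int i"] i(1) unfolding f_def by auto
      qed
    qed
    then have bij: "bij_betw f {..<n} V" using inj unfolding bij_betw_def inj_on_def by blast
    have adjc: "A (f i) (f j) \<longleftrightarrow> j = (i + 1) mod n \<or> i = (j + 1) mod n" if ij: "i < n" "j < n" for i j
    proof -
      have m: "(i + 1) mod n < n" "(j + 1) mod n < n" using n by simp_all
      have "A (f i) (f j) \<longleftrightarrow> f j \<in> N (u (int i))" unfolding f_def N_def by simp
      also have "\<dots> \<longleftrightarrow> f j = u (int i + 1) \<or> f j = u (int i - 1)" unfolding Nu by blast
      also have "f j = u (int i - 1) \<longleftrightarrow> f i = u (int j + 1)"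
      proof
        assume "f j = u (int i - 1)"
        then show "f i = u (int j + 1)" using per[of "int j" "int i - 1"] unfolding f_def by simp
      next
        assume "f i = u (int j + 1)"
        then show "f j = u (int i - 1)" using per[of "int i" "int j + 1"] unfolding f_def by simp
      qed
      also have "f j = u (int i + 1) \<longleftrightarrow> j = (i + 1) mod n" unfolding un[OF ij(1)] using inj[OF ij(2) m(1)] by blast
      also have "f i = u (int j + 1) \<longleftrightarrow> i = (j + 1) mod n" unfolding un[OF ij(2)] using inj[OF ij(1) m(2)] by blast
      finally show ?thesis .
    qed
    have False by (rule small[OF n3 n5 bij], rule adjc, assumption+)
    then show ?thesis ..
  qed
qed

end

subsection \<open>The distinguishing index\<close>

lemma graph_iso_complete:
  assumes "finite V" "\<And>u v. u \<in> V \<Longrightarrow> v \<in> V \<Longrightarrow> {u, v} \<in> E \<longleftrightarrow> u \<noteq> v"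
  shows "graph_iso V E (K_verts (card V)) (K_edges (card V))"
proof -
  obtain f where f: "bij_betw f V {0..<card V}" using ex_bij_betw_finite_nat[OF assms(1)] by blast
  have "{u, v} \<in> E \<longleftrightarrow> {f u, f v} \<in> K_edges (card V)" if uv: "u \<in> V" "v \<in> V" for u v
  proof -
    have "f u < card V" "f v < card V" using bij_betwE[OF f] uv by auto
    then have "{f u, f v} \<in> K_edges (card V) \<longleftrightarrow> f u \<noteq> f v" unfolding K_edges_def by (auto simp: doubleton_eq_iff)
    also have "\<dots> \<longleftrightarrow> u \<noteq> v" using f uv by (auto simp: bij_betw_def dest: inj_onD)
    finally show ?thesis using assms(2)[OF uv] by simp
  qed
  then show ?thesis unfolding graph_iso_def K_verts_def using f by blast
qed

lemma graph_iso_bipartite: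
  assumes fin: "finite X" "finite Y" and c: "card X = n" "card Y = n" and XY: "X \<inter> Y = {}"
    and E: "\<And>x y. x \<in> X \<Longrightarrow> y \<in> Y \<Longrightarrow> {x, y} \<in> E" "\<And>x y. x \<in> X \<Longrightarrow> y \<in> X \<Longrightarrow> {x, y} \<notin> E" "\<And>x y. x \<in> Y \<Longrightarrow> y \<in> Y \<Longrightarrow> {x, y} \<notin> E"
  shows "graph_iso (X \<union> Y) E (Knn_verts n) (Knn_edges n)"
proof -
  obtain f where f: "bij_betw f X {0..<n}" using ex_bij_betw_finite_nat[OF fin(1)] c by blast
  have "card {n..<2 * n} = card Y" using c by simp
  then obtain g where g: "bij_betw g Y {n..<2 * n}" using fin by (metis finite_atLeastLessThan finite_same_card_bij)
  define h where "h = (\<lambda>v. if v \<in> X then f v else g v)"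
  have hf: "h x < n" if "x \<in> X" for x using bij_betwE[OF f] that by (auto simp: h_def)
  have hg: "n \<le> h y \<and> h y < 2 * n" if "y \<in> Y" for y using bij_betwE[OF g] that XY by (auto simp: h_def)
  have "bij_betw h X {0..<n}" using f by (rule bij_betw_cong[THEN iffD1, rotated]) (auto simp: h_def)
  moreover have "bij_betw h Y {n..<2 * n}" using g by (rule bij_betw_cong[THEN iffD1, rotated]) (use XY in \<open>auto simp: h_def\<close>)
  ultimately have "bij_betw h (X \<union> Y) ({0..<n} \<union> {n..<2 * n})" by (rule bij_betw_combine) auto
  moreover have "{0..<n} \<union> {n..<2 * n} = Knn_verts n" by (auto simp: Knn_verts_def)
  ultimately have bij: "bij_betw h (X \<union> Y) (Knn_verts n)" by simp
  have e: "{a, b} \<in> Knn_edges n \<longleftrightarrow> (a < n \<and> n \<le> b \<and> b < 2 * n) \<or> (b < n \<and> n \<le> a \<and> a < 2 * n)" for a b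
    unfolding Knn_edges_def by (auto simp: doubleton_eq_iff)
  have "{u, v} \<in> E \<longleftrightarrow> {h u, h v} \<in> Knn_edges n" if uv: "u \<in> X \<union> Y" "v \<in> X \<union> Y" for u v
  proof -
    consider "u \<in> X" "v \<in> X" | "u \<in> X" "v \<in> Y" | "u \<in> Y" "v \<in> X" | "u \<in> Y" "v \<in> Y" using uv by blast
    then show ?thesis
    proof cases
      case 1 then show ?thesis using E(2) hf[of u] hf[of v] unfolding e by auto
    next
      case 2 then show ?thesis using E(1) hf[of u] hg[of v] unfolding e by auto
    next
      case 3
      then have "{u, v} \<in> E" using E(1)[of v u] by (simp add: insert_commute)
      then show ?thesis using 3 hf[of v] hg[of u] unfolding e by auto
    next
      case 4 then show ?thesis using E(3) hg[of u] hg[of v] unfolding e by auto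
    qed
  qed
  then show ?thesis unfolding graph_iso_def using bij by blast
qed

lemma graph_iso_C5:
  fixes f :: "nat \<Rightarrow> 'a"
  assumes f: "bij_betw f {..<5} V"
    and E: "\<And>i j. i < 5 \<Longrightarrow> j < 5 \<Longrightarrow> {f i, f j} \<in> E \<longleftrightarrow> j = (i + 1) mod 5 \<or> i = (j + 1) mod 5"
  shows "graph_iso V E C5_verts C5_edges"
proof -
  define g where "g = inv_into {..<5} f"
  have g: "bij_betw g V C5_verts"
    using bij_betw_inv_into[OF f] unfolding g_def C5_verts_def by (simp add: atLeast0LessThan)
  have "{u, v} \<in> E \<longleftrightarrow> {g u, g v} \<in> C5_edges" if uv: "u \<in> V" "v \<in> V" for u v
  proof -
    have l: "g u < 5" "g v < 5" using bij_betwE[OF g] uv by (auto simp: C5_verts_def)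
    have "f (g u) = u" "f (g v) = v" using bij_betw_inv_into_right[OF f] uv unfolding g_def by auto
    then have "{u, v} \<in> E \<longleftrightarrow> g v = (g u + 1) mod 5 \<or> g u = (g v + 1) mod 5" using E[OF l] by simp
    also have "\<dots> \<longleftrightarrow> {g u, g v} \<in> C5_edges" using l unfolding C5_edges_def by (auto simp: doubleton_eq_iff)
    finally show ?thesis .
  qed
  then show ?thesis unfolding graph_iso_def using g by blast
qed

lemma distinguishing_index_le_2:
  fixes c :: "'a set \<Rightarrow> nat"
  assumes c: "\<And>e. c e < 2" and "distinguishing V E c"
  shows "distinguishing_index V E \<le> 2"
proof -
  have "enat 2 \<in> {enat k | k. \<exists>c :: 'a set \<Rightarrow> nat. (\<forall>e\<in>E. c e < k) \<and> distinguishing V E c}" using assms by blast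
  then have "distinguishing_index V E \<le> enat 2" unfolding distinguishing_index_def by (rule Inf_lower)
  then show ?thesis by (simp add: numeral_eq_enat)
qed

theorem theorem3:
  fixes V :: "'a set" and E :: "'a set set"
  assumes "simple_graph V E"
    and "connected_graph V E"
    and "locally_finite V E"
    and "regular V E"
    and "\<not> (\<exists>n\<le>5. graph_iso V E (K_verts n) (K_edges n))"
    and "\<not> (\<exists>n\<le>3. graph_iso V E (Knn_verts n) (Knn_edges n))"
    and "\<not> graph_iso V E C5_verts C5_edges"
  shows "distinguishing_index V E \<le> 2"
proof -
  define A where "A = (\<lambda>u v. {u, v} \<in> E)"
  have A_E: "A u v \<equiv> {u, v} \<in> E" for u v unfolding A_def .
  have nb: "neighbours E v = {u. A v u}" for v unfolding neighbours_def A_def by (simp add: insert_commute)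
  obtain d where d: "\<And>v. v \<in> V \<Longrightarrow> card {u. A v u} = d" using assms(4) unfolding regular_def nb by blast
  have A: "u \<in> V \<and> v \<in> V \<and> u \<noteq> v" if "A u v" for u v
  proof -
    have "{u, v} \<in> E" using that unfolding A_def .
    then have "\<exists>a b. {u, v} = {a, b} \<and> a \<noteq> b \<and> a \<in> V \<and> b \<in> V"
      using assms(1) unfolding simple_graph_def by blast
    then obtain a b where "{u, v} = {a, b}" "a \<noteq> b" "a \<in> V" "b \<in> V" by blast
    then show ?thesis by (auto simp: doubleton_eq_iff)
  qed
  have ne: "V \<noteq> {}" and reach: "\<And>u v. u \<in> V \<Longrightarrow> v \<in> V \<Longrightarrow> A\<^sup>*\<^sup>* u v"
    using assms(2) unfolding connected_graph_def A_def by auto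
  interpret rgraph V A d
  proof
    show "A v u" if "A u v" for u v using that by (simp add: A_def insert_commute)
    show "\<not> A u u" "A u v \<Longrightarrow> u \<in> V" for u v using A by blast+
    show "finite {u. A v u}" if "v \<in> V" for v using assms(3) that unfolding locally_finite_def nb by blast
    show "\<exists>u\<in>S. \<exists>v\<in>V - S. A u v" if S: "S \<subseteq> V" "S \<noteq> {}" "S \<noteq> V" for S
    proof (rule ccontr)
      assume n: "\<not> ?thesis"
      obtain u v where uv: "u \<in> S" "v \<in> V - S" using S by blast
      have "A\<^sup>*\<^sup>* u v" using reach uv S by blast
      then have "v \<in> S" using uv(1)
      proof (induction rule: rtranclp_induct)
        case (step y z) then show ?case using n A by blast
      qed
      then show False using uv by blast
    qed
  qed (rule d)
  \<comment> \<open>A complete graph of degree \<open>d\<close> has \<open>d + 1\<close> vertices,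
    and those with at most five vertices are excluded.\<close>
  have noK: "5 \<le> d" if compl: "\<And>x y. x \<in> V \<Longrightarrow> y \<in> V \<Longrightarrow> x \<noteq> y \<Longrightarrow> A x y"
  proof (rule ccontr)
    assume small: "\<not> 5 \<le> d"
    obtain v where v: "v \<in> V" using ne by blast
    have V_eq: "V = insert v (N v)" using compl v NI N_V(1) by blast
    then have V: "finite V" "card V = d + 1" using fin_N[OF v] card_N[OF v] N_irr[of v] by (metis finite_insert, metis Suc_eq_plus1 card_insert_disjoint fin_N v)
    have "graph_iso V E (K_verts (card V)) (K_edges (card V))"
    proof (rule graph_iso_complete[OF V(1)])
      fix u v assume "u \<in> V" "v \<in> V"
      then have "A u v \<longleftrightarrow> u \<noteq> v" using compl A by blast
      then show "{u, v} \<in> E \<longleftrightarrow> u \<noteq> v" unfolding A_def .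
    qed
    then show False using assms(5) V(2) small by (metis Suc_eq_plus1 Suc_leI not_le)
  qed
  \<comment> \<open>Here both sides have \<open>d\<close> vertices. For \<open>d = 0\<close> the
    graph is a single vertex, which falls under \<open>noK\<close>.\<close>
  have noB: "4 \<le> d" if XY: "V = X \<union> Y" "X \<inter> Y = {}" "X \<noteq> {}" "\<And>x. x \<in> X \<Longrightarrow> N x = Y" "\<And>y. y \<in> Y \<Longrightarrow> N y = X" for X Y
  proof (rule ccontr)
    assume small: "\<not> 4 \<le> d"
    obtain x where x: "x \<in> X" using XY by blast
    have Y: "finite Y" "card Y = d" using fin_N[of x] card_N[of x] XY x by auto
    have AX: "A a b" if "a \<in> X" "b \<in> Y" for a b using XY(4)[OF that(1)] that(2) ND by blast
    have AXX: "\<not> A a b" if "a \<in> X" "b \<in> X" for a b using XY(4)[OF that(1)] that(2) NI XY(2) by blast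
    have AYY: "\<not> A a b" if "a \<in> Y" "b \<in> Y" for a b using XY(5)[OF that(1)] that(2) NI XY(2) by blast
    show False
    proof (cases "d = 0")
      case True
      then have "V = {x}" using closed_V[of "{x}"] XY x Y by auto
      then show False using noK True by auto
    next
      case False
      then obtain y where y: "y \<in> Y" using Y by fastforce
      have X: "finite X" "card X = d" using fin_N[of y] card_N[of y] XY y by auto
      have "graph_iso (X \<union> Y) E (Knn_verts d) (Knn_edges d)"
        by (rule graph_iso_bipartite[OF X(1) Y(1) X(2) Y(2) XY(2)]; fold A_E; use AX AXX AYY in blast)
      then show False using assms(6) small XY(1) by (metis not_le Suc_leI eval_nat_numeral(2) less_Suc_eq_le numeral_3_eq_3 semiring_norm(26,27) eval_nat_numeral(3) not_less_eq_eq)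
    qed
  qed
  have "\<exists>C. distinguishes C"
  proof -
    obtain v where v: "v \<in> V" using ne by blast
    consider "d = 0" | "d = 1" | "d = 2" | "d = 3" | "4 \<le> d" by linarith
    then show ?thesis
    proof cases
      case 1
      then have "N v = {}" using card_N[OF v] fin_N[OF v] by simp
      then have "V = {v}" using closed_V[of "{v}"] v by auto
      then show ?thesis using noK 1 by auto
    next
      case 2
      then obtain w where w: "N v = {w}" using card_N[OF v] by (auto simp: card_1_singleton_iff)
      have wV: "w \<in> V" "v \<in> N w" using w N_V N_sym by blast+
      then have "N w = {v}" using N_eqI[of w "{v}"] 2 by simp
      then have "V = {v, w}" using closed_V[of "{v, w}"] w v wV by auto
      then have "A x y" if "x \<in> V" "y \<in> V" "x \<noteq> y" for x y using that w wV ND A_sym by blast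
      then show ?thesis using noK 2 by auto
    next
      case 3
      show ?thesis
      proof (rule cycle_case[OF 3 ne])
        fix n :: nat and f assume n: "3 \<le> n" "n \<le> 5" and f: "bij_betw f {..<n} V"
          and adj: "\<And>i j. i < n \<Longrightarrow> j < n \<Longrightarrow> A (f i) (f j) \<longleftrightarrow> j = (i + 1) mod n \<or> i = (j + 1) mod n"
        have img: "V = f ` {..<n}" using f by (simp add: bij_betw_def)
        \<comment> \<open>The triangle is also a complete graph and the 4-cycle a complete bipartite
          one, so only the 5-cycle is an exception of its own.\<close>
        consider "n = 3" | "n = 4" | "n = 5" using n by linarith
        then show False
        proof cases
          case n3: 1
          have "A x y" if "x \<in> V" "y \<in> V" "x \<noteq> y" for x y
          proof -
            from that(1,2) obtain i j where ij: "i < 3" "j < 3" "x = f i" "y = f j" unfolding img n3 by blast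
            then have "i \<noteq> j" using that(3) by blast
            then have "j = (i + 1) mod 3 \<or> i = (j + 1) mod 3" using ij(1,2) by presburger
            then show ?thesis using adj[of i j] ij n3 by simp
          qed
          then show False using noK 3 by fastforce
        next
          case n4: 2
          have V4: "V = {f 0, f 2} \<union> {f 1, f 3}"
          proof -
            have "{..<4::nat} = {0, 1, 2, 3}" by auto
            then show ?thesis unfolding img n4 by auto
          qed
          have N4: "N (f i) = f ` {j. j < 4 \<and> (j = (i + 1) mod 4 \<or> i = (j + 1) mod 4)}" if "i < 4" for i
          proof
            show "N (f i) \<subseteq> f ` {j. j < 4 \<and> (j = (i + 1) mod 4 \<or> i = (j + 1) mod 4)}"
            proof
              fix y assume y: "y \<in> N (f i)"
              then obtain j where j: "j < 4" "y = f j" using N_V(1)[OF y] unfolding img n4 by blast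
              then show "y \<in> f ` {j. j < 4 \<and> (j = (i + 1) mod 4 \<or> i = (j + 1) mod 4)}" using adj[of i j] y ND that n4 by blast
            qed
            show "f ` {j. j < 4 \<and> (j = (i + 1) mod 4 \<or> i = (j + 1) mod 4)} \<subseteq> N (f i)" using adj[of i] NI that n4 by blast
          qed
          have sets: "{j. j < (4::nat) \<and> (j = (i + 1) mod 4 \<or> i = (j + 1) mod 4)} = (if i = 0 \<or> i = 2 then {1, 3} else {0, 2})"
            if "i < 4" for i :: nat
          proof (rule set_eqI)
            fix j
            have "(j < 4 \<and> (j = (i + 1) mod 4 \<or> i = (j + 1) mod 4)) = (if i = 0 \<or> i = 2 then j = 1 \<or> j = 3 else j = 0 \<or> j = 2)"
            proof (cases "j < 4")
              case True
              have "i = 0 \<or> i = 1 \<or> i = 2 \<or> i = 3" using that by linarith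
              moreover have "j = 0 \<or> j = 1 \<or> j = 2 \<or> j = 3" using True by linarith
              ultimately show ?thesis by (elim disjE) simp_all
            qed auto
            then show "j \<in> {j. j < 4 \<and> (j = (i + 1) mod 4 \<or> i = (j + 1) mod 4)} \<longleftrightarrow> j \<in> (if i = 0 \<or> i = 2 then {1, 3} else {0, 2})"
              by (simp split: if_splits)
          qed
          have inj: "f i \<noteq> f j" if "i < 4" "j < 4" "i \<noteq> j" for i j
            using f that unfolding bij_betw_def n4 by (auto dest: inj_onD)
          have "4 \<le> d"
          proof (rule noB[OF V4])
            show "{f 0, f 2} \<inter> {f 1, f 3} = {}" using inj by auto
            show "N x = {f 1, f 3}" if "x \<in> {f 0, f 2}" for x using that N4[of 0] N4[of 2] sets[of 0] sets[of 2] by auto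
            show "N x = {f 0, f 2}" if "x \<in> {f 1, f 3}" for x using that N4[of 1] N4[of 3] sets[of 1] sets[of 3] by auto
          qed simp
          then show False using 3 by simp
        next
          case n5: 3
          have "graph_iso V E C5_verts C5_edges"
            by (rule graph_iso_C5[OF f[unfolded n5]], fold A_E) (rule adj[unfolded n5])
          then show False using assms(7) by blast
        qed
      qed
    next
      case 4
      show ?thesis
      proof (rule cubic_case[OF 4 ne])
        show "\<not> (\<forall>x\<in>V. \<forall>y\<in>V. x \<noteq> y \<longrightarrow> A x y)" using noK 4 by fastforce
        show False if "V = X \<union> Y" "X \<inter> Y = {}" "X \<noteq> {}" "\<And>x. x \<in> X \<Longrightarrow> N x = Y" "\<And>y. y \<in> Y \<Longrightarrow> N y = X" for X Y
          using noB[OF that] 4 by simp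
      qed
    next
      case 5
      show ?thesis
      proof (cases tri_free)
        case True then show ?thesis using triangle_free_case[OF 5 _ ne] by blast
      next
        case False
        then obtain u w where "A u w" "N u \<inter> N w \<noteq> {}" unfolding tri_free_def by blast
        then show ?thesis using triangle_case[OF 5, of w u] NI noK by blast
      qed
    qed
  qed
  then obtain C where C: "symc C" "\<And>\<phi>. aut \<phi> \<Longrightarrow> pres C \<phi> \<Longrightarrow> \<forall>v\<in>V. \<phi> v = v" unfolding distinguishes_def by blast
  define c where "c = (\<lambda>e. if \<exists>u v. e = {u, v} \<and> C u v then 1 else 0 :: nat)"
  have c: "c {u, v} = (if C u v then 1 else 0)" for u v
    unfolding c_def using symcD[OF C(1)] by (auto simp: doubleton_eq_iff)
  have "distinguishing V E c"
    unfolding distinguishing_def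
  proof (intro allI impI)
    fix \<phi> assume h: "graph_automorphism V E \<phi> \<and> preserves E c \<phi>"
    have "aut \<phi>" using h unfolding aut_def graph_automorphism_def A_E by blast
    moreover have "pres C \<phi>"
      unfolding pres_def
    proof (intro allI impI)
      fix u v assume "A u v"
      then have "c (\<phi> ` {u, v}) = c {u, v}" using h unfolding preserves_def A_def by blast
      then show "C (\<phi> u) (\<phi> v) = C u v" using c by (auto split: if_splits)
    qed
    ultimately show "\<forall>v\<in>V. \<phi> v = v" by (rule C(2))
  qed
  moreover have "c e < 2" for e by (simp add: c_def)
  ultimately show ?thesis by (rule distinguishing_index_le_2[rotated])
qed

end
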